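(* Let $\mathfrak R=\{\mathbf r_1,\mathbf r_2,\mathbf r_3\}$ be a non-rich partial frame in involution on an open neighborhood $\Omega\subset\mathbb R^n$ of $\bar u$ (with flat symmetric connection $\tilde\nabla$), such that $\mathfrak R$ does not satisfy at least one of the following two conditions (required to hold on some open neighborhood $\Omega'\subset\Omega$ of $\bar u$ for all $1\le i\ne j\le3$): (i) $\tilde\nabla_{\mathbf r_i}\mathbf r_j\in\operatorname{span}_{C^\infty(\Omega')}\{\mathbf r_i,\mathbf r_j\}\iff[\mathbf r_i,\mathbf r_j]\in\operatorname{span}_{C^\infty(\Omega')}\{\mathbf r_i,\mathbf r_j\}$; (ii) $\tilde\nabla_{\mathbf r_i}\mathbf r_j\in\operatorname{span}_{C^\infty(\Omega')}\mathfrak R$. Then there are exactly two possibilities: - either the $\lambda$-system (written out in the context, with $m=3$) implies that $\lambda^1=\lambda^2=\lambda^3=\lambda$ in a neighborhood of $\bar u$, where the function $\lambda$ is constant along the integral manifolds of the involutive frame $\mathfrak R$ and may take arbitrary values on an $(n-3)$-dimensional manifold $\Xi_0$ passing through $\bar u$ and transverse to $\mathfrak R$; - or, up to permutation of indices, the $\lambda$-system implies that $\lambda^1=\lambda^2=\lambda$, but allows the possibility that $\lambda\ne\lambda^3$ in a neighborhood of $\bar u$. In this case, the function $\lambda^3$ is uniquely determined by its values on an $(n-2)$-dimensional manifold $\Xi_1$ passing through $\bar u$ and transverse to $\{\mathbf r_1,\mathbf r_2\}$, and the function $\lambda$ is uniquely determined by its values on an $(n-3)$-dimensional manifold $\Xi_2$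 passing through $\bar u$ and transverse to $\mathfrak R$. In both cases, the $\lambda$-system has a locally unique solution with prescribed data (in the first case, the values of $\lambda$ on $\Xi_0$; in the second case, the values of $\lambda^3$ on $\Xi_1$ and the values of $\lambda$ on $\Xi_2$), and for each such solution the system $\tilde\nabla_{\mathbf r_i}\mathbf f=\lambda^i\mathbf r_i$, $i=1,2,3$, has a locally unique solution $\mathbf f$ determined by the values of $\mathbf f$ on an $(n-3)$-dimensional manifold $\Xi$ passing through $\bar u$ and transverse to $\mathfrak R$. The set $\mathcal F(\mathfrak R)$ contains no strictly hyperbolic fluxes.
   Context: All objects are $C^\infty$-smooth. A connection $\tilde\nabla$ is symmetric if $\tilde\nabla_{\mathbf r}\mathbf s-\tilde\nabla_{\mathbf s}\mathbf r=[\mathbf r,\mathbf s]$ and flat if $\tilde\nabla_{\mathbf r}\tilde\nabla_{\mathbf s}\mathbf t-\tilde\nabla_{\mathbf s}\tilde\nabla_{\mathbf r}\mathbf t=\tilde\nabla_{[\mathbf r,\mathbf s]}\mathbf t$; concretely, $\tilde\nabla$ is the connection with $\tilde\nabla_{\partial/\partial u^i}\partial/\partial u^j=0$ for fixed coordinates $u^1,\dots,u^n$. A partial frame on $\Omega$ is a set of smooth vector fields linearly independent at every point; it is in involution if all brackets $[\mathbf r_i,\mathbf r_j]$ lie in $\operatorname{span}_{C^\infty(\Omega)}\mathfrak R$, and rich if $[\mathbf r_i,\mathbf r_j]\in\operatorname{span}_{C^\infty(\Omega)}\{\mathbf r_i,\mathbf r_j\}$ for all $i,j$. $\mathcal F(\mathfrak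 R)$ is the set of smooth vector fields $\mathbf f$ near $\bar u$ for which there exist smooth functions $\lambda^i$ near $\bar u$ with $\tilde\nabla_{\mathbf r_i}\mathbf f=\lambda^i\mathbf r_i$, $i=1,2,3$; its elements are called fluxes. A flux is strictly hyperbolic (near $\bar u$) if at each point of a neighborhood of $\bar u$ the operator $\mathbf v\mapsto\tilde\nabla_{\mathbf v}\mathbf f$ has $n$ distinct real eigenvalues. A submanifold is transverse to a set of vector fields if at each of its points its tangent space is complementary to their span. The $\lambda$-system: complete $\mathfrak R$ to a frame $\{\mathbf r_1,\dots,\mathbf r_m,\mathbf s_{m+1},\dots,\mathbf s_n\}$ ($m=3$), and let $[\mathbf r_i,\mathbf r_j]=\sum_{k=1}^m c_{ij}^k\mathbf r_k$, $\tilde\nabla_{\mathbf r_i}\mathbf r_j=\sum_{k=1}^m\Gamma_{ij}^k\mathbf r_k+\sum_{l=m+1}^n\Gamma_{ij}^l\mathbf s_l$. The $\lambda$-system for functions $\lambda^1,\dots,\lambda^m$ is $\mathbf r_i(\lambda^j)=\Gamma^j_{ji}(\lambda^i-\lambda^j)$ for $1\le i\ne j\le m$; $\lambda^j\Gamma_{ij}^k-\lambda^i\Gamma_{ji}^k-c_{ij}^k\lambda^k=0$ for distinct $i,j,k\in\{1,\dots,m\}$; $(\lambda^j-\lambda^i)\Gamma_{ji}^l=0$ for $1\le i\ne j\le m$, $l=m+1,\dots,n$.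
   Formalization: The two-case alternative is proved if each condition ∇_{r_i}r_j or [r_i,r_j] in span{r_i,r_j}, ∇_{r_i}r_j in span R, Γ^i_{ik}=Γ^j_{jk} holds near ū or fails on a dense subset of a neighborhood of ū; without this it is false for some smooth frames. The flux claims need no such condition. *)

theory Defs
  imports "HOL-Analysis.Analysis"
begin

primrec Ck_on :: "nat \<Rightarrow> 'a::real_normed_vector set \<Rightarrow> ('a \<Rightarrow> 'b::real_normed_vector) \<Rightarrow> bool" where
  "Ck_on 0 U f \<longleftrightarrow> continuous_on U f"
| "Ck_on (Suc k) U f \<longleftrightarrow>
     (\<forall>x\<in>U. f differentiable (at x)) \<and> (\<forall>v. Ck_on k U (\<lambda>x. frechet_derivative f (at x) v))"

text \<open>Meant for open \<open>U\<close> in a finite-dimensional space.\<close>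

definition smooth_on :: "'a::real_normed_vector set \<Rightarrow> ('a \<Rightarrow> 'b::real_normed_vector) \<Rightarrow> bool" where
  "smooth_on U f \<longleftrightarrow> (\<forall>k. Ck_on k U f)"

definition smooth_data :: "'a::real_normed_vector set \<Rightarrow> ('a \<Rightarrow> 'b::real_normed_vector) \<Rightarrow> bool" where
  "smooth_data M g \<longleftrightarrow>
     (\<forall>p\<in>M. \<exists>U h. open U \<and> p \<in> U \<and> smooth_on U h \<and> (\<forall>u\<in>U \<inter> M. h u = g u))"

text \<open>
  The flat symmetric connection for which the coordinate fields of \<open>real^'n\<close> are parallel.
  For scalar \<open>Y\<close> this is the derivative \<open>X(Y)\<close> of a function along \<open>X\<close>.
\<close>

definition nabla :: "('a::real_normed_vector \<Rightarrow> 'a) \<Rightarrow> ('a \<Rightarrow> 'b::real_normed_vector) \<Rightarrow> 'a \<Rightarrow> 'b" where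
  "nabla X Y u = frechet_derivative Y (at u) (X u)"

definition lie_bracket ::
    "('a::real_normed_vector \<Rightarrow> 'a) \<Rightarrow> ('a \<Rightarrow> 'a) \<Rightarrow> 'a \<Rightarrow> 'a" where
  "lie_bracket X Y u = frechet_derivative Y (at u) (X u) - frechet_derivative X (at u) (Y u)"

definition nbhd_in :: "'a::topological_space \<Rightarrow> 'a set \<Rightarrow> 'a set \<Rightarrow> bool" where
  "nbhd_in p A U \<longleftrightarrow> open U \<and> p \<in> U \<and> U \<subseteq> A"

text \<open>
  Triples are indexed by the three-element type \<open>3\<close>, whose elements are \<open>1\<close>, \<open>2\<close> and
  \<open>3\<close> (the last one is equal to \<open>0\<close> in this type).
\<close>

definition smooth_span :: "'a::real_normed_vector set \<Rightarrow> ('i \<Rightarrow> 'a \<Rightarrow> 'a) \<Rightarrow> 'i set \<Rightarrow> ('a \<Rightarrow> 'a) set" where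
  "smooth_span U r I =
     {X. \<exists>a. (\<forall>i\<in>I. smooth_on U (a i)) \<and> (\<forall>u\<in>U. X u = (\<Sum>i\<in>I. a i u *\<^sub>R r i u))}"

definition partial_frame :: "(real^'n) set \<Rightarrow> (3 \<Rightarrow> real^'n \<Rightarrow> real^'n) \<Rightarrow> bool" where
  "partial_frame U r \<longleftrightarrow>
     (\<forall>i. smooth_on U (r i)) \<and>
     (\<forall>u\<in>U. inj (\<lambda>i. r i u) \<and> independent (range (\<lambda>i. r i u)))"

definition in_involution :: "(real^'n) set \<Rightarrow> (3 \<Rightarrow> real^'n \<Rightarrow> real^'n) \<Rightarrow> bool" where
  "in_involution U r \<longleftrightarrow> (\<forall>i j. lie_bracket (r i) (r j) \<in> smooth_span U r UNIV)"

definition rich :: "(real^'n) set \<Rightarrow> (3 \<Rightarrow> real^'n \<Rightarrow> real^'n) \<Rightarrow> bool" where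
  "rich U r \<longleftrightarrow> (\<forall>i j. lie_bracket (r i) (r j) \<in> smooth_span U r {i, j})"

definition condition_i :: "(real^'n) set \<Rightarrow> (3 \<Rightarrow> real^'n \<Rightarrow> real^'n) \<Rightarrow> bool" where
  "condition_i U r \<longleftrightarrow>
     (\<forall>i j. i \<noteq> j \<longrightarrow>
        (nabla (r i) (r j) \<in> smooth_span U r {i, j} \<longleftrightarrow>
         lie_bracket (r i) (r j) \<in> smooth_span U r {i, j}))"

definition condition_ii :: "(real^'n) set \<Rightarrow> (3 \<Rightarrow> real^'n \<Rightarrow> real^'n) \<Rightarrow> bool" where
  "condition_ii U r \<longleftrightarrow>
     (\<forall>i j. i \<noteq> j \<longrightarrow> nabla (r i) (r j) \<in> smooth_span U r UNIV)"

definition frame_vectors ::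
    "(3 \<Rightarrow> real^'n \<Rightarrow> real^'n) \<Rightarrow> (nat \<Rightarrow> real^'n \<Rightarrow> real^'n) \<Rightarrow> real^'n \<Rightarrow> (real^'n) set" where
  "frame_vectors r s u = range (\<lambda>i. r i u) \<union> (\<lambda>l. s l u) ` {4..CARD('n)}"

text \<open>
  The cardinality condition makes all \<open>n\<close> vectors pairwise distinct, so independence of the set
  is independence of the family.
\<close>

definition completes_to_frame ::
    "(real^'n) set \<Rightarrow> (3 \<Rightarrow> real^'n \<Rightarrow> real^'n) \<Rightarrow> (nat \<Rightarrow> real^'n \<Rightarrow> real^'n) \<Rightarrow> bool" where
  "completes_to_frame U r s \<longleftrightarrow>
     (\<forall>l\<in>{4..CARD('n)}. smooth_on U (s l)) \<and>
     (\<forall>u\<in>U. independent (frame_vectors r s u) \<and> card (frame_vectors r s u) = CARD('n))"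

text \<open>
  \<open>Gam r s i j k\<close> and \<open>Gams r s i j l\<close> are the coefficients of \<open>r k\<close> and \<open>s l\<close> in
  \<open>nabla (r i) (r j)\<close>; \<open>brc r s i j k\<close> is the coefficient of \<open>r k\<close> in the bracket.
\<close>

definition Gam ::
    "(3 \<Rightarrow> real^'n \<Rightarrow> real^'n) \<Rightarrow> (nat \<Rightarrow> real^'n \<Rightarrow> real^'n) \<Rightarrow> 3 \<Rightarrow> 3 \<Rightarrow> 3 \<Rightarrow> real^'n \<Rightarrow> real" where
  "Gam r s i j k u = representation (frame_vectors r s u) (nabla (r i) (r j) u) (r k u)"

definition Gams ::
    "(3 \<Rightarrow> real^'n \<Rightarrow> real^'n) \<Rightarrow> (nat \<Rightarrow> real^'n \<Rightarrow> real^'n) \<Rightarrow> 3 \<Rightarrow> 3 \<Rightarrow> nat \<Rightarrow> real^'n \<Rightarrow> real" where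
  "Gams r s i j l u = representation (frame_vectors r s u) (nabla (r i) (r j) u) (s l u)"

definition brc ::
    "(3 \<Rightarrow> real^'n \<Rightarrow> real^'n) \<Rightarrow> (nat \<Rightarrow> real^'n \<Rightarrow> real^'n) \<Rightarrow> 3 \<Rightarrow> 3 \<Rightarrow> 3 \<Rightarrow> real^'n \<Rightarrow> real" where
  "brc r s i j k u = representation (frame_vectors r s u) (lie_bracket (r i) (r j) u) (r k u)"

definition lambda_equations ::
    "(3 \<Rightarrow> real^'n \<Rightarrow> real^'n) \<Rightarrow> (nat \<Rightarrow> real^'n \<Rightarrow> real^'n) \<Rightarrow>
     (real^'n) set \<Rightarrow> (real^'n \<Rightarrow> real^3) \<Rightarrow> bool" where
  "lambda_equations r s U lam \<longleftrightarrow>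
     smooth_on U lam \<and>
     (\<forall>u\<in>U.
       (\<forall>i j. i \<noteq> j \<longrightarrow>
          nabla (r i) (\<lambda>v. lam v $ j) u = Gam r s j i j u * (lam u $ i - lam u $ j)) \<and>
       (\<forall>i j k. distinct [i, j, k] \<longrightarrow>
          lam u $ j * Gam r s i j k u - lam u $ i * Gam r s j i k u
            - brc r s i j k u * lam u $ k = 0) \<and>
       (\<forall>i j. i \<noteq> j \<longrightarrow> (\<forall>l\<in>{4..CARD('n)}.
          (lam u $ j - lam u $ i) * Gams r s j i l u = 0)))"

definition flux_system ::
    "(3 \<Rightarrow> real^'n \<Rightarrow> real^'n) \<Rightarrow> (real^'n \<Rightarrow> real^3) \<Rightarrow>
     (real^'n) set \<Rightarrow> (real^'n \<Rightarrow> real^'n) \<Rightarrow> bool" where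
  "flux_system r lam U f \<longleftrightarrow>
     smooth_on U f \<and> (\<forall>u\<in>U. \<forall>i. nabla (r i) f u = lam u $ i *\<^sub>R r i u)"

definition fluxes ::
    "real^'n \<Rightarrow> (real^'n) set \<Rightarrow> (3 \<Rightarrow> real^'n \<Rightarrow> real^'n) \<Rightarrow> (real^'n \<Rightarrow> real^'n) set" where
  "fluxes ubar Om r =
     {f. \<exists>U lam. nbhd_in ubar Om U \<and> smooth_on U lam \<and> flux_system r lam U f}"

definition strictly_hyperbolic :: "real^'n \<Rightarrow> (real^'n \<Rightarrow> real^'n) \<Rightarrow> bool" where
  "strictly_hyperbolic ubar f \<longleftrightarrow>
     (\<exists>U. nbhd_in ubar UNIV U \<and>
        (\<forall>u\<in>U. card {\<mu>::real. \<exists>v. v \<noteq> 0 \<and> nabla (\<lambda>_. v) f u = \<mu> *\<^sub>R v} = CARD('n)))"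

text \<open>Embedded submanifolds without boundary of \<open>real^'n\<close>, not necessarily closed subsets.\<close>

definition submanifold :: "nat \<Rightarrow> (real^'n) set \<Rightarrow> bool" where
  "submanifold d M \<longleftrightarrow>
     (\<forall>p\<in>M. \<exists>U V L. \<exists>\<phi> \<psi> :: real^'n \<Rightarrow> real^'n.
        open U \<and> p \<in> U \<and> open V \<and> homeomorphism U V \<phi> \<psi> \<and>
        smooth_on U \<phi> \<and> smooth_on V \<psi> \<and>
        subspace L \<and> dim L = d \<and> \<phi> ` (U \<inter> M) = V \<inter> L)"

definition tangent_space :: "(real^'n) set \<Rightarrow> real^'n \<Rightarrow> (real^'n) set" where
  "tangent_space M p =
     {v. \<exists>\<gamma> e. e > (0::real) \<and> smooth_on {-e<..<e} \<gamma> \<and> \<gamma> ` {-e<..<e} \<subseteq> M \<and> \<gamma> 0 = p \<and>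
        (\<gamma> has_vector_derivative v) (at 0)}"

definition transverse :: "(3 \<Rightarrow> real^'n \<Rightarrow> real^'n) \<Rightarrow> 3 set \<Rightarrow> (real^'n) set \<Rightarrow> bool" where
  "transverse r I M \<longleftrightarrow>
     (\<forall>p\<in>M. let T = tangent_space M p; S = span ((\<lambda>i. r i p) ` I) in
        T \<inter> S = {0} \<and> {a + b | a b. a \<in> T \<and> b \<in> S} = UNIV)"

definition transversal ::
    "real^'n \<Rightarrow> (real^'n) set \<Rightarrow> (3 \<Rightarrow> real^'n \<Rightarrow> real^'n) \<Rightarrow> 3 set \<Rightarrow> nat \<Rightarrow> (real^'n) set \<Rightarrow> bool" where
  "transversal ubar Om r I d M \<longleftrightarrow>
     submanifold d M \<and> ubar \<in> M \<and> M \<subseteq> Om \<and> transverse r I M"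

definition integral_manifold :: "(3 \<Rightarrow> real^'n \<Rightarrow> real^'n) \<Rightarrow> (real^'n) set \<Rightarrow> bool" where
  "integral_manifold r N \<longleftrightarrow>
     submanifold 3 N \<and> connected N \<and>
     (\<forall>p\<in>N. tangent_space N p = span (range (\<lambda>i. r i p)))"

text \<open>
  \<open>P U \<phi>\<close> says that \<open>\<phi>\<close> solves the problem, with its prescribed data, on the open set \<open>U\<close>.
\<close>

definition locally_uniquely_solvable ::
    "'a::topological_space \<Rightarrow> 'a set \<Rightarrow> ('a set \<Rightarrow> ('a \<Rightarrow> 'b) \<Rightarrow> bool) \<Rightarrow> bool" where
  "locally_uniquely_solvable p A P \<longleftrightarrow>
     (\<exists>U \<phi>. nbhd_in p A U \<and> P U \<phi>) \<and>
     (\<forall>U U' \<phi> \<phi>'. nbhd_in p A U \<and> P U \<phi> \<and> nbhd_in p A U' \<and> P U' \<phi>' \<longrightarrow>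
        (\<exists>V. nbhd_in p (U \<inter> U') V \<and> (\<forall>u\<in>V. \<phi> u = \<phi>' u)))"

definition all_equal_case ::
    "real^'n \<Rightarrow> (real^'n) set \<Rightarrow> (3 \<Rightarrow> real^'n \<Rightarrow> real^'n) \<Rightarrow> (nat \<Rightarrow> real^'n \<Rightarrow> real^'n) \<Rightarrow> bool" where
  "all_equal_case ubar W r s \<longleftrightarrow>
     (\<forall>U lam. nbhd_in ubar W U \<and> lambda_equations r s U lam \<longrightarrow>
        (\<exists>V. nbhd_in ubar U V \<and> (\<forall>u\<in>V. lam u $ 1 = lam u $ 2 \<and> lam u $ 2 = lam u $ 3) \<and>
             (\<forall>N. N \<subseteq> V \<and> integral_manifold r N \<longrightarrow> (\<lambda>u. lam u $ 1) constant_on N))) \<and>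
     (\<forall>\<Xi>0 g. transversal ubar W r UNIV (CARD('n) - 3) \<Xi>0 \<and> smooth_data \<Xi>0 g \<longrightarrow>
        locally_uniquely_solvable ubar W
          (\<lambda>U lam. lambda_equations r s U lam \<and> (\<forall>u\<in>U \<inter> \<Xi>0. \<forall>i. lam u $ i = g u)))"

text \<open>Here \<open>(i, j, k)\<close> is the permutation of \<open>(1, 2, 3)\<close>.\<close>

definition two_equal_case ::
    "real^'n \<Rightarrow> (real^'n) set \<Rightarrow> (3 \<Rightarrow> real^'n \<Rightarrow> real^'n) \<Rightarrow> (nat \<Rightarrow> real^'n \<Rightarrow> real^'n) \<Rightarrow>
     3 \<Rightarrow> 3 \<Rightarrow> 3 \<Rightarrow> bool" where
  "two_equal_case ubar W r s i j k \<longleftrightarrow>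
     (\<forall>U lam. nbhd_in ubar W U \<and> lambda_equations r s U lam \<longrightarrow>
        (\<exists>V. nbhd_in ubar U V \<and> (\<forall>u\<in>V. lam u $ i = lam u $ j))) \<and>
     (\<exists>U lam. nbhd_in ubar W U \<and> lambda_equations r s U lam \<and>
        (\<forall>u\<in>U. lam u $ i = lam u $ j \<and> lam u $ i \<noteq> lam u $ k)) \<and>
     (\<forall>\<Xi>1 \<Xi>2 g1 g2.
        transversal ubar W r {i, j} (CARD('n) - 2) \<Xi>1 \<and> smooth_data \<Xi>1 g1 \<and>
        transversal ubar W r UNIV (CARD('n) - 3) \<Xi>2 \<and> smooth_data \<Xi>2 g2 \<longrightarrow>
        locally_uniquely_solvable ubar W
          (\<lambda>U lam. lambda_equations r s U lam \<and>
             (\<forall>u\<in>U \<inter> \<Xi>1. lam u $ k = g1 u) \<and>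
             (\<forall>u\<in>U \<inter> \<Xi>2. lam u $ i = g2 u \<and> lam u $ j = g2 u)))"

text \<open>
  A pointwise closed condition \<open>P\<close> is decided at \<open>p\<close> if it is identically satisfied near \<open>p\<close>
  or violated on a dense subset of a neighbourhood of \<open>p\<close>. The points at which this fails form
  a nowhere dense set, and for real-analytic frames there are none. Without some such
  requirement a frame can exhibit different behaviour on the two sides of a hypersurface through
  \<open>p\<close>: near the origin of \<open>real^4\<close> with coordinates \<open>x, y, z, w\<close> take \<open>r 1 = dx + z dy\<close>,
  \<open>r 2 = dy\<close>, \<open>r 3 = dz + \<phi>(w) y dx\<close> where \<open>dx, dy, dz\<close> are the coordinate vector fields and
  \<open>\<phi>\<close> is smooth, positive for \<open>w > 0\<close> and zero for \<open>w \<le> 0\<close>. Then the three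
  functions coincide for \<open>w > 0\<close>, but only the first two have to for \<open>w < 0\<close>.
\<close>

definition decided_at :: "'a::topological_space \<Rightarrow> ('a \<Rightarrow> bool) \<Rightarrow> bool" where
  "decided_at p P \<longleftrightarrow>
     (\<exists>U. nbhd_in p UNIV U \<and> ((\<forall>u\<in>U. P u) \<or> U \<subseteq> closure {u\<in>U. \<not> P u}))"

definition constant_type_at ::
    "real^'n \<Rightarrow> (3 \<Rightarrow> real^'n \<Rightarrow> real^'n) \<Rightarrow> (nat \<Rightarrow> real^'n \<Rightarrow> real^'n) \<Rightarrow> bool" where
  "constant_type_at ubar r s \<longleftrightarrow>
     (\<forall>i j. i \<noteq> j \<longrightarrow>
        decided_at ubar (\<lambda>u. nabla (r i) (r j) u \<in> span {r i u, r j u}) \<and>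
        decided_at ubar (\<lambda>u. lie_bracket (r i) (r j) u \<in> span {r i u, r j u}) \<and>
        decided_at ubar (\<lambda>u. nabla (r i) (r j) u \<in> span (range (\<lambda>k. r k u)))) \<and>
     (\<forall>i j k. distinct [i, j, k] \<longrightarrow>
        decided_at ubar (\<lambda>u. Gam r s i k i u = Gam r s j k j u))"

end

theory Submission
  imports Defs
begin

text \<open>
  A \<open>\<lambda>\<close>-solution satisfies pointwise algebraic equations. At a point where condition (i) or (ii)
  fails they make two of the three functions equal. Once \<open>\<lambda>\<^sup>i = \<lambda>\<^sup>j = \<lambda>\<close> near \<open>ubar\<close>, they
  force \<open>\<lambda>\<^sup>k = \<lambda>\<close> as well, unless \<open>[r i, r j]\<close>, \<open>nabla (r i) (r k)\<close> and \<open>nabla (r j) (r k)\<close> lie in the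
  spans of the two fields involved and \<open>\<Gamma>\<^sub>i\<^sub>k\<^sup>i = \<Gamma>\<^sub>j\<^sub>k\<^sup>j\<close>. In this
  remaining case flatness applied to \<open>r k\<close> and the \<open>r k\<close>-component of the Jacobi identity are
  exactly the integrability conditions that reduce the \<open>\<lambda>\<close>-system to successive problems
  \<open>r m (f) = h m\<close> along the leaves of \<open>r i, r j\<close> and of the whole frame. The algebraic
  equations are also the integrability conditions of the flux system, so that two of the
  eigenvalues of every flux coincide at points arbitrarily close to \<open>ubar\<close>.

  Such problems are solved by lifting the fields to \<open>(r m, h m)\<close> on the product with the target
  space; after a linear recombination the lifted fields commute, and their exponential map applied
  to the graph of the data sweeps out the graph of \<open>f\<close>.
\<close>

section \<open>Smooth functions and smooth families\<close>

text \<open>Besides algebra the proof rests on smooth dependence of flows on their starting point. A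
  derivative of a flow solves the linearized equation along the flow, whose right-hand side depends
  on time through the flow and is controlled only as a continuous function of time. The induction on
  the order of differentiability therefore runs over families \<open>Ck_fam\<close>: k derivatives
  in the space variable, all of them jointly continuous in time and space. Flows are run up to time
  one for fields so small that the Lipschitz constant is 1/2; the integral equation is then a
  contraction, and two solutions are compared at the maximum of their distance.

  The other obstacle is the passage from points to neighbourhoods. The algebraic equations yield
  equalities only where a condition is violated, and such points may accumulate at
  \<open>ubar\<close> without filling a neighbourhood of it. \<open>decided_at\<close> then makes
  them dense near \<open>ubar\<close>, so that continuity finishes the argument. The reduced system
  is decoupled by \<open>\<sigma>\<close>, a solution of the linear equation that
  \<open>\<lambda>\<^sup>k - \<lambda>\<close> satisfies along \<open>r i\<close> and
  \<open>r j\<close>.\<close>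

primrec Ck_fam ::
    "nat \<Rightarrow> 'c::topological_space set \<Rightarrow> 'a::real_normed_vector set \<Rightarrow>
     ('c \<Rightarrow> 'a \<Rightarrow> 'b::real_normed_vector) \<Rightarrow> bool" where
  "Ck_fam 0 S U f \<longleftrightarrow> continuous_on (S \<times> U) (\<lambda>(s, x). f s x)"
| "Ck_fam (Suc k) S U f \<longleftrightarrow> continuous_on (S \<times> U) (\<lambda>(s, x). f s x) \<and>
     (\<forall>s\<in>S. \<forall>x\<in>U. f s differentiable at x) \<and>
     (\<forall>v. Ck_fam k S U (\<lambda>s x. frechet_derivative (f s) (at x) v))"

lemma Ck_fam_continuous: "Ck_fam k S U f \<Longrightarrow> continuous_on (S \<times> U) (\<lambda>(s, x). f s x)"
  by (cases k) auto

lemma Ck_fam_Suc_imp: "Ck_fam (Suc k) S U f \<Longrightarrow> Ck_fam k S U f"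
proof (induction k arbitrary: f)
  case (Suc k)
  then show ?case using Ck_fam.simps(2)[of "Suc k" S U f] by auto
qed auto

lemma frechet_derivative_cong_open:
  assumes "open U" "x \<in> U" "\<And>y. y \<in> U \<Longrightarrow> f y = g y"
  shows "frechet_derivative f (at x) = frechet_derivative g (at x)"
proof -
  have "(f has_derivative D) (at x) \<longleftrightarrow> (g has_derivative D) (at x)" for D
    using has_derivative_transform_within_open[OF _ assms(1,2), of f D UNIV g]
      has_derivative_transform_within_open[OF _ assms(1,2), of g D UNIV f] assms(3) by metis
  then show ?thesis
    unfolding frechet_derivative_def by presburger
qed

lemma differentiable_cong_open:
  assumes "open U" "x \<in> U" "\<And>y. y \<in> U \<Longrightarrow> f y = g y" "f differentiable at x"
  shows "g differentiable at x"
  using has_derivative_transform_within_open[OF _ assms(1,2), of f _ UNIV g] assms(3,4)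
  unfolding differentiable_def by metis

lemma has_frechet_derivative:
  "f differentiable at x \<Longrightarrow> (f has_derivative frechet_derivative f (at x)) (at x)"
  using frechet_derivative_works by blast

lemma Ck_fam_cong:
  assumes "open U" "\<And>s x. s \<in> S \<Longrightarrow> x \<in> U \<Longrightarrow> f s x = g s x" "Ck_fam k S U f"
  shows "Ck_fam k S U g"
  using assms(2,3)
proof (induction k arbitrary: f g)
  case 0
  then show ?case by (auto intro: continuous_on_eq)
next
  case (Suc k)
  have "continuous_on (S \<times> U) (\<lambda>(s, x). g s x)"
    by (rule continuous_on_eq[of _ "\<lambda>(s, x). f s x"]) (use Suc.prems in auto)
  moreover have "g s differentiable at x" if "s \<in> S" "x \<in> U" for s x
    using differentiable_cong_open[OF assms(1) that(2), of "f s" "g s"] Suc.prems that by auto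
  moreover have "Ck_fam k S U (\<lambda>s x. frechet_derivative (g s) (at x) v)" for v
    by (rule Suc.IH[of "\<lambda>s x. frechet_derivative (f s) (at x) v"])
      (use Suc.prems frechet_derivative_cong_open[OF assms(1)] in \<open>auto, metis\<close>)
  ultimately show ?case by simp
qed

text \<open>The derivative may be given by any explicit formula \<open>f'\<close>: it agrees with
  \<open>frechet_derivative\<close> by uniqueness, and since \<open>U\<close> is open the agreement
  passes to all further derivatives.\<close>

lemma Ck_fam_SucI:
  assumes "open U" "continuous_on (S \<times> U) (\<lambda>(s, x). f s x)"
    and "\<And>s x. s \<in> S \<Longrightarrow> x \<in> U \<Longrightarrow> (f s has_derivative f' s x) (at x)"
    and "\<And>v. Ck_fam k S U (\<lambda>s x. f' s x v)"
  shows "Ck_fam (Suc k) S U f"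
proof -
  have "Ck_fam k S U (\<lambda>s x. frechet_derivative (f s) (at x) v)" for v
    by (rule Ck_fam_cong[OF assms(1) _ assms(4)[of v]]) (metis assms(3) frechet_derivative_at)
  then show ?thesis using assms(2,3) by (auto simp: differentiable_def)
qed

lemma Ck_fam_SucD:
  assumes "Ck_fam (Suc k) S U f"
  shows "s \<in> S \<Longrightarrow> x \<in> U \<Longrightarrow> (f s has_derivative frechet_derivative (f s) (at x)) (at x)"
    and "Ck_fam k S U (\<lambda>s x. frechet_derivative (f s) (at x) v)"
  using assms by (auto intro: has_frechet_derivative)

lemma Ck_fam_subset:
  assumes "Ck_fam k S U f" "V \<subseteq> U" "T \<subseteq> S"
  shows "Ck_fam k T V f"
  using assms(1)
proof (induction k arbitrary: f)
  case 0
  then show ?case using assms by (auto intro: continuous_on_subset)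
next
  case (Suc k)
  have "continuous_on (T \<times> V) (\<lambda>(s, x). f s x)"
    by (rule continuous_on_subset[of "S \<times> U"]) (use Suc.prems assms in auto)
  moreover have "\<forall>s\<in>T. \<forall>x\<in>V. f s differentiable at x"
    using Suc.prems assms(2,3) by (simp add: subset_iff)
  ultimately show ?case using Suc by simp
qed

text \<open>Closure properties are proved once, for families, and transferred to single functions by
  regarding these as constant families. Over an empty \<open>S\<close> every family is
  \<open>Ck_fam\<close>, so the equivalence needs a point of \<open>S\<close>.\<close>

lemma Ck_on_eq_fam:
  fixes f :: "'a::real_normed_vector \<Rightarrow> 'b::real_normed_vector" and S :: "'c::topological_space set"
  assumes "S \<noteq> {}"
  shows "Ck_on k U f \<longleftrightarrow> Ck_fam k S U (\<lambda>_. f)"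
proof (induction k arbitrary: f)
  have *: "continuous_on (S \<times> U) (\<lambda>(s, x). f x) \<longleftrightarrow> continuous_on U f" for f :: "'a \<Rightarrow> 'b"
  proof
    obtain s where s: "s \<in> S" using assms by blast
    assume "continuous_on (S \<times> U) (\<lambda>(s, x). f x)"
    then have "continuous_on U ((\<lambda>(s, x). f x) \<circ> Pair s)"
      by (intro continuous_on_compose) (auto intro!: continuous_intros intro: continuous_on_subset simp: s image_subset_iff)
    then show "continuous_on U f" by (simp add: o_def)
  next
    assume "continuous_on U f"
    then have "continuous_on (S \<times> U) (\<lambda>z. f (snd z))"
      by (rule continuous_on_compose2) (auto intro!: continuous_intros)
    then show "continuous_on (S \<times> U) (\<lambda>(s, x). f x)" by (simp add: case_prod_beta')
  qed
  case 0
  show ?case using * by simp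
  case (Suc k)
  then show ?case
    using assms by (auto simp: * intro!: differentiable_imp_continuous_on
        differentiable_at_imp_differentiable_on)
qed

lemma Ck_on_iff_fam: "Ck_on k U f \<longleftrightarrow> Ck_fam k {0::real} U (\<lambda>_. f)"
  by (rule Ck_on_eq_fam) simp

lemma Ck_fam_const: "open U \<Longrightarrow> Ck_fam k S U (\<lambda>s x. c)"
proof (induction k arbitrary: c)
  case (Suc k)
  show ?case
    by (rule Ck_fam_SucI[where f' = "\<lambda>s x v. 0"]) (use Suc in \<open>auto intro!: continuous_intros simp: case_prod_beta'\<close>)
qed (auto simp: case_prod_beta')

lemma (in bounded_linear) Ck_fam:
  assumes U: "open U" and "Ck_fam k S U g"
  shows "Ck_fam k S U (\<lambda>s x. f (g s x))"
  using assms(2)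
proof (induction k arbitrary: g)
  case 0
  then show ?case using continuous_on[of "S \<times> U" "\<lambda>(s,x). g s x"] by (simp add: case_prod_beta')
next
  case (Suc k)
  have "continuous_on (S \<times> U) (\<lambda>(s, x). f (g s x))"
    using continuous_on[of "S \<times> U" "\<lambda>(s,x). g s x"] Suc.prems by (simp add: case_prod_beta')
  then show ?case
    by (rule Ck_fam_SucI[OF U, where f' = "\<lambda>s x v. f (frechet_derivative (g s) (at x) v)"])
      (auto intro!: Suc.IH has_derivative Ck_fam_SucD[OF Suc.prems])
qed

lemma Ck_fam_add:
  assumes U: "open U" and "Ck_fam k S U f" "Ck_fam k S U g"
  shows "Ck_fam k S U (\<lambda>s x. f s x + g s x)"
  using assms(2,3)
proof (induction k arbitrary: f g)
  case 0
  then show ?case using continuous_on_add by (fastforce simp: case_prod_beta')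
next
  case (Suc k)
  have "continuous_on (S \<times> U) (\<lambda>(s, x). f s x + g s x)"
    using Suc.prems[THEN Ck_fam_continuous] continuous_on_add by (fastforce simp: case_prod_beta')
  then show ?case
    by (rule Ck_fam_SucI[OF U, where f' = "\<lambda>s x v. frechet_derivative (f s) (at x) v + frechet_derivative (g s) (at x) v"])
      (auto intro!: Suc.IH has_derivative_add Ck_fam_SucD[OF Suc.prems(1)] Ck_fam_SucD[OF Suc.prems(2)])
qed

lemma (in bounded_bilinear) Ck_fam:
  assumes U: "open U" and "Ck_fam k S U f" "Ck_fam k S U g"
  shows "Ck_fam k S U (\<lambda>s x. prod (f s x) (g s x))"
  using assms(2,3)
proof (induction k arbitrary: f g)
  case 0
  then show ?case using continuous_on by (fastforce simp: case_prod_beta')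
next
  case (Suc k)
  have "continuous_on (S \<times> U) (\<lambda>(s, x). prod (f s x) (g s x))"
    using Suc.prems[THEN Ck_fam_continuous] continuous_on by (fastforce simp: case_prod_beta')
  then show ?case
    by (rule Ck_fam_SucI[OF U, where f' = "\<lambda>s x v. prod (f s x) (frechet_derivative (g s) (at x) v) +
        prod (frechet_derivative (f s) (at x) v) (g s x)"])
      (auto intro!: Suc.IH FDERIV Ck_fam_add U Ck_fam_SucD[OF Suc.prems(1)] Ck_fam_SucD[OF Suc.prems(2)]
        Ck_fam_Suc_imp[OF Suc.prems(1)] Ck_fam_Suc_imp[OF Suc.prems(2)])
qed

lemma Ck_fam_sum:
  assumes "open U" "\<And>i. i \<in> I \<Longrightarrow> Ck_fam k S U (f i)"
  shows "Ck_fam k S U (\<lambda>s x. \<Sum>i\<in>I. f i s x)"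
  using assms(2)
proof (induction I rule: infinite_finite_induct)
  case (insert i I)
  then show ?case by (simp add: Ck_fam_add[OF assms(1)])
qed (auto simp: Ck_fam_const[OF assms(1)])

lemma linear_eq_sum_Basis:
  fixes L :: "'a::euclidean_space \<Rightarrow> 'b::real_vector"
  assumes "linear L"
  shows "L w = (\<Sum>b\<in>Basis. (w \<bullet> b) *\<^sub>R L b)"
proof -
  have "L w = L (\<Sum>b\<in>Basis. (w \<bullet> b) *\<^sub>R b)" by (simp add: euclidean_representation)
  then show ?thesis by (simp only: linear_sum[OF assms] linear_cmul[OF assms])
qed

text \<open>In the chain rule both the point and the direction of the derivative of \<open>g\<close>
  move with \<open>x\<close>, whereas \<open>Ck_fam\<close> speaks about fixed directions. Expanding
  the moving direction in \<open>Basis\<close> leaves products of scalar coefficients with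
  derivatives of \<open>g\<close> in fixed directions, to which the induction hypothesis
  applies.\<close>

lemma Ck_fam_compose:
  fixes f :: "'c::topological_space \<Rightarrow> 'a::real_normed_vector \<Rightarrow> 'b::euclidean_space"
    and g :: "'c \<Rightarrow> 'b \<Rightarrow> 'd::real_normed_vector"
  assumes U: "open U" "open V" and "Ck_fam k S U f" "Ck_fam k S V g"
    and sub: "\<And>s x. s \<in> S \<Longrightarrow> x \<in> U \<Longrightarrow> f s x \<in> V"
  shows "Ck_fam k S U (\<lambda>s x. g s (f s x))"
proof -
  have cont: "continuous_on (S \<times> U) (\<lambda>(s, x). g s (f s x))"
    if "continuous_on (S \<times> U) (\<lambda>(s, x). f s x)" "continuous_on (S \<times> V) (\<lambda>(s, x). g s x)" for g :: "'c \<Rightarrow> 'b \<Rightarrow> 'd"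
  proof -
    have "continuous_on (S \<times> U) (\<lambda>z. (fst z, f (fst z) (snd z)))"
      using that(1) by (intro continuous_intros) (auto simp: case_prod_beta')
    moreover have "(\<lambda>z. (fst z, f (fst z) (snd z))) ` (S \<times> U) \<subseteq> S \<times> V"
      using sub by auto
    ultimately show ?thesis
      using continuous_on_compose2[OF that(2)] by (fastforce simp: case_prod_beta')
  qed
  show ?thesis
    using assms(3,4)
  proof (induction k arbitrary: g)
    case 0
    then show ?case using cont by auto
  next
    case (Suc k)
    have eq: "frechet_derivative (g s) (at y) w =
        (\<Sum>b\<in>Basis. (w \<bullet> b) *\<^sub>R frechet_derivative (g s) (at y) b)" if "s \<in> S" "y \<in> V" for s y w
    proof -
      have "linear (frechet_derivative (g s) (at y))"
        using Ck_fam_SucD(1)[OF Suc.prems(2) that] by (rule has_derivative_linear)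
      then show ?thesis by (rule linear_eq_sum_Basis)
    qed
    show ?case
    proof (rule Ck_fam_SucI[OF U(1), where f' = "\<lambda>s x v. \<Sum>b\<in>Basis. (frechet_derivative (f s) (at x) v \<bullet> b) *\<^sub>R
            frechet_derivative (g s) (at (f s x)) b"])
      show "continuous_on (S \<times> U) (\<lambda>(s, x). g s (f s x))"
        using cont Suc.prems by simp
      fix s x assume sx: "s \<in> S" "x \<in> U"
      have "(g s \<circ> f s has_derivative frechet_derivative (g s) (at (f s x)) \<circ> frechet_derivative (f s) (at x)) (at x)"
        using sx sub by (intro diff_chain_at Ck_fam_SucD(1)[OF Suc.prems(1)] Ck_fam_SucD(1)[OF Suc.prems(2)])
      then show "((\<lambda>x. g s (f s x)) has_derivative (\<lambda>v. \<Sum>b\<in>Basis. (frechet_derivative (f s) (at x) v \<bullet> b) *\<^sub>R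
            frechet_derivative (g s) (at (f s x)) b)) (at x)"
        unfolding eq[OF sx(1) sub[OF sx], symmetric] by (simp only: o_def)
    next
      fix v
      show "Ck_fam k S U (\<lambda>s x. \<Sum>b\<in>Basis. (frechet_derivative (f s) (at x) v \<bullet> b) *\<^sub>R
            frechet_derivative (g s) (at (f s x)) b)"
      proof (rule Ck_fam_sum[OF U(1)])
        fix b :: 'b
        have 1: "Ck_fam k S U (\<lambda>s x. frechet_derivative (f s) (at x) v \<bullet> b)"
          by (rule bounded_linear.Ck_fam[OF bounded_linear_inner_left U(1) Ck_fam_SucD(2)[OF Suc.prems(1)]])
        have 2: "Ck_fam k S U (\<lambda>s x. frechet_derivative (g s) (at (f s x)) b)"
          by (rule Suc.IH[OF Ck_fam_Suc_imp[OF Suc.prems(1)] Ck_fam_SucD(2)[OF Suc.prems(2)]])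
        show "Ck_fam k S U (\<lambda>s x. (frechet_derivative (f s) (at x) v \<bullet> b) *\<^sub>R
            frechet_derivative (g s) (at (f s x)) b)"
          by (rule bounded_bilinear.Ck_fam[OF bounded_bilinear_scaleR U(1) 1 2])
      qed
    qed
  qed
qed

text \<open>The direction \<open>L v\<close> in the chain rule is constant, so the induction closes
  without a basis expansion.\<close>

lemma Ck_fam_linear_arg:
  fixes L :: "'a::real_normed_vector \<Rightarrow> 'b::real_normed_vector"
    and f :: "'d::topological_space \<Rightarrow> 'b \<Rightarrow> 'c::real_normed_vector"
  assumes L: "bounded_linear L" and U: "open U" "open V" and sub: "\<And>x. x \<in> V \<Longrightarrow> L x \<in> U"
    and "Ck_fam k S U f"
  shows "Ck_fam k S V (\<lambda>s x. f s (L x))"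
proof -
  have cont: "continuous_on (S \<times> V) (\<lambda>(s, x). f s (L x))" if "continuous_on (S \<times> U) (\<lambda>(s, x). f s x)" for f :: "'d \<Rightarrow> 'b \<Rightarrow> 'c"
  proof -
    have "continuous_on (S \<times> V) (\<lambda>z. (fst z, L (snd z)))"
      by (intro continuous_intros bounded_linear.continuous_on[OF L])
    moreover have "(\<lambda>z. (fst z, L (snd z))) ` (S \<times> V) \<subseteq> S \<times> U"
      using sub by auto
    ultimately show ?thesis
      using continuous_on_compose2[OF that] by (fastforce simp: case_prod_beta')
  qed
  show ?thesis
    using assms(5)
  proof (induction k arbitrary: f)
  case 0
  then show ?case using cont by simp
next
  case (Suc k)
  show ?case
  proof (rule Ck_fam_SucI[OF U(2), where f' = "\<lambda>s x v. frechet_derivative (f s) (at (L x)) (L v)"])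
    show "continuous_on (S \<times> V) (\<lambda>(s, x). f s (L x))" using cont Suc.prems by simp
    fix s x assume "s \<in> S" "x \<in> V"
    then show "((\<lambda>x. f s (L x)) has_derivative (\<lambda>v. frechet_derivative (f s) (at (L x)) (L v))) (at x)"
      using diff_chain_at[OF bounded_linear_imp_has_derivative[OF L] Ck_fam_SucD(1)[OF Suc.prems], of s x] sub
      by (simp add: o_def)
  qed (use Suc.IH[OF Ck_fam_SucD(2)[OF Suc.prems]] in auto)
  qed
qed

section \<open>Smooth functions as constant families\<close>

lemma frechet_derivative_linear_at:
  "f differentiable at x \<Longrightarrow> linear (frechet_derivative f (at x))"
  using has_frechet_derivative has_derivative_linear by blast

lemma smooth_on_fam: "smooth_on U f \<longleftrightarrow> (\<forall>k. Ck_fam k {0::real} U (\<lambda>_. f))"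
  by (simp add: smooth_on_def Ck_on_iff_fam)

lemma smooth_on_differentiable: "smooth_on U f \<Longrightarrow> x \<in> U \<Longrightarrow> f differentiable at x"
  unfolding smooth_on_def using Ck_on.simps(2) by blast

lemma smooth_on_has_derivative:
  "smooth_on U f \<Longrightarrow> x \<in> U \<Longrightarrow> (f has_derivative frechet_derivative f (at x)) (at x)"
  by (simp add: smooth_on_differentiable has_frechet_derivative)

lemma smooth_on_deriv: "smooth_on U f \<Longrightarrow> smooth_on U (\<lambda>x. frechet_derivative f (at x) v)"
  unfolding smooth_on_def using Ck_on.simps(2) by blast

lemma smooth_on_continuous: "smooth_on U f \<Longrightarrow> continuous_on U f"
  unfolding smooth_on_def using Ck_on.simps(1) by blast

lemma smooth_on_subset: "smooth_on U f \<Longrightarrow> V \<subseteq> U \<Longrightarrow> smooth_on V f"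
  unfolding smooth_on_fam using Ck_fam_subset by blast

lemma smooth_on_cong: "open U \<Longrightarrow> smooth_on U f \<Longrightarrow> (\<And>x. x \<in> U \<Longrightarrow> f x = g x) \<Longrightarrow> smooth_on U g"
  unfolding smooth_on_fam using Ck_fam_cong[of U "{0}" "\<lambda>_. f" "\<lambda>_. g"] by blast

named_theorems smooth_intros

lemma smooth_on_const [smooth_intros]: "open U \<Longrightarrow> smooth_on U (\<lambda>_. c)"
  by (simp add: smooth_on_fam Ck_fam_const)

lemma smooth_on_add [smooth_intros]:
  "open U \<Longrightarrow> smooth_on U f \<Longrightarrow> smooth_on U g \<Longrightarrow> smooth_on U (\<lambda>x. f x + g x)"
  by (simp add: smooth_on_fam Ck_fam_add)

lemma smooth_on_sum [smooth_intros]: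
  "open U \<Longrightarrow> (\<And>i. i \<in> I \<Longrightarrow> smooth_on U (f i)) \<Longrightarrow> smooth_on U (\<lambda>x. \<Sum>i\<in>I. f i x)"
  by (simp add: smooth_on_fam Ck_fam_sum)

lemma smooth_on_bounded_linear:
  "bounded_linear L \<Longrightarrow> open U \<Longrightarrow> smooth_on U f \<Longrightarrow> smooth_on U (\<lambda>x. L (f x))"
  unfolding smooth_on_fam using bounded_linear.Ck_fam by fast

lemmas smooth_on_minus [smooth_intros] = smooth_on_bounded_linear[OF bounded_linear_minus[OF bounded_linear_ident]]
lemmas smooth_on_fst [smooth_intros] = smooth_on_bounded_linear[OF bounded_linear_fst]
lemmas smooth_on_snd [smooth_intros] = smooth_on_bounded_linear[OF bounded_linear_snd]
lemmas smooth_on_nth [smooth_intros] = smooth_on_bounded_linear[OF bounded_linear_vec_nth]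

lemma smooth_on_diff [smooth_intros]:
  "open U \<Longrightarrow> smooth_on U f \<Longrightarrow> smooth_on U g \<Longrightarrow> smooth_on U (\<lambda>x. f x - g x)"
  using smooth_on_add[OF _ _ smooth_on_minus, of U f g] by simp

lemma smooth_on_bilinear:
  "bounded_bilinear B \<Longrightarrow> open U \<Longrightarrow> smooth_on U f \<Longrightarrow> smooth_on U g \<Longrightarrow> smooth_on U (\<lambda>x. B (f x) (g x))"
  unfolding smooth_on_fam using bounded_bilinear.Ck_fam by fast

lemmas smooth_on_scaleR [smooth_intros] = smooth_on_bilinear[OF bounded_bilinear_scaleR]
lemmas smooth_on_mult [smooth_intros] = smooth_on_bilinear[OF bounded_bilinear_mult]
lemmas smooth_on_inner [smooth_intros] = smooth_on_bilinear[OF bounded_bilinear_inner]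

lemma smooth_on_linear: 
  assumes "bounded_linear L" "open U" shows "smooth_on U L"
proof -
  have "Ck_fam k {0::real} U (\<lambda>_. L)" for k
  proof (cases k)
    case 0
    then show ?thesis using Ck_on_iff_fam[of 0 U L] assms
      bounded_linear.continuous_on[OF assms(1) continuous_on_id, of U] by (simp only: Ck_on.simps)
  next
    case (Suc m)
    have "(L has_derivative L) (at x)" for x using assms bounded_linear_imp_has_derivative by blast
    then show ?thesis
      unfolding Suc using assms
      by (intro Ck_fam_SucI[where f' = "\<lambda>s x. L"] Ck_fam_const)
        (auto simp: case_prod_beta' intro!: bounded_linear.continuous_on[of L] continuous_intros)
  qed
  then show ?thesis by (simp add: smooth_on_fam)
qed

lemma smooth_on_id [smooth_intros]: "open U \<Longrightarrow> smooth_on U (\<lambda>x. x)"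
  by (rule smooth_on_linear) (auto simp: bounded_linear_ident)

lemma smooth_on_Pair [smooth_intros]:
  assumes "open U" "smooth_on U f" "smooth_on U g"
  shows "smooth_on U (\<lambda>x. (f x, g x))"
proof -
  have "smooth_on U (\<lambda>x. (f x, 0) + (0, g x))"
    using assms by (intro smooth_on_add smooth_on_bounded_linear[of "\<lambda>x. (x, 0)"] smooth_on_bounded_linear[of "\<lambda>x. (0, x)"])
      (auto intro!: bounded_linear_Pair bounded_linear_ident bounded_linear_zero)
  then show ?thesis by simp
qed

lemma smooth_on_compose:
  fixes f :: "'a::real_normed_vector \<Rightarrow> 'b::euclidean_space"
  assumes "open U" "open V" "smooth_on U f" "smooth_on V g" "\<And>x. x \<in> U \<Longrightarrow> f x \<in> V"
  shows "smooth_on U (\<lambda>x. g (f x))"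
  using assms Ck_fam_compose[OF assms(1,2), of _ "{0::real}" "\<lambda>_. f" "\<lambda>_. g"] unfolding smooth_on_fam by blast

text \<open>The direction varies with the point; its basis expansion reduces the claim to
  derivatives in constant directions.\<close>

lemma smooth_on_frechet_apply [smooth_intros]:
  fixes f :: "'a::euclidean_space \<Rightarrow> 'b::real_normed_vector"
  assumes U: "open U" and f: "smooth_on U f" and X: "smooth_on U X"
  shows "smooth_on U (\<lambda>x. frechet_derivative f (at x) (X x))"
proof (rule smooth_on_cong[OF U])
  show "smooth_on U (\<lambda>x. \<Sum>b\<in>Basis. (X x \<bullet> b) *\<^sub>R frechet_derivative f (at x) b)"
    using assms by (intro smooth_intros smooth_on_deriv) auto
  show "(\<Sum>b\<in>Basis. (X x \<bullet> b) *\<^sub>R frechet_derivative f (at x) b) = frechet_derivative f (at x) (X x)"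
    if "x \<in> U" for x
    by (rule linear_eq_sum_Basis[OF frechet_derivative_linear_at[OF smooth_on_differentiable[OF f that]], symmetric])
qed

lemma smooth_on_nabla [smooth_intros]:
  fixes f :: "'a::euclidean_space \<Rightarrow> 'b::real_normed_vector"
  shows "open U \<Longrightarrow> smooth_on U X \<Longrightarrow> smooth_on U f \<Longrightarrow> smooth_on U (nabla X f)"
  unfolding nabla_def by (rule smooth_on_frechet_apply)

lemma smooth_on_lie_bracket [smooth_intros]:
  fixes X Y :: "'a::euclidean_space \<Rightarrow> 'a"
  shows "open U \<Longrightarrow> smooth_on U X \<Longrightarrow> smooth_on U Y \<Longrightarrow> smooth_on U (lie_bracket X Y)"
  unfolding lie_bracket_def by (intro smooth_intros)

lemma smooth_on_prod [smooth_intros]: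
  fixes f :: "'i \<Rightarrow> 'a::real_normed_vector \<Rightarrow> real"
  assumes "open U" "\<And>i. i \<in> I \<Longrightarrow> smooth_on U (f i)"
  shows "smooth_on U (\<lambda>x. \<Prod>i\<in>I. f i x)"
  using assms(2)
  by (induction I rule: infinite_finite_induct) (auto intro!: smooth_intros assms(1))

text \<open>The derivative is a multiple of the function itself, so each order follows from the
  previous one.\<close>

lemma smooth_on_exp_UNIV: "smooth_on UNIV (exp :: real \<Rightarrow> real)"
proof -
  have "Ck_fam k {0::real} UNIV (\<lambda>_. exp :: real \<Rightarrow> real)" for k
  proof (induction k)
    case 0
    show ?case by (auto simp: case_prod_beta' intro!: continuous_intros)
  next
    case (Suc k)
    have "bounded_linear (\<lambda>x::real. v * x)" for v by (rule bounded_linear_mult_right)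
    then have "Ck_fam k {0::real} UNIV (\<lambda>_ x. v * exp x :: real)" for v
      using bounded_linear.Ck_fam[of "\<lambda>x. v * x" UNIV k "{0}" "\<lambda>_. exp"] Suc by simp
    then show ?case
      by (intro Ck_fam_SucI[where f' = "\<lambda>s x v. v * exp x"])
        (auto simp: case_prod_beta' intro!: continuous_intros derivative_eq_intros simp: mult.commute)
  qed
  then show ?thesis by (simp add: smooth_on_fam)
qed

text \<open>The derivative is a multiple of the square of the function, hence of class k as soon as
  the function is.\<close>

lemma smooth_on_inverse_nonzero: "smooth_on (- {0}) (inverse :: real \<Rightarrow> real)"
proof -
  have "Ck_fam k {0::real} (- {0}) (\<lambda>_. inverse :: real \<Rightarrow> real)" for k
  proof (induction k)
    case 0
    show ?case by (auto simp: case_prod_beta' intro!: continuous_intros)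
  next
    case (Suc k)
    have o: "open (- {0::real})" by auto
    have "Ck_fam k {0::real} (- {0}) (\<lambda>_ x. inverse x * inverse x :: real)"
      using bounded_bilinear.Ck_fam[OF bounded_bilinear_mult o Suc Suc] .
    then have "Ck_fam k {0::real} (- {0}) (\<lambda>_ x. (- v) * (inverse x * inverse x) :: real)" for v
      using bounded_linear.Ck_fam[OF bounded_linear_mult_right o, of k "{0}" "\<lambda>_ x. inverse x * inverse x" "- v"] by simp
    then show ?case
      by (intro Ck_fam_SucI[where f' = "\<lambda>s x v. (- v) * (inverse x * inverse x)"])
        (auto simp: case_prod_beta' power2_eq_square intro!: continuous_intros derivative_eq_intros)
  qed
  then show ?thesis by (simp add: smooth_on_fam)
qed

lemma smooth_on_exp [smooth_intros]: "open U \<Longrightarrow> smooth_on U f \<Longrightarrow> smooth_on U (\<lambda>x. exp (f x :: real))"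
  using smooth_on_compose[OF _ _ _ smooth_on_exp_UNIV, of U f] by simp

lemma smooth_on_divide [smooth_intros]:
  "open U \<Longrightarrow> smooth_on U f \<Longrightarrow> smooth_on U g \<Longrightarrow> (\<And>x. x \<in> U \<Longrightarrow> g x \<noteq> 0) \<Longrightarrow> smooth_on U (\<lambda>x. f x / g x :: real)"
  using smooth_on_mult[OF _ _ smooth_on_compose[OF _ _ _ smooth_on_inverse_nonzero, of U g], of f]
  by (auto simp: divide_inverse)

section \<open>Smooth dependence of flows on parameters\<close>

text \<open>Plays the role of Gronwall's inequality: at a point where \<open>norm w\<close> attains
  its maximum, the self-bound with \<open>M\<close> equal to this maximum gives
  \<open>M \<le> c + q * M\<close>.\<close>

lemma norm_le_of_self_bound:
  fixes w :: "real \<Rightarrow> 'e::real_normed_vector"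
  assumes "continuous_on {0..1} w" "q < 1" "t \<in> {0..1}"
    and self: "\<And>M t. (\<And>s. s \<in> {0..1} \<Longrightarrow> norm (w s) \<le> M) \<Longrightarrow> t \<in> {0..1} \<Longrightarrow> norm (w t) \<le> c + q * M"
  shows "norm (w t) \<le> c / (1 - q)"
proof -
  obtain m where m: "m \<in> {0..1}" "\<And>s. s \<in> {0..1} \<Longrightarrow> norm (w s) \<le> norm (w m)"
    using continuous_attains_sup[of "{0..1::real}" "\<lambda>s. norm (w s)"] continuous_on_norm[OF assms(1)] by auto
  have "norm (w m) \<le> c + q * norm (w m)" using self[OF m(2) m(1)] .
  then have "norm (w m) \<le> c / (1 - q)" using assms(2) by (simp add: field_simps)
  then show ?thesis using m(2)[OF assms(3)] by linarith
qed

lemma norm_integral_le: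
  fixes f :: "real \<Rightarrow> 'e::banach"
  assumes "continuous_on {0..1} f" "s \<in> {0..1}" "\<And>t. t \<in> {0..1} \<Longrightarrow> norm (f t) \<le> B"
  shows "norm (integral {0..s} f) \<le> B"
proof -
  have "0 \<le> B" using norm_ge_zero[of "f 0"] assms(3)[of 0] by (simp del: norm_ge_zero)
  have "norm (integral {0..s} f) \<le> B * (s - 0)"
    using assms by (intro integral_bound) (auto intro: continuous_on_subset)
  also have "\<dots> \<le> B * 1" using \<open>0 \<le> B\<close> assms(2) by (intro mult_left_mono) auto
  finally show ?thesis by simp
qed

lemma integrable_initial_segment:
  fixes f :: "real \<Rightarrow> 'e::banach"
  assumes "continuous_on {0..1} f" "s \<in> {0..1}"
  shows "f integrable_on {0..s}"
  using assms by (intro integrable_continuous_real) (auto intro: continuous_on_subset)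

text \<open>Picard iteration: over the unit interval the Lipschitz constant 1/2 makes the integral
  operator a contraction for the supremum norm.\<close>

lemma integral_equation_solution:
  fixes F :: "real \<Rightarrow> 'e::euclidean_space \<Rightarrow> 'e"
  assumes cont: "continuous_on ({0..1} \<times> UNIV) (\<lambda>(s, y). F s y)"
    and lip: "\<And>s y y'. s \<in> {0..1} \<Longrightarrow> norm (F s y - F s y') \<le> norm (y - y') / 2"
  obtains u where "continuous_on {0..1} u" "\<And>s. s \<in> {0..1} \<Longrightarrow> u s = p + integral {0..s} (\<lambda>t. F t (u t))"
proof -
  \<comment> \<open>Bounded continuous functions live on the whole line, so the operator evaluates
    the integral at the time clamped to the unit interval.\<close>
  define cl :: "real \<Rightarrow> real" where "cl s = max 0 (min 1 s)" for s
  have cl: "cl s \<in> {0..1}" "s \<in> {0..1} \<Longrightarrow> cl s = s" for s by (auto simp: cl_def)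
  define J where "J u s = p + integral {0..cl s} (\<lambda>t. F t (u t))" for u s
  have Fu: "continuous_on {0..1} (\<lambda>t. F t (u t))" if "continuous_on {0..1} u" for u
  proof -
    have "continuous_on {0..1} (\<lambda>t. (\<lambda>(s, y). F s y) (t, u t))"
      by (rule continuous_on_compose2[OF cont]) (use that in \<open>auto intro!: continuous_intros\<close>)
    then show ?thesis by simp
  qed
  have contI: "continuous_on {0..1} (\<lambda>s. p + integral {0..s} (\<lambda>t. F t (u t)))" if "continuous_on {0..1} u" for u
    by (intro continuous_intros indefinite_integral_continuous_1 integrable_continuous_real Fu that)
  have J: "J u \<in> bcontfun" if "continuous_on {0..1} u" for u
  proof -
    have "continuous_on UNIV (J u)"
      unfolding J_def
    proof (rule continuous_on_compose2[OF contI[OF that]])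
      show "continuous_on UNIV cl" unfolding cl_def by (intro continuous_intros)
    qed (use cl in auto)
    moreover have "range (J u) \<subseteq> (\<lambda>s. p + integral {0..s} (\<lambda>t. F t (u t))) ` {0..1}"
      using cl(1) by (auto simp: J_def)
    then have "bounded (range (J u))"
      using compact_imp_bounded[OF compact_continuous_image[OF contI[OF that]]] bounded_subset by auto
    ultimately show ?thesis by (simp add: bcontfun_def)
  qed
  define T where "T u = Bcontfun (J (apply_bcontfun u))" for u
  have T: "apply_bcontfun (T u) = J (apply_bcontfun u)" for u
    unfolding T_def by (rule Bcontfun_inverse) (auto intro: J)
  have "dist (T u) (T v) \<le> 1/2 * dist u v" for u v
  proof (rule dist_bound)
    fix s
    have "norm (integral {0..cl s} (\<lambda>t. F t (u t) - F t (v t))) \<le> dist u v / 2"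
    proof (rule norm_integral_le)
      show "continuous_on {0..1} (\<lambda>t. F t (u t) - F t (v t))"
        by (intro continuous_intros Fu) auto
      fix t :: real assume "t \<in> {0..1}"
      then have "norm (F t (u t) - F t (v t)) \<le> norm (u t - v t) / 2" by (rule lip)
      also have "\<dots> \<le> dist u v / 2" using dist_bounded[of u t v] by (simp add: dist_norm)
      finally show "norm (F t (u t) - F t (v t)) \<le> dist u v / 2" .
    qed (use cl in auto)
    also have "integral {0..cl s} (\<lambda>t. F t (u t) - F t (v t)) =
        integral {0..cl s} (\<lambda>t. F t (u t)) - integral {0..cl s} (\<lambda>t. F t (v t))"
      by (intro integral_diff integrable_initial_segment Fu cl) auto
    finally show "dist (apply_bcontfun (T u) s) (apply_bcontfun (T v) s) \<le> 1/2 * dist u v"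
      by (simp add: T J_def dist_norm)
  qed
  then obtain u where "T u = u" using banach_fix_type[of "1/2" T] by auto
  then have "apply_bcontfun u s = J (apply_bcontfun u) s" for s using T[of u] by simp
  then have "apply_bcontfun u s = p + integral {0..s} (\<lambda>t. F t (u t))" if "s \<in> {0..1}" for s
    unfolding J_def using cl(2)[OF that] by metis
  then show thesis by (intro that[of "apply_bcontfun u"]) auto
qed

text \<open>Compactness of the time interval makes continuity at \<open>x0\<close> uniform in
  time.\<close>

lemma uniform_on_unit_interval:
  fixes f :: "real \<Rightarrow> 'p::metric_space \<Rightarrow> 'e::metric_space"
  assumes "continuous_on ({0..1} \<times> N) (\<lambda>(s, x). f s x)" "x0 \<in> N" "e > 0"
  shows "\<exists>d>0. \<forall>x\<in>N. dist x x0 < d \<longrightarrow> (\<forall>s\<in>{0..1}. dist (f s x) (f s x0) \<le> e)"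
proof -
  have "continuous_on (N \<times> {0..1}) (\<lambda>z. (\<lambda>(s, x). f s x) (snd z, fst z))"
    by (rule continuous_on_compose2[OF assms(1)]) (auto intro!: continuous_intros)
  then have "continuous_on (N \<times> {0..1}) (\<lambda>(x, s). f s x)" by (simp add: case_prod_beta')
  from continuous_on_prod_compactE[OF this _ assms(2,3)]
  obtain X where X: "x0 \<in> X" "open X" "\<forall>x\<in>X \<inter> N. \<forall>s\<in>{0..1}. dist (f s x) (f s x0) \<le> e"
    by auto
  then obtain d where "d > 0" "ball x0 d \<subseteq> X" by (meson open_contains_ball)
  then show ?thesis using X(3) by (intro exI[of _ d]) (auto simp: subset_iff dist_commute)
qed

lemma continuous_on_section:
  assumes "continuous_on (A \<times> N) (\<lambda>(s, x). f s x)" "x \<in> N"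
  shows "continuous_on A (\<lambda>s. f s x)"
proof -
  have "continuous_on A (\<lambda>s. (\<lambda>(s, x). f s x) (s, x))"
    by (rule continuous_on_compose2[OF assms(1)]) (use assms(2) in \<open>auto intro!: continuous_intros\<close>)
  then show ?thesis by simp
qed

lemma continuous_on_composite_path:
  assumes "continuous_on (A \<times> M) (\<lambda>(s, y). F s y)" "continuous_on (A \<times> N) (\<lambda>(s, x). u s x)"
    and "\<And>s x. s \<in> A \<Longrightarrow> x \<in> N \<Longrightarrow> u s x \<in> M"
  shows "continuous_on (A \<times> N) (\<lambda>(s, x). F s (u s x))"
proof -
  have "continuous_on (A \<times> N) (\<lambda>z. (\<lambda>(s, y). F s y) (fst z, u (fst z) (snd z)))"
    by (rule continuous_on_compose2[OF assms(1)])
      (use assms in \<open>auto intro!: continuous_intros simp: case_prod_beta'\<close>)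
  then show ?thesis by (simp add: case_prod_beta')
qed

text \<open>The solutions are chosen separately for each parameter. Their joint continuity is a
  consequence of the equation, since the difference of two of them bounds itself with factor
  1/2.\<close>

lemma integral_equation_solution_param:
  fixes F :: "real \<Rightarrow> 'p::metric_space \<Rightarrow> 'e::euclidean_space \<Rightarrow> 'e"
  assumes cont: "continuous_on ({0..1} \<times> N \<times> UNIV) (\<lambda>(s, x, y). F s x y)"
    and lip: "\<And>s x y y'. s \<in> {0..1} \<Longrightarrow> x \<in> N \<Longrightarrow> norm (F s x y - F s x y') \<le> norm (y - y') / 2"
    and p: "continuous_on N p"
  obtains u where "continuous_on ({0..1} \<times> N) (\<lambda>(s, x). u s x)"
    "\<And>s x. s \<in> {0..1} \<Longrightarrow> x \<in> N \<Longrightarrow> u s x = p x + integral {0..s} (\<lambda>t. F t x (u t x))"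
proof -
  have "\<exists>u. continuous_on {0..1} u \<and> (\<forall>s\<in>{0..1}. u s = p x + integral {0..s} (\<lambda>t. F t x (u t)))"
    if x: "x \<in> N" for x
  proof -
    have "continuous_on ({0..1} \<times> UNIV) (\<lambda>z. (\<lambda>(s, x, y). F s x y) (fst z, x, snd z))"
      by (rule continuous_on_compose2[OF cont]) (use x in \<open>auto intro!: continuous_intros\<close>)
    then have "continuous_on ({0..1} \<times> UNIV) (\<lambda>(s, y). F s x y)" by (simp add: case_prod_beta')
    then show ?thesis
      by (rule integral_equation_solution[OF _ lip[OF _ x], where p = "p x"]) blast+
  qed
  then obtain U where U: "\<And>x. x \<in> N \<Longrightarrow> continuous_on {0..1} (U x) \<and>
      (\<forall>s\<in>{0..1}. U x s = p x + integral {0..s} (\<lambda>t. F t x (U x t)))"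
    by metis
  define u where "u s x = U x s" for s x
  have u: "continuous_on {0..1} (\<lambda>s. u s x)" if "x \<in> N" for x
    using U[OF that] by (simp add: u_def)
  have eq: "u s x = p x + integral {0..s} (\<lambda>t. F t x (u t x))" if "x \<in> N" "s \<in> {0..1}" for x s
    unfolding u_def using U[OF that(1)] that(2) by blast
  have contF: "continuous_on ({0..1} \<times> N) (\<lambda>(s, x). F s x (u s x0))" if "x0 \<in> N" for x0
  proof -
    have "continuous_on ({0..1} \<times> N) (\<lambda>z. u (fst z) x0)"
      by (rule continuous_on_compose2[OF u[OF that]]) (auto intro!: continuous_intros)
    then have "continuous_on ({0..1} \<times> N) (\<lambda>z. (\<lambda>(s, x, y). F s x y) (fst z, snd z, u (fst z) x0))"
      by (intro continuous_on_compose2[OF cont]) (auto intro!: continuous_intros)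
    then show ?thesis by (simp add: case_prod_beta')
  qed
  have contF': "continuous_on {0..1} (\<lambda>s. F s x (u s x))" if "x \<in> N" for x
    using continuous_on_section[OF contF[OF that] that] .
  have unif: "\<exists>d>0. \<forall>x\<in>N. dist x x0 < d \<longrightarrow> (\<forall>s\<in>{0..1}. norm (u s x - u s x0) \<le> e)"
    if x0: "x0 \<in> N" and "e > 0" for x0 e
  proof -
    \<comment> \<open>One quarter for the change of \<open>F\<close> along the path belonging to
      \<open>x0\<close>, one for the change of \<open>p\<close>; the self-bound with factor 1/2
      doubles their sum to \<open>e\<close>.\<close>
    have e4: "e / 4 > 0" using \<open>e > 0\<close> by simp
    obtain d1 where d1: "d1 > 0" "\<And>x s. x \<in> N \<Longrightarrow> dist x x0 < d1 \<Longrightarrow> s \<in> {0..1} \<Longrightarrow>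
        dist (F s x (u s x0)) (F s x0 (u s x0)) \<le> e / 4"
      using uniform_on_unit_interval[OF contF[OF x0] x0 e4] by metis
    obtain d2 where d2: "d2 > 0" "\<And>x. x \<in> N \<Longrightarrow> dist x x0 < d2 \<Longrightarrow> dist (p x) (p x0) < e / 4"
      using p[unfolded continuous_on_iff] x0 e4 by metis
    have "norm (u s x - u s x0) \<le> e" if x: "x \<in> N" "dist x x0 < d1" "dist x x0 < d2" and s: "s \<in> {0..1}" for x s
    proof -
      have "norm (u s x - u s x0) \<le> (e / 2) / (1 - 1 / 2)"
      proof (rule norm_le_of_self_bound[where t = s])
        show "continuous_on {0..1} (\<lambda>s. u s x - u s x0)"
          by (intro continuous_intros u x x0)
        fix M t assume M: "\<And>s. s \<in> {0..1} \<Longrightarrow> norm (u s x - u s x0) \<le> M" and t: "t \<in> {0..1::real}"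
        have "norm (integral {0..t} (\<lambda>t. F t x (u t x) - F t x0 (u t x0))) \<le> e / 4 + M / 2"
        proof (rule norm_integral_le[OF _ t])
          show "continuous_on {0..1} (\<lambda>t. F t x (u t x) - F t x0 (u t x0))"
            by (intro continuous_intros contF' x x0)
          fix r :: real assume r: "r \<in> {0..1}"
          have "norm (F r x (u r x) - F r x (u r x0)) \<le> M / 2"
            using lip[OF r x(1), of "u r x" "u r x0"] M[OF r] by linarith
          moreover have "norm (F r x (u r x0) - F r x0 (u r x0)) \<le> e / 4"
            using d1(2)[OF x(1,2) r] by (simp add: dist_norm)
          ultimately show "norm (F r x (u r x) - F r x0 (u r x0)) \<le> e / 4 + M / 2"
            using norm_triangle_ineq[of "F r x (u r x) - F r x (u r x0)" "F r x (u r x0) - F r x0 (u r x0)"] by simp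
        qed
        also have "integral {0..t} (\<lambda>t. F t x (u t x) - F t x0 (u t x0)) = (u t x - u t x0) - (p x - p x0)"
          by (subst integral_diff) (auto intro!: integrable_initial_segment contF' x x0 t simp: eq x x0 t[simplified])
        finally have "norm ((u t x - u t x0) - (p x - p x0)) \<le> e / 4 + M / 2" .
        moreover have "norm (p x - p x0) \<le> e / 4" using d2(2)[OF x(1,3)] by (simp add: dist_norm)
        ultimately show "norm (u t x - u t x0) \<le> e / 2 + 1 / 2 * M"
          using norm_triangle_ineq[of "(u t x - u t x0) - (p x - p x0)" "p x - p x0"] by simp
      qed (use s in auto)
      then show ?thesis by simp
    qed
    then show ?thesis using d1(1) d2(1) by (intro exI[of _ "min d1 d2"]) auto
  qed
  have "continuous_on ({0..1} \<times> N) (\<lambda>(s, x). u s x)"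
    unfolding continuous_on_iff
  proof (intro ballI allI impI)
    fix z0 and e :: real assume z0: "z0 \<in> {0..1::real} \<times> N" and "e > 0"
    obtain s0 x0 where z0_eq: "z0 = (s0, x0)" by (cases z0)
    then have *: "s0 \<in> {0..1}" "x0 \<in> N" "e > 0" using z0 \<open>e > 0\<close> by auto
    then obtain d1 where d1: "d1 > 0" "\<And>x s. x \<in> N \<Longrightarrow> dist x x0 < d1 \<Longrightarrow> s \<in> {0..1} \<Longrightarrow> norm (u s x - u s x0) \<le> e / 2"
      using unif[of x0 "e / 2"] by auto
    obtain d2 where d2: "d2 > 0" "\<And>s. s \<in> {0..1} \<Longrightarrow> dist s s0 < d2 \<Longrightarrow> dist (u s x0) (u s0 x0) < e / 2"
      using u[OF *(2), unfolded continuous_on_iff] * by (metis half_gt_zero)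
    have "dist (u s x) (u s0 x0) < e" if "s \<in> {0..1}" "x \<in> N" "dist (s, x) (s0, x0) < min d1 d2" for s x
    proof -
      have "dist s s0 < d2" "dist x x0 < d1"
        using that(3) dist_fst_le[of "(s, x)" "(s0, x0)"] dist_snd_le[of "(s, x)" "(s0, x0)"] by auto
      then have "dist (u s x) (u s x0) \<le> e / 2" "dist (u s x0) (u s0 x0) < e / 2"
        using d1(2) d2(2) that by (auto simp: dist_norm)
      then show ?thesis using dist_triangle[of "u s x" "u s0 x0" "u s x0"] by linarith
    qed
    then show "\<exists>d>0. \<forall>z\<in>{0..1} \<times> N. dist z z0 < d \<longrightarrow>
        dist (case z of (s, x) \<Rightarrow> u s x) (case z0 of (s, x) \<Rightarrow> u s x) < e"
      unfolding z0_eq using d1(1) d2(1) by (intro exI[of _ "min d1 d2"]) auto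
  qed
  then show thesis by (rule that[of u]) (simp add: eq)
qed

text \<open>First-order Taylor estimate along a curve, with a radius independent of time: the curve
  is compact, so the derivative varies by at most \<open>e\<close> on a tube around it, and the mean
  value inequality applies on each ball of the tube.\<close>

lemma Ck_fam_uniform_linearization:
  fixes f :: "real \<Rightarrow> 'q::euclidean_space \<Rightarrow> 'e::real_normed_vector"
  assumes Q: "open Q" and f: "Ck_fam (Suc 0) {0..1} Q f"
    and c: "continuous_on {0..1} c" "\<And>s. s \<in> {0..1} \<Longrightarrow> c s \<in> Q" and "e > 0"
  obtains d where "d > 0" "\<And>s q. s \<in> {0..1} \<Longrightarrow> norm (q - c s) < d \<Longrightarrow> q \<in> Q \<and>
    norm (f s q - f s (c s) - frechet_derivative (f s) (at (c s)) (q - c s)) \<le> e * norm (q - c s)"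
proof -
  have "compact (c ` {0..1})" using compact_continuous_image c by blast
  moreover have "c ` {0..1} \<subseteq> Q" using c(2) by blast
  ultimately obtain r where r: "r > 0" "(\<Union>x\<in>c ` {0..1}. ball x r) \<subseteq> Q"
    using compact_subset_open_imp_ball_epsilon_subset[OF _ Q] by metis
  then have rQ: "c s + w \<in> Q" if "s \<in> {0..1}" "norm w < r" for s w
  proof -
    have "c s + w \<in> ball (c s) r" using that(2) by (simp add: dist_norm)
    then show ?thesis using r(2) that(1) by blast
  qed
  \<comment> \<open>The operator norm is bounded by the sum of the norms of the values at the basis
    vectors.\<close>
  define e' where "e' = e / real (DIM('q))"
  have e': "e' > 0" using \<open>e > 0\<close> by (simp add: e'_def)
  have "\<exists>d>0. \<forall>w\<in>ball 0 r. dist w 0 < d \<longrightarrow> (\<forall>s\<in>{0..1}.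
      norm (frechet_derivative (f s) (at (c s + w)) b - frechet_derivative (f s) (at (c s)) b) \<le> e')" for b
  proof -
    have "continuous_on ({0..1} \<times> Q) (\<lambda>(s, x). frechet_derivative (f s) (at x) b)"
      using f by simp
    moreover have "continuous_on ({0..1} \<times> ball 0 r) (\<lambda>(s, w). c s + w)"
      unfolding case_prod_beta' by (intro continuous_intros continuous_on_compose2[OF c(1)]) auto
    ultimately have "continuous_on ({0..1} \<times> ball 0 r) (\<lambda>(s, w). frechet_derivative (f s) (at (c s + w)) b)"
      by (rule continuous_on_composite_path) (use rQ in auto)
    moreover have "0 \<in> ball 0 r" using r(1) by simp
    ultimately have "\<exists>d>0. \<forall>w\<in>ball 0 r. dist w 0 < d \<longrightarrow> (\<forall>s\<in>{0..1}.
        dist (frechet_derivative (f s) (at (c s + w)) b) (frechet_derivative (f s) (at (c s + 0)) b) \<le> e')"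
      by (rule uniform_on_unit_interval[OF _ _ e'])
    then show ?thesis by (simp only: dist_norm add_0_right)
  qed
  then obtain d where d: "\<And>b. d b > 0" "\<And>b w s. w \<in> ball 0 r \<Longrightarrow> dist w 0 < d b \<Longrightarrow> s \<in> {0..1} \<Longrightarrow>
      norm (frechet_derivative (f s) (at (c s + w)) b - frechet_derivative (f s) (at (c s)) b) \<le> e'"
    by metis
  define D where "D = Min (insert r (d ` (Basis :: 'q set)))"
  have D: "D > 0" "D \<le> r" using d(1) r(1) by (auto simp: D_def)
  have D3: "D \<le> d b" if "b \<in> Basis" for b
    unfolding D_def using that by (intro Min_le) auto
  have der: "(f s has_derivative frechet_derivative (f s) (at x)) (at x)" if "s \<in> {0..1}" "x \<in> Q" for s x
    using Ck_fam_SucD(1)[OF f that] .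
  show thesis
  proof (rule that[OF D(1)])
    fix s q assume s: "s \<in> {0..1::real}" and q: "norm (q - c s) < D"
    have sub: "ball (c s) D \<subseteq> Q"
    proof
      fix x assume "x \<in> ball (c s) D"
      then show "x \<in> Q" using D(2) rQ[OF s, of "x - c s"] by (simp add: dist_norm norm_minus_commute)
    qed
    have "norm (f s q - f s (c s) - frechet_derivative (f s) (at (c s)) (q - c s)) \<le> norm (q - c s) * e"
    proof (rule differentiable_bound_linearization[where S = "ball (c s) D" and f = "f s"])
      show "c s + t *\<^sub>R (q - c s) \<in> ball (c s) D" if "t \<in> {0..1}" for t
      proof -
        have "norm (t *\<^sub>R (q - c s)) \<le> 1 * norm (q - c s)"
          unfolding norm_scaleR using that by (intro mult_right_mono) auto
        then show ?thesis using q by (simp add: dist_norm)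
      qed
      fix x assume x: "x \<in> ball (c s) D"
      then have xQ: "x \<in> Q" "c s \<in> Q" using sub c(2) s by auto
      show "(f s has_derivative frechet_derivative (f s) (at x)) (at x within ball (c s) D)"
        using der[OF s xQ(1)] by (rule has_derivative_at_withinI)
      let ?L = "frechet_derivative (f s) (at x) - frechet_derivative (f s) (at (c s))"
      have lin: "linear ?L"
        using has_derivative_linear[OF der[OF s xQ(1)]] has_derivative_linear[OF der[OF s xQ(2)]]
        by (auto simp: fun_diff_def intro!: linear_compose_sub)
      have b: "norm (?L b) \<le> e'" if "b \<in> Basis" for b
      proof -
        have "norm (x - c s) < D" using x by (simp add: dist_norm norm_minus_commute)
        then show ?thesis
          using d(2)[of "x - c s" b s] D(2) D3[OF that] s by (simp add: fun_diff_def)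
      qed
      show "onorm ?L \<le> e"
      proof (rule onorm_le)
        fix h
        have "norm (?L h) = norm (\<Sum>b\<in>Basis. (h \<bullet> b) *\<^sub>R ?L b)"
          by (rule arg_cong[OF linear_eq_sum_Basis[OF lin]])
        also have "\<dots> \<le> (\<Sum>b\<in>(Basis :: 'q set). norm h * e')"
        proof (rule sum_norm_le)
          fix c :: 'q assume "c \<in> Basis"
          then show "norm ((h \<bullet> c) *\<^sub>R ?L c) \<le> norm h * e'"
            unfolding norm_scaleR using b Basis_le_norm by (intro mult_mono) auto
        qed
        finally show "norm (?L h) \<le> e * norm h" by (simp add: e'_def mult.commute)
      qed
    qed (use D(1) in auto)
    then show "q \<in> Q \<and> norm (f s q - f s (c s) - frechet_derivative (f s) (at (c s)) (q - c s)) \<le> e * norm (q - c s)"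
      using sub q by (auto simp: subset_iff dist_norm norm_minus_commute mult.commute)
  qed
qed

text \<open>Compares \<open>f (y + t *\<^sub>R w)\<close> with its linearization for one small
  \<open>t > 0\<close> and divides by \<open>t\<close>; the linearization error
  \<open>e' * norm w\<close> is exactly the slack \<open>e\<close>.\<close>

lemma lipschitz_derivative_bound:
  fixes f :: "'a::real_normed_vector \<Rightarrow> 'b::real_normed_vector"
  assumes der: "(f has_derivative f') (at y)" and Y: "open Y" "y \<in> Y"
    and lip: "\<And>y'. y' \<in> Y \<Longrightarrow> norm (f y' - f y) \<le> K * norm (y' - y)"
  shows "norm (f' w) \<le> K * norm w"
proof (cases "w = 0")
  case True
  then show ?thesis using has_derivative_linear[OF der] by (simp add: linear_0)
next
  case False
  then have w: "norm w > 0" by simp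
  show ?thesis
  proof (rule field_le_epsilon)
    fix e :: real assume "e > 0"
    define e' where "e' = e / norm w"
    have e': "e' > 0" using \<open>e > 0\<close> w by (simp add: e'_def)
    obtain d where d: "d > 0" "\<And>y'. norm (y' - y) < d \<Longrightarrow> norm (f y' - f y - f' (y' - y)) \<le> e' * norm (y' - y)"
      using der[unfolded has_derivative_at_alt] e' by blast
    obtain r where r: "r > 0" "ball y r \<subseteq> Y" using Y open_contains_ball by metis
    define t where "t = min d r / (2 * norm w)"
    have t: "t > 0" using d(1) r(1) w by (simp add: t_def)
    have tw: "norm (t *\<^sub>R w) = min d r / 2" using w t d(1) r(1) by (simp add: t_def)
    then have "norm (t *\<^sub>R w) < d" "norm (t *\<^sub>R w) < r" using d(1) r(1) by linarith+
    then have "norm (f (y + t *\<^sub>R w) - f y - f' (t *\<^sub>R w)) \<le> e' * norm (t *\<^sub>R w)"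
      and "norm (f (y + t *\<^sub>R w) - f y) \<le> K * norm (t *\<^sub>R w)"
      using d(2)[of "y + t *\<^sub>R w"] lip[of "y + t *\<^sub>R w"] r(2) by (auto simp: subset_iff dist_norm)
    then have "norm (f' (t *\<^sub>R w)) \<le> (K + e') * norm (t *\<^sub>R w)"
      using norm_triangle_ineq4[of "f (y + t *\<^sub>R w) - f y" "f (y + t *\<^sub>R w) - f y - f' (t *\<^sub>R w)"]
      by (simp add: algebra_simps)
    then have "t * norm (f' w) \<le> t * ((K + e') * norm w)"
      using has_derivative_linear[OF der] t by (simp add: linear_cmul mult.assoc mult.left_commute)
    then have "norm (f' w) \<le> (K + e') * norm w" using t by simp
    also have "\<dots> = K * norm w + e" using w by (simp add: e'_def field_simps)
    finally show "norm (f' w) \<le> K * norm w + e" .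
  qed
qed

lemma continuous_on_apply_linear_family:
  fixes L :: "'a::topological_space \<Rightarrow> 'q::euclidean_space \<Rightarrow> 'e::real_normed_vector"
  assumes "\<And>b. b \<in> Basis \<Longrightarrow> continuous_on S (\<lambda>x. L x b)" "continuous_on S w" "\<And>x. x \<in> S \<Longrightarrow> linear (L x)"
  shows "continuous_on S (\<lambda>x. L x (w x))"
proof (rule continuous_on_eq)
  show "continuous_on S (\<lambda>x. \<Sum>b\<in>Basis. (w x \<bullet> b) *\<^sub>R L x b)"
    by (intro continuous_intros assms)
  show "(\<Sum>b\<in>Basis. (w x \<bullet> b) *\<^sub>R L x b) = L x (w x)" if "x \<in> S" for x
    by (rule linear_eq_sum_Basis[OF assms(3)[OF that], symmetric])
qed

text \<open>The solution \<open>u\<close> is part of the data and not constructed, so that the same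
  locale applies to the derivatives of \<open>u\<close>, which solve equations of this form with
  another \<open>G\<close>.\<close>

locale parametric_integral_equation =
  fixes N :: "'p::euclidean_space set" and Y :: "'e::euclidean_space set"
    and G :: "real \<Rightarrow> 'p \<times> 'e \<Rightarrow> 'e" and p :: "'p \<Rightarrow> 'e" and u :: "real \<Rightarrow> 'p \<Rightarrow> 'e"
  assumes open_N: "open N" and open_Y: "open Y"
    and lipschitz: "\<And>s x y y'. s \<in> {0..1} \<Longrightarrow> x \<in> N \<Longrightarrow> y \<in> Y \<Longrightarrow> y' \<in> Y \<Longrightarrow>
      norm (G s (x, y) - G s (x, y')) \<le> 1/2 * norm (y - y')"
    and continuous_u: "continuous_on ({0..1} \<times> N) (\<lambda>(s, x). u s x)"
    and u_in: "\<And>s x. s \<in> {0..1} \<Longrightarrow> x \<in> N \<Longrightarrow> u s x \<in> Y"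
    and u_eq: "\<And>s x. s \<in> {0..1} \<Longrightarrow> x \<in> N \<Longrightarrow> u s x = p x + integral {0..s} (\<lambda>t. G t (x, u t x))"
begin

definition DG :: "real \<Rightarrow> 'p \<Rightarrow> 'p \<times> 'e \<Rightarrow> 'e" where
  "DG s x = frechet_derivative (G s) (at (x, u s x))"

lemma continuous_xu: "continuous_on ({0..1} \<times> N) (\<lambda>(s, x). (x, u s x))"
  using continuous_u unfolding case_prod_beta' by (intro continuous_intros)

context
  assumes G: "Ck_fam (Suc 0) {0..1} (N \<times> Y) G"
begin

lemma has_derivative_G: "s \<in> {0..1} \<Longrightarrow> x \<in> N \<Longrightarrow> (G s has_derivative DG s x) (at (x, u s x))"
  unfolding DG_def using Ck_fam_SucD(1)[OF G] u_in by auto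

lemma linear_DG: "s \<in> {0..1} \<Longrightarrow> x \<in> N \<Longrightarrow> linear (DG s x)"
  using has_derivative_G has_derivative_linear by blast

lemma continuous_DG: "continuous_on ({0..1} \<times> N) (\<lambda>(s, x). DG s x d)"
  unfolding DG_def
  by (rule continuous_on_composite_path[OF Ck_fam_continuous[OF Ck_fam_SucD(2)[OF G]] continuous_xu])
    (use u_in in auto)

text \<open>The linearized equation inherits the constant 1/2 in the state variable, so existence
  and uniqueness of its solutions follow by the same contraction argument.\<close>

lemma DG_vertical_bound:
  assumes "s \<in> {0..1}" "x \<in> N"
  shows "norm (DG s x (0, w)) \<le> 1/2 * norm w"
proof -
  have "((\<lambda>y. (x, y)) has_derivative (\<lambda>w. (0, w))) (at (u s x))"
    by (auto intro!: derivative_eq_intros)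
  from diff_chain_at[OF this has_derivative_G[OF assms]]
  have "((\<lambda>y. G s (x, y)) has_derivative (\<lambda>w. DG s x (0, w))) (at (u s x))"
    by (simp add: o_def)
  then show ?thesis
    by (rule lipschitz_derivative_bound[OF _ open_Y u_in[OF assms]]) (use lipschitz assms u_in in auto)
qed

lemma variational_solution:
  assumes p: "continuous_on N a"
  obtains z where "continuous_on ({0..1} \<times> N) (\<lambda>(s, x). z s x)"
    "\<And>s x. s \<in> {0..1} \<Longrightarrow> x \<in> N \<Longrightarrow> z s x = a x + integral {0..s} (\<lambda>t. DG t x (v, z t x))"
proof -
  have cont: "continuous_on ({0..1} \<times> N \<times> UNIV) (\<lambda>(s, x, y). DG s x (v, y))"
  proof -
    have 1: "continuous_on ({0..1} \<times> N \<times> (UNIV :: 'e set)) (\<lambda>z. DG (fst z) (fst (snd z)) d)" for d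
    proof -
      have "continuous_on ({0..1} \<times> N \<times> (UNIV :: 'e set)) (\<lambda>z. (\<lambda>(s, x). DG s x d) (fst z, fst (snd z)))"
        by (rule continuous_on_compose2[OF continuous_DG]) (auto intro!: continuous_intros)
      then show ?thesis by simp
    qed
    have "continuous_on ({0..1} \<times> N \<times> UNIV) (\<lambda>z. DG (fst z) (fst (snd z)) (v, snd (snd z)))"
      by (rule continuous_on_apply_linear_family) (use 1 linear_DG in \<open>auto intro!: continuous_intros\<close>)
    then show ?thesis by (simp add: case_prod_beta')
  qed
  have lip: "norm (DG s x (v, y) - DG s x (v, y')) \<le> norm (y - y') / 2" if "s \<in> {0..1}" "x \<in> N" for s x y y'
  proof -
    have "DG s x (v, y) - DG s x (v, y') = DG s x (0, y - y')"
      using linear_diff[OF linear_DG[OF that], of "(v, y)" "(v, y')"] by simp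
    then show ?thesis using DG_vertical_bound[OF that, of "y - y'"] by simp
  qed
  show thesis
    by (rule integral_equation_solution_param[OF cont lip p]) (use that in auto)
qed

text \<open>The difference of two solutions bounds itself with factor 1/2 and no constant term. This
  identifies the derivative of a flow with any explicitly known solution of the variational
  equation.\<close>

lemma variational_unique:
  assumes x: "x \<in> N" and z: "continuous_on {0..1} z" and w: "continuous_on {0..1} w"
    and z_eq: "\<And>s. s \<in> {0..1} \<Longrightarrow> z s = a + integral {0..s} (\<lambda>t. DG t x (v, z t))"
    and w_eq: "\<And>s. s \<in> {0..1} \<Longrightarrow> w s = a + integral {0..s} (\<lambda>t. DG t x (v, w t))"
    and s: "s \<in> {0..1}"
  shows "z s = w s"
proof -
  have cont: "continuous_on {0..1} (\<lambda>t. DG t x (v, y t))" if "continuous_on {0..1} y" for y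
    by (rule continuous_on_apply_linear_family)
      (use x linear_DG continuous_on_section[OF continuous_DG x] that in \<open>auto intro!: continuous_intros\<close>)
  have "norm (z s - w s) \<le> 0 / (1 - 1/2)"
  proof (rule norm_le_of_self_bound)
    fix M t assume M: "\<And>s. s \<in> {0..1} \<Longrightarrow> norm (z s - w s) \<le> M" and t: "t \<in> {0..1::real}"
    have "norm (integral {0..t} (\<lambda>t. DG t x (v, z t) - DG t x (v, w t))) \<le> 1/2 * M"
    proof (rule norm_integral_le[OF _ t])
      show "continuous_on {0..1} (\<lambda>t. DG t x (v, z t) - DG t x (v, w t))"
        by (intro continuous_intros cont z w)
      fix r :: real assume r: "r \<in> {0..1}"
      have "DG r x (v, z r) - DG r x (v, w r) = DG r x (0, z r - w r)"
        using linear_diff[OF linear_DG[OF r x], of "(v, z r)" "(v, w r)"] by simp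
      then show "norm (DG r x (v, z r) - DG r x (v, w r)) \<le> 1/2 * M"
        using DG_vertical_bound[OF r x, of "z r - w r"] M[OF r] by simp
    qed
    moreover have "integral {0..t} (\<lambda>t. DG t x (v, z t) - DG t x (v, w t)) = z t - w t"
      unfolding z_eq[OF t] w_eq[OF t]
      by (subst integral_diff) (auto intro!: integrable_initial_segment cont z w t)
    ultimately show "norm (z t - w t) \<le> 0 + 1/2 * M" by simp
  qed (use s z w in \<open>auto intro!: continuous_intros\<close>)
  then show ?thesis by simp
qed

text \<open>The variational equation supplies the candidate for the derivative. The remainder
  \<open>w\<close> of the first-order expansion solves an integral equation whose integrand is the
  linearization error of \<open>G\<close> plus \<open>DG\<close> applied to \<open>w\<close>, so
  \<open>w\<close> is bounded by a small multiple of \<open>norm (x - x0)\<close>.\<close>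

lemma has_derivative_solution:
  assumes p: "\<And>x. x \<in> N \<Longrightarrow> (p has_derivative p' x) (at x)" "\<And>v. continuous_on N (\<lambda>x. p' x v)"
  obtains z where "\<And>v. continuous_on ({0..1} \<times> N) (\<lambda>(s, x). z v s x)"
    "\<And>s x. s \<in> {0..1} \<Longrightarrow> x \<in> N \<Longrightarrow> (u s has_derivative (\<lambda>v. z v s x)) (at x)"
    "\<And>v s x. s \<in> {0..1} \<Longrightarrow> x \<in> N \<Longrightarrow> z v s x = p' x v + integral {0..s} (\<lambda>t. DG t x (v, z v t x))"
proof -
  have "\<exists>z. continuous_on ({0..1} \<times> N) (\<lambda>(s, x). z s x) \<and>
    (\<forall>s\<in>{0..1}. \<forall>x\<in>N. z s x = p' x b + integral {0..s} (\<lambda>t. DG t x (b, z t x)))" for b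
    by (rule variational_solution[OF p(2)[of b], of b]) blast
  then obtain \<zeta> where \<zeta>: "\<And>b. continuous_on ({0..1} \<times> N) (\<lambda>(s, x). \<zeta> b s x)"
    "\<And>b s x. s \<in> {0..1} \<Longrightarrow> x \<in> N \<Longrightarrow> \<zeta> b s x = p' x b + integral {0..s} (\<lambda>t. DG t x (b, \<zeta> b t x))"
    by metis
  \<comment> \<open>Solving only for basis directions and extending linearly makes the candidate
    linear in \<open>v\<close> by construction.\<close>
  define z where "z v s x = (\<Sum>b\<in>Basis. (v \<bullet> b) *\<^sub>R \<zeta> b s x)" for v s x
  have cont_z: "continuous_on ({0..1} \<times> N) (\<lambda>(s, x). z v s x)" for v
    using \<zeta>(1) unfolding z_def case_prod_beta' by (intro continuous_intros)
  have cont_DG: "continuous_on {0..1} (\<lambda>t. DG t x (v, y t))" if "continuous_on {0..1} y" "x \<in> N" for y x v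
    by (rule continuous_on_apply_linear_family)
      (use linear_DG continuous_on_section[OF continuous_DG] that in \<open>auto intro!: continuous_intros\<close>)
  have z_eq: "z v s x = p' x v + integral {0..s} (\<lambda>t. DG t x (v, z v t x))"
    if s: "s \<in> {0..1}" and x: "x \<in> N" for v s x
  proof -
    have 1: "DG t x (v, z v t x) = (\<Sum>b\<in>Basis. (v \<bullet> b) *\<^sub>R DG t x (b, \<zeta> b t x))" if t: "t \<in> {0..1}" for t
    proof -
      have "(v, z v t x) = (\<Sum>b\<in>Basis. (v \<bullet> b) *\<^sub>R (b, \<zeta> b t x))"
        by (simp add: z_def prod_eq_iff fst_sum snd_sum euclidean_representation)
      then show ?thesis by (simp only: linear_sum[OF linear_DG[OF t x]] linear_cmul[OF linear_DG[OF t x]])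
    qed
    have "integral {0..s} (\<lambda>t. DG t x (v, z v t x)) = integral {0..s} (\<lambda>t. \<Sum>b\<in>Basis. (v \<bullet> b) *\<^sub>R DG t x (b, \<zeta> b t x))"
      by (rule integral_cong) (use 1 s in auto)
    also have "\<dots> = (\<Sum>b\<in>Basis. integral {0..s} (\<lambda>t. (v \<bullet> b) *\<^sub>R DG t x (b, \<zeta> b t x)))"
      by (intro integral_sum integrable_initial_segment[OF _ s] continuous_intros cont_DG
          continuous_on_section[OF \<zeta>(1)] x) auto
    also have "\<dots> = (\<Sum>b\<in>Basis. (v \<bullet> b) *\<^sub>R (\<zeta> b s x - p' x b))"
      using \<zeta>(2)[OF s x] by (intro sum.cong) auto
    also have "\<dots> = z v s x - (\<Sum>b\<in>Basis. (v \<bullet> b) *\<^sub>R p' x b)"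
      by (simp add: z_def scaleR_diff_right sum_subtractf)
    also have "(\<Sum>b\<in>Basis. (v \<bullet> b) *\<^sub>R p' x b) = p' x v"
      using linear_eq_sum_Basis[OF has_derivative_linear[OF p(1)[OF x]], of v] by simp
    finally show ?thesis by simp
  qed
  have "(u s has_derivative (\<lambda>v. z v s x0)) (at x0)" if s: "s \<in> {0..1}" and x0: "x0 \<in> N" for s x0
  proof -
    have "linear (\<lambda>v. z v s x0)"
      by (rule linearI) (simp_all add: z_def inner_add_left scaleR_left_distrib sum.distrib scaleR_right.sum)
    then have bl: "bounded_linear (\<lambda>v. z v s x0)" by (simp add: linear_conv_bounded_linear)
    have "\<exists>K. \<forall>t\<in>{0..1}. norm (\<zeta> b t x0) \<le> K" for b
    proof -
      have "continuous_on {0..1} (\<lambda>t. \<zeta> b t x0)" by (rule continuous_on_section[OF \<zeta>(1) x0])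
      then have "bounded ((\<lambda>t. \<zeta> b t x0) ` {0..1})" by (intro compact_imp_bounded compact_continuous_image) auto
      then show ?thesis by (auto simp: bounded_iff)
    qed
    then obtain K where K: "\<And>b t. t \<in> {0..1} \<Longrightarrow> norm (\<zeta> b t x0) \<le> K b" by metis
    define Kz where "Kz = (\<Sum>b\<in>Basis. K b)"
    have Kz: "norm (z h t x0) \<le> Kz * norm h" if "t \<in> {0..1}" for h t
    proof -
      have "norm (z h t x0) \<le> (\<Sum>b\<in>Basis. norm h * K b)"
        unfolding z_def
      proof (rule sum_norm_le)
        fix c :: 'p assume "c \<in> Basis"
        then show "norm ((h \<bullet> c) *\<^sub>R \<zeta> c t x0) \<le> norm h * K c"
          unfolding norm_scaleR using K[OF that] Basis_le_norm by (intro mult_mono) auto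
      qed
      then show ?thesis by (simp add: Kz_def sum_distrib_left mult.commute)
    qed
    have "K b \<ge> 0" for b using order_trans[OF norm_ge_zero K[of 0 b]] by simp
    then have Kz0: "Kz \<ge> 0" unfolding Kz_def by (intro sum_nonneg)
    show ?thesis
      unfolding has_derivative_at_alt
    proof (intro conjI bl allI impI)
      fix e :: real assume "e > 0"
      \<comment> \<open>The bound 1/4 keeps the factor in the self-bound of \<open>w\<close> at most
        1/2 + 1/4, and dividing by 1 - 3/4 then produces the 4. In \<open>2 + Kz\<close>, one unit
        comes from the expansion of \<open>p\<close>, one from \<open>x - x0\<close> in the argument
        of \<open>G\<close>, and \<open>Kz\<close> from the linear part of \<open>u\<close>.\<close>
      define e1 where "e1 = min (1/4) (e / (4 * (2 + Kz)))"
      have e1: "e1 > 0" "e1 \<le> 1/4" unfolding e1_def using \<open>e > 0\<close> Kz0 by (simp, intro min.cobounded1)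
      have "e1 \<le> e / (4 * (2 + Kz))" unfolding e1_def by (rule min.cobounded2)
      moreover have "4 * (2 + Kz) > 0" using Kz0 by simp
      ultimately have "e1 * (4 * (2 + Kz)) \<le> e" using pos_le_divide_eq by blast
      then have e1': "4 * (e1 * (2 + Kz)) \<le> e" by (simp only: mult.left_commute mult.assoc)
      obtain d1 where d1: "d1 > 0" "\<And>t q. t \<in> {0..1} \<Longrightarrow> norm (q - (x0, u t x0)) < d1 \<Longrightarrow>
         norm (G t q - G t (x0, u t x0) - DG t x0 (q - (x0, u t x0))) \<le> e1 * norm (q - (x0, u t x0))"
      proof (rule Ck_fam_uniform_linearization[OF open_Times[OF open_N open_Y] G _ _ e1(1), of "\<lambda>t. (x0, u t x0)"])
        show "continuous_on {0..1} (\<lambda>t. (x0, u t x0))"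
          by (intro continuous_intros continuous_on_section[OF continuous_u x0])
      qed (use u_in x0 in \<open>auto simp: DG_def\<close>)
      obtain d2 where d2: "d2 > 0" "\<And>x t. x \<in> N \<Longrightarrow> dist x x0 < d2 \<Longrightarrow> t \<in> {0..1} \<Longrightarrow> dist (u t x) (u t x0) \<le> d1 / 4"
        using uniform_on_unit_interval[OF continuous_u x0, of "d1 / 4"] d1(1) by auto
      obtain d3 where d3: "d3 > 0" "\<And>x. norm (x - x0) < d3 \<Longrightarrow> norm (p x - p x0 - p' x0 (x - x0)) \<le> e1 * norm (x - x0)"
        using p(1)[OF x0, unfolded has_derivative_at_alt] e1(1) by blast
      obtain d4 where d4: "d4 > 0" "ball x0 d4 \<subseteq> N" using open_N x0 open_contains_ball by metis
      define d where "d = min (min (d1 / 4) d2) (min d3 d4)"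
      have "norm (u s x - u s x0 - z (x - x0) s x0) \<le> e * norm (x - x0)" if x: "norm (x - x0) < d" for x
      proof -
        have xs: "norm (x - x0) < d1 / 4" "dist x x0 < d2" "norm (x - x0) < d3" "x \<in> N"
          using x d4(2) by (auto simp: d_def dist_norm subset_iff norm_minus_commute)
        let ?h = "x - x0"
        define w where "w t = u t x - u t x0 - z ?h t x0" for t
        have cw: "continuous_on {0..1} w"
          unfolding w_def by (intro continuous_intros continuous_on_section[OF continuous_u] continuous_on_section[OF cont_z] x0 xs)
        have cG: "continuous_on {0..1} (\<lambda>t. G t (x', u t x'))" if "x' \<in> N" for x'
        proof -
          have "continuous_on {0..1} (\<lambda>t. (\<lambda>(s, q). G s q) (t, (x', u t x')))"
            by (rule continuous_on_compose2[OF Ck_fam_continuous[OF G]])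
              (use that u_in continuous_on_section[OF continuous_u that] in \<open>auto intro!: continuous_intros\<close>)
          then show ?thesis by simp
        qed
        have w_eq: "w t = (p x - p x0 - p' x0 ?h) +
            integral {0..t} (\<lambda>t. G t (x, u t x) - G t (x0, u t x0) - DG t x0 (?h, z ?h t x0))" if t: "t \<in> {0..1}" for t
        proof -
          have "integral {0..t} (\<lambda>t. G t (x, u t x) - G t (x0, u t x0) - DG t x0 (?h, z ?h t x0)) =
            integral {0..t} (\<lambda>t. G t (x, u t x)) - integral {0..t} (\<lambda>t. G t (x0, u t x0)) -
            integral {0..t} (\<lambda>t. DG t x0 (?h, z ?h t x0))"
            by (subst integral_diff integral_diff;
                (intro integrable_initial_segment[OF _ t] continuous_intros cG cont_DG continuous_on_section[OF cont_z] x0 xs)?)+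
              simp
          then show ?thesis
            unfolding w_def using u_eq[OF t xs(4)] u_eq[OF t x0] z_eq[OF t x0, of ?h] by simp
        qed
        have "norm (w s) \<le> (e1 * (2 + Kz) * norm ?h) / (1 - 3/4)"
        proof (rule norm_le_of_self_bound[OF cw _ s])
          fix M t assume M: "\<And>s. s \<in> {0..1} \<Longrightarrow> norm (w s) \<le> M" and t: "t \<in> {0..1::real}"
          have M0: "M \<ge> 0" using M[OF t] norm_ge_zero order_trans by blast
          have "norm (integral {0..t} (\<lambda>t. G t (x, u t x) - G t (x0, u t x0) - DG t x0 (?h, z ?h t x0))) \<le>
              e1 * (norm ?h + (M + Kz * norm ?h)) + 1/2 * M"
          proof (rule norm_integral_le[OF _ t])
            show "continuous_on {0..1} (\<lambda>t. G t (x, u t x) - G t (x0, u t x0) - DG t x0 (?h, z ?h t x0))"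
              by (intro continuous_intros cG cont_DG continuous_on_section[OF cont_z] x0 xs)
            fix r :: real assume r: "r \<in> {0..1}"
            let ?q = "(x, u r x) - (x0, u r x0)"
            have du: "norm (u r x - u r x0) \<le> d1 / 4" using d2(2)[OF xs(4,2) r] by (simp add: dist_norm)
            have nq: "norm ?q \<le> norm ?h + norm (u r x - u r x0)"
              using norm_Pair_le[of ?h "u r x - u r x0"] by simp
            then have "norm ?q < d1" using du xs(1) d1(1) by linarith
            from d1(2)[OF r this] have 1: "norm (G r (x, u r x) - G r (x0, u r x0) - DG r x0 ?q) \<le> e1 * norm ?q" .
            have "u r x - u r x0 = w r + z ?h r x0" by (simp add: w_def)
            then have "norm (u r x - u r x0) \<le> M + Kz * norm ?h"
              using norm_triangle_ineq[of "w r" "z ?h r x0"] M[OF r] Kz[OF r, of ?h] by simp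
            then have "e1 * norm ?q \<le> e1 * (norm ?h + (M + Kz * norm ?h))"
              using nq e1(1) by (intro mult_left_mono) auto
            then have 1: "norm (G r (x, u r x) - G r (x0, u r x0) - DG r x0 ?q) \<le> e1 * (norm ?h + (M + Kz * norm ?h))"
              using 1 by linarith
            have "DG r x0 ?q - DG r x0 (?h, z ?h r x0) = DG r x0 (0, w r)"
              using linear_diff[OF linear_DG[OF r x0], of ?q "(?h, z ?h r x0)"] by (simp add: w_def)
            then have 2: "norm (DG r x0 ?q - DG r x0 (?h, z ?h r x0)) \<le> 1/2 * M"
              using DG_vertical_bound[OF r x0, of "w r"] M[OF r] by simp
            have "G r (x, u r x) - G r (x0, u r x0) - DG r x0 (?h, z ?h r x0) =
                (G r (x, u r x) - G r (x0, u r x0) - DG r x0 ?q) + (DG r x0 ?q - DG r x0 (?h, z ?h r x0))"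
              by simp
            then show "norm (G r (x, u r x) - G r (x0, u r x0) - DG r x0 (?h, z ?h r x0)) \<le>
                e1 * (norm ?h + (M + Kz * norm ?h)) + 1/2 * M"
              using norm_triangle_mono[OF 1 2] by metis
          qed
          then have "norm (w t) \<le> e1 * norm ?h + (e1 * (norm ?h + (M + Kz * norm ?h)) + 1/2 * M)"
            unfolding w_eq[OF t] by (rule norm_triangle_mono[OF d3(2)[OF xs(3)]])
          also have "\<dots> = e1 * (2 + Kz) * norm ?h + (e1 + 1/2) * M" by (simp add: algebra_simps)
          also have "\<dots> \<le> e1 * (2 + Kz) * norm ?h + 3/4 * M"
            using e1(2) M0 by (intro add_left_mono mult_right_mono) auto
          finally show "norm (w t) \<le> e1 * (2 + Kz) * norm ?h + 3/4 * M" .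
        qed auto
        also have "\<dots> = 4 * (e1 * (2 + Kz)) * norm ?h" by simp
        also have "\<dots> \<le> e * norm ?h" using e1' by (intro mult_right_mono) auto
        finally show ?thesis by (simp add: w_def)
      qed
      moreover have "d > 0" using d1(1) d2(1) d3(1) d4(1) by (simp add: d_def)
      ultimately show "\<exists>d>0. \<forall>y. norm (y - x0) < d \<longrightarrow> norm (u s y - u s x0 - z (y - x0) s x0) \<le> e * norm (y - x0)"
        by blast
    qed
  qed
  then show thesis by (rule that[OF cont_z _ z_eq])
qed

end

end

lemma Ck_fam_le: "Ck_fam k S U f \<Longrightarrow> j \<le> k \<Longrightarrow> Ck_fam j S U f"
proof (induction k)
  case (Suc k)
  then show ?case using Ck_fam_Suc_imp le_Suc_eq by metis
qed simp

lemma Ck_fam_linear: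
  fixes L :: "'a::real_normed_vector \<Rightarrow> 'b::real_normed_vector" and S :: "'c::topological_space set"
  shows "bounded_linear L \<Longrightarrow> open U \<Longrightarrow> Ck_fam k S U (\<lambda>s. L)"
proof (cases "S = {}")
  case True
  have "Ck_fam k {} U f" for k and f :: "'c \<Rightarrow> 'a \<Rightarrow> 'b"
    by (induction k arbitrary: f) auto
  then show "bounded_linear L \<Longrightarrow> open U \<Longrightarrow> Ck_fam k S U (\<lambda>s. L)" using True by simp
next
  case False
  then show "bounded_linear L \<Longrightarrow> open U \<Longrightarrow> Ck_fam k S U (\<lambda>s. L)"
    using smooth_on_linear[of L U] Ck_on_eq_fam[OF False, of k U L] by (simp add: smooth_on_def)
qed

lemma Ck_fam_Pair:
  assumes "open U" "Ck_fam k S U f" "Ck_fam k S U g"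
  shows "Ck_fam k S U (\<lambda>s x. (f s x, g s x))"
proof -
  have "Ck_fam k S U (\<lambda>s x. (f s x, 0) + (0, g s x))"
    using assms by (intro Ck_fam_add bounded_linear.Ck_fam[of "\<lambda>x. (x, 0)"] bounded_linear.Ck_fam[of "\<lambda>x. (0, x)"])
      (auto intro!: bounded_linear_Pair bounded_linear_ident bounded_linear_zero)
  then show ?thesis by simp
qed

text \<open>
  The derivative of the solution solves an integral equation of the same form whose right-hand side
  has one derivative less.
\<close>

theorem integral_equation_Ck:
  fixes N :: "'p::euclidean_space set" and Y :: "'e::euclidean_space set"
  assumes "parametric_integral_equation N Y G p u"
    and "Ck_fam k {0..1} (N \<times> Y) G" "Ck_fam k {0..1::real} N (\<lambda>_. p)"
  shows "Ck_fam k {0..1} N u"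
  using assms
proof (induction k arbitrary: Y G p u)
  case 0
  then show ?case by (simp add: parametric_integral_equation.continuous_u)
next
  case (Suc k)
  interpret parametric_integral_equation N Y G p u by (rule Suc.prems(1))
  have G1: "Ck_fam (Suc 0) {0..1} (N \<times> Y) G" by (rule Ck_fam_le[OF Suc.prems(2)]) simp
  note facts = has_derivative_solution[OF G1] linear_DG[OF G1] DG_vertical_bound[OF G1]
  \<comment> \<open>The coefficients of the variational equation are derivatives of \<open>G\<close>
    along \<open>u\<close>, so \<open>u\<close> itself must first be known to be of class k.\<close>
  have u: "Ck_fam k {0..1} N u"
    using Suc.IH[OF Suc.prems(1)] Suc.prems(2,3) by (auto simp del: Ck_fam.simps intro: Ck_fam_Suc_imp)
  have p': "(p has_derivative frechet_derivative p (at x)) (at x)" if "x \<in> N" for x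
    by (rule Ck_fam_SucD(1)[OF Suc.prems(3) _ that, of 0]) simp
  have p'k: "Ck_fam k {0..1::real} N (\<lambda>_ x. frechet_derivative p (at x) v)" for v
    using Ck_fam_SucD(2)[OF Suc.prems(3)] by simp
  have p'c: "continuous_on N (\<lambda>x. frechet_derivative p (at x) v)" for v
  proof -
    have "continuous_on N (\<lambda>x. (\<lambda>(s, x). frechet_derivative p (at x) v) (0 :: real, x))"
      by (rule continuous_on_compose2[OF Ck_fam_continuous[OF p'k]]) (auto intro!: continuous_intros)
    then show ?thesis by simp
  qed
  obtain z where z: "\<And>v. continuous_on ({0..1} \<times> N) (\<lambda>(s, x). z v s x)"
    "\<And>s x. s \<in> {0..1} \<Longrightarrow> x \<in> N \<Longrightarrow> (u s has_derivative (\<lambda>v. z v s x)) (at x)"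
    "\<And>v s x. s \<in> {0..1} \<Longrightarrow> x \<in> N \<Longrightarrow>
      z v s x = frechet_derivative p (at x) v + integral {0..s} (\<lambda>t. DG t x (v, z v t x))"
    by (rule has_derivative_solution[OF G1 p' p'c]) (assumption | rule that)+
  have oNY: "open (N \<times> Y)" "open (N \<times> (UNIV :: 'e set))" using open_N open_Y by (auto intro: open_Times)
  have DGk: "Ck_fam k {0..1} N (\<lambda>s x. DG s x d)" for d
    unfolding DG_def
    using u_in by (intro Ck_fam_compose[OF open_N oNY(1) _ Ck_fam_SucD(2)[OF Suc.prems(2)]]
        Ck_fam_Pair[OF open_N Ck_fam_linear[OF bounded_linear_ident open_N] u]) auto
  have "Ck_fam k {0..1} N (z v)" for v
  proof -
    \<comment> \<open>This is \<open>DG s x (v, y)\<close> with \<open>y\<close> expanded in the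
      basis: in this form its regularity in \<open>(x, y)\<close> follows from that of
      \<open>DG\<close> in constant directions.\<close>
    define G' where "G' s q = DG s (fst q) (v, 0) + (\<Sum>c\<in>Basis. (snd q \<bullet> c) *\<^sub>R DG s (fst q) (0, c))" for s and q :: "'p \<times> 'e"
    have G': "G' s (x, y) = DG s x (v, y)" if "s \<in> {0..1}" "x \<in> N" for s x y
    proof -
      have "linear (\<lambda>y. DG s x (0, y))"
        using linear_compose[OF _ facts(2)[OF that], of "\<lambda>y. (0, y)"] by (simp add: o_def linear_iff)
      from linear_eq_sum_Basis[OF this, of y] show ?thesis
        using linear_add[OF facts(2)[OF that], of "(v, 0)" "(0, y)"] by (simp add: G'_def)
    qed
    show ?thesis
    proof (rule Suc.IH)
      show "Ck_fam k {0..1} (N \<times> UNIV) G'"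
        unfolding G'_def
        by (intro Ck_fam_add[OF oNY(2)] Ck_fam_sum[OF oNY(2)] bounded_bilinear.Ck_fam[OF bounded_bilinear_scaleR oNY(2)]
            Ck_fam_linear_arg[OF bounded_linear_fst open_N oNY(2) _ DGk]
            Ck_fam_linear[OF bounded_linear_compose[OF bounded_linear_inner_left bounded_linear_snd, unfolded o_def] oNY(2)])
          auto
      show "Ck_fam k {0..1::real} N (\<lambda>_ x. frechet_derivative p (at x) v)" by (rule p'k)
      show "parametric_integral_equation N UNIV G' (\<lambda>x. frechet_derivative p (at x) v) (z v)"
      proof
        show "norm (G' s (x, y) - G' s (x, y')) \<le> 1/2 * norm (y - y')" if sx: "s \<in> {0..1}" "x \<in> N" for s x y y'
        proof -
          have "DG s x (v, y) - DG s x (v, y') = DG s x (0, y - y')"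
            using linear_diff[OF facts(2)[OF sx], of "(v, y)" "(v, y')"] by simp
          then show ?thesis using facts(3)[OF sx, of "y - y'"] by (simp add: G'[OF sx])
        qed
        show "z v s x = frechet_derivative p (at x) v + integral {0..s} (\<lambda>t. G' t (x, z v t x))"
          if sx: "s \<in> {0..1}" "x \<in> N" for s x
        proof -
          have "integral {0..s} (\<lambda>t. G' t (x, z v t x)) = integral {0..s} (\<lambda>t. DG t x (v, z v t x))"
            by (rule integral_cong) (use G' sx in auto)
          then show ?thesis using z(3)[OF sx, of v] by simp
        qed
      qed (use open_N z(1) in auto)
    qed
  qed
  then show ?case
    by (intro Ck_fam_SucI[OF open_N continuous_u z(2)])
qed

section \<open>Exponential map of commuting fields\<close>

lemma Ck_fam_imp_Ck_on:
  assumes "open U" "Ck_fam k S U f" "s \<in> S"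
  shows "Ck_on k U (f s)"
proof -
  have "Ck_fam k {s} U (\<lambda>_. f s)"
    using Ck_fam_cong[OF assms(1) _ Ck_fam_subset[OF assms(2) subset_refl, of "{s}"], of "\<lambda>_. f s"] assms(3) by auto
  then show ?thesis using Ck_on_eq_fam[of "{s}"] by blast
qed

text \<open>Compactness bounds the field and its derivatives in basis directions; convexity of the
  ball turns the latter bound into a Lipschitz constant.\<close>

lemma smooth_bounded_lipschitz_on_cball:
  fixes X :: "'e::euclidean_space \<Rightarrow> 'b::real_normed_vector"
  assumes "smooth_on U X" "cball p R \<subseteq> U"
  obtains K where "K > 0" "\<And>y. y \<in> cball p R \<Longrightarrow> norm (X y) \<le> K"
    "\<And>y y'. y \<in> cball p R \<Longrightarrow> y' \<in> cball p R \<Longrightarrow> norm (X y - X y') \<le> K * norm (y - y')"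
proof -
  have bd: "\<exists>B. \<forall>y\<in>cball p R. norm (f y) \<le> B" if "smooth_on U f" for f :: "'e \<Rightarrow> 'b"
  proof -
    have "continuous_on (cball p R) f"
      using smooth_on_continuous[OF that] assms(2) continuous_on_subset by blast
    then have "bounded (f ` cball p R)" by (intro compact_imp_bounded compact_continuous_image) auto
    then show ?thesis by (auto simp: bounded_iff)
  qed
  obtain B where B: "\<And>y. y \<in> cball p R \<Longrightarrow> norm (X y) \<le> B" using bd[OF assms(1)] by blast
  obtain C where C: "\<And>b y. y \<in> cball p R \<Longrightarrow> norm (frechet_derivative X (at y) b) \<le> C b"
    using bd[OF smooth_on_deriv[OF assms(1)]] by metis
  define L where "L = (\<Sum>b\<in>Basis. C b)"
  have on: "onorm (frechet_derivative X (at y)) \<le> L" if y: "y \<in> cball p R" for y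
  proof (rule onorm_le)
    fix h
    have "linear (frechet_derivative X (at y))"
      using y assms by (intro frechet_derivative_linear_at smooth_on_differentiable) auto
    then have "norm (frechet_derivative X (at y) h) = norm (\<Sum>b\<in>Basis. (h \<bullet> b) *\<^sub>R frechet_derivative X (at y) b)"
      by (rule arg_cong[OF linear_eq_sum_Basis])
    also have "\<dots> \<le> (\<Sum>b\<in>Basis. norm h * C b)"
    proof (rule sum_norm_le)
      fix b :: 'e assume "b \<in> Basis"
      then show "norm ((h \<bullet> b) *\<^sub>R frechet_derivative X (at y) b) \<le> norm h * C b"
        unfolding norm_scaleR using C[OF y] Basis_le_norm by (intro mult_mono) auto
    qed
    finally show "norm (frechet_derivative X (at y) h) \<le> L * norm h"
      by (simp add: L_def sum_distrib_left mult.commute)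
  qed
  show thesis
  proof
    show "max 1 (max B L) > 0" by simp
    show "norm (X y) \<le> max 1 (max B L)" if "y \<in> cball p R" for y using B[OF that] by simp
    fix y y' assume yy: "y \<in> cball p R" "y' \<in> cball p R"
    have "norm (X y - X y') \<le> L * norm (y - y')"
    proof (rule differentiable_bound[OF convex_cball _ on yy(1) yy(2)])
      show "(X has_derivative frechet_derivative X (at x)) (at x within cball p R)" if "x \<in> cball p R" for x
        by (rule has_derivative_at_withinI[OF smooth_on_has_derivative[OF assms(1)]]) (use that assms(2) in blast)
    qed
    also have "\<dots> \<le> max 1 (max B L) * norm (y - y')" by (intro mult_right_mono) auto
    finally show "norm (X y - X y') \<le> max 1 (max B L) * norm (y - y')" .
  qed
qed

text \<open>
  \<open>\<Phi> x\<close> is the time-one value of the flow of \<open>\<Sum>i. \<tau> i x *\<^sub>R X i\<close> started at \<open>p x\<close>. Commutativity enters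
  because it makes \<open>s *\<^sub>R (\<Sum>i. \<tau> i w *\<^sub>R X i)\<close> a solution of the variational equation along the flow.
\<close>

lemma exp_of_commuting_fields:
  fixes X :: "'i::finite \<Rightarrow> 'e::euclidean_space \<Rightarrow> 'e" and p :: "'p::euclidean_space \<Rightarrow> 'e"
    and \<tau> :: "'i \<Rightarrow> 'p \<Rightarrow> real"
  assumes \<Omega>: "open \<Omega>" and X: "\<And>i. smooth_on \<Omega> (X i)"
    and comm: "\<And>i j y. y \<in> \<Omega> \<Longrightarrow> frechet_derivative (X i) (at y) (X j y) = frechet_derivative (X j) (at y) (X i y)"
    and \<tau>: "\<And>i. bounded_linear (\<tau> i)" "\<And>i. \<tau> i x0 = 0"
    and P0: "open P0" "x0 \<in> P0" and p: "smooth_on P0 p" "p x0 \<in> \<Omega>"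
  obtains N \<Phi> where "open N" "x0 \<in> N" "N \<subseteq> P0" "smooth_on N \<Phi>" "\<Phi> ` N \<subseteq> \<Omega>"
    "\<And>x. x \<in> N \<Longrightarrow> (\<And>i. \<tau> i x = 0) \<Longrightarrow> \<Phi> x = p x"
    "\<And>x w. x \<in> N \<Longrightarrow> frechet_derivative p (at x) w = 0 \<Longrightarrow>
      frechet_derivative \<Phi> (at x) w = (\<Sum>i\<in>UNIV. \<tau> i w *\<^sub>R X i (\<Phi> x))"
    "\<And>v. frechet_derivative \<Phi> (at x0) v = frechet_derivative p (at x0) v + (\<Sum>i\<in>UNIV. \<tau> i v *\<^sub>R X i (p x0))"
proof -
  obtain R where R: "R > 0" "cball (p x0) R \<subseteq> \<Omega>"
    using \<Omega> p(2) open_contains_cball by metis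
  have "\<exists>K>0. (\<forall>y\<in>cball (p x0) R. norm (X i y) \<le> K) \<and>
      (\<forall>y\<in>cball (p x0) R. \<forall>y'\<in>cball (p x0) R. norm (X i y - X i y') \<le> K * norm (y - y'))" for i
    by (rule smooth_bounded_lipschitz_on_cball[OF X[of i] R(2)]) blast
  then obtain K' where K': "\<And>i. K' i > 0" "\<And>i y. y \<in> cball (p x0) R \<Longrightarrow> norm (X i y) \<le> K' i"
    "\<And>i y y'. y \<in> cball (p x0) R \<Longrightarrow> y' \<in> cball (p x0) R \<Longrightarrow> norm (X i y - X i y') \<le> K' i * norm (y - y')"
    by metis
  define K where "K = (\<Sum>i\<in>UNIV. K' i)"
  have K: "K > 0" unfolding K_def using K'(1) by (intro sum_pos) auto
  \<comment> \<open>With coefficients \<open>\<tau> i x\<close> of size at most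
    \<open>\<delta>\<close>, the first bound limits the motion in unit time to \<open>R / 3\<close>,
    so that paths starting within \<open>R / 3\<close> of \<open>p x0\<close> stay in the ball; the
    second makes the Lipschitz constant 1/2.\<close>
  define \<delta> where "\<delta> = min (R / (3 * K)) (1 / (2 * K))"
  have \<delta>: "\<delta> > 0" using R(1) K by (simp add: \<delta>_def)
  have "\<delta> \<le> R / (3 * K)" "\<delta> \<le> 1 / (2 * K)" unfolding \<delta>_def by (rule min.cobounded1, rule min.cobounded2)
  then have \<delta>K: "\<delta> * K \<le> R / 3" "\<delta> * K \<le> 1/2" using K by (auto simp: field_simps)
  have "eventually (\<lambda>x. x \<in> P0 \<and> (\<forall>i. \<bar>\<tau> i x\<bar> < \<delta>) \<and> dist (p x) (p x0) < R / 3) (nhds x0)"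
  proof (intro eventually_conj)
    show "eventually (\<lambda>x. x \<in> P0) (nhds x0)" using P0 eventually_nhds by blast
    have "eventually (\<lambda>x. \<bar>\<tau> i x\<bar> < \<delta>) (nhds x0)" for i
    proof -
      have "continuous (at x0) (\<tau> i)" using linear_continuous_at[OF \<tau>(1)] .
      then have "((\<lambda>x. \<tau> i x) \<longlongrightarrow> \<tau> i x0) (nhds x0)" by (simp add: continuous_at tendsto_at_iff_tendsto_nhds)
      from tendstoD[OF this \<delta>] show ?thesis by (simp add: \<tau>(2))
    qed
    then show "eventually (\<lambda>x. \<forall>i. \<bar>\<tau> i x\<bar> < \<delta>) (nhds x0)" by (rule eventually_all_finite)
    have "continuous (at x0) p"
      using smooth_on_continuous[OF p(1)] P0 continuous_on_eq_continuous_at by blast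
    then have "(p \<longlongrightarrow> p x0) (nhds x0)" by (simp add: continuous_at tendsto_at_iff_tendsto_nhds)
    from tendstoD[OF this, of "R / 3"] show "eventually (\<lambda>x. dist (p x) (p x0) < R / 3) (nhds x0)" using R(1) by simp
  qed
  then obtain N where N: "open N" "x0 \<in> N"
    and Nx: "\<And>x. x \<in> N \<Longrightarrow> x \<in> P0" "\<And>x i. x \<in> N \<Longrightarrow> \<bar>\<tau> i x\<bar> \<le> \<delta>" "\<And>x. x \<in> N \<Longrightarrow> dist (p x) (p x0) < R / 3"
    unfolding eventually_nhds by (metis less_imp_le)
  \<comment> \<open>Composing with the projection onto the closed ball extends the fields to the
    whole space without increasing their Lipschitz constants. The solutions stay in the ball, where
    the projection is the identity.\<close>
  define cp where "cp = closest_point (cball (p x0) R)"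
  have cp_in: "cp y \<in> cball (p x0) R" for y
    unfolding cp_def by (rule closest_point_in_set) (use R(1) in auto)
  have cp_id: "cp y = y" if "y \<in> cball (p x0) R" for y
    unfolding cp_def by (rule closest_point_self[OF that])
  have cp_lip: "norm (cp y - cp y') \<le> norm (y - y')" for y y'
    using closest_point_lipschitz[of "cball (p x0) R" y y'] R(1) by (simp add: cp_def dist_norm)
  have cp_cont: "continuous_on UNIV cp"
    unfolding cp_def using R(1) by (intro continuous_on_closest_point) auto
  have Xcp: "continuous_on UNIV (\<lambda>y. X i (cp y))" for i
    by (rule continuous_on_compose2[OF smooth_on_continuous[OF X] cp_cont]) (use cp_in R(2) in auto)
  define F where "F s x y = (\<Sum>i\<in>UNIV. \<tau> i x *\<^sub>R X i (cp y))" for s :: real and x y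
  have sumb: "norm (\<Sum>i\<in>UNIV. \<tau> i x *\<^sub>R f i) \<le> \<delta> * (K * c)"
    if "x \<in> N" "\<And>i. norm (f i) \<le> K' i * c" for x c and f :: "'i \<Rightarrow> 'e"
  proof -
    have "norm (\<Sum>i\<in>UNIV. \<tau> i x *\<^sub>R f i) \<le> (\<Sum>i\<in>UNIV. \<delta> * (K' i * c))"
    proof (rule sum_norm_le)
      show "norm (\<tau> i x *\<^sub>R f i) \<le> \<delta> * (K' i * c)" for i
        unfolding norm_scaleR using Nx(2)[OF that(1)] that(2) \<delta> by (intro mult_mono) auto
    qed
    then show ?thesis by (simp add: K_def sum_distrib_left sum_distrib_right mult.assoc)
  qed
  have contF: "continuous_on ({0..1} \<times> N \<times> UNIV) (\<lambda>(s, x, y). F s x y)"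
    unfolding F_def case_prod_beta'
    by (intro continuous_intros continuous_on_compose2[OF Xcp] bounded_linear.continuous_on[OF \<tau>(1)]) auto
  have lipF: "norm (F s x y - F s x y') \<le> norm (y - y') / 2" if "x \<in> N" for s x y y'
  proof -
    have eq: "F s x y - F s x y' = (\<Sum>i\<in>UNIV. \<tau> i x *\<^sub>R (X i (cp y) - X i (cp y')))"
      by (simp add: F_def scaleR_diff_right sum_subtractf)
    have "norm (X i (cp y) - X i (cp y')) \<le> K' i * norm (y - y')" for i
      using K'(3)[OF cp_in cp_in, of i y y'] mult_left_mono[OF cp_lip[of y y'], of "K' i"] K'(1)[of i] by linarith
    then have "norm (F s x y - F s x y') \<le> \<delta> * (K * norm (y - y'))" unfolding eq by (rule sumb[OF that])
    also have "\<dots> \<le> 1/2 * norm (y - y')" unfolding mult.assoc[symmetric] using \<delta>K by (intro mult_right_mono) auto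
    finally show ?thesis by simp
  qed
  have cont_p: "continuous_on N p" using smooth_on_continuous[OF p(1)] Nx(1) by (meson continuous_on_subset subsetI)
  obtain u where u: "continuous_on ({0..1} \<times> N) (\<lambda>(s, x). u s x)"
    "\<And>s x. s \<in> {0..1} \<Longrightarrow> x \<in> N \<Longrightarrow> u s x = p x + integral {0..s} (\<lambda>t. F t x (u t x))"
    by (rule integral_equation_solution_param[OF contF lipF cont_p]) (assumption | rule that)+
  have u_in: "u s x \<in> ball (p x0) R" if s: "s \<in> {0..1}" and x: "x \<in> N" for s x
  proof -
    have "norm (integral {0..s} (\<lambda>t. F t x (u t x))) \<le> R / 3"
    proof (rule norm_integral_le[OF _ s])
      have "continuous_on {0..1} (\<lambda>t. (\<lambda>(s, x, y). F s x y) (t, x, u t x))"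
        by (rule continuous_on_compose2[OF contF])
          (use x continuous_on_section[OF u(1) x] in \<open>auto intro!: continuous_intros\<close>)
      then show "continuous_on {0..1} (\<lambda>t. F t x (u t x))" by simp
      fix t :: real
      have "norm (F t x (u t x)) \<le> \<delta> * (K * 1)"
        unfolding F_def using K'(2)[OF cp_in] by (intro sumb[OF x]) simp
      then show "norm (F t x (u t x)) \<le> R / 3" using \<delta>K by simp
    qed
    moreover have "norm (p x - p x0) < R / 3" using Nx(3)[OF x] by (simp add: dist_norm)
    ultimately have "norm ((p x - p x0) + integral {0..s} (\<lambda>t. F t x (u t x))) < R / 3 + R / 3"
      by (rule_tac norm_triangle_lt) linarith
    then have "norm (u s x - p x0) < R" using u(2)[OF s x] R(1) by (simp add: algebra_simps)
    then show ?thesis by (simp add: dist_norm norm_minus_commute)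
  qed
  define G where "G = (\<lambda>(s::real) q. \<Sum>i\<in>UNIV. \<tau> i (fst q) *\<^sub>R X i (snd q))"
  have FG: "F s x (u t x) = G s (x, u t x)" if "t \<in> {0..1}" "x \<in> N" for s t x
    using cp_id[of "u t x"] u_in[OF that] by (simp add: F_def G_def)
  interpret parametric_integral_equation N "ball (p x0) R" G p u
  proof
    show "open N" by (rule N(1))
    show "open (ball (p x0) R)" by simp
    show "norm (G s (x, y) - G s (x, y')) \<le> 1/2 * norm (y - y')"
      if "x \<in> N" "y \<in> ball (p x0) R" "y' \<in> ball (p x0) R" for s x y y'
      using lipF[OF that(1), of s y y'] cp_id[of y] cp_id[of y'] that by (simp add: F_def G_def)
    show "continuous_on ({0..1} \<times> N) (\<lambda>(s, x). u s x)" by (rule u(1))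
    show "u s x \<in> ball (p x0) R" if "s \<in> {0..1}" "x \<in> N" for s x by (rule u_in[OF that])
    show "u s x = p x + integral {0..s} (\<lambda>t. G t (x, u t x))" if sx: "s \<in> {0..1}" "x \<in> N" for s x
    proof -
      have "integral {0..s} (\<lambda>t. G t (x, u t x)) = integral {0..s} (\<lambda>t. F t x (u t x))"
        by (rule integral_cong) (use FG sx in auto)
      then show ?thesis using u(2)[OF sx] by simp
    qed
  qed
  have ball\<Omega>: "ball (p x0) R \<subseteq> \<Omega>" using R(2) ball_subset_cball by blast
  have oNB: "open (N \<times> ball (p x0) R)" using N(1) by (intro open_Times) auto
  have G_smooth: "smooth_on (N \<times> ball (p x0) R) (G s)" for s
    unfolding G_def
  proof (intro smooth_on_sum smooth_on_scaleR oNB)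
    fix i
    show "smooth_on (N \<times> ball (p x0) R) (\<lambda>q. \<tau> i (fst q))"
      using smooth_on_linear[OF bounded_linear_compose[OF \<tau>(1) bounded_linear_fst] oNB] by (simp add: o_def)
    show "smooth_on (N \<times> ball (p x0) R) (\<lambda>q. X i (snd q))"
      by (rule smooth_on_compose[OF oNB \<Omega> smooth_on_linear[OF bounded_linear_snd oNB] X]) (use ball\<Omega> in auto)
  qed
  have Gk: "Ck_fam k {0..1} (N \<times> ball (p x0) R) G" for k
    using G_smooth[of 0] Ck_on_eq_fam[of "{0..1::real}" k "N \<times> ball (p x0) R" "G 0"]
    by (simp add: smooth_on_def G_def)
  have p_N: "smooth_on N p" using smooth_on_subset[OF p(1)] Nx(1) by blast
  have pk: "Ck_fam k {0..1::real} N (\<lambda>_. p)" for k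
    using p_N Ck_on_eq_fam[of "{0..1::real}" k N p] by (simp add: smooth_on_def)
  have uk: "Ck_fam k {0..1} N u" for k
    by (rule integral_equation_Ck[OF parametric_integral_equation_axioms Gk pk])
  have \<Phi>_smooth: "smooth_on N (u 1)"
    unfolding smooth_on_def using Ck_fam_imp_Ck_on[OF N(1) uk, of 1] by simp
  have DG_eq: "DG s x (v, w) = (\<Sum>i\<in>UNIV. \<tau> i v *\<^sub>R X i (u s x)) +
      (\<Sum>i\<in>UNIV. \<tau> i x *\<^sub>R frechet_derivative (X i) (at (u s x)) w)" if sx: "s \<in> {0..1}" "x \<in> N" for s x v w
  proof -
    have "(X i has_derivative frechet_derivative (X i) (at (u s x))) (at (u s x))" for i
      using smooth_on_has_derivative[OF X] u_in[OF sx] ball\<Omega> by blast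
    then have 1: "((\<lambda>q. X i (snd q)) has_derivative (\<lambda>q. frechet_derivative (X i) (at (u s x)) (snd q))) (at (x, u s x))" for i
      using has_derivative_compose[OF has_derivative_snd[OF has_derivative_ident], of "X i" _ "(x, u s x)" UNIV] by simp
    have 2: "((\<lambda>q :: 'p \<times> 'e. \<tau> i (fst q)) has_derivative (\<lambda>q. \<tau> i (fst q))) (at (x, u s x))" for i
      by (rule bounded_linear_imp_has_derivative[OF bounded_linear_compose[OF \<tau>(1) bounded_linear_fst]])
    have "((\<lambda>q. \<tau> i (fst q) *\<^sub>R X i (snd q)) has_derivative
        (\<lambda>q. \<tau> i x *\<^sub>R frechet_derivative (X i) (at (u s x)) (snd q) + \<tau> i (fst q) *\<^sub>R X i (u s x))) (at (x, u s x))" for i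
      using has_derivative_scaleR[OF 2 1] by simp
    then have "(G s has_derivative (\<lambda>q. \<Sum>i\<in>UNIV. \<tau> i x *\<^sub>R frechet_derivative (X i) (at (u s x)) (snd q) +
        \<tau> i (fst q) *\<^sub>R X i (u s x))) (at (x, u s x))"
      unfolding G_def by (rule has_derivative_sum)
    then have "DG s x = (\<lambda>q. \<Sum>i\<in>UNIV. \<tau> i x *\<^sub>R frechet_derivative (X i) (at (u s x)) (snd q) +
        \<tau> i (fst q) *\<^sub>R X i (u s x))"
      unfolding DG_def by (rule frechet_derivative_at[symmetric])
    then show ?thesis by (simp add: sum.distrib)
  qed
  have p': "(p has_derivative frechet_derivative p (at x)) (at x)" if "x \<in> N" for x
    using smooth_on_has_derivative[OF p_N that] .
  have p'c: "continuous_on N (\<lambda>x. frechet_derivative p (at x) v)" for v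
    by (rule smooth_on_continuous[OF smooth_on_deriv[OF p_N]])
  obtain z where z: "\<And>v. continuous_on ({0..1} \<times> N) (\<lambda>(s, x). z v s x)"
    "\<And>s x. s \<in> {0..1} \<Longrightarrow> x \<in> N \<Longrightarrow> (u s has_derivative (\<lambda>v. z v s x)) (at x)"
    "\<And>v s x. s \<in> {0..1} \<Longrightarrow> x \<in> N \<Longrightarrow>
      z v s x = frechet_derivative p (at x) v + integral {0..s} (\<lambda>t. DG t x (v, z v t x))"
    by (rule has_derivative_solution[OF Gk p' p'c]) (assumption | rule that)+
  have D\<Phi>: "frechet_derivative (u 1) (at x) v = z v 1 x" if "x \<in> N" for x v
    using frechet_derivative_at[OF z(2)[of 1 x]] that by (metis atLeastAtMost_iff order_refl zero_le_one)
  show thesis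
  proof (rule that[of N "u 1"])
    show "open N" "x0 \<in> N" "smooth_on N (u 1)" using N \<Phi>_smooth by auto
    show "N \<subseteq> P0" using Nx(1) by blast
    show "u 1 ` N \<subseteq> \<Omega>" using u_in[of 1] ball\<Omega> by auto
    have fixed: "u s x = p x" if "x \<in> N" "\<And>i. \<tau> i x = 0" "s \<in> {0..1}" for x s
      using u(2)[OF that(3,1)] by (simp add: F_def that(2))
    show "u 1 x = p x" if "x \<in> N" "\<And>i. \<tau> i x = 0" for x
      using fixed[OF that, of 1] by simp
    fix v
    \<comment> \<open>All coefficients vanish at \<open>x0\<close>, hence the flow stands still
      there and the integrand is constant in time.\<close>
    have "integral {0..1} (\<lambda>t. DG t x0 (v, z v t x0)) = integral {0..1::real} (\<lambda>t. \<Sum>i\<in>UNIV. \<tau> i v *\<^sub>R X i (p x0))"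
      by (rule integral_cong) (use DG_eq N(2) fixed[OF N(2) \<tau>(2)] \<tau>(2) in simp)
    then show "frechet_derivative (u 1) (at x0) v = frechet_derivative p (at x0) v + (\<Sum>i\<in>UNIV. \<tau> i v *\<^sub>R X i (p x0))"
      using D\<Phi>[OF N(2), of v] z(3)[of 1 x0 v] N(2) by simp
  next
    fix x w assume x: "x \<in> N" and pw: "frechet_derivative p (at x) w = 0"
    define Y where "Y t = t *\<^sub>R (\<Sum>i\<in>UNIV. \<tau> i w *\<^sub>R X i (u t x))" for t
    have ux: "continuous_on {0..1} (\<lambda>t. u t x)" by (rule continuous_on_section[OF u(1) x])
    have Xu: "continuous_on {0..1} (\<lambda>t. X i (u t x))" for i
      by (rule continuous_on_compose2[OF smooth_on_continuous[OF X] ux]) (use u_in x ball\<Omega> in auto)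
    have Ycont: "continuous_on {0..1} Y" unfolding Y_def by (intro continuous_intros Xu)
    have contG: "continuous_on {0..1} (\<lambda>t. G t (x, u t x))"
      unfolding G_def fst_conv snd_conv by (intro continuous_intros Xu)
    have udot: "((\<lambda>t. u t x) has_vector_derivative G t (x, u t x)) (at t within {0..1})" if t: "t \<in> {0..1}" for t
    proof -
      have "((\<lambda>s. p x + integral {0..s} (\<lambda>t. G t (x, u t x))) has_vector_derivative G t (x, u t x)) (at t within {0..1})"
        using integral_has_vector_derivative[OF contG t] by (auto intro!: derivative_eq_intros)
      then show ?thesis
        by (rule has_vector_derivative_transform[rotated 2]) (use u_eq[OF _ x] t in auto)
    qed
    have Ydot: "(Y has_vector_derivative DG t x (w, Y t)) (at t within {0..1})" if t: "t \<in> {0..1}" for t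
    proof -
      have uO: "u t x \<in> \<Omega>" using u_in[OF t x] ball\<Omega> by blast
      let ?D = "\<lambda>i. frechet_derivative (X i) (at (u t x))"
      have lin: "linear (?D i)" for i
        using smooth_on_differentiable[OF X uO] by (rule frechet_derivative_linear_at)
      have Xdot: "((\<lambda>t. X i (u t x)) has_vector_derivative ?D i (G t (x, u t x))) (at t within {0..1})" for i
        using vector_derivative_diff_chain_within[OF udot[OF t], of "X i" "?D i"]
          has_derivative_at_withinI[OF smooth_on_has_derivative[OF X uO]] by (simp add: o_def)
      have Y': "(Y has_vector_derivative t *\<^sub>R (\<Sum>i\<in>UNIV. \<tau> i w *\<^sub>R ?D i (G t (x, u t x))) +
          (\<Sum>i\<in>UNIV. \<tau> i w *\<^sub>R X i (u t x))) (at t within {0..1})"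
        unfolding Y_def
        using has_vector_derivative_scaleR[OF DERIV_ident, of "\<lambda>t. \<Sum>i\<in>UNIV. \<tau> i w *\<^sub>R X i (u t x)" _ t "{0..1}"]
          has_vector_derivative_sum[of UNIV "\<lambda>i t. \<tau> i w *\<^sub>R X i (u t x)" "\<lambda>i. \<tau> i w *\<^sub>R ?D i (G t (x, u t x))"]
          has_vector_derivative_scaleR[OF DERIV_const, OF Xdot, of "\<tau> _ w"]
        by auto
      \<comment> \<open>Here the indices \<open>i\<close> and \<open>j\<close> change roles by
        \<open>comm\<close>: the derivative of the fields along the path turns into the linearized
        flow field applied to \<open>Y\<close>.\<close>
      have "(\<Sum>i\<in>UNIV. \<tau> i w *\<^sub>R ?D i (G t (x, u t x))) =
          (\<Sum>i\<in>UNIV. \<Sum>j\<in>UNIV. (\<tau> i w * \<tau> j x) *\<^sub>R ?D i (X j (u t x)))"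
        unfolding G_def fst_conv snd_conv linear_sum[OF lin] linear_cmul[OF lin] by (simp add: scaleR_right.sum)
      also have "\<dots> = (\<Sum>j\<in>UNIV. \<Sum>i\<in>UNIV. (\<tau> i w * \<tau> j x) *\<^sub>R ?D j (X i (u t x)))"
        by (subst sum.swap) (intro sum.cong refl arg_cong[where f = "scaleR _"] comm[OF uO])
      also have "\<dots> = (\<Sum>j\<in>UNIV. \<tau> j x *\<^sub>R ?D j (\<Sum>i\<in>UNIV. \<tau> i w *\<^sub>R X i (u t x)))"
        unfolding linear_sum[OF lin] linear_cmul[OF lin] by (simp add: scaleR_right.sum mult.commute)
      finally have "(\<Sum>i\<in>UNIV. \<tau> i w *\<^sub>R ?D i (G t (x, u t x))) =
          (\<Sum>j\<in>UNIV. \<tau> j x *\<^sub>R ?D j (\<Sum>i\<in>UNIV. \<tau> i w *\<^sub>R X i (u t x)))" .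
      then have "t *\<^sub>R (\<Sum>i\<in>UNIV. \<tau> i w *\<^sub>R ?D i (G t (x, u t x))) = (\<Sum>j\<in>UNIV. \<tau> j x *\<^sub>R ?D j (Y t))"
        unfolding Y_def linear_cmul[OF lin] by (simp add: scaleR_right.sum mult.commute)
      with Y' show ?thesis unfolding DG_eq[OF t x] by (simp add: add.commute)
    qed
    have "Y s = 0 + integral {0..s} (\<lambda>t. DG t x (w, Y t))" if s: "s \<in> {0..1}" for s
    proof -
      have "((\<lambda>t. DG t x (w, Y t)) has_integral (Y s - Y 0)) {0..s}"
        using s by (intro fundamental_theorem_of_calculus has_vector_derivative_within_subset[OF Ydot]) auto
      then have "integral {0..s} (\<lambda>t. DG t x (w, Y t)) = Y s - Y 0" by (rule integral_unique)
      moreover have "Y 0 = 0" by (simp add: Y_def)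
      ultimately show ?thesis by simp
    qed
    moreover have "z w s x = 0 + integral {0..s} (\<lambda>t. DG t x (w, z w t x))" if "s \<in> {0..1}" for s
      using z(3)[OF that x, of w] pw by simp
    ultimately have "z w 1 x = Y 1"
      by (intro variational_unique[OF Gk x continuous_on_section[OF z(1) x] Ycont, where a = 0 and v = w]) auto
    then show "frechet_derivative (u 1) (at x) w = (\<Sum>i\<in>UNIV. \<tau> i w *\<^sub>R X i (u 1 x))"
      using D\<Phi>[OF x, of w] by (simp add: Y_def)
  qed
qed

section \<open>Second derivatives and covariant derivatives\<close>

text \<open>After subtraction of its expected value the second difference is the increment of
  \<open>\<psi>\<close> over \<open>{0..h}\<close>. The mean value inequality bounds it through the
  derivative of \<open>\<psi>\<close>, in which \<open>g\<close> is compared with its linearization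
  at \<open>x\<close> in two points.\<close>

lemma second_difference_estimate:
  fixes f :: "'a::real_normed_vector \<Rightarrow> 'b::real_normed_vector"
  assumes U: "open U" "x \<in> U" and f: "smooth_on U f" and "e > 0"
  shows "\<exists>d>0. \<forall>h. 0 < h \<and> h < d \<longrightarrow>
    norm (f (x + h *\<^sub>R v + h *\<^sub>R w) - f (x + h *\<^sub>R v) - f (x + h *\<^sub>R w) + f x -
      h\<^sup>2 *\<^sub>R frechet_derivative (\<lambda>y. frechet_derivative f (at y) w) (at x) v) \<le> e * h\<^sup>2"
proof -
  define g where "g = (\<lambda>y. frechet_derivative f (at y) w)"
  define L where "L = frechet_derivative g (at x)"
  have gder: "(g has_derivative L) (at x)"
    unfolding L_def using smooth_on_has_derivative[OF smooth_on_deriv[OF f] U(2)] by (simp add: g_def)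
  have L: "linear L" using gder has_derivative_linear by blast
  \<comment> \<open>The two linearization errors have arguments of norm at most
    \<open>h * (norm v + norm w)\<close> and \<open>h * norm w\<close>; the summand 1 keeps
    \<open>C\<close> positive.\<close>
  define C where "C = norm v + 2 * norm w + 1"
  have C: "C > 0" "norm v + 2 * norm w \<le> C" using norm_ge_zero[of v] norm_ge_zero[of w] unfolding C_def by linarith+
  define e' where "e' = e / C"
  have e': "e' > 0" using C \<open>e > 0\<close> by (simp add: e'_def)
  obtain d1 where d1: "d1 > 0" "\<And>y. norm (y - x) < d1 \<Longrightarrow> norm (g y - g x - L (y - x)) \<le> e' * norm (y - x)"
    using gder[unfolded has_derivative_at_alt] e' by blast
  obtain r where r: "r > 0" "ball x r \<subseteq> U" using U open_contains_ball by metis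
  define d where "d = min d1 r / C"
  have d: "d > 0" "d * C \<le> d1" "d * C \<le> r" using C d1(1) r(1) by (auto simp: d_def)
  have "norm (f (x + h *\<^sub>R v + h *\<^sub>R w) - f (x + h *\<^sub>R v) - f (x + h *\<^sub>R w) + f x - h\<^sup>2 *\<^sub>R L v) \<le> e * h\<^sup>2"
    if h: "0 < h" "h < d" for h
  proof -
    have small: "norm (s *\<^sub>R v + t *\<^sub>R w) \<le> h * (norm v + norm w)"
      if "s \<in> {0..h}" "t \<in> {0..h}" for s t
    proof -
      have "norm (s *\<^sub>R v + t *\<^sub>R w) \<le> norm (s *\<^sub>R v) + norm (t *\<^sub>R w)" by (rule norm_triangle_ineq)
      also have "\<dots> \<le> h * norm v + h * norm w"
        unfolding norm_scaleR using that by (intro add_mono mult_right_mono) auto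
      finally show ?thesis by (simp add: algebra_simps)
    qed
    have "h * (norm v + norm w) \<le> h * C" using h norm_ge_zero[of w] by (intro mult_left_mono) (auto simp: C_def)
    also have "\<dots> < d * C" using h C by simp
    finally have hd: "h * (norm v + norm w) < d1" "h * (norm v + norm w) < r" using d by auto
    define \<psi> where "\<psi> t = f (x + h *\<^sub>R v + t *\<^sub>R w) - f (x + t *\<^sub>R w) - t *\<^sub>R (h *\<^sub>R L v)" for t
    have fder: "((\<lambda>t. f (y + t *\<^sub>R w)) has_derivative (\<lambda>s. s *\<^sub>R g (y + t *\<^sub>R w))) (at t within {0..h})"
      if "y + t *\<^sub>R w \<in> U" for y t
    proof -
      have 1: "((\<lambda>t. y + t *\<^sub>R w) has_derivative (\<lambda>s. s *\<^sub>R w)) (at t within {0..h})"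
        by (auto intro!: derivative_eq_intros)
      have 2: "(f has_derivative frechet_derivative f (at (y + t *\<^sub>R w))) (at (y + t *\<^sub>R w))"
        using smooth_on_has_derivative[OF f that] .
      show ?thesis
        using has_derivative_compose[OF 1 2] linear_cmul[OF has_derivative_linear[OF 2]] by (simp add: g_def)
    qed
    have inU: "x + (s *\<^sub>R v + t *\<^sub>R w) \<in> U" if "s \<in> {0..h}" "t \<in> {0..h}" for s t
    proof -
      have "dist (x + (s *\<^sub>R v + t *\<^sub>R w)) x < r" using small[OF that] hd(2) by (simp add: dist_norm)
      then have "x + (s *\<^sub>R v + t *\<^sub>R w) \<in> ball x r" by (metis mem_ball dist_commute)
      then show ?thesis using r(2) by blast
    qed
    have der: "(\<psi> has_derivative (\<lambda>s. s *\<^sub>R (g (x + h *\<^sub>R v + t *\<^sub>R w) - g (x + t *\<^sub>R w) - h *\<^sub>R L v))) (at t within {0..h})"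
      if t: "t \<in> {0..h}" for t
    proof -
      have "((\<lambda>t. f (x + h *\<^sub>R v + t *\<^sub>R w)) has_derivative (\<lambda>s. s *\<^sub>R g (x + h *\<^sub>R v + t *\<^sub>R w))) (at t within {0..h})"
        by (rule fder) (use inU[OF _ t, of h] h in \<open>simp add: add.assoc\<close>)
      moreover have "((\<lambda>t. f (x + t *\<^sub>R w)) has_derivative (\<lambda>s. s *\<^sub>R g (x + t *\<^sub>R w))) (at t within {0..h})"
        by (rule fder) (use inU[OF _ t, of 0] h in simp)
      moreover have "((\<lambda>t. t *\<^sub>R (h *\<^sub>R L v)) has_derivative (\<lambda>s. s *\<^sub>R (h *\<^sub>R L v))) (at t within {0..h})"
        by (auto intro!: derivative_eq_intros)
      ultimately show ?thesis
        unfolding \<psi>_def by (auto intro!: has_derivative_eq_rhs[OF has_derivative_diff[OF has_derivative_diff]] simp: scaleR_diff_right)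
    qed
    have bound: "norm (g (x + h *\<^sub>R v + t *\<^sub>R w) - g (x + t *\<^sub>R w) - h *\<^sub>R L v) \<le> e * h" if t: "t \<in> {0..h}" for t
    proof -
      let ?a = "h *\<^sub>R v + t *\<^sub>R w" and ?b = "0 *\<^sub>R v + t *\<^sub>R w"
      have na: "norm ?a \<le> h * (norm v + norm w)" using small[of h t] h t by simp
      have nb: "norm ?b \<le> h * norm w" using t by (simp add: mult_right_mono)
      have "norm ?b \<le> h * (norm v + norm w)" using small[of 0 t] h t by simp
      then have "norm (g (x + ?a) - g x - L ?a) \<le> e' * norm ?a" "norm (g (x + ?b) - g x - L ?b) \<le> e' * norm ?b"
        using d1(2)[of "x + ?a"] d1(2)[of "x + ?b"] na hd(1) by auto
      then have "norm ((g (x + ?a) - g x - L ?a) - (g (x + ?b) - g x - L ?b)) \<le> e' * norm ?a + e' * norm ?b"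
        by (rule norm_triangle_le_diff[OF add_mono])
      also have "(g (x + ?a) - g x - L ?a) - (g (x + ?b) - g x - L ?b) =
          g (x + h *\<^sub>R v + t *\<^sub>R w) - g (x + t *\<^sub>R w) - h *\<^sub>R L v"
        by (simp add: linear_add[OF L] linear_cmul[OF L] add.assoc)
      also have "e' * norm ?a + e' * norm ?b \<le> e' * (h * (norm v + norm w)) + e' * (h * norm w)"
        using na nb e' by (intro add_mono mult_left_mono) auto
      also have "\<dots> = e' * (h * (norm v + 2 * norm w))" by (simp add: algebra_simps)
      also have "\<dots> \<le> e' * (h * C)" using C(2) e' h by (intro mult_left_mono) auto
      also have "\<dots> = e * h" using C by (simp add: e'_def)
      finally show ?thesis .
    qed
    have "norm (\<psi> h - \<psi> 0) \<le> (e * h) * norm (h - 0)"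
    proof (rule differentiable_bound[OF _ der])
      show "onorm (\<lambda>s. s *\<^sub>R (g (x + h *\<^sub>R v + t *\<^sub>R w) - g (x + t *\<^sub>R w) - h *\<^sub>R L v)) \<le> e * h" if "t \<in> {0..h}" for t
        using bound[OF that] by (intro onorm_le) (simp add: mult.commute mult_left_mono)
    qed (use h in auto)
    moreover have "\<psi> h - \<psi> 0 = f (x + h *\<^sub>R v + h *\<^sub>R w) - f (x + h *\<^sub>R v) - f (x + h *\<^sub>R w) + f x - h\<^sup>2 *\<^sub>R L v"
      by (simp add: \<psi>_def power2_eq_square)
    ultimately show ?thesis using h by (simp add: power2_eq_square mult.assoc)
  qed
  then show ?thesis using d(1) unfolding L_def g_def by blast
qed

text \<open>Both mixed derivatives are limits of one and the same second difference, symmetric in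
  \<open>v\<close> and \<open>w\<close>, divided by the square of the step.\<close>

lemma frechet_derivative_symmetric:
  fixes f :: "'a::real_normed_vector \<Rightarrow> 'b::real_normed_vector"
  assumes "open U" "x \<in> U" "smooth_on U f"
  shows "frechet_derivative (\<lambda>y. frechet_derivative f (at y) w) (at x) v =
    frechet_derivative (\<lambda>y. frechet_derivative f (at y) v) (at x) w" (is "?l = ?r")
proof -
  have "norm (?l - ?r) \<le> 0 + e" if "e > 0" for e
  proof -
    have e2: "e / 2 > 0" using that by simp
    obtain d where d: "d > 0" "\<And>h. 0 < h \<Longrightarrow> h < d \<Longrightarrow>
        norm (f (x + h *\<^sub>R v + h *\<^sub>R w) - f (x + h *\<^sub>R v) - f (x + h *\<^sub>R w) + f x - h\<^sup>2 *\<^sub>R ?l) \<le> e / 2 * h\<^sup>2"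
      using second_difference_estimate[OF assms e2, of v w] by blast
    obtain d' where d': "d' > 0" "\<And>h. 0 < h \<Longrightarrow> h < d' \<Longrightarrow>
        norm (f (x + h *\<^sub>R w + h *\<^sub>R v) - f (x + h *\<^sub>R w) - f (x + h *\<^sub>R v) + f x - h\<^sup>2 *\<^sub>R ?r) \<le> e / 2 * h\<^sup>2"
      using second_difference_estimate[OF assms e2, of w v] by blast
    define h where "h = min d d' / 2"
    have h: "0 < h" "h < d" "h < d'" using d(1) d'(1) by (auto simp: h_def)
    let ?S = "f (x + h *\<^sub>R v + h *\<^sub>R w) - f (x + h *\<^sub>R v) - f (x + h *\<^sub>R w) + f x"
    have S: "f (x + h *\<^sub>R w + h *\<^sub>R v) - f (x + h *\<^sub>R w) - f (x + h *\<^sub>R v) + f x = ?S"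
      by (simp add: algebra_simps)
    have "norm ((?S - h\<^sup>2 *\<^sub>R ?r) - (?S - h\<^sup>2 *\<^sub>R ?l)) \<le> e / 2 * h\<^sup>2 + e / 2 * h\<^sup>2"
      using d'(2)[OF h(1,3)] d(2)[OF h(1,2)] unfolding S by (rule norm_triangle_le_diff[OF add_mono])
    also have "(?S - h\<^sup>2 *\<^sub>R ?r) - (?S - h\<^sup>2 *\<^sub>R ?l) = h\<^sup>2 *\<^sub>R (?l - ?r)"
      by (simp only: scaleR_diff_right diff_diff_eq2) (simp add: algebra_simps)
    finally have "h\<^sup>2 * norm (?l - ?r) \<le> h\<^sup>2 * e" by (simp add: mult.commute)
    then show ?thesis using h(1) by simp
  qed
  then have "norm (?l - ?r) \<le> 0" by (rule field_le_epsilon)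
  then show ?thesis by simp
qed

text \<open>Product rule for the derivative of \<open>f\<close> applied to a moving direction,
  obtained from the basis expansion. The same formula for the constant field \<open>X x\<close>
  reassembles the expanded second derivative.\<close>

lemma has_derivative_along_field:
  fixes f :: "'a::euclidean_space \<Rightarrow> 'b::real_normed_vector"
  assumes U: "open U" "x \<in> U" and f: "smooth_on U f" and X: "(X has_derivative X') (at x)"
  shows "((\<lambda>y. frechet_derivative f (at y) (X y)) has_derivative
    (\<lambda>v. frechet_derivative (\<lambda>y. frechet_derivative f (at y) (X x)) (at x) v + frechet_derivative f (at x) (X' v))) (at x)"
proof -
  let ?F = "\<lambda>b. frechet_derivative (\<lambda>y. frechet_derivative f (at y) b) (at x)"
  have F: "((\<lambda>y. frechet_derivative f (at y) b) has_derivative ?F b) (at x)" for b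
    using smooth_on_has_derivative[OF smooth_on_deriv[OF f] U(2)] .
  have eq: "frechet_derivative f (at y) c = (\<Sum>b\<in>Basis. (c \<bullet> b) *\<^sub>R frechet_derivative f (at y) b)" if "y \<in> U" for y c
    using linear_eq_sum_Basis[OF frechet_derivative_linear_at[OF smooth_on_differentiable[OF f that]]] .
  have sumder: "((\<lambda>y. \<Sum>b\<in>Basis. (Z y \<bullet> b) *\<^sub>R frechet_derivative f (at y) b) has_derivative
      (\<lambda>v. \<Sum>b\<in>Basis. (Z x \<bullet> b) *\<^sub>R ?F b v + (Z' v \<bullet> b) *\<^sub>R frechet_derivative f (at x) b)) (at x)"
    if "(Z has_derivative Z') (at x)" for Z Z'
    by (intro has_derivative_sum has_derivative_scaleR[OF has_derivative_inner_left[OF that] F])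
  have *: "((\<lambda>y. frechet_derivative f (at y) (Z y)) has_derivative
      (\<lambda>v. \<Sum>b\<in>Basis. (Z x \<bullet> b) *\<^sub>R ?F b v + (Z' v \<bullet> b) *\<^sub>R frechet_derivative f (at x) b)) (at x)"
    if "(Z has_derivative Z') (at x)" for Z Z'
    by (rule has_derivative_transform_within_open[OF sumder[OF that] U]) (rule eq[symmetric])
  have "?F (X x) = (\<lambda>v. \<Sum>b\<in>Basis. (X x \<bullet> b) *\<^sub>R ?F b v)"
    using frechet_derivative_at[OF *[OF has_derivative_const[of "X x"]]] by simp
  then have "(\<lambda>v. ?F (X x) v + frechet_derivative f (at x) (X' v)) =
      (\<lambda>v. \<Sum>b\<in>Basis. (X x \<bullet> b) *\<^sub>R ?F b v + (X' v \<bullet> b) *\<^sub>R frechet_derivative f (at x) b)"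
    unfolding sum.distrib eq[OF U(2), symmetric] by (simp only:)
  then show ?thesis using *[OF X] by (simp only:)
qed

text \<open>The second-order terms cancel by symmetry of the second derivative. For a vector field
  \<open>f\<close> this is flatness of the connection, for a scalar \<open>f\<close> the description
  of the bracket as a commutator of derivations.\<close>

lemma nabla_commutator:
  fixes X Y :: "'a::euclidean_space \<Rightarrow> 'a" and f :: "'a \<Rightarrow> 'b::real_normed_vector"
  assumes "open U" "u \<in> U" "smooth_on U X" "smooth_on U Y" "smooth_on U f"
  shows "nabla X (nabla Y f) u - nabla Y (nabla X f) u = nabla (lie_bracket X Y) f u"
proof -
  have "nabla Z (nabla Z' f) u = frechet_derivative (\<lambda>y. frechet_derivative f (at y) (Z' u)) (at u) (Z u) +
      frechet_derivative f (at u) (frechet_derivative Z' (at u) (Z u))" if "smooth_on U Z'" for Z Z'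
  proof -
    from frechet_derivative_at[OF has_derivative_along_field[OF assms(1,2,5) smooth_on_has_derivative[OF that assms(2)]]]
    show ?thesis unfolding nabla_def by (rule fun_cong[OF sym])
  qed
  note nn = this[OF assms(4), of X] this[OF assms(3), of Y]
  have "linear (frechet_derivative f (at u))"
    using smooth_on_differentiable[OF assms(5,2)] by (rule frechet_derivative_linear_at)
  from linear_diff[OF this, of "frechet_derivative Y (at u) (X u)" "frechet_derivative X (at u) (Y u)"]
  have *: "nabla (lie_bracket X Y) f u = frechet_derivative f (at u) (frechet_derivative Y (at u) (X u)) -
      frechet_derivative f (at u) (frechet_derivative X (at u) (Y u))"
    by (simp only: nabla_def lie_bracket_def)
  show ?thesis
    unfolding nn * frechet_derivative_symmetric[OF assms(1,2,5), of "Y u" "X u"] by simp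
qed

section \<open>Derivation rules\<close>

lemma nabla_cong:
  assumes "open U" "u \<in> U" "\<And>v. v \<in> U \<Longrightarrow> f v = g v"
  shows "nabla X f u = nabla X g u"
  using frechet_derivative_cong_open[OF assms] by (simp add: nabla_def)

lemma nabla_add:
  assumes "f differentiable at u" "g differentiable at u"
  shows "nabla X (\<lambda>v. f v + g v) u = nabla X f u + nabla X g u"
  using fun_cong[OF frechet_derivative_at[OF has_derivative_add[OF has_frechet_derivative[OF assms(1)] has_frechet_derivative[OF assms(2)]], symmetric], of "X u"]
  by (simp add: nabla_def)

lemma nabla_diff:
  assumes "f differentiable at u" "g differentiable at u"
  shows "nabla X (\<lambda>v. f v - g v) u = nabla X f u - nabla X g u"
  using fun_cong[OF frechet_derivative_at[OF has_derivative_diff[OF has_frechet_derivative[OF assms(1)] has_frechet_derivative[OF assms(2)]], symmetric], of "X u"]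
  by (simp add: nabla_def)

lemma nabla_scaleR:
  assumes "f differentiable at u" "g differentiable at u"
  shows "nabla X (\<lambda>v. f v *\<^sub>R g v) u = nabla X f u *\<^sub>R g u + f u *\<^sub>R nabla X g u"
  using fun_cong[OF frechet_derivative_at[OF has_derivative_scaleR[OF has_frechet_derivative[OF assms(1)] has_frechet_derivative[OF assms(2)]], symmetric], of "X u"]
  by (simp add: nabla_def)

lemma nabla_mult:
  fixes f g :: "_ \<Rightarrow> real"
  assumes "f differentiable at u" "g differentiable at u"
  shows "nabla X (\<lambda>v. f v * g v) u = nabla X f u * g u + f u * nabla X g u"
  using nabla_scaleR[OF assms] by simp

lemma nabla_exp:
  fixes f :: "_ \<Rightarrow> real"
  assumes "f differentiable at u"
  shows "nabla X (\<lambda>v. exp (f v)) u = exp (f u) * nabla X f u"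
  using fun_cong[OF frechet_derivative_at[OF has_derivative_exp[OF has_frechet_derivative[OF assms]], symmetric], of "X u"]
  by (simp add: nabla_def)

lemma nabla_const: "nabla X (\<lambda>v. c) u = 0"
  by (simp add: nabla_def)

lemma nabla_field_add:
  assumes "f differentiable at u" "X u = a *\<^sub>R Y u + b *\<^sub>R Z u"
  shows "nabla X f u = a *\<^sub>R nabla Y f u + b *\<^sub>R nabla Z f u"
  using frechet_derivative_linear_at[OF assms(1)] by (simp add: nabla_def assms(2) linear_add linear_cmul)

section \<open>Inverse functions and echelon frames\<close>

lemma Ck_fam_vec:
  fixes f :: "'c::topological_space \<Rightarrow> 'a::real_normed_vector \<Rightarrow> 'b::euclidean_space ^ 'm::finite"
  assumes "open U" "\<And>i. Ck_fam k S U (\<lambda>s x. f s x $ i)"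
  shows "Ck_fam k S U f"
proof -
  have bl: "bounded_linear (\<lambda>c::'b. axis i c)" for i :: 'm
    unfolding linear_conv_bounded_linear[symmetric] by (rule linearI) (auto simp: vec_eq_iff axis_def)
  have "Ck_fam k S U (\<lambda>s x. \<Sum>i\<in>UNIV. axis i (f s x $ i))"
    by (intro Ck_fam_sum[OF assms(1)] bounded_linear.Ck_fam[OF bl assms(1)] assms(2))
  moreover have "(\<Sum>i\<in>UNIV. axis i (v $ i)) = v" for v :: "'b ^ 'm"
    by (simp add: vec_eq_iff axis_def if_distrib sum.If_cases cong: if_cong)
  ultimately show ?thesis by simp
qed

lemma smooth_on_vec:
  fixes f :: "'a::real_normed_vector \<Rightarrow> 'b::euclidean_space ^ 'm::finite"
  assumes "open U" "\<And>i. smooth_on U (\<lambda>x. f x $ i)"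
  shows "smooth_on U f"
  using Ck_fam_vec[OF assms(1), of _ "{0::real}" "\<lambda>_. f"] assms(2) unfolding smooth_on_fam by blast

lemma smooth_on_det [smooth_intros]:
  fixes A :: "'a::real_normed_vector \<Rightarrow> real ^ 'm ^ 'm"
  assumes "open U" "\<And>i j. smooth_on U (\<lambda>x. A x $ i $ j)"
  shows "smooth_on U (\<lambda>x. det (A x))"
  unfolding det_def by (intro smooth_on_sum smooth_on_mult smooth_on_const smooth_on_prod assms)

lemma open_det_nonzero: "open {A :: real ^ 'm ^ 'm. det A \<noteq> 0}"
proof -
  have "smooth_on UNIV (\<lambda>A :: real ^ 'm ^ 'm. A $ i $ j)" for i j
    by (intro smooth_intros) auto
  then have "continuous_on UNIV (det :: real ^ 'm ^ 'm \<Rightarrow> real)"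
    by (intro smooth_on_continuous smooth_on_det) auto
  then have "open (det -` (- {0}) :: (real ^ 'm ^ 'm) set)" by (intro open_vimage) auto
  moreover have "det -` (- {0}) = {A :: real ^ 'm ^ 'm. det A \<noteq> 0}" by auto
  ultimately show ?thesis by simp
qed

lemma matrix_inv_mul:
  fixes A :: "real ^ 'm ^ 'm"
  assumes "det A \<noteq> 0"
  shows "A ** matrix_inv A = mat 1" "matrix_inv A ** A = mat 1"
proof -
  have "\<exists>B. A ** B = mat 1 \<and> B ** A = mat 1"
    using assms unfolding invertible_det_nz[symmetric] invertible_def .
  from someI_ex[OF this] show "A ** matrix_inv A = mat 1" "matrix_inv A ** A = mat 1"
    unfolding matrix_inv_def by auto
qed

text \<open>Cramer's rule writes each component as a quotient of determinants.\<close>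

lemma smooth_on_matrix_inv_vec: "smooth_on {A :: real ^ 'm ^ 'm. det A \<noteq> 0} (\<lambda>A. matrix_inv A *v b)"
proof (rule smooth_on_vec[OF open_det_nonzero])
  fix k :: 'm
  let ?S = "{A :: real ^ 'm ^ 'm. det A \<noteq> 0}"
  show "smooth_on ?S (\<lambda>A. (matrix_inv A *v b) $ k)"
  proof (rule smooth_on_cong[OF open_det_nonzero])
    have "smooth_on ?S (\<lambda>A. (\<chi> i j. if j = k then b $ i else A $ i $ j) $ i $ j)" for i j
      by (cases "j = k") (auto intro!: smooth_intros open_det_nonzero)
    then show "smooth_on ?S (\<lambda>A. det (\<chi> i j. if j = k then b $ i else A $ i $ j) / det A)"
      by (intro smooth_on_divide smooth_on_det open_det_nonzero
          smooth_on_nth[OF open_det_nonzero smooth_on_nth[OF open_det_nonzero smooth_on_id[OF open_det_nonzero]]]) auto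
    fix A :: "real ^ 'm ^ 'm" assume A: "A \<in> ?S"
    then have "A *v (matrix_inv A *v b) = b"
      using matrix_inv_mul(1)[of A] by (simp add: matrix_vector_mul_assoc)
    then have "matrix_inv A *v b = (\<chi> k. det (\<chi> i j. if j = k then b $ i else A $ i $ j) / det A)"
      using A cramer[of A] by simp
    then show "det (\<chi> i j. if j = k then b $ i else A $ i $ j) / det A = (matrix_inv A *v b) $ k"
      by simp
  qed
qed

lemma smooth_on_matrix_inv_entry:
  fixes A :: "'a::real_normed_vector \<Rightarrow> real ^ 'm ^ 'm"
  assumes "open U" "\<And>i j. smooth_on U (\<lambda>x. A x $ i $ j)" "\<And>x. x \<in> U \<Longrightarrow> det (A x) \<noteq> 0"
  shows "smooth_on U (\<lambda>x. matrix_inv (A x) $ i $ j)"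
proof -
  have "smooth_on U A" using assms(2) by (intro smooth_on_vec assms(1))
  then have "smooth_on U (\<lambda>x. (matrix_inv (A x) *v axis j 1) $ i)"
    using assms(1,3) by (intro smooth_on_nth smooth_on_compose[OF _ open_det_nonzero _ smooth_on_matrix_inv_vec]) auto
  then show ?thesis by (simp add: matrix_vector_mult_basis column_def)
qed

text \<open>The derivative of \<open>\<Psi>\<close> at \<open>y\<close> is the inverse matrix of the
  derivative of \<open>\<Phi>\<close> at \<open>\<Psi> y\<close>. This formula raises the regularity
  of \<open>\<Psi>\<close> by one order at each step of the induction.\<close>

lemma smooth_inverse_function:
  fixes \<Phi> :: "real ^ 'n \<Rightarrow> real ^ 'n"
  assumes N: "open N" "x0 \<in> N" and \<Phi>: "smooth_on N \<Phi>" and inj: "inj (frechet_derivative \<Phi> (at x0))"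
  obtains N' V \<Psi> where "open N'" "x0 \<in> N'" "N' \<subseteq> N" "open V" "homeomorphism N' V \<Phi> \<Psi>" "smooth_on V \<Psi>"
proof -
  let ?D = "\<lambda>x. frechet_derivative \<Phi> (at x)"
  have D: "(\<Phi> has_derivative ?D x) (at x)" if "x \<in> N" for x using smooth_on_has_derivative[OF \<Phi> that] .
  have bl: "bounded_linear (?D x)" if "x \<in> N" for x using D[OF that] by (rule has_derivative_bounded_linear)
  define f' where "f' x = Blinfun (?D x)" for x
  have f': "blinfun_apply (f' x) = ?D x" if "x \<in> N" for x
    unfolding f'_def by (rule bounded_linear_Blinfun_apply[OF bl[OF that]])
  have cont: "continuous_on N f'"
  proof (rule continuous_on_blinfun_componentwise)
    fix b :: "real ^ 'n"
    show "continuous_on N (\<lambda>x. blinfun_apply (f' x) b)"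
      by (rule continuous_on_eq[OF smooth_on_continuous[OF smooth_on_deriv[OF \<Phi>]]]) (simp add: f')
  qed
  have lin: "linear (?D x0)" using bl[OF N(2)] by (simp add: linear_conv_bounded_linear)
  obtain g where g: "linear g" "\<And>v. g (?D x0 v) = v"
    using linear_injective_left_inverse[OF lin inj] by (auto simp: o_def fun_eq_iff)
  have inv: "Blinfun g o\<^sub>L f' x0 = id_blinfun"
    using g by (intro blinfun_eqI) (simp add: bounded_linear_Blinfun_apply linear_conv_bounded_linear f'[OF N(2)])
  have der: "(\<Phi> has_derivative blinfun_apply (f' x)) (at x)" if "x \<in> N" for x using D that f' by simp
  obtain N' V \<Psi> g' where NV: "open N'" "N' \<subseteq> N" "x0 \<in> N'" "open V" "homeomorphism N' V \<Phi> \<Psi>"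
    and g': "\<And>y. y \<in> V \<Longrightarrow> (\<Psi> has_derivative g' y) (at y)"
      "\<And>y. y \<in> V \<Longrightarrow> g' y = inv (blinfun_apply (f' (\<Psi> y)))"
      "\<And>y. y \<in> V \<Longrightarrow> bij (blinfun_apply (f' (\<Psi> y)))"
    by (rule inverse_function_theorem[OF N(1) der cont N(2) inv]) (assumption | rule that)+
  have \<Psi>: "\<Psi> y \<in> N" if "y \<in> V" for y using NV(2,5) that unfolding homeomorphism_def by blast
  have M: "det (matrix (?D (\<Psi> y))) \<noteq> 0" "g' y v = matrix_inv (matrix (?D (\<Psi> y))) *v v" if y: "y \<in> V" for y v
  proof -
    have lin: "linear (?D (\<Psi> y))" using bl[OF \<Psi>[OF y]] by (simp add: linear_conv_bounded_linear)
    have bij: "bij (?D (\<Psi> y))" using g'(3)[OF y] f'[OF \<Psi>[OF y]] by simp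
    then show det: "det (matrix (?D (\<Psi> y))) \<noteq> 0"
      using det_nz_iff_inj[OF lin] bij_is_inj by blast
    have "?D (\<Psi> y) (g' y v) = v"
      using g'(2)[OF y] f'[OF \<Psi>[OF y]] surj_f_inv_f[OF bij_is_surj[OF bij]] by simp
    then have "matrix (?D (\<Psi> y)) *v g' y v = v"
      using fun_cong[OF matrix_vector_mul(2)[OF lin], of "g' y v"] by simp
    then have "matrix_inv (matrix (?D (\<Psi> y))) *v v = (matrix_inv (matrix (?D (\<Psi> y))) ** matrix (?D (\<Psi> y))) *v g' y v"
      by (simp add: matrix_vector_mul_assoc[symmetric])
    then show "g' y v = matrix_inv (matrix (?D (\<Psi> y))) *v v" using matrix_inv_mul(2)[OF det] by simp
  qed
  have cont\<Psi>: "continuous_on V \<Psi>" using NV(5) by (simp add: homeomorphism_def)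
  have "Ck_fam k {0::real} V (\<lambda>_. \<Psi>)" for k
  proof (induction k)
    case 0
    show ?case using cont\<Psi> Ck_on_iff_fam[of 0 V \<Psi>] by simp
  next
    case (Suc k)
    have "Ck_fam k {0::real} V (\<lambda>_ y. matrix (?D (\<Psi> y)))"
    proof (intro Ck_fam_vec NV(4))
      fix i j
      have "Ck_fam k {0::real} N (\<lambda>_ x. ?D x (axis j 1) $ i)"
        using smooth_on_nth[OF N(1) smooth_on_deriv[OF \<Phi>]] unfolding smooth_on_fam by blast
      then show "Ck_fam k {0::real} V (\<lambda>_ y. matrix (?D (\<Psi> y)) $ i $ j)"
        unfolding matrix_def using Ck_fam_compose[OF NV(4) N(1) Suc _ \<Psi>] by simp
    qed
    then have "Ck_fam k {0::real} V (\<lambda>_ y. matrix_inv (matrix (?D (\<Psi> y))) *v v)" for v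
      by (rule Ck_fam_compose[OF NV(4) open_det_nonzero])
        (use smooth_on_matrix_inv_vec[unfolded smooth_on_fam] M(1) in auto)
    then have "Ck_fam k {0::real} V (\<lambda>_ y. g' y v)" for v
      by (rule Ck_fam_cong[OF NV(4), rotated]) (simp add: M(2))
    moreover have "continuous_on ({0::real} \<times> V) (\<lambda>(s, x). \<Psi> x)"
      using Ck_fam_continuous[OF Suc] .
    ultimately show ?case
      using g'(1) by (intro Ck_fam_SucI[OF NV(4), where f' = "\<lambda>_. g'"])
  qed
  then have "smooth_on V \<Psi>" unfolding smooth_on_fam by blast
  then show thesis using that NV by blast
qed

text \<open>The vectors \<open>a k\<close> are dual to the fields at \<open>p\<close>, so the matrix
  of the products \<open>a k \<bullet> r j u\<close> is the identity at \<open>p\<close> and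
  invertible nearby; \<open>B\<close> is its transposed inverse, and the two identities are the two
  sides of inversion.\<close>

lemma dual_coefficients:
  fixes r :: "'i::finite \<Rightarrow> 'e::euclidean_space \<Rightarrow> 'e"
  assumes W: "open W" "p \<in> W" and r: "\<And>i. smooth_on W (r i)"
    and indep: "inj (\<lambda>i. r i p)" "independent (range (\<lambda>i. r i p))"
  obtains V and a :: "'i \<Rightarrow> 'e" and B :: "'i \<Rightarrow> 'i \<Rightarrow> 'e \<Rightarrow> real"
  where "open V" "p \<in> V" "V \<subseteq> W" "\<And>i j. smooth_on V (B i j)"
    "\<And>u i k. u \<in> V \<Longrightarrow> (\<Sum>j\<in>UNIV. B i j u * (a k \<bullet> r j u)) = (if i = k then 1 else 0)"
    "\<And>u j k. u \<in> V \<Longrightarrow> (\<Sum>i\<in>UNIV. (a i \<bullet> r k u) * B i j u) = (if k = j then 1 else 0)"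
proof -
  obtain g :: "'e \<Rightarrow> real ^ 'i" where g: "linear g"
    "\<forall>x\<in>range (\<lambda>i. r i p). g x = axis (inv (\<lambda>i. r i p) x) 1"
    using linear_independent_extend[OF indep(2), of "\<lambda>x. axis (inv (\<lambda>i. r i p) x) 1"] by blast
  have gr: "g (r j p) = axis j 1" for j using g(2) inv_f_f[OF indep(1), of j] by simp
  define a where "a k = adjoint g (axis k 1)" for k
  have a: "a k \<bullet> v = g v $ k" for k v
  proof -
    have "v \<bullet> a k = g v \<bullet> axis k 1" unfolding a_def by (rule adjoint_works[OF g(1)])
    then show ?thesis by (simp add: inner_axis inner_commute)
  qed
  define M where "M u = (\<chi> k j. a k \<bullet> r j u)" for u
  have M_entry: "M u $ k $ j = a k \<bullet> r j u" for u k j by (simp add: M_def)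
  have M: "smooth_on W (\<lambda>u. M u $ k $ j)" for k j
    unfolding M_entry using r W by (auto intro!: smooth_intros)
  have "M p = mat 1" unfolding M_def by (simp add: a gr vec_eq_iff mat_def axis_def)
  define V where "V = W \<inter> (\<lambda>u. det (M u)) -` (- {0})"
  have "open V" unfolding V_def
    by (intro continuous_open_preimage smooth_on_continuous smooth_on_det W M) auto
  moreover have "p \<in> V" using W \<open>M p = mat 1\<close> by (simp add: V_def)
  moreover have VW: "V \<subseteq> W" by (auto simp: V_def)
  moreover have "smooth_on V (\<lambda>u. matrix_inv (M u) $ j $ i)" for i j
    using smooth_on_subset[OF M VW] \<open>open V\<close> by (intro smooth_on_matrix_inv_entry) (auto simp: V_def)
  moreover have "(\<Sum>j\<in>UNIV. matrix_inv (M u) $ j $ i * (a k \<bullet> r j u)) = (if i = k then 1 else 0)" if "u \<in> V" for u i k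
  proof -
    have "(M u ** matrix_inv (M u)) $ k $ i = (if i = k then 1 else 0)"
      using matrix_inv_mul(1)[of "M u"] that by (auto simp: V_def mat_def)
    then show ?thesis by (simp add: matrix_matrix_mult_def M_entry mult.commute)
  qed
  moreover have "(\<Sum>i\<in>UNIV. (a i \<bullet> r k u) * matrix_inv (M u) $ j $ i) = (if k = j then 1 else 0)" if "u \<in> V" for u j k
  proof -
    have "(matrix_inv (M u) ** M u) $ j $ k = (if k = j then 1 else 0)"
      using matrix_inv_mul(2)[of "M u"] that by (auto simp: V_def mat_def)
    then show ?thesis by (simp add: matrix_matrix_mult_def M_entry mult.commute)
  qed
  ultimately show thesis by (rule that[where a = a and B = "\<lambda>i j u. matrix_inv (M u) $ j $ i"])
qed

text \<open>The products of \<open>X i\<close> with the fixed vectors \<open>a k\<close> are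
  constant, so every derivative of \<open>X i\<close> is annihilated by all \<open>a k\<close>, and
  so is the bracket of \<open>X i\<close> and \<open>X j\<close>. By involution this bracket is a
  combination of the \<open>R m\<close>, and such a combination vanishes once all \<open>a k\<close>
  annihilate it.\<close>

lemma commuting_echelon_fields:
  fixes R :: "'i::finite \<Rightarrow> 'e::euclidean_space \<Rightarrow> 'e"
  assumes \<Omega>: "open \<Omega>" "y \<in> \<Omega>" and R: "\<And>i. smooth_on \<Omega> (R i)" and B: "\<And>i j. smooth_on \<Omega> (B i j :: 'e \<Rightarrow> real)"
    and dual: "\<And>u i k. u \<in> \<Omega> \<Longrightarrow> (\<Sum>j\<in>UNIV. B i j u * (a k \<bullet> R j u)) = (if i = k then 1 else 0)"
    and dual': "\<And>u j k. u \<in> \<Omega> \<Longrightarrow> (\<Sum>i\<in>UNIV. (a i \<bullet> R k u) * B i j u) = (if k = j then 1 else 0)"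
    and bracket: "\<And>i j. \<exists>c. lie_bracket (R i) (R j) y = (\<Sum>k\<in>UNIV. c k *\<^sub>R R k y)"
  defines "X \<equiv> \<lambda>i u. \<Sum>j\<in>UNIV. B i j u *\<^sub>R R j u"
  shows "frechet_derivative (X i) (at y) (X j y) = frechet_derivative (X j) (at y) (X i y)"
proof -
  have Rd: "(R i has_derivative frechet_derivative (R i) (at y)) (at y)" for i
    by (rule smooth_on_has_derivative[OF R \<Omega>(2)])
  have Bd: "(B i j has_derivative frechet_derivative (B i j) (at y)) (at y)" for i j
    by (rule smooth_on_has_derivative[OF B \<Omega>(2)])
  have Rl: "linear (frechet_derivative (R i) (at y))" for i using Rd has_derivative_linear by blast
  have Xd: "(X i has_derivative (\<lambda>v. \<Sum>j\<in>UNIV. B i j y *\<^sub>R frechet_derivative (R j) (at y) v +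
      frechet_derivative (B i j) (at y) v *\<^sub>R R j y)) (at y)" for i
    unfolding X_def by (intro has_derivative_sum has_derivative_scaleR Bd Rd)
  have DX: "frechet_derivative (X i) (at y) v = (\<Sum>j\<in>UNIV. B i j y *\<^sub>R frechet_derivative (R j) (at y) v) +
      (\<Sum>j\<in>UNIV. frechet_derivative (B i j) (at y) v *\<^sub>R R j y)" for i v
    using fun_cong[OF frechet_derivative_at[OF Xd[of i], symmetric], of v] by (simp add: sum.distrib)
  have DX0: "a k \<bullet> frechet_derivative (X i) (at y) v = 0" for i k v
  proof -
    have "a k \<bullet> X i u = (if i = k then 1 else 0)" if "u \<in> \<Omega>" for u
      using dual[OF that, of i k] by (simp add: X_def inner_sum_right)
    then have "((\<lambda>u. a k \<bullet> X i u) has_derivative (\<lambda>v. 0)) (at y)"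
      by (intro has_derivative_transform_within_open[OF has_derivative_const \<Omega>]) auto
    moreover have "((\<lambda>u. a k \<bullet> X i u) has_derivative (\<lambda>v. a k \<bullet> frechet_derivative (X i) (at y) v)) (at y)"
      using has_derivative_inner_right[OF has_frechet_derivative[of "X i" y]] Xd differentiable_def by blast
    ultimately show ?thesis using has_derivative_unique fun_cong by metis
  qed
  obtain c where c: "\<And>i j. lie_bracket (R i) (R j) y = (\<Sum>k\<in>UNIV. c i j k *\<^sub>R R k y)"
    using bracket by metis
  let ?BB = "\<lambda>i j. \<Sum>k\<in>UNIV. B i k y *\<^sub>R frechet_derivative (R k) (at y) (X j y)"
  have BB: "?BB i j = (\<Sum>k\<in>UNIV. \<Sum>l\<in>UNIV. (B i k y * B j l y) *\<^sub>R frechet_derivative (R k) (at y) (R l y))" for i j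
    unfolding X_def linear_sum[OF Rl] linear_cmul[OF Rl] by (simp add: scaleR_right.sum)
  have BB': "?BB j i = (\<Sum>k\<in>UNIV. \<Sum>l\<in>UNIV. (B i k y * B j l y) *\<^sub>R frechet_derivative (R l) (at y) (R k y))"
    unfolding BB by (subst sum.swap) (simp add: mult.commute)
  have "?BB j i - ?BB i j = (\<Sum>k\<in>UNIV. \<Sum>l\<in>UNIV. (B i k y * B j l y) *\<^sub>R lie_bracket (R k) (R l) y)"
    unfolding BB[of i j] BB' lie_bracket_def by (simp add: sum_subtractf scaleR_diff_right)
  also have "\<dots> = (\<Sum>k\<in>UNIV. \<Sum>l\<in>UNIV. \<Sum>m\<in>UNIV. (B i k y * B j l y * c k l m) *\<^sub>R R m y)"
    unfolding c by (simp add: scaleR_right.sum)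
  also have "\<dots> = (\<Sum>k\<in>UNIV. \<Sum>m\<in>UNIV. \<Sum>l\<in>UNIV. (B i k y * B j l y * c k l m) *\<^sub>R R m y)"
    by (rule sum.cong[OF refl]) (rule sum.swap)
  also have "\<dots> = (\<Sum>m\<in>UNIV. \<Sum>k\<in>UNIV. \<Sum>l\<in>UNIV. (B i k y * B j l y * c k l m) *\<^sub>R R m y)"
    by (rule sum.swap)
  also have "\<dots> = (\<Sum>m\<in>UNIV. (\<Sum>k\<in>UNIV. \<Sum>l\<in>UNIV. B i k y * B j l y * c k l m) *\<^sub>R R m y)"
    by (simp only: scaleR_sum_left)
  finally have BBdiff: "?BB j i - ?BB i j = (\<Sum>m\<in>UNIV. (\<Sum>k\<in>UNIV. \<Sum>l\<in>UNIV. B i k y * B j l y * c k l m) *\<^sub>R R m y)" .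
  \<comment> \<open>Coefficients of the bracket of \<open>X i\<close> and \<open>X j\<close> in the
    fields \<open>R m\<close>: one part from the brackets of the \<open>R k\<close>, two from
    differentiating \<open>B\<close>.\<close>
  define \<gamma> where "\<gamma> m = (\<Sum>k\<in>UNIV. \<Sum>l\<in>UNIV. B i k y * B j l y * c k l m) +
      frechet_derivative (B j m) (at y) (X i y) - frechet_derivative (B i m) (at y) (X j y)" for m
  have diff: "frechet_derivative (X j) (at y) (X i y) - frechet_derivative (X i) (at y) (X j y) = (\<Sum>m\<in>UNIV. \<gamma> m *\<^sub>R R m y)"
    using BBdiff unfolding DX \<gamma>_def by (simp add: scaleR_add_left scaleR_diff_left sum.distrib sum_subtractf algebra_simps)
  have "(\<Sum>m\<in>UNIV. \<gamma> m * (a k \<bullet> R m y)) = 0" for k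
  proof -
    have "a k \<bullet> (\<Sum>m\<in>UNIV. \<gamma> m *\<^sub>R R m y) = 0" unfolding diff[symmetric] by (simp add: inner_diff_right DX0)
    then show ?thesis by (simp add: inner_sum_right)
  qed
  \<comment> \<open>Since \<open>B\<close> inverts the matrix of the products
    \<open>a k \<bullet> R m y\<close>, the vanishing sums give back each single
    coefficient.\<close>
  then have "0 = (\<Sum>k\<in>UNIV. (\<Sum>m\<in>UNIV. \<gamma> m * (a k \<bullet> R m y)) * B k n y)" for n by simp
  also have "(\<Sum>k\<in>UNIV. (\<Sum>m\<in>UNIV. \<gamma> m * (a k \<bullet> R m y)) * B k n y) = \<gamma> n" for n
  proof -
    have "(\<Sum>k\<in>UNIV. (\<Sum>m\<in>UNIV. \<gamma> m * (a k \<bullet> R m y)) * B k n y) = (\<Sum>m\<in>UNIV. \<gamma> m * (\<Sum>k\<in>UNIV. (a k \<bullet> R m y) * B k n y))"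
      unfolding sum_distrib_right sum_distrib_left by (subst sum.swap) (simp add: mult.assoc)
    also have "\<dots> = \<gamma> n" unfolding dual'[OF \<Omega>(2)] by (simp add: if_distrib cong: if_cong)
    finally show ?thesis .
  qed
  finally have "\<gamma> n = 0" for n by simp
  then show ?thesis using diff by simp
qed

section \<open>Frobenius problems along a transverse submanifold\<close>

text \<open>Splits the space into \<open>L\<close>, which will be the straightened data manifold,
  and as many orthonormal directions as there are fields; these will carry the flow times.\<close>

lemma orthonormal_complement_basis:
  fixes L :: "(real ^ 'n) set"
  assumes L: "subspace L" and dim: "dim L + CARD('i::finite) = CARD('n)"
  obtains b :: "'i::finite \<Rightarrow> real ^ 'n" where "\<And>i j. b i \<bullet> b j = (if i = j then 1 else 0)"
    "\<And>i x. x \<in> L \<Longrightarrow> b i \<bullet> x = 0" "\<And>x. x - (\<Sum>i\<in>UNIV. (b i \<bullet> x) *\<^sub>R b i) \<in> L"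
proof -
  define L' where "L' = {y. \<forall>x\<in>L. orthogonal x y}"
  have sub: "subspace L'"
    unfolding L'_def subspace_def by (auto simp: orthogonal_def inner_add_right)
  have "dim L' + dim L = CARD('n)"
    using dim_subspace_orthogonal_to_vectors[OF L subspace_UNIV] by (simp add: L'_def)
  then have dL': "dim L' = CARD('i)" using dim by simp
  obtain B where B: "B \<subseteq> L'" "pairwise orthogonal B" "\<And>x. x \<in> B \<Longrightarrow> norm x = 1"
      "independent B" "card B = dim L'" "span B = L'"
    using orthonormal_basis_subspace[OF sub] by metis
  have fB: "finite B" using B(4) by (rule independent_imp_finite)
  obtain b where b: "bij_betw b (UNIV :: 'i set) B"
    using finite_same_card_bij[of "UNIV :: 'i set" B] fB B(5) dL' by auto
  then have bB: "b i \<in> B" for i by (auto simp: bij_betw_def)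
  have inj: "inj b" using b by (simp add: bij_betw_def)
  show thesis
  proof
    show "b i \<bullet> b j = (if i = j then 1 else 0)" for i j
    proof (cases "i = j")
      case True
      then show ?thesis using B(3)[OF bB[of i]] by (simp add: norm_eq_1)
    next
      case False
      then have "b i \<noteq> b j" using inj by (auto dest: injD)
      then have "orthogonal (b i) (b j)" using B(2) bB pairwiseD by metis
      then show ?thesis using False by (simp add: orthogonal_def)
    qed
    show bL: "b i \<bullet> x = 0" if "x \<in> L" for i x
      using bB[of i] B(1) that by (auto simp: L'_def orthogonal_def inner_commute)
    fix x
    obtain y z where yz: "y \<in> span L" "\<And>w. w \<in> span L \<Longrightarrow> orthogonal z w" "x = y + z"
      using orthogonal_subspace_decomp_exists[of L x] by metis
    have y: "y \<in> L" using yz(1) span_eq_iff[THEN iffD2, OF L] by simp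
    have "z \<in> L'" using yz(2) span_base by (auto simp: L'_def orthogonal_commute)
    then have "(\<Sum>c\<in>B. (z \<bullet> c) *\<^sub>R c) = z"
      using B(6) by (intro orthonormal_basis_expand[OF B(2,3) _ fB]) auto
    then have "z = (\<Sum>i\<in>UNIV. (z \<bullet> b i) *\<^sub>R b i)"
      using sum.reindex_bij_betw[OF b, of "\<lambda>c. (z \<bullet> c) *\<^sub>R c"] by simp
    moreover have "b i \<bullet> x = z \<bullet> b i" for i
      using bL[OF y, of i] by (simp add: yz(3) inner_add_right inner_commute)
    ultimately have "x - (\<Sum>i\<in>UNIV. (b i \<bullet> x) *\<^sub>R b i) = y" using yz(3) by simp
    then show "x - (\<Sum>i\<in>UNIV. (b i \<bullet> x) *\<^sub>R b i) \<in> L" using y by simp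
  qed
qed

lemma frechet_derivative_fst_arg:
  assumes "f differentiable at (fst q)"
  shows "frechet_derivative (\<lambda>q. f (fst q)) (at q) v = frechet_derivative f (at (fst q)) (fst v)"
proof -
  have "((\<lambda>q. f (fst q)) has_derivative (\<lambda>v. frechet_derivative f (at (fst q)) (fst v))) (at q)"
    using has_derivative_compose[OF has_derivative_fst[OF has_derivative_ident] has_frechet_derivative[OF assms]] by simp
  from frechet_derivative_at[OF this] show ?thesis by metis
qed

lemma frechet_derivative_Pair:
  assumes "f differentiable at q" "g differentiable at q"
  shows "frechet_derivative (\<lambda>q. (f q, g q)) (at q) v = (frechet_derivative f (at q) v, frechet_derivative g (at q) v)"
  using fun_cong[OF frechet_derivative_at[OF has_derivative_Pair[OF assms[THEN has_frechet_derivative]], symmetric], of v]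
  by simp

lemma differentiable_fst_arg: "f differentiable at (fst q) \<Longrightarrow> (\<lambda>q. f (fst q)) differentiable at q"
  using has_derivative_compose[OF has_derivative_fst[OF has_derivative_ident] has_frechet_derivative[of f "fst q"]]
  unfolding differentiable_def by blast

lemma smooth_on_fst_arg:
  fixes f :: "'a::euclidean_space \<Rightarrow> 'b::real_normed_vector"
  assumes "open U" "smooth_on U f"
  shows "smooth_on (U \<times> (UNIV :: 'c::real_normed_vector set)) (\<lambda>q. f (fst q))"
  using assms by (intro smooth_on_compose[OF _ assms(1) smooth_on_linear[OF bounded_linear_fst] assms(2)]) (auto intro: open_Times)

text \<open>The chart image of the straight line through \<open>q\<close> in direction
  \<open>l\<close> is a curve with this velocity.\<close>

lemma curve_in_submanifold:
  fixes \<psi> :: "real ^ 'n \<Rightarrow> real ^ 'n"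
  assumes V: "open V" "q \<in> V" and \<psi>: "smooth_on V \<psi>" and L: "subspace L" "q \<in> L" "l \<in> L"
    and M: "\<And>y. y \<in> V \<inter> L \<Longrightarrow> \<psi> y \<in> M"
  shows "frechet_derivative \<psi> (at q) l \<in> tangent_space M (\<psi> q)"
proof -
  have "open ((\<lambda>t::real. q + t *\<^sub>R l) -` V)"
    by (intro open_vimage V continuous_intros)
  moreover have "0 \<in> (\<lambda>t::real. q + t *\<^sub>R l) -` V" using V by simp
  ultimately obtain e where e: "e > 0" "ball 0 e \<subseteq> (\<lambda>t::real. q + t *\<^sub>R l) -` V"
    using open_contains_ball by metis
  have inV: "q + t *\<^sub>R l \<in> V" if "t \<in> {-e<..<e}" for t
    using e(2) that by (auto simp: subset_iff dist_real_def)
  have inL: "q + t *\<^sub>R l \<in> L" for t using L by (simp add: subspace_add subspace_scale)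
  let ?\<gamma> = "\<lambda>t. \<psi> (q + t *\<^sub>R l)"
  have "smooth_on {-e<..<e} (\<lambda>t. q + t *\<^sub>R l)"
    by (intro smooth_intros) auto
  from smooth_on_compose[OF _ V(1) this \<psi>] have "smooth_on {-e<..<e} ?\<gamma>"
    using inV by auto
  moreover have "?\<gamma> ` {-e<..<e} \<subseteq> M" using M inV inL by blast
  moreover have "(?\<gamma> has_vector_derivative frechet_derivative \<psi> (at q) l) (at 0)"
  proof -
    have "((\<lambda>t::real. q + t *\<^sub>R l) has_derivative (\<lambda>t. t *\<^sub>R l)) (at 0)"
      by (auto intro!: derivative_eq_intros)
    moreover have d: "(\<psi> has_derivative frechet_derivative \<psi> (at q)) (at q)"
      by (rule smooth_on_has_derivative[OF \<psi> V(2)])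
    ultimately have "(?\<gamma> has_derivative (\<lambda>t. frechet_derivative \<psi> (at q) (t *\<^sub>R l))) (at 0)"
      using has_derivative_compose[of "\<lambda>t::real. q + t *\<^sub>R l" "\<lambda>t. t *\<^sub>R l" 0 UNIV \<psi>] by simp
    then show ?thesis
      unfolding has_vector_derivative_def linear_cmul[OF has_derivative_linear[OF d]] .
  qed
  ultimately show ?thesis
    unfolding tangent_space_def using e(1) by (intro CollectI exI[of _ ?\<gamma>] exI[of _ e]) auto
qed

text \<open>
  The fields \<open>(r i, h i)\<close> on \<open>real^'n \<times> 'b\<close> have the same structure functions as the \<open>r i\<close>, by the
  second half of \<open>integrable\<close>. Their leaves through the graph of \<open>g\<close> over \<open>M\<close> sweep out the graph of
  the solution, which is \<open>F\<close> in the chart \<open>\<Phi>\<close>; the kernel of \<open>P\<close> consists of the leafwise directions.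
\<close>

theorem frobenius_chart:
  fixes r :: "'i::finite \<Rightarrow> real ^ 'n \<Rightarrow> real ^ 'n" and h :: "'i \<Rightarrow> real ^ 'n \<Rightarrow> 'b::euclidean_space"
    and g :: "real ^ 'n \<Rightarrow> 'b"
  assumes W: "open W" "p \<in> W" and r: "\<And>i. smooth_on W (r i)" and h: "\<And>i. smooth_on W (h i)" and g: "smooth_on W g"
    and indep: "inj (\<lambda>i. r i p)" "independent (range (\<lambda>i. r i p))"
    and integrable: "\<And>u i j. u \<in> W \<Longrightarrow> \<exists>c. lie_bracket (r i) (r j) u = (\<Sum>k\<in>UNIV. c k *\<^sub>R r k u) \<and>
      nabla (r i) (h j) u - nabla (r j) (h i) u = (\<Sum>k\<in>UNIV. c k *\<^sub>R h k u)"
    and M: "submanifold d M" "p \<in> M" "d + CARD('i) = CARD('n)" "tangent_space M p \<inter> span (range (\<lambda>i. r i p)) = {0}"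
  obtains e V and \<Phi> \<Psi> P :: "real ^ 'n \<Rightarrow> real ^ 'n" and F where "e > 0" "open V" "p \<in> V" "V \<subseteq> W" "homeomorphism (ball 0 e) V \<Phi> \<Psi>"
    "smooth_on (ball 0 e) \<Phi>" "smooth_on V \<Psi>" "smooth_on (ball 0 e) F"
    "linear P" "\<And>x. norm (P x) \<le> norm x" "\<And>x. P (P x) = P x"
    "\<And>x. x \<in> ball 0 e \<Longrightarrow> \<Phi> (P x) \<in> M" "\<And>x. x \<in> ball 0 e \<Longrightarrow> F (P x) = g (\<Phi> (P x))"
    "\<And>u. u \<in> V \<inter> M \<Longrightarrow> P (\<Psi> u) = \<Psi> u"
    "\<And>x w. x \<in> ball 0 e \<Longrightarrow> P w = 0 \<Longrightarrow> \<exists>c. frechet_derivative \<Phi> (at x) w = (\<Sum>i\<in>UNIV. c i *\<^sub>R r i (\<Phi> x)) \<and>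
      frechet_derivative F (at x) w = (\<Sum>i\<in>UNIV. c i *\<^sub>R h i (\<Phi> x))"
    "\<And>x i. x \<in> ball 0 e \<Longrightarrow> \<exists>w. P w = 0 \<and> frechet_derivative \<Phi> (at x) w = r i (\<Phi> x) \<and>
      frechet_derivative F (at x) w = h i (\<Phi> x)"
proof -
  obtain U Vc L and \<phi> \<psi> :: "real ^ 'n \<Rightarrow> real ^ 'n" where chart: "open U" "p \<in> U" "open Vc" "homeomorphism U Vc \<phi> \<psi>"
      "smooth_on U \<phi>" "smooth_on Vc \<psi>" "subspace L" "dim L = d" "\<phi> ` (U \<inter> M) = Vc \<inter> L"
    using bspec[OF M(1)[unfolded submanifold_def] M(2)] by blast
  define q0 where "q0 = \<phi> p"
  have q0: "q0 \<in> Vc" "q0 \<in> L" "\<psi> q0 = p"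
    using chart(2,4,9) M(2) by (auto simp: q0_def homeomorphism_def)
  have \<psi>M: "\<psi> y \<in> M" if "y \<in> Vc \<inter> L" for y
  proof -
    have "y \<in> \<phi> ` (U \<inter> M)" unfolding chart(9) by (rule that)
    then obtain m where "m \<in> U \<inter> M" "y = \<phi> m" by auto
    then show ?thesis using homeomorphism_apply1[OF chart(4), of m] by simp
  qed
  obtain b :: "'i \<Rightarrow> real ^ 'n" where b: "\<And>i j. b i \<bullet> b j = (if i = j then 1 else 0)"
    "\<And>i x. x \<in> L \<Longrightarrow> b i \<bullet> x = 0" "\<And>x. x - (\<Sum>i\<in>UNIV. (b i \<bullet> x) *\<^sub>R b i) \<in> L"
    by (rule orthonormal_complement_basis[OF chart(7), where 'i = 'i]) (use chart(8) M(3) in auto)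
  \<comment> \<open>Orthogonal projection onto \<open>L\<close>. In the chart to be built,
    \<open>P x\<close> is the position on the data manifold relative to \<open>q0\<close>, and the
    products \<open>b i \<bullet> x\<close> are the flow times.\<close>
  define P where "P x = x - (\<Sum>i\<in>UNIV. (b i \<bullet> x) *\<^sub>R b i)" for x
  have PL: "P x \<in> L" for x using b(3) by (simp add: P_def)
  have P_id: "P x = x" if "\<And>i. b i \<bullet> x = 0" for x using that by (simp add: P_def)
  have bP: "b i \<bullet> P x = 0" for i x using b(2)[OF PL] .
  have PP: "P (P x) = P x" for x by (rule P_id[OF bP])
  have P_lin: "linear P"
    unfolding P_def by (intro linearI)
      (simp_all add: inner_add_right scaleR_left_distrib sum.distrib scaleR_diff_right scaleR_right.sum algebra_simps)
  have P_bl: "bounded_linear P" using P_lin by (simp add: linear_conv_bounded_linear)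
  have P_norm: "norm (P x) \<le> norm x" for x
  proof -
    have xP: "x - P x = (\<Sum>i\<in>UNIV. (b i \<bullet> x) *\<^sub>R b i)" by (simp add: P_def)
    have "orthogonal (P x) (x - P x)"
      unfolding orthogonal_def xP inner_sum_right by (simp add: bP inner_commute[of "P x"])
    then have "norm (P x + (x - P x)) ^ 2 = norm (P x) ^ 2 + norm (x - P x) ^ 2" by (rule norm_add_Pythagorean)
    then have "norm (P x) ^ 2 \<le> norm x ^ 2" by simp
    then show ?thesis by (rule power2_le_imp_le) simp
  qed
  have P0_expand: "w = (\<Sum>i\<in>UNIV. (b i \<bullet> w) *\<^sub>R b i)" if "P w = 0" for w using that by (simp add: P_def)
  have bsum: "b k \<bullet> (\<Sum>i\<in>UNIV. c i *\<^sub>R b i) = c k" for c k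
    by (simp add: inner_sum_right b(1) if_distrib cong: if_cong)
  have P_sum: "P (\<Sum>i\<in>UNIV. c i *\<^sub>R b i) = 0" for c unfolding P_def bsum by simp
  obtain V1 and a :: "'i \<Rightarrow> real ^ 'n" and B :: "'i \<Rightarrow> 'i \<Rightarrow> real ^ 'n \<Rightarrow> real"
    where V1: "open V1" "p \<in> V1" "V1 \<subseteq> W" and B: "\<And>i j. smooth_on V1 (B i j)"
    and dual: "\<And>u i k. u \<in> V1 \<Longrightarrow> (\<Sum>j\<in>UNIV. B i j u * (a k \<bullet> r j u)) = (if i = k then 1 else 0)"
    and dual': "\<And>u j k. u \<in> V1 \<Longrightarrow> (\<Sum>i\<in>UNIV. (a i \<bullet> r k u) * B i j u) = (if k = j then 1 else 0)"
    by (rule dual_coefficients[OF W r indep]) (rule that; assumption)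
  define \<Omega> where "\<Omega> = V1 \<times> (UNIV :: 'b set)"
  define R where "R j q = (r j (fst q), h j (fst q))" for j and q :: "(real ^ 'n) \<times> 'b"
  define X where "X i q = (\<Sum>j\<in>UNIV. B i j (fst q) *\<^sub>R R j q)" for i q
  have \<Omega>: "open \<Omega>" unfolding \<Omega>_def by (intro open_Times V1(1) open_UNIV)
  have rV: "smooth_on V1 (r i)" and hV: "smooth_on V1 (h i)" for i
    using smooth_on_subset[OF _ V1(3)] r h by auto
  have R_smooth: "smooth_on \<Omega> (R j)" for j
    using \<Omega> smooth_on_fst_arg[OF V1(1) rV] smooth_on_fst_arg[OF V1(1) hV]
    unfolding R_def \<Omega>_def by (intro smooth_on_Pair)
  have B_smooth: "smooth_on \<Omega> (\<lambda>q. B i j (fst q))" for i j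
    unfolding \<Omega>_def by (rule smooth_on_fst_arg[OF V1(1) B])
  have X_smooth: "smooth_on \<Omega> (X i)" for i
    unfolding X_def by (intro smooth_on_sum smooth_on_scaleR \<Omega> B_smooth R_smooth)
  have X_comm: "frechet_derivative (X i) (at y) (X j y) = frechet_derivative (X j) (at y) (X i y)" if y: "y \<in> \<Omega>" for i j y
    unfolding X_def
  proof (rule commuting_echelon_fields[where a = "\<lambda>k. (a k, 0)" and B = "\<lambda>i j q. B i j (fst q)", OF \<Omega> y R_smooth B_smooth])
    fix i j
    have u: "fst y \<in> V1" "fst y \<in> W" using y V1(3) by (auto simp: \<Omega>_def)
    have rd: "r k differentiable at (fst y)" and hd: "h k differentiable at (fst y)" for k
      using smooth_on_differentiable[OF r u(2)] smooth_on_differentiable[OF h u(2)] by auto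
    have DR: "frechet_derivative (R k) (at y) v = (frechet_derivative (r k) (at (fst y)) (fst v), frechet_derivative (h k) (at (fst y)) (fst v))" for k v
      unfolding R_def frechet_derivative_Pair[OF differentiable_fst_arg[OF rd] differentiable_fst_arg[OF hd]]
      by (simp add: frechet_derivative_fst_arg rd hd)
    obtain c where c: "lie_bracket (r i) (r j) (fst y) = (\<Sum>k\<in>UNIV. c k *\<^sub>R r k (fst y))"
        "nabla (r i) (h j) (fst y) - nabla (r j) (h i) (fst y) = (\<Sum>k\<in>UNIV. c k *\<^sub>R h k (fst y))"
      using integrable[OF u(2)] by blast
    have "lie_bracket (R i) (R j) y = (\<Sum>k\<in>UNIV. c k *\<^sub>R R k y)"
      unfolding lie_bracket_def[of "R i"] DR using c
      by (simp add: R_def lie_bracket_def nabla_def prod_eq_iff fst_sum snd_sum)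
    then show "\<exists>c. lie_bracket (R i) (R j) y = (\<Sum>k\<in>UNIV. c k *\<^sub>R R k y)" by blast
  qed (use dual dual' in \<open>auto simp: \<Omega>_def R_def\<close>)
  define Q where "Q = Vc \<inter> \<psi> -` W"
  have Q: "open Q" unfolding Q_def using smooth_on_continuous[OF chart(6)] chart(3) W(1) by (intro continuous_open_preimage)
  have \<psi>Q: "smooth_on Q \<psi>" using smooth_on_subset[OF chart(6)] by (simp add: Q_def)
  define pp where "pp y = (\<psi> y, g (\<psi> y))" for y
  have pp: "smooth_on Q pp"
    unfolding pp_def using Q by (intro smooth_on_Pair \<psi>Q smooth_on_compose[OF Q W(1) \<psi>Q g]) (auto simp: Q_def)
  define P0 where "P0 = (\<lambda>x. q0 + P x) -` Q"
  have P0: "open P0" unfolding P0_def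
    by (intro open_vimage Q continuous_intros bounded_linear.continuous_on[OF P_bl])
  have z0: "0 \<in> P0" using q0 W(2) linear_0[OF P_lin] by (simp add: P0_def Q_def)
  \<comment> \<open>The point on the graph of \<open>g\<close> at which the flow starts. It depends
    on \<open>P x\<close> only, so its derivative vanishes on the kernel of
    \<open>P\<close>.\<close>
  define pt where "pt x = pp (q0 + P x)" for x
  have qP: "smooth_on P0 (\<lambda>x. q0 + P x)" by (intro smooth_on_add smooth_on_const smooth_on_linear P0 P_bl)
  have pt: "smooth_on P0 pt"
    unfolding pt_def by (rule smooth_on_compose[OF P0 Q qP pp]) (simp add: P0_def)
  have Dpt: "frechet_derivative pt (at x) w = (frechet_derivative pp (at (q0 + P x)) (P w))" if "x \<in> P0" for x w
  proof -
    have "(pp has_derivative frechet_derivative pp (at (q0 + P x))) (at (q0 + P x))"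
      using smooth_on_has_derivative[OF pp] that by (simp add: P0_def)
    moreover have "((\<lambda>x. q0 + P x) has_derivative P) (at x)"
      using has_derivative_add[OF has_derivative_const[of q0] bounded_linear_imp_has_derivative[OF P_bl]] by simp
    ultimately have "(pt has_derivative (\<lambda>w. frechet_derivative pp (at (q0 + P x)) (P w))) (at x)"
      unfolding pt_def using has_derivative_compose[of "\<lambda>x. q0 + P x" P x UNIV pp] by simp
    from fun_cong[OF frechet_derivative_at[OF this], of w] show ?thesis by simp
  qed
  have pp_lin: "linear (frechet_derivative pp (at y))" if "y \<in> Q" for y
    using smooth_on_differentiable[OF pp that] by (rule frechet_derivative_linear_at)
  have pt0: "pt 0 = (p, g p)" using q0(3) linear_0[OF P_lin] by (simp add: pt_def pp_def)
  obtain N \<Theta> where N: "open N" "0 \<in> N" "N \<subseteq> P0" and \<Theta>: "smooth_on N \<Theta>" "\<Theta> ` N \<subseteq> \<Omega>"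
    "\<And>x. x \<in> N \<Longrightarrow> (\<And>i. b i \<bullet> x = 0) \<Longrightarrow> \<Theta> x = pt x"
    "\<And>x w. x \<in> N \<Longrightarrow> frechet_derivative pt (at x) w = 0 \<Longrightarrow>
      frechet_derivative \<Theta> (at x) w = (\<Sum>i\<in>UNIV. (b i \<bullet> w) *\<^sub>R X i (\<Theta> x))"
    "\<And>v. frechet_derivative \<Theta> (at 0) v = frechet_derivative pt (at 0) v + (\<Sum>i\<in>UNIV. (b i \<bullet> v) *\<^sub>R X i (pt 0))"
  proof (rule exp_of_commuting_fields[where X = X, OF \<Omega> X_smooth X_comm, of "\<lambda>i x. b i \<bullet> x" 0 P0 pt])
    show "pt 0 \<in> \<Omega>" using pt0 V1(2) by (simp add: \<Omega>_def)
  qed (use P0 z0 pt in \<open>auto simp: bounded_linear_inner_right\<close>)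
  define \<Phi> where "\<Phi> x = fst (\<Theta> x)" for x
  define F where "F x = snd (\<Theta> x)" for x
  have \<Phi>: "smooth_on N \<Phi>" and F: "smooth_on N F"
    unfolding \<Phi>_def F_def by (intro smooth_on_fst smooth_on_snd N(1) \<Theta>(1))+
  have \<Phi>V1: "\<Phi> x \<in> V1" if "x \<in> N" for x using \<Theta>(2) that by (auto simp: \<Omega>_def \<Phi>_def)
  have \<Phi>F: "\<Phi> = (\<lambda>x. fst (\<Theta> x))" "F = (\<lambda>x. snd (\<Theta> x))" by (auto simp: \<Phi>_def F_def)
  have D\<Theta>: "frechet_derivative \<Phi> (at x) v = fst (frechet_derivative \<Theta> (at x) v)"
    "frechet_derivative F (at x) v = snd (frechet_derivative \<Theta> (at x) v)" if "x \<in> N" for x v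
    using fun_cong[OF frechet_derivative_at[OF has_derivative_fst[OF smooth_on_has_derivative[OF \<Theta>(1) that]]], of v]
      fun_cong[OF frechet_derivative_at[OF has_derivative_snd[OF smooth_on_has_derivative[OF \<Theta>(1) that]]], of v]
    by (simp_all add: \<Phi>F)
  have aX: "a k \<bullet> fst (X i q) = (if i = k then 1 else 0)" if "q \<in> \<Omega>" for k i q
    using dual[of "fst q" i k] that by (simp add: X_def R_def fst_sum inner_sum_right \<Omega>_def mem_Times_iff)
  \<comment> \<open>The derivative at 0 adds a tangent vector of \<open>M\<close> to a combination
    of the fields. If the sum vanishes, transversality makes both vanish; pairing with
    \<open>a k\<close> then kills the flow times of \<open>v\<close>, and the left inverse
    \<open>\<phi>\<close> of \<open>\<psi>\<close> kills \<open>P v\<close>.\<close>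
  have inj: "inj (frechet_derivative \<Phi> (at 0))"
  proof -
    have lin: "linear (frechet_derivative \<Phi> (at 0))"
      using smooth_on_differentiable[OF \<Phi> N(2)] by (rule frechet_derivative_linear_at)
    have "v = 0" if v: "frechet_derivative \<Phi> (at 0) v = 0" for v
    proof -
      let ?S = "\<Sum>i\<in>UNIV. (b i \<bullet> v) *\<^sub>R fst (X i (pt 0))"
      have "q0 \<in> Q" using z0 linear_0[OF P_lin] by (simp add: P0_def)
      then have \<psi>d: "\<psi> differentiable at q0" using smooth_on_differentiable[OF \<psi>Q] by blast
      have gd: "(\<lambda>y. g (\<psi> y)) differentiable at q0"
        using smooth_on_differentiable[OF smooth_on_compose[OF Q W(1) \<psi>Q g] \<open>q0 \<in> Q\<close>] by (auto simp: Q_def)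
      have "fst (frechet_derivative pt (at 0) v) = frechet_derivative \<psi> (at q0) (P v)"
        using Dpt[OF z0, of v] linear_0[OF P_lin]
        unfolding pp_def frechet_derivative_Pair[OF \<psi>d gd] by (simp add: frechet_derivative_Pair[OF \<psi>d gd])
      then have eq: "frechet_derivative \<psi> (at q0) (P v) + ?S = 0"
        using v D\<Theta>(1)[OF N(2), of v] \<Theta>(5)[of v] by (simp add: fst_sum)
      have span: "?S \<in> span (range (\<lambda>i. r i p))"
      proof -
        have "fst (X i (pt 0)) = (\<Sum>j\<in>UNIV. B i j p *\<^sub>R r j p)" for i
          by (simp add: X_def R_def pt0 fst_sum)
        then show ?thesis by (simp only:) (intro span_sum span_scale span_base rangeI)
      qed
      have tang: "frechet_derivative \<psi> (at q0) (P v) \<in> tangent_space M p"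
        using curve_in_submanifold[OF chart(3) q0(1) chart(6,7) q0(2) PL \<psi>M] q0(3) by metis
      have D0: "frechet_derivative \<psi> (at q0) (P v) = 0"
      proof -
        have "frechet_derivative \<psi> (at q0) (P v) = - ?S" using eq by (simp add: eq_neg_iff_add_eq_0)
        then have "frechet_derivative \<psi> (at q0) (P v) \<in> span (range (\<lambda>i. r i p))" using span_neg[OF span] by simp
        then show ?thesis using tang M(4) by blast
      qed
      have bv: "b k \<bullet> v = 0" for k
      proof -
        have "?S = 0" using eq D0 by simp
        then have "a k \<bullet> ?S = 0" by simp
        moreover have "pt 0 \<in> \<Omega>" using pt0 V1(2) by (simp add: \<Omega>_def)
        ultimately show ?thesis by (simp add: inner_sum_right aX if_distrib cong: if_cong)
      qed
      have "frechet_derivative \<phi> (at p) (frechet_derivative \<psi> (at q0) (P v)) = P v"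
      proof -
        have "(\<phi> has_derivative frechet_derivative \<phi> (at p)) (at (\<psi> q0))"
          using smooth_on_has_derivative[OF chart(5,2)] q0(3) by simp
        from has_derivative_compose[OF has_frechet_derivative[OF \<psi>d] this]
        have "((\<lambda>y. \<phi> (\<psi> y)) has_derivative (\<lambda>w. frechet_derivative \<phi> (at p) (frechet_derivative \<psi> (at q0) w))) (at q0)" .
        moreover have "((\<lambda>y. \<phi> (\<psi> y)) has_derivative (\<lambda>w. w)) (at q0)"
          by (rule has_derivative_transform_within_open[OF has_derivative_ident chart(3) q0(1)])
            (use chart(4) in \<open>simp add: homeomorphism_apply2\<close>)
        ultimately have "(\<lambda>w. frechet_derivative \<phi> (at p) (frechet_derivative \<psi> (at q0) w)) = (\<lambda>w. w)"
          by (rule has_derivative_unique)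
        then show ?thesis by (rule fun_cong)
      qed
      then have "P v = 0"
        unfolding D0 using linear_0[OF frechet_derivative_linear_at[OF smooth_on_differentiable[OF chart(5,2)]]] by simp
      then show "v = 0" using P_id[OF bv] by simp
    qed
    then show ?thesis using linear_injective_0[OF lin] by blast
  qed
  obtain N' V' \<Psi> where NV: "open N'" "0 \<in> N'" "N' \<subseteq> N" "open V'" "homeomorphism N' V' \<Phi> \<Psi>" "smooth_on V' \<Psi>"
    by (rule smooth_inverse_function[OF N(1,2) \<Phi> inj]) (rule that)
  have P00: "P 0 = 0" by (rule linear_0[OF P_lin])
  have \<Phi>0: "\<Phi> 0 = p" using \<Theta>(3)[OF N(2)] pt0 by (simp add: \<Phi>_def)
  obtain e1 where e1: "e1 > 0" "ball 0 e1 \<subseteq> N'" using NV(1,2) open_contains_ball by metis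
  \<comment> \<open>The condition on \<open>\<phi>\<close> ensures that for each point
    \<open>u\<close> of \<open>M\<close> in \<open>V\<close> the vector \<open>\<phi> u - q0\<close>
    lies in \<open>N'\<close>, where \<open>\<Phi>\<close> is injective. That vector lies in
    \<open>L\<close> and is mapped to \<open>u\<close>, so it is \<open>\<Psi> u\<close>.\<close>
  define S where "S = N' \<inter> \<Phi> -` (W \<inter> (U \<inter> \<phi> -` ball q0 e1))"
  have cont\<Phi>: "continuous_on N' \<Phi>" using NV(5) by (simp add: homeomorphism_def)
  have "open (U \<inter> \<phi> -` ball q0 e1)"
    using chart(1) smooth_on_continuous[OF chart(5)] by (intro continuous_open_preimage) auto
  then have "open S" unfolding S_def by (intro continuous_open_preimage[OF cont\<Phi> NV(1)] open_Int[OF W(1)])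
  moreover have "0 \<in> S" using NV(2) \<Phi>0 W(2) chart(2) e1(1) by (simp add: S_def q0_def)
  ultimately obtain e2 where e2: "e2 > 0" "ball 0 e2 \<subseteq> S" using open_contains_ball by metis
  define e where "e = min e1 e2"
  have e: "e > 0" "ball 0 e \<subseteq> S" "ball 0 e \<subseteq> N'" "ball 0 e \<subseteq> N" using e1 e2 NV(3) by (auto simp: e_def)
  define V where "V = \<Phi> ` ball 0 e"
  have Veq: "V = V' \<inter> \<Psi> -` ball 0 e"
    unfolding V_def using e(3) NV(5) by (auto simp: homeomorphism_def)
  have Px: "P x \<in> ball 0 e" if "x \<in> ball 0 e" for x using P_norm[of x] that by simp
  have flat: "\<Theta> (P x) = pt x" if "x \<in> ball 0 e" for x
    using \<Theta>(3)[of "P x"] Px[OF that] e(4) bP PP by (auto simp: pt_def)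
  show thesis
  proof (rule that[of e V \<Phi> \<Psi> F P])
    show "e > 0" "linear P" "\<And>x. norm (P x) \<le> norm x" "\<And>x. P (P x) = P x" using e P_lin P_norm PP by auto
    show "open V"
      unfolding Veq using NV(4,5) by (intro continuous_open_preimage) (auto simp: homeomorphism_def)
    show "p \<in> V" unfolding V_def using \<Phi>0 e(1) by (metis centre_in_ball imageI)
    show "V \<subseteq> W" unfolding V_def using e(2) by (auto simp: S_def)
    show "homeomorphism (ball 0 e) V \<Phi> \<Psi>"
      using homeomorphism_of_subsets[OF NV(5) e(3), of V' V] by (simp add: V_def)
    show "smooth_on (ball 0 e) \<Phi>" "smooth_on (ball 0 e) F"
      using smooth_on_subset[OF \<Phi> e(4)] smooth_on_subset[OF F e(4)] by auto
    show "smooth_on V \<Psi>" using smooth_on_subset[OF NV(6)] Veq by blast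
    show "\<Phi> (P x) \<in> M" "F (P x) = g (\<Phi> (P x))" if "x \<in> ball 0 e" for x
    proof -
      have "x \<in> P0" using that e(4) N(3) by blast
      then have "q0 + P x \<in> Vc \<inter> L" using q0(2) PL chart(7) by (auto simp: P0_def Q_def subspace_add)
      then show "\<Phi> (P x) \<in> M" using \<psi>M flat[OF that] by (simp add: \<Phi>_def pt_def pp_def)
      show "F (P x) = g (\<Phi> (P x))" using flat[OF that] by (simp add: \<Phi>_def F_def pt_def pp_def)
    qed
    show "P (\<Psi> u) = \<Psi> u" if u: "u \<in> V \<inter> M" for u
    proof -
      obtain x where x: "x \<in> ball 0 e" "u = \<Phi> x" using u by (auto simp: V_def)
      then have uU: "u \<in> U" "\<phi> u \<in> ball q0 e1" using e(2) by (auto simp: S_def)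
      define y where "y = \<phi> u - q0"
      have "\<phi> u \<in> L" "\<psi> (\<phi> u) = u" using uU(1) u chart(4,9) by (auto simp: homeomorphism_def)
      then have yL: "y \<in> L" using q0(2) chart(7) by (simp add: y_def subspace_diff)
      have yN: "y \<in> N'" using uU(2) e1(2) by (auto simp: y_def subset_iff dist_norm norm_minus_commute)
      have Py: "P y = y" using P_id b(2)[OF yL] by blast
      have "\<Theta> y = pt y" using \<Theta>(3)[of y] yN NV(3) b(2)[OF yL] by blast
      then have "\<Phi> y = u" using Py \<open>\<psi> (\<phi> u) = u\<close> by (simp add: \<Phi>_def pt_def pp_def y_def)
      then have "\<Psi> u = y" using NV(5) yN homeomorphism_apply1 by metis
      then show ?thesis using Py by simp
    qed
    have Dker: "frechet_derivative \<Theta> (at x) w = (\<Sum>i\<in>UNIV. (b i \<bullet> w) *\<^sub>R X i (\<Theta> x))"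
      if "x \<in> ball 0 e" "P w = 0" for x w
    proof (rule \<Theta>(4))
      show "x \<in> N" using that e(4) by blast
      then have "x \<in> P0" using N(3) by blast
      then show "frechet_derivative pt (at x) w = 0"
        using Dpt[of x w] that(2) linear_0[OF pp_lin[of "q0 + P x"]] by (simp add: P0_def)
    qed
    have RX: "X i (\<Theta> x) = (\<Sum>j\<in>UNIV. B i j (\<Phi> x) *\<^sub>R (r j (\<Phi> x), h j (\<Phi> x)))" for i x
      by (simp add: X_def R_def \<Phi>_def)
    show "\<exists>c. frechet_derivative \<Phi> (at x) w = (\<Sum>i\<in>UNIV. c i *\<^sub>R r i (\<Phi> x)) \<and>
        frechet_derivative F (at x) w = (\<Sum>i\<in>UNIV. c i *\<^sub>R h i (\<Phi> x))" if x: "x \<in> ball 0 e" and w: "P w = 0" for x w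
    proof -
      have "frechet_derivative \<Theta> (at x) w = (\<Sum>i\<in>UNIV. \<Sum>j\<in>UNIV. ((b i \<bullet> w) * B i j (\<Phi> x)) *\<^sub>R (r j (\<Phi> x), h j (\<Phi> x)))"
        unfolding Dker[OF x w] RX scaleR_right.sum scaleR_scaleR ..
      also have "\<dots> = (\<Sum>j\<in>UNIV. \<Sum>i\<in>UNIV. ((b i \<bullet> w) * B i j (\<Phi> x)) *\<^sub>R (r j (\<Phi> x), h j (\<Phi> x)))"
        by (rule sum.swap)
      also have "\<dots> = (\<Sum>j\<in>UNIV. (\<Sum>i\<in>UNIV. (b i \<bullet> w) * B i j (\<Phi> x)) *\<^sub>R (r j (\<Phi> x), h j (\<Phi> x)))"
        by (simp only: scaleR_sum_left)
      finally have eq: "frechet_derivative \<Theta> (at x) w = (\<Sum>j\<in>UNIV. (\<Sum>i\<in>UNIV. (b i \<bullet> w) * B i j (\<Phi> x)) *\<^sub>R (r j (\<Phi> x), h j (\<Phi> x)))" .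
      have "x \<in> N" using x e(4) by blast
      then show ?thesis
        using D\<Theta>[of x w] unfolding eq
        by (intro exI[of _ "\<lambda>j. \<Sum>i\<in>UNIV. (b i \<bullet> w) * B i j (\<Phi> x)"]) (simp add: fst_sum snd_sum)
    qed
    show "\<exists>w. P w = 0 \<and> frechet_derivative \<Phi> (at x) w = r k (\<Phi> x) \<and> frechet_derivative F (at x) w = h k (\<Phi> x)"
      if x: "x \<in> ball 0 e" for x k
    proof -
      have xN: "x \<in> N" using x e(4) by blast
      \<comment> \<open>By \<open>dual'\<close> these coefficients expand \<open>r k\<close> in the
        commuting fields.\<close>
      define w where "w = (\<Sum>i\<in>UNIV. (a i \<bullet> r k (\<Phi> x)) *\<^sub>R b i)"
      have w: "P w = 0" unfolding w_def by (rule P_sum)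
      have bw: "b i \<bullet> w = a i \<bullet> r k (\<Phi> x)" for i unfolding w_def by (rule bsum)
      have "frechet_derivative \<Theta> (at x) w = (\<Sum>i\<in>UNIV. \<Sum>j\<in>UNIV. ((a i \<bullet> r k (\<Phi> x)) * B i j (\<Phi> x)) *\<^sub>R (r j (\<Phi> x), h j (\<Phi> x)))"
        unfolding Dker[OF x w] bw RX scaleR_right.sum scaleR_scaleR ..
      also have "\<dots> = (\<Sum>j\<in>UNIV. \<Sum>i\<in>UNIV. ((a i \<bullet> r k (\<Phi> x)) * B i j (\<Phi> x)) *\<^sub>R (r j (\<Phi> x), h j (\<Phi> x)))"
        by (rule sum.swap)
      also have "\<dots> = (\<Sum>j\<in>UNIV. (\<Sum>i\<in>UNIV. (a i \<bullet> r k (\<Phi> x)) * B i j (\<Phi> x)) *\<^sub>R (r j (\<Phi> x), h j (\<Phi> x)))"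
        by (simp only: scaleR_sum_left)
      also have "\<dots> = (r k (\<Phi> x), h k (\<Phi> x))"
        unfolding dual'[OF \<Phi>V1[OF xN]] by (simp add: if_distrib[of "\<lambda>c. c *\<^sub>R _"] cong: if_cong del: scaleR_Pair)
      finally show ?thesis using w D\<Theta>[OF xN, of w] by (intro exI[of _ w]) simp
    qed
  qed
qed

lemma frechet_derivative_compose:
  assumes "f differentiable at x" "g differentiable at (f x)"
  shows "frechet_derivative (\<lambda>x. g (f x)) (at x) v = frechet_derivative g (at (f x)) (frechet_derivative f (at x) v)"
  using fun_cong[OF frechet_derivative_at[OF has_derivative_compose[OF has_frechet_derivative[OF assms(1)]
      has_frechet_derivative[OF assms(2)]], symmetric], of v] by simp

text \<open>The solution is \<open>F\<close> composed with the inverse chart \<open>\<Psi>\<close>.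
  Each field \<open>r i\<close> is the image of a vector \<open>w\<close> along which
  \<open>F\<close> has derivative \<open>h i\<close>, and the chain rule through
  \<open>\<Phi>\<close> gives the equation.\<close>

theorem frobenius_existence:
  fixes r :: "'i::finite \<Rightarrow> real ^ 'n \<Rightarrow> real ^ 'n" and h :: "'i \<Rightarrow> real ^ 'n \<Rightarrow> 'b::euclidean_space"
    and g :: "real ^ 'n \<Rightarrow> 'b"
  assumes W: "open W" "p \<in> W" and r: "\<And>i. smooth_on W (r i)" and h: "\<And>i. smooth_on W (h i)" and g: "smooth_on W g"
    and indep: "inj (\<lambda>i. r i p)" "independent (range (\<lambda>i. r i p))"
    and integrable: "\<And>u i j. u \<in> W \<Longrightarrow> \<exists>c. lie_bracket (r i) (r j) u = (\<Sum>k\<in>UNIV. c k *\<^sub>R r k u) \<and>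
      nabla (r i) (h j) u - nabla (r j) (h i) u = (\<Sum>k\<in>UNIV. c k *\<^sub>R h k u)"
    and M: "submanifold d M" "p \<in> M" "d + CARD('i) = CARD('n)" "tangent_space M p \<inter> span (range (\<lambda>i. r i p)) = {0}"
  shows "\<exists>V f. nbhd_in p W V \<and> smooth_on V f \<and> (\<forall>u\<in>V. \<forall>i. nabla (r i) f u = h i u) \<and> (\<forall>u\<in>V \<inter> M. f u = g u)"
proof -
  obtain e V and \<Phi> \<Psi> P :: "real ^ 'n \<Rightarrow> real ^ 'n" and F where c: "e > 0" "open V" "p \<in> V" "V \<subseteq> W"
    "homeomorphism (ball 0 e) V \<Phi> \<Psi>" "smooth_on (ball 0 e) \<Phi>" "smooth_on V \<Psi>" "smooth_on (ball 0 e) F"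
    "\<And>x. x \<in> ball 0 e \<Longrightarrow> F (P x) = g (\<Phi> (P x))" "\<And>u. u \<in> V \<inter> M \<Longrightarrow> P (\<Psi> u) = \<Psi> u"
    "\<And>x i. x \<in> ball 0 e \<Longrightarrow> \<exists>w. P w = 0 \<and> frechet_derivative \<Phi> (at x) w = r i (\<Phi> x) \<and>
      frechet_derivative F (at x) w = h i (\<Phi> x)"
    by (rule frobenius_chart[OF W r h g indep integrable M], assumption) (rule that; assumption)
  define f where "f u = F (\<Psi> u)" for u
  have \<Psi>: "\<Psi> u \<in> ball 0 e" "\<Phi> (\<Psi> u) = u" if "u \<in> V" for u
    using c(5) that by (auto simp: homeomorphism_def)
  have f: "smooth_on V f"
    unfolding f_def by (rule smooth_on_compose[OF c(2) open_ball c(7,8)]) (rule \<Psi>)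
  have "nabla (r i) f u = h i u" if u: "u \<in> V" for u i
  proof -
    let ?x = "\<Psi> u"
    obtain w where w: "frechet_derivative \<Phi> (at ?x) w = r i u" "frechet_derivative F (at ?x) w = h i u"
      using c(11)[OF \<Psi>(1)[OF u], of i] \<Psi>(2)[OF u] by auto
    have "F y = f (\<Phi> y)" if "y \<in> ball 0 e" for y
      using homeomorphism_apply1[OF c(5) that] by (simp add: f_def)
    then have "frechet_derivative F (at ?x) w = frechet_derivative (\<lambda>y. f (\<Phi> y)) (at ?x) w"
      using frechet_derivative_cong_open[OF open_ball \<Psi>(1)[OF u]] by metis
    also have "\<dots> = frechet_derivative f (at (\<Phi> ?x)) (frechet_derivative \<Phi> (at ?x) w)"
      using smooth_on_differentiable[OF c(6) \<Psi>(1)[OF u]] smooth_on_differentiable[OF f u] \<Psi>(2)[OF u]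
      by (intro frechet_derivative_compose) auto
    finally show ?thesis using w \<Psi>(2)[OF u] by (simp add: nabla_def)
  qed
  moreover have "f u = g u" if "u \<in> V \<inter> M" for u
    using c(9)[of "\<Psi> u"] c(10)[OF that] \<Psi>[of u] that by (simp add: f_def)
  ultimately show ?thesis
    using c(2,3,4) f by (intro exI[of _ V] exI[of _ f]) (auto simp: nbhd_in_def)
qed

text \<open>The chart for \<open>h = 0\<close> joins each point to the data manifold: the segment
  from \<open>P x\<close> to \<open>x\<close> runs in the kernel of \<open>P\<close>, so its image
  under \<open>\<Phi>\<close> is tangent to the leaves and \<open>\<delta>\<close> is constant along
  it.\<close>

theorem frobenius_uniqueness:
  fixes r :: "'i::finite \<Rightarrow> real ^ 'n \<Rightarrow> real ^ 'n" and \<delta> :: "real ^ 'n \<Rightarrow> 'b::euclidean_space"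
  assumes W: "open W" "p \<in> W" and r: "\<And>i. smooth_on W (r i)"
    and indep: "inj (\<lambda>i. r i p)" "independent (range (\<lambda>i. r i p))"
    and involutive: "\<And>u i j. u \<in> W \<Longrightarrow> \<exists>c. lie_bracket (r i) (r j) u = (\<Sum>k\<in>UNIV. c k *\<^sub>R r k u)"
    and M: "submanifold d M" "p \<in> M" "d + CARD('i) = CARD('n)" "tangent_space M p \<inter> span (range (\<lambda>i. r i p)) = {0}"
    and \<delta>: "\<And>u. u \<in> W \<Longrightarrow> \<delta> differentiable at u" "\<And>u i. u \<in> W \<Longrightarrow> nabla (r i) \<delta> u = 0"
      "\<And>u. u \<in> W \<inter> M \<Longrightarrow> \<delta> u = 0"
  shows "\<exists>V. nbhd_in p W V \<and> (\<forall>u\<in>V. \<delta> u = 0)"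
proof -
  define h where "h = (\<lambda>(i::'i) (u::real ^ 'n). 0 :: 'b)"
  have h: "smooth_on W (h i)" for i unfolding h_def by (intro smooth_on_const W(1))
  have g: "smooth_on W (\<lambda>u. 0 :: 'b)" by (intro smooth_on_const W(1))
  have int: "\<exists>c. lie_bracket (r i) (r j) u = (\<Sum>k\<in>UNIV. c k *\<^sub>R r k u) \<and>
      nabla (r i) (h j) u - nabla (r j) (h i) u = (\<Sum>k\<in>UNIV. c k *\<^sub>R h k u)" if "u \<in> W" for u i j
    using involutive[OF that, of i j] by (simp add: h_def nabla_const)
  obtain e V and \<Phi> \<Psi> P :: "real ^ 'n \<Rightarrow> real ^ 'n" and F where c: "e > 0" "open V" "p \<in> V" "V \<subseteq> W"
    "homeomorphism (ball 0 e) V \<Phi> \<Psi>" "smooth_on (ball 0 e) \<Phi>" "linear P" "\<And>x. norm (P x) \<le> norm x" "\<And>x. P (P x) = P x"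
    "\<And>x. x \<in> ball 0 e \<Longrightarrow> \<Phi> (P x) \<in> M"
    "\<And>x w. x \<in> ball 0 e \<Longrightarrow> P w = 0 \<Longrightarrow> \<exists>c. frechet_derivative \<Phi> (at x) w = (\<Sum>i\<in>UNIV. c i *\<^sub>R r i (\<Phi> x)) \<and>
      frechet_derivative F (at x) w = (\<Sum>i\<in>UNIV. c i *\<^sub>R h i (\<Phi> x))"
    by (rule frobenius_chart[OF W r h g indep int M], assumption) (rule that; assumption)
  have "\<delta> u = 0" if u: "u \<in> V" for u
  proof -
    define x where "x = \<Psi> u"
    have x: "x \<in> ball 0 e" "\<Phi> x = u" using c(5) u by (auto simp: homeomorphism_def x_def)
    have Px: "P x \<in> ball 0 e" using c(8)[of x] x(1) by simp
    define w where "w = x - P x"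
    have w: "P w = 0" using linear_diff[OF c(7), of x "P x"] c(9) by (simp add: w_def)
    have seg: "P x + t *\<^sub>R w \<in> ball 0 e" if "t \<in> {0..1}" for t
    proof -
      have "P x + t *\<^sub>R w = (1 - t) *\<^sub>R P x + t *\<^sub>R x" by (simp add: w_def algebra_simps)
      then show ?thesis using convexD[OF convex_ball Px x(1), of "1 - t" t] that by simp
    qed
    have "((\<lambda>t. \<delta> (\<Phi> (P x + t *\<^sub>R w))) has_derivative (\<lambda>s. 0)) (at t within {0..1})" if t: "t \<in> {0..1}" for t
    proof -
      let ?y = "P x + t *\<^sub>R w"
      have \<Phi>y: "\<Phi> ?y \<in> V" using c(5) seg[OF t] by (auto simp: homeomorphism_def)
      have d1: "((\<lambda>t. P x + t *\<^sub>R w) has_derivative (\<lambda>s. s *\<^sub>R w)) (at t within {0..1})"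
        by (auto intro!: derivative_eq_intros)
      have d2: "(\<Phi> has_derivative frechet_derivative \<Phi> (at ?y)) (at ?y)"
        by (rule smooth_on_has_derivative[OF c(6) seg[OF t]])
      have d3: "(\<delta> has_derivative frechet_derivative \<delta> (at (\<Phi> ?y))) (at (\<Phi> ?y))"
        using \<delta>(1) \<Phi>y c(4) by (intro has_frechet_derivative) auto
      have l2: "linear (frechet_derivative \<Phi> (at ?y))" and l3: "linear (frechet_derivative \<delta> (at (\<Phi> ?y)))"
        using d2 d3 has_derivative_linear by auto
      obtain k where k: "frechet_derivative \<Phi> (at ?y) w = (\<Sum>i\<in>UNIV. k i *\<^sub>R r i (\<Phi> ?y))"
        using c(11)[OF seg[OF t] w] by blast
      have "frechet_derivative \<delta> (at (\<Phi> ?y)) (r i (\<Phi> ?y)) = 0" for i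
        using \<delta>(2)[of "\<Phi> ?y" i] \<Phi>y c(4) by (auto simp: nabla_def)
      then have "frechet_derivative \<delta> (at (\<Phi> ?y)) (frechet_derivative \<Phi> (at ?y) (s *\<^sub>R w)) = 0" for s
        by (simp add: linear_cmul[OF l2] linear_cmul[OF l3] k linear_sum[OF l3])
      then show ?thesis
        using has_derivative_compose[OF has_derivative_compose[OF d1 d2] d3] by simp
    qed
    then have "\<delta> (\<Phi> (P x + 0 *\<^sub>R w)) = \<delta> (\<Phi> (P x + 1 *\<^sub>R w))"
      by (rule has_derivative_zero_unique[of "{0..1}", OF convex_real_interval(5)]) auto
    moreover have "\<Phi> (P x) \<in> W \<inter> M" using c(4,5,10) x(1) Px by (auto simp: homeomorphism_def)
    ultimately show ?thesis using \<delta>(3)[of "\<Phi> (P x)"] x(2) by (simp add: w_def)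
  qed
  then show ?thesis using c(2,3,4) by (intro exI[of _ V]) (auto simp: nbhd_in_def)
qed

section \<open>Affine transversals\<close>

lemma submanifold_affine:
  fixes L :: "(real ^ 'n) set"
  assumes "subspace L"
  shows "submanifold (dim L) {u. u - p \<in> L}" "tangent_space {u. u - p \<in> L} p \<subseteq> L"
proof -
  let ?M = "{u. u - p \<in> L}"
  have hom: "homeomorphism UNIV UNIV (\<lambda>x. x - p) (\<lambda>x. x + p)"
    by (auto simp: homeomorphism_def intro!: continuous_intros)
  have "smooth_on UNIV (\<lambda>x :: real ^ 'n. x - p)" "smooth_on UNIV (\<lambda>x :: real ^ 'n. x + p)"
    by (intro smooth_intros open_UNIV)+
  moreover have "(\<lambda>x. x - p) ` (UNIV \<inter> ?M) = UNIV \<inter> L"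
  proof
    show "UNIV \<inter> L \<subseteq> (\<lambda>x. x - p) ` (UNIV \<inter> ?M)"
    proof
      fix y assume "y \<in> UNIV \<inter> L"
      then show "y \<in> (\<lambda>x. x - p) ` (UNIV \<inter> ?M)" by (intro image_eqI[of _ _ "y + p"]) auto
    qed
  qed auto
  ultimately show "submanifold (dim L) ?M"
    unfolding submanifold_def using hom assms
    by (intro ballI, rule_tac exI[of _ UNIV], rule_tac exI[of _ UNIV], rule_tac exI[of _ L],
        rule_tac exI[of _ "\<lambda>x. x - p"], rule_tac exI[of _ "\<lambda>x. x + p"]) simp
  show "tangent_space ?M p \<subseteq> L"
  proof
    fix v assume "v \<in> tangent_space ?M p"
    then obtain \<gamma> e where \<gamma>: "e > (0::real)" "\<gamma> ` {-e<..<e} \<subseteq> ?M" "\<gamma> 0 = p" "(\<gamma> has_vector_derivative v) (at 0)"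
      unfolding tangent_space_def by blast
    have in_L: "\<gamma> t - p \<in> L" if "t \<in> {-e<..<e}" for t
      using \<gamma>(2) that by blast
    \<comment> \<open>The component \<open>z\<close> of the velocity orthogonal to \<open>L\<close>
      vanishes, because the product of \<open>z\<close> with the displacement along the curve is
      identically zero.\<close>
    obtain y z where yz: "y \<in> span L" "\<And>w. w \<in> span L \<Longrightarrow> orthogonal z w" "v = y + z"
      using orthogonal_subspace_decomp_exists[of L v] by metis
    have y: "y \<in> L" using yz(1) span_eq_iff[THEN iffD2, OF assms] by simp
    have "((\<lambda>t. z \<bullet> (\<gamma> t - p)) has_derivative (\<lambda>s. z \<bullet> (s *\<^sub>R v))) (at 0)"
      using has_derivative_inner_right[OF has_derivative_diff[OF \<gamma>(4)[unfolded has_vector_derivative_def] has_derivative_const[of p]], of z]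
      by simp
    moreover have "((\<lambda>t. z \<bullet> (\<gamma> t - p)) has_derivative (\<lambda>s. 0)) (at 0)"
    proof (rule has_derivative_transform_within_open[OF has_derivative_const[of 0]])
      show "open {-e<..<e}" "0 \<in> {-e<..<e}" using \<gamma>(1) by auto
      show "0 = z \<bullet> (\<gamma> t - p)" if "t \<in> {-e<..<e}" for t
        using yz(2)[OF span_base[OF in_L[OF that]]] by (simp add: orthogonal_def)
    qed
    ultimately have "(\<lambda>s. z \<bullet> (s *\<^sub>R v)) = (\<lambda>s. 0)" by (rule has_derivative_unique)
    then have "z \<bullet> v = 0" using fun_cong[of "\<lambda>s. z \<bullet> (s *\<^sub>R v)" "\<lambda>s. 0" 1] by simp
    moreover have "z \<bullet> y = 0" using yz(1,2) by (simp add: orthogonal_def)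
    ultimately have "z = 0" using yz(3) by (simp add: inner_add_right)
    then show "v \<in> L" using y yz(3) by simp
  qed
qed

text \<open>The affine subspace through \<open>p\<close> orthogonal to the given vectors. It
  provides data manifolds when a solution with chosen values at \<open>ubar\<close> has to be
  produced.\<close>

lemma exists_transversal:
  fixes r :: "'i::finite \<Rightarrow> real ^ 'n"
  assumes "inj r" "independent (range r)"
  obtains M where "submanifold (CARD('n) - CARD('i)) M" "p \<in> M" "CARD('i) \<le> CARD('n)"
    "tangent_space M p \<inter> span (range r) = {0}"
proof -
  define L where "L = {y. \<forall>x\<in>span (range r). orthogonal x y}"
  have sub: "subspace L"
    unfolding L_def subspace_def by (auto simp: orthogonal_def inner_add_right)
  have "dim (span (range r)) = CARD('i)"
    using assms by (simp add: dim_eq_card_independent card_image)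
  then have "dim L + CARD('i) = CARD('n)"
    using dim_subspace_orthogonal_to_vectors[of "span (range r)" UNIV] by (simp add: L_def)
  then have dim: "dim L = CARD('n) - CARD('i)" "CARD('i) \<le> CARD('n)" by auto
  let ?M = "{u. u - p \<in> L}"
  have "0 \<in> tangent_space ?M p"
    unfolding tangent_space_def
    using subspace_0[OF sub]
    by (intro CollectI exI[of _ "\<lambda>t. p"] exI[of _ 1]) (auto intro!: smooth_intros)
  moreover have "L \<inter> span (range r) \<subseteq> {0}" by (auto simp: L_def orthogonal_def)
  ultimately have "tangent_space ?M p \<inter> span (range r) = {0}"
    using submanifold_affine(2)[OF sub, of p] by (auto simp: span_zero)
  then show thesis
    using submanifold_affine(1)[OF sub, of p] dim subspace_0[OF sub] by (intro that[of ?M]) auto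
qed

lemma lie_bracket_nabla: "lie_bracket X Y u = nabla X Y u - nabla Y X u"
  by (simp add: lie_bracket_def nabla_def)

text \<open>Expressing brackets by \<open>nabla\<close> and derivatives along a bracket by
  \<open>nabla_commutator\<close> produces twelve second covariant derivatives, which cancel in
  pairs.\<close>

lemma jacobi_identity:
  fixes X Y Z :: "'a::euclidean_space \<Rightarrow> 'a"
  assumes "open U" "u \<in> U" "smooth_on U X" "smooth_on U Y" "smooth_on U Z"
  shows "lie_bracket X (lie_bracket Y Z) u - lie_bracket Y (lie_bracket X Z) u + lie_bracket Z (lie_bracket X Y) u = 0"
proof -
  have *: "lie_bracket X (lie_bracket Y Z) u = nabla X (nabla Y Z) u - nabla X (nabla Z Y) u -
      (nabla Y (nabla Z X) u - nabla Z (nabla Y X) u)"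
    if "smooth_on U X" "smooth_on U Y" "smooth_on U Z" for X Y Z
  proof -
    have "lie_bracket Y Z = (\<lambda>v. nabla Y Z v - nabla Z Y v)" by (rule ext) (rule lie_bracket_nabla)
    then have "nabla X (lie_bracket Y Z) u = nabla X (nabla Y Z) u - nabla X (nabla Z Y) u"
      using smooth_on_differentiable[OF smooth_on_nabla[OF assms(1) that(2,3)] assms(2)]
        smooth_on_differentiable[OF smooth_on_nabla[OF assms(1) that(3,2)] assms(2)]
      by (simp add: nabla_diff)
    then show ?thesis
      unfolding lie_bracket_nabla[of X "lie_bracket Y Z"] nabla_commutator[OF assms(1,2) that(2,3,1)] by simp
  qed
  show ?thesis
    using *[OF assms(3,4,5)] *[OF assms(4,3,5)] *[OF assms(5,3,4)] by simp
qed

text \<open>If \<open>P\<close> does not hold throughout the neighbourhood, its violations are dense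
  there, and a continuous function that vanishes at them vanishes identically nearby.\<close>

lemma decided_dichotomy:
  assumes "decided_at p P"
  shows "eventually P (nhds p) \<or>
    (\<forall>f U. open U \<longrightarrow> p \<in> U \<longrightarrow> continuous_on U (f :: 'a::topological_space \<Rightarrow> real) \<longrightarrow>
      (\<forall>u\<in>U. \<not> P u \<longrightarrow> f u = 0) \<longrightarrow> eventually (\<lambda>u. f u = 0) (nhds p))"
proof -
  obtain U0 where U0: "open U0" "p \<in> U0" "(\<forall>u\<in>U0. P u) \<or> U0 \<subseteq> closure {u\<in>U0. \<not> P u}"
    using assms unfolding decided_at_def nbhd_in_def by blast
  show ?thesis
  proof (cases "\<forall>u\<in>U0. P u")
    case True
    then show ?thesis using U0 eventually_nhds by blast
  next
    case False
    then have dense: "U0 \<subseteq> closure {u\<in>U0. \<not> P u}" using U0 by blast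
    have "eventually (\<lambda>u. f u = 0) (nhds p)"
      if U: "open U" "p \<in> U" and f: "continuous_on U f" and z: "\<forall>u\<in>U. \<not> P u \<longrightarrow> f u = 0" for f :: "'a \<Rightarrow> real" and U
    proof -
      have "f u = 0" if u: "u \<in> U0 \<inter> U" for u
      proof (rule ccontr)
        assume "f u \<noteq> 0"
        define T where "T = U \<inter> f -` (- {0})"
        have "open T" unfolding T_def by (rule continuous_open_preimage[OF f U(1)]) auto
        moreover have "u \<in> T" using u \<open>f u \<noteq> 0\<close> by (simp add: T_def)
        moreover have "u \<in> closure {u\<in>U0. \<not> P u}" using dense u by blast
        ultimately obtain v where "v \<in> {u\<in>U0. \<not> P u}" "v \<in> T"
          using open_Int_closure_eq_empty[of T "{u\<in>U0. \<not> P u}"] by blast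
        then show False using z by (auto simp: T_def)
      qed
      then show ?thesis
        unfolding eventually_nhds using U0(1,2) U by (intro exI[of _ "U0 \<inter> U"]) auto
    qed
    then show ?thesis by blast
  qed
qed

lemma eigenvector_sum_zero:
  fixes T :: "'a::real_vector \<Rightarrow> 'a"
  assumes "linear T" "finite S" "\<And>\<mu>. \<mu> \<in> S \<Longrightarrow> T (w \<mu>) = \<mu> *\<^sub>R w \<mu>" "(\<Sum>\<mu>\<in>S. w \<mu>) = 0" "\<mu> \<in> S"
  shows "w \<mu> = 0"
  using assms(2-)
proof (induction S arbitrary: w \<mu> rule: finite_induct)
  case (insert \<nu> S)
  have "T (\<Sum>\<mu>\<in>insert \<nu> S. w \<mu>) = (\<Sum>\<mu>\<in>insert \<nu> S. \<mu> *\<^sub>R w \<mu>)"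
    unfolding linear_sum[OF assms(1)] by (intro sum.cong refl insert.prems(1))
  then have "(\<Sum>\<mu>\<in>insert \<nu> S. \<mu> *\<^sub>R w \<mu>) - \<nu> *\<^sub>R (\<Sum>\<mu>\<in>insert \<nu> S. w \<mu>) = 0"
    using insert.prems(2) linear_0[OF assms(1)] by simp
  then have "(\<Sum>\<mu>\<in>S. (\<mu> - \<nu>) *\<^sub>R w \<mu>) = 0"
    using insert.hyps by (simp add: scaleR_right.sum sum_subtractf scaleR_diff_left scaleR_add_right scaleR_sum_right)
  moreover have "T ((\<kappa> - \<nu>) *\<^sub>R w \<kappa>) = \<kappa> *\<^sub>R (\<kappa> - \<nu>) *\<^sub>R w \<kappa>" if "\<kappa> \<in> S" for \<kappa>
    using insert.prems(1)[of \<kappa>] that by (simp add: linear_cmul[OF assms(1)] mult.commute)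
  ultimately have "(\<kappa> - \<nu>) *\<^sub>R w \<kappa> = 0" if "\<kappa> \<in> S" for \<kappa>
    using insert.IH[of "\<lambda>\<mu>. (\<mu> - \<nu>) *\<^sub>R w \<mu>"] that by blast
  then have S0: "w \<kappa> = 0" if "\<kappa> \<in> S" for \<kappa> using that insert.hyps by auto
  then have "w \<nu> = 0" using insert.prems(2) insert.hyps by simp
  then show ?case using S0 insert.prems(3) by auto
qed simp

text \<open>One eigenvector for each eigenvalue other than \<open>\<mu>0\<close>, together with
  \<open>a\<close> and \<open>b\<close>, form an independent set; with \<open>DIM('a)\<close>
  eigenvalues it would have one vector too many.\<close>

lemma repeated_eigenvalue_card:
  fixes T :: "'a::euclidean_space \<Rightarrow> 'a"
  assumes T: "linear T" and ab: "a \<noteq> b" "independent {a, b}" "T a = \<mu>0 *\<^sub>R a" "T b = \<mu>0 *\<^sub>R b"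
  shows "card {\<mu>. \<exists>v. v \<noteq> 0 \<and> T v = \<mu> *\<^sub>R v} \<noteq> DIM('a)"
proof
  define S where "S = {\<mu>. \<exists>v. v \<noteq> 0 \<and> T v = \<mu> *\<^sub>R v}"
  assume "card {\<mu>. \<exists>v. v \<noteq> 0 \<and> T v = \<mu> *\<^sub>R v} = DIM('a)"
  then have card: "card S = DIM('a)" by (simp add: S_def)
  then have fin: "finite S" using card_ge_0_finite DIM_positive by metis
  have a0: "a \<noteq> 0" "b \<noteq> 0" using ab(2) dependent_zero by auto
  have \<mu>0: "\<mu>0 \<in> S" using ab(3) a0 unfolding S_def by blast
  define v where "v \<mu> = (SOME v. v \<noteq> 0 \<and> T v = \<mu> *\<^sub>R v)" for \<mu>
  have "v \<mu> \<noteq> 0 \<and> T (v \<mu>) = \<mu> *\<^sub>R v \<mu>" if "\<mu> \<in> S" for \<mu>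
    using that unfolding v_def S_def mem_Collect_eq by (rule someI_ex)
  then have v: "v \<mu> \<noteq> 0" "T (v \<mu>) = \<mu> *\<^sub>R v \<mu>" if "\<mu> \<in> S" for \<mu>
    using that by auto
  let ?S' = "S - {\<mu>0}"
  have finS': "finite ?S'" using fin by blast
  have inj: "inj_on v ?S'"
  proof (rule inj_onI)
    fix \<mu> \<nu> assume "\<mu> \<in> ?S'" "\<nu> \<in> ?S'" "v \<mu> = v \<nu>"
    then have "\<mu> *\<^sub>R v \<mu> = \<nu> *\<^sub>R v \<mu>" using v(2)[of \<mu>] v(2)[of \<nu>] by (metis DiffD1)
    then show "\<mu> = \<nu>" using v(1)[of \<mu>] \<open>\<mu> \<in> ?S'\<close> by simp
  qed
  have notin: "a \<notin> v ` ?S'" "b \<notin> v ` ?S'"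
  proof -
    have "\<mu> = \<mu>0" if "\<mu> \<in> S" "v \<mu> = c" "c \<noteq> 0" "T c = \<mu>0 *\<^sub>R c" for \<mu> c
      using v(2)[OF that(1)] that(2,3,4) scaleR_cancel_right[of \<mu> c \<mu>0] by metis
    then show "a \<notin> v ` ?S'" "b \<notin> v ` ?S'" using a0 ab by blast+
  qed
  let ?B = "insert a (insert b (v ` ?S'))"
  have "independent ?B"
    unfolding independent_explicit
  proof (intro conjI allI impI)
    show "finite ?B" using finS' by simp
    fix c assume "(\<Sum>x\<in>?B. c x *\<^sub>R x) = 0"
    then have sum0: "c a *\<^sub>R a + c b *\<^sub>R b + (\<Sum>\<mu>\<in>?S'. c (v \<mu>) *\<^sub>R v \<mu>) = 0"
      using notin ab(1) finS' by (simp add: sum.reindex[OF inj] add.assoc)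
    \<comment> \<open>Groups a vanishing combination by eigenvalue, with \<open>a\<close> and
      \<open>b\<close> together in the summand for \<open>\<mu>0\<close>.\<close>
    define w where "w \<mu> = (if \<mu> = \<mu>0 then c a *\<^sub>R a + c b *\<^sub>R b else c (v \<mu>) *\<^sub>R v \<mu>)" for \<mu>
    have "(\<Sum>\<mu>\<in>S. w \<mu>) = w \<mu>0 + (\<Sum>\<mu>\<in>?S'. w \<mu>)" by (rule sum.remove[OF fin \<mu>0])
    also have "(\<Sum>\<mu>\<in>?S'. w \<mu>) = (\<Sum>\<mu>\<in>?S'. c (v \<mu>) *\<^sub>R v \<mu>)" by (rule sum.cong) (auto simp: w_def)
    finally have "(\<Sum>\<mu>\<in>S. w \<mu>) = 0" using sum0 by (simp add: w_def)
    moreover have "T (w \<mu>) = \<mu> *\<^sub>R w \<mu>" if "\<mu> \<in> S" for \<mu>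
      using v(2)[OF that] ab(3,4)
      by (simp add: w_def linear_add[OF T] linear_cmul[OF T] scaleR_add_right mult.commute)
    ultimately have w0: "w \<mu> = 0" if "\<mu> \<in> S" for \<mu> using eigenvector_sum_zero[OF T fin, of w \<mu>] that by blast
    have "c a *\<^sub>R a + c b *\<^sub>R b = 0" using w0[OF \<mu>0] by (simp add: w_def)
    then have "(\<Sum>x\<in>{a, b}. c x *\<^sub>R x) = 0" using ab(1) by simp
    then have "c a = 0" "c b = 0" using ab(2) unfolding independent_explicit by blast+
    moreover have "c (v \<mu>) = 0" if "\<mu> \<in> ?S'" for \<mu>
      using w0[of \<mu>] v(1)[of \<mu>] that by (auto simp: w_def)
    ultimately show "\<forall>x\<in>?B. c x = 0" by auto
  qed
  then have "card ?B \<le> DIM('a)" using independent_card_le by blast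
  moreover have "card ?B = Suc (Suc (card ?S'))"
    using notin ab(1) finS' by (simp add: card_image[OF inj])
  moreover have "Suc (card ?S') = card S" using card.remove[OF fin \<mu>0] by simp
  ultimately show False using card by simp
qed

text \<open>The derivative of \<open>f\<close> vanishes on all tangent spaces of \<open>N\<close>.
  In a slice chart, segments in \<open>L\<close> map to curves in \<open>N\<close>, so
  \<open>f\<close> is locally constant on \<open>N\<close>, and connectedness concludes.\<close>

lemma constant_on_integral_manifold:
  fixes f :: "real ^ 'n \<Rightarrow> real"
  assumes N: "integral_manifold r N" and V: "N \<subseteq> V" and f: "\<And>u. u \<in> V \<Longrightarrow> f differentiable at u"
    and zero: "\<And>u i. u \<in> V \<Longrightarrow> nabla (r i) f u = 0"
  shows "f constant_on N"
proof -
  have con: "connected N" and sub: "submanifold 3 N"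
    and tang: "\<And>p. p \<in> N \<Longrightarrow> tangent_space N p = span (range (\<lambda>i. r i p))"
    using N unfolding integral_manifold_def by auto
  have Df0: "frechet_derivative f (at p) v = 0" if p: "p \<in> N" and v: "v \<in> tangent_space N p" for p v
  proof -
    have lin: "linear (frechet_derivative f (at p))" using f p V by (intro frechet_derivative_linear_at) auto
    have "v \<in> span (range (\<lambda>i. r i p))" using v tang[OF p] by simp
    moreover have "span (range (\<lambda>i. r i p)) \<subseteq> {v. frechet_derivative f (at p) v = 0}"
    proof (rule span_minimal)
      show "range (\<lambda>i. r i p) \<subseteq> {v. frechet_derivative f (at p) v = 0}" using zero p V by (auto simp: nabla_def)
      show "subspace {v. frechet_derivative f (at p) v = 0}"
        using lin by (rule linear_subspace_kernel)
    qed
    ultimately show ?thesis by blast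
  qed
  have "\<exists>T. openin (top_of_set N) T \<and> p \<in> T \<and> (\<forall>q\<in>T. f q = f p)" if p: "p \<in> N" for p
  proof -
    obtain U Vc L and \<phi> \<psi> :: "real ^ 'n \<Rightarrow> real ^ 'n" where chart: "open U" "p \<in> U" "open Vc" "homeomorphism U Vc \<phi> \<psi>"
        "smooth_on U \<phi>" "smooth_on Vc \<psi>" "subspace L" "dim L = 3" "\<phi> ` (U \<inter> N) = Vc \<inter> L"
      using bspec[OF sub[unfolded submanifold_def] p] by blast
    have \<psi>N: "\<psi> y \<in> N" if "y \<in> Vc \<inter> L" for y
    proof -
      have "y \<in> \<phi> ` (U \<inter> N)" unfolding chart(9) by (rule that)
      then obtain m where "m \<in> U \<inter> N" "y = \<phi> m" by auto
      then show ?thesis using homeomorphism_apply1[OF chart(4), of m] by simp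
    qed
    have \<phi>p: "\<phi> p \<in> Vc" using chart(2,4) by (auto simp: homeomorphism_def)
    obtain e where e: "e > 0" "ball (\<phi> p) e \<subseteq> Vc" using chart(3) \<phi>p open_contains_ball by metis
    define T where "T = N \<inter> (U \<inter> \<phi> -` ball (\<phi> p) e)"
    have "open (U \<inter> \<phi> -` ball (\<phi> p) e)"
      using smooth_on_continuous[OF chart(5)] chart(1) by (rule continuous_open_preimage) simp
    then have "openin (top_of_set N) T" unfolding T_def by (rule openin_open_Int)
    moreover have "p \<in> T" using p chart(2) e(1) by (simp add: T_def)
    moreover have "f q = f p" if q: "q \<in> T" for q
    proof -
      define C where "C = ball (\<phi> p) e \<inter> L"
      have L: "\<phi> x \<in> C" if "x \<in> T" for x using that chart(9) e(2) by (auto simp: T_def C_def)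
      have "convex C" unfolding C_def by (intro convex_Int convex_ball subspace_imp_convex chart(7))
      have der: "((\<lambda>t. f (\<psi> (\<phi> p + t *\<^sub>R (\<phi> q - \<phi> p)))) has_derivative (\<lambda>s. 0)) (at t within {0..1})"
        if t: "t \<in> {0..1}" for t
      proof -
        let ?l = "\<phi> q - \<phi> p" and ?y = "\<phi> p + t *\<^sub>R (\<phi> q - \<phi> p)"
        have "?y = (1 - t) *\<^sub>R \<phi> p + t *\<^sub>R \<phi> q" by (simp add: algebra_simps)
        then have y: "?y \<in> C"
          using convexD[OF \<open>convex C\<close> L[OF \<open>p \<in> T\<close>] L[OF q], of "1 - t" t] t by simp
        then have yV: "?y \<in> Vc" "?y \<in> L" using e(2) by (auto simp: C_def)
        have lL: "?l \<in> L" using L[OF \<open>p \<in> T\<close>] L[OF q] chart(7) by (auto simp: C_def subspace_diff)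
        have tg: "frechet_derivative \<psi> (at ?y) ?l \<in> tangent_space N (\<psi> ?y)"
          by (rule curve_in_submanifold[OF chart(3) yV(1) chart(6,7) yV(2) lL \<psi>N])
        have \<psi>yN: "\<psi> ?y \<in> N" using \<psi>N yV by blast
        have d1: "((\<lambda>t. \<phi> p + t *\<^sub>R ?l) has_derivative (\<lambda>s. s *\<^sub>R ?l)) (at t within {0..1})"
          by (auto intro!: derivative_eq_intros)
        have d2: "(\<psi> has_derivative frechet_derivative \<psi> (at ?y)) (at ?y)"
          by (rule smooth_on_has_derivative[OF chart(6) yV(1)])
        have d3: "(f has_derivative frechet_derivative f (at (\<psi> ?y))) (at (\<psi> ?y))"
          using f \<psi>yN V by (intro has_frechet_derivative) auto
        have "frechet_derivative f (at (\<psi> ?y)) (frechet_derivative \<psi> (at ?y) (s *\<^sub>R ?l)) = 0" for s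
          using Df0[OF \<psi>yN tg]
          by (simp add: linear_cmul[OF has_derivative_linear[OF d2]] linear_cmul[OF has_derivative_linear[OF d3]])
        then show ?thesis using has_derivative_compose[OF has_derivative_compose[OF d1 d2] d3] by simp
      qed
      have "f (\<psi> (\<phi> p + 0 *\<^sub>R (\<phi> q - \<phi> p))) = f (\<psi> (\<phi> p + 1 *\<^sub>R (\<phi> q - \<phi> p)))"
        by (rule has_derivative_zero_unique[of "{0..1}", OF convex_real_interval(5) der]) auto
      then show ?thesis
        using homeomorphism_apply1[OF chart(4), of p] homeomorphism_apply1[OF chart(4), of q] chart(2) q by (simp add: T_def)
    qed
    ultimately show ?thesis by blast
  qed
  then show ?thesis
    by (rule locally_constant_imp_constant[OF con])
qed

section \<open>The algebraic part of the lambda system\<close>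

lemma nhds_open_subset:
  assumes "eventually P (nhds p)" "open W" "p \<in> W"
  obtains V where "nbhd_in p W V" "\<And>u. u \<in> V \<Longrightarrow> P u"
proof -
  obtain S where "open S" "p \<in> S" "\<forall>u\<in>S. P u" using assms(1) unfolding eventually_nhds by blast
  then show thesis using assms(2,3) by (intro that[of "S \<inter> W"]) (auto simp: nbhd_in_def)
qed

lemma nbhd_in_eventually: "nbhd_in p W V \<Longrightarrow> (\<And>u. u \<in> V \<Longrightarrow> P u) \<Longrightarrow> eventually P (nhds p)"
  unfolding nbhd_in_def eventually_nhds by blast

lemma UNIV_3_distinct:
  fixes i j k :: 3
  assumes "distinct [i, j, k]"
  shows "UNIV = {i, j, k}"
proof -
  have "card {i, j, k} = card (UNIV :: 3 set)" using assms by simp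
  then show ?thesis using card_subset_eq[of UNIV "{i, j, k}"] by auto
qed

lemma sum_3_distinct:
  fixes i j k :: 3
  assumes "distinct [i, j, k]"
  shows "(\<Sum>m\<in>UNIV. f m) = f i + f j + (f k :: 'a::comm_monoid_add)"
  unfolding UNIV_3_distinct[OF assms] using assms by (simp add: add.assoc)

lemma ex_third:
  fixes i j :: 3
  assumes "i \<noteq> j"
  obtains k where "distinct [i, j, k]"
proof -
  have "card {i, j} < card (UNIV :: 3 set)" using assms by simp
  then have "{i, j} \<noteq> UNIV" by auto
  then obtain k where "k \<notin> {i, j}" by blast
  then show thesis using assms that[of k] by auto
qed

lemma lie_bracket_self: "lie_bracket X X u = 0"
  by (simp add: lie_bracket_def)

lemma lie_bracket_swap: "lie_bracket Y X u = - lie_bracket X Y u"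
  by (simp add: lie_bracket_def)

lemma smooth_span_pointwise:
  assumes "X \<in> smooth_span V r I" "u \<in> V"
  shows "X u \<in> span ((\<lambda>i. r i u) ` I)"
proof -
  from assms obtain a where "X u = (\<Sum>i\<in>I. a i u *\<^sub>R r i u)" unfolding smooth_span_def by blast
  then show ?thesis by (simp only:) (intro span_sum span_scale span_base imageI)
qed

section \<open>Coordinates with respect to the completed frame\<close>

locale completed_frame =
  fixes ubar :: "real ^ 'n" and W :: "(real ^ 'n) set"
    and r :: "3 \<Rightarrow> real ^ 'n \<Rightarrow> real ^ 'n" and s :: "nat \<Rightarrow> real ^ 'n \<Rightarrow> real ^ 'n"
  assumes open_W: "open W" and ubar_W: "ubar \<in> W"
    and r_smooth: "\<And>i. smooth_on W (r i)"
    and r_inj: "\<And>u. u \<in> W \<Longrightarrow> inj (\<lambda>i. r i u)"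
    and r_indep: "\<And>u. u \<in> W \<Longrightarrow> independent (range (\<lambda>i. r i u))"
    and involutive: "\<And>u i j. u \<in> W \<Longrightarrow> \<exists>c. lie_bracket (r i) (r j) u = (\<Sum>k\<in>UNIV. c k *\<^sub>R r k u)"
    and completes: "completes_to_frame W r s"
begin

definition rcoord :: "3 \<Rightarrow> real ^ 'n \<Rightarrow> real ^ 'n \<Rightarrow> real" where
  "rcoord k u v = representation (frame_vectors r s u) v (r k u)"

definition scoord :: "nat \<Rightarrow> real ^ 'n \<Rightarrow> real ^ 'n \<Rightarrow> real" where
  "scoord l u v = representation (frame_vectors r s u) v (s l u)"

lemma Gam_rcoord: "Gam r s i j k u = rcoord k u (nabla (r i) (r j) u)"
  by (simp add: Gam_def rcoord_def)

lemma brc_rcoord: "brc r s i j k u = rcoord k u (lie_bracket (r i) (r j) u)"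
  by (simp add: brc_def rcoord_def)

lemma Gams_scoord: "Gams r s i j l u = scoord l u (nabla (r i) (r j) u)"
  by (simp add: Gams_def scoord_def)

context
  fixes u assumes u: "u \<in> W"
begin

lemma frame_indep: "independent (frame_vectors r s u)" "card (frame_vectors r s u) = CARD('n)"
  using completes u unfolding completes_to_frame_def by auto

lemma frame_span: "v \<in> span (frame_vectors r s u)"
  using card_ge_dim_independent[of "frame_vectors r s u" UNIV] frame_indep by auto

lemma r_mem: "r i u \<in> frame_vectors r s u"
  by (simp add: frame_vectors_def)

lemma card_ge_3: "3 \<le> CARD('n)"
proof -
  have "card (range (\<lambda>i. r i u)) = 3" using r_inj[OF u] by (simp add: card_image)
  then show ?thesis using independent_card_le[OF r_indep[OF u]] by simp
qed

text \<open>The cardinality of the frame leaves no room for coincidences: three of its elements are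
  the \<open>r i u\<close>, so the remaining indices must supply as many further vectors.\<close>

lemma frame_disjoint: "inj_on (\<lambda>l. s l u) {4..CARD('n)}" "range (\<lambda>i. r i u) \<inter> (\<lambda>l. s l u) ` {4..CARD('n)} = {}"
proof -
  let ?R = "range (\<lambda>i. r i u)" and ?S = "(\<lambda>l. s l u) ` {4..CARD('n)}"
  have cR: "card ?R = 3" using r_inj[OF u] by (simp add: card_image)
  have cS: "card ?S \<le> CARD('n) - 3" using card_image_le[of "{4..CARD('n)}" "\<lambda>l. s l u"] by simp
  have "card ?R + card ?S = card (?R \<union> ?S) + card (?R \<inter> ?S)" by (intro card_Un_Int) auto
  then have "card ?S = CARD('n) - 3 + card (?R \<inter> ?S)"
    using frame_indep(2) cR card_ge_3 by (simp add: frame_vectors_def)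
  then have "card ?S = CARD('n) - 3" "card (?R \<inter> ?S) = 0" using cS by auto
  then show "inj_on (\<lambda>l. s l u) {4..CARD('n)}" "?R \<inter> ?S = {}"
    by (auto intro!: eq_card_imp_inj_on)
qed

lemma linear_rcoord: "linear (rcoord k u)"
  unfolding rcoord_def using frame_indep(1) frame_span
  by (intro linearI) (simp_all add: representation_add representation_scale)

lemma linear_scoord: "linear (scoord l u)"
  unfolding scoord_def using frame_indep(1) frame_span
  by (intro linearI) (simp_all add: representation_add representation_scale)

lemma rcoord_r: "rcoord k u (r j u) = (if j = k then 1 else 0)"
  unfolding rcoord_def representation_basis[OF frame_indep(1) r_mem] using r_inj[OF u] by (auto dest: injD)

lemma scoord_r: "l \<in> {4..CARD('n)} \<Longrightarrow> scoord l u (r j u) = 0"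
  unfolding scoord_def representation_basis[OF frame_indep(1) r_mem] using frame_disjoint(2) by force

lemma frame_expansion:
  "v = (\<Sum>k\<in>UNIV. rcoord k u v *\<^sub>R r k u) + (\<Sum>l\<in>{4..CARD('n)}. scoord l u v *\<^sub>R s l u)"
proof -
  have fin: "finite (frame_vectors r s u)" by (simp add: frame_vectors_def)
  have "v = (\<Sum>b\<in>frame_vectors r s u. representation (frame_vectors r s u) v b *\<^sub>R b)"
    using sum_representation_eq[OF frame_indep(1) frame_span fin subset_refl] by simp
  also have "\<dots> = (\<Sum>b\<in>range (\<lambda>i. r i u). representation (frame_vectors r s u) v b *\<^sub>R b) +
      (\<Sum>b\<in>(\<lambda>l. s l u) ` {4..CARD('n)}. representation (frame_vectors r s u) v b *\<^sub>R b)"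
    by (subst (2) frame_vectors_def) (rule sum.union_disjoint, use frame_disjoint(2) in auto)
  finally show ?thesis
    unfolding sum.reindex[OF r_inj[OF u]] sum.reindex[OF frame_disjoint(1)] by (simp add: rcoord_def scoord_def)
qed

lemma coord_eqI:
  assumes "\<And>k. rcoord k u v = rcoord k u w" "\<And>l. l \<in> {4..CARD('n)} \<Longrightarrow> scoord l u v = scoord l u w"
  shows "v = w"
  by (subst frame_expansion[of v], subst frame_expansion[of w]) (simp add: assms)

lemma in_span_iff:
  "v \<in> span ((\<lambda>i. r i u) ` I) \<longleftrightarrow> (\<forall>k. k \<notin> I \<longrightarrow> rcoord k u v = 0) \<and> (\<forall>l\<in>{4..CARD('n)}. scoord l u v = 0)"
proof
  assume v: "v \<in> span ((\<lambda>i. r i u) ` I)"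
  have "span ((\<lambda>i. r i u) ` I) \<subseteq> {v. rcoord k u v = 0}" if "k \<notin> I" for k
    using that by (intro span_minimal linear_subspace_kernel linear_rcoord) (auto simp: rcoord_r)
  moreover have "span ((\<lambda>i. r i u) ` I) \<subseteq> {v. scoord l u v = 0}" if "l \<in> {4..CARD('n)}" for l
    using that by (intro span_minimal linear_subspace_kernel linear_scoord) (auto simp: scoord_r)
  ultimately show "(\<forall>k. k \<notin> I \<longrightarrow> rcoord k u v = 0) \<and> (\<forall>l\<in>{4..CARD('n)}. scoord l u v = 0)"
    using v by blast
next
  assume *: "(\<forall>k. k \<notin> I \<longrightarrow> rcoord k u v = 0) \<and> (\<forall>l\<in>{4..CARD('n)}. scoord l u v = 0)"
  then have "v = (\<Sum>k\<in>UNIV. rcoord k u v *\<^sub>R r k u)" using frame_expansion[of v] by simp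
  also have "\<dots> = (\<Sum>k\<in>I. rcoord k u v *\<^sub>R r k u)"
    using * by (intro sum.mono_neutral_right) auto
  also have "\<dots> \<in> span ((\<lambda>i. r i u) ` I)" by (intro span_sum span_scale span_base) auto
  finally show "v \<in> span ((\<lambda>i. r i u) ` I)" .
qed

lemmas in_span_pair = in_span_iff[of _ "{i, j}" for i j, simplified image_insert image_empty]

lemma brc_Gam: "brc r s i j k u = Gam r s i j k u - Gam r s j i k u"
  unfolding brc_rcoord Gam_rcoord lie_bracket_nabla by (rule linear_diff[OF linear_rcoord])

lemma bracket_in_span: "lie_bracket (r i) (r j) u \<in> span (range (\<lambda>k. r k u))"
proof -
  obtain c where "lie_bracket (r i) (r j) u = (\<Sum>k\<in>UNIV. c k *\<^sub>R r k u)" using involutive[OF u] by blast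
  then show ?thesis by (simp only:) (intro span_sum span_scale span_base rangeI)
qed

lemma scoord_bracket: "l \<in> {4..CARD('n)} \<Longrightarrow> scoord l u (lie_bracket (r i) (r j) u) = 0"
  using bracket_in_span in_span_iff[of _ UNIV] by blast

text \<open>Torsion-freeness and involution: the bracket has no component along the completing
  fields.\<close>

lemma Gams_sym: "l \<in> {4..CARD('n)} \<Longrightarrow> Gams r s i j l u = Gams r s j i l u"
  using scoord_bracket[of l i j] linear_diff[OF linear_scoord, of l]
  unfolding Gams_scoord lie_bracket_nabla by simp

lemma bracket_expansion: "lie_bracket (r i) (r j) u = (\<Sum>k\<in>UNIV. brc r s i j k u *\<^sub>R r k u)"
  using frame_expansion[of "lie_bracket (r i) (r j) u"] scoord_bracket by (simp add: brc_rcoord)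

lemma r_combination_zero:
  assumes "distinct [i, j, k]" "a *\<^sub>R r i u + b *\<^sub>R r j u + c *\<^sub>R r k u = 0"
  shows "a = 0" "b = 0" "c = 0"
proof -
  have "rcoord m u (a *\<^sub>R r i u + b *\<^sub>R r j u + c *\<^sub>R r k u) = 0" for m
    using assms(2) linear_0[OF linear_rcoord] by simp
  then have *: "a * rcoord m u (r i u) + b * rcoord m u (r j u) + c * rcoord m u (r k u) = 0" for m
    by (simp add: linear_add[OF linear_rcoord] linear_cmul[OF linear_rcoord])
  show "a = 0" "b = 0" "c = 0"
    using *[of i] *[of j] *[of k] assms(1) by (auto simp: rcoord_r)
qed

end

lemma brc_swap: "u \<in> W \<Longrightarrow> brc r s j i k u = - brc r s i j k u"
  by (simp add: brc_Gam)

lemma brc_self: "u \<in> W \<Longrightarrow> brc r s i i k u = 0"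
  by (simp add: brc_Gam)

text \<open>Frame coordinates are defined pointwise through \<open>representation\<close>; this
  property provides their smoothness for fields tangent to the span of the \<open>r i\<close>.
  Quantifying over open subsets makes it hereditary.\<close>

definition coordinate_domain :: "(real ^ 'n) set \<Rightarrow> bool" where
  "coordinate_domain V \<longleftrightarrow> nbhd_in ubar W V \<and> (\<forall>X k U. open U \<longrightarrow> U \<subseteq> V \<longrightarrow> smooth_on U X \<longrightarrow>
    (\<forall>u\<in>U. X u \<in> span (range (\<lambda>i. r i u))) \<longrightarrow> smooth_on U (\<lambda>u. rcoord k u (X u)))"

lemma coordinate_domainD:
  assumes "coordinate_domain V"
  shows "nbhd_in ubar W V"
    "open U \<Longrightarrow> U \<subseteq> V \<Longrightarrow> smooth_on U X \<Longrightarrow> (\<And>u. u \<in> U \<Longrightarrow> X u \<in> span (range (\<lambda>i. r i u))) \<Longrightarrow>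
      smooth_on U (\<lambda>u. rcoord k u (X u))"
  using assms unfolding coordinate_domain_def by blast+

text \<open>On the span of the \<open>r i\<close>, the dual coefficients express a coordinate of
  \<open>X u\<close> as a sum of products \<open>(a i \<bullet> X u) * B i k u\<close>, which are
  smooth.\<close>

lemma ex_coordinate_domain: "\<exists>V. coordinate_domain V"
proof -
  obtain V and a :: "3 \<Rightarrow> real ^ 'n" and B :: "3 \<Rightarrow> 3 \<Rightarrow> real ^ 'n \<Rightarrow> real"
    where V: "open V" "ubar \<in> V" "V \<subseteq> W" and B: "\<And>i j. smooth_on V (B i j)"
    and "\<And>u i k. u \<in> V \<Longrightarrow> (\<Sum>j\<in>UNIV. B i j u * (a k \<bullet> r j u)) = (if i = k then 1 else 0)"
    and dual: "\<And>u j k. u \<in> V \<Longrightarrow> (\<Sum>i\<in>UNIV. (a i \<bullet> r k u) * B i j u) = (if k = j then 1 else 0)"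
    by (rule dual_coefficients[OF open_W ubar_W r_smooth r_inj[OF ubar_W] r_indep[OF ubar_W]]) (rule that; assumption)
  show ?thesis
    unfolding coordinate_domain_def
  proof (intro exI[of _ V] conjI allI impI)
    show "nbhd_in ubar W V" using V by (simp add: nbhd_in_def)
    fix X k U assume U: "open U" "U \<subseteq> V" and X: "smooth_on U X" and "\<forall>u\<in>U. X u \<in> span (range (\<lambda>i. r i u))"
    then have sp: "X u \<in> span (range (\<lambda>i. r i u))" if "u \<in> U" for u using that by blast
    show "smooth_on U (\<lambda>u. rcoord k u (X u))"
    proof (rule smooth_on_cong[OF U(1)])
      show "smooth_on U (\<lambda>u. \<Sum>i\<in>UNIV. (a i \<bullet> X u) * B i k u)"
        using smooth_on_subset[OF B U(2)] X U(1) by (intro smooth_on_sum smooth_on_mult smooth_on_inner smooth_on_const)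
      fix u assume u: "u \<in> U"
      then have uW: "u \<in> W" and uV: "u \<in> V" using U(2) V(3) by auto
      have "\<forall>l\<in>{4..CARD('n)}. scoord l u (X u) = 0" using sp[OF u] in_span_iff[OF uW, of _ UNIV] by blast
      then have Xu: "X u = (\<Sum>m\<in>UNIV. rcoord m u (X u) *\<^sub>R r m u)" using frame_expansion[OF uW, of "X u"] by simp
      have "(\<Sum>i\<in>UNIV. (a i \<bullet> X u) * B i k u) =
          (\<Sum>i\<in>UNIV. \<Sum>m\<in>UNIV. rcoord m u (X u) * ((a i \<bullet> r m u) * B i k u))"
        by (subst Xu) (simp add: inner_sum_right sum_distrib_right mult.assoc)
      also have "\<dots> = (\<Sum>m\<in>UNIV. \<Sum>i\<in>UNIV. rcoord m u (X u) * ((a i \<bullet> r m u) * B i k u))"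
        by (rule sum.swap)
      also have "\<dots> = (\<Sum>m\<in>UNIV. rcoord m u (X u) * (if m = k then 1 else 0))"
        by (simp only: sum_distrib_left[symmetric] dual[OF uV])
      also have "\<dots> = rcoord k u (X u)" by (simp add: if_distrib cong: if_cong)
      finally show "(\<Sum>i\<in>UNIV. (a i \<bullet> X u) * B i k u) = rcoord k u (X u)" .
    qed
  qed
qed

text \<open>The part of the system without derivatives, at a single point. It is separated because
  it is also derived for the eigenvalues of a flux, in \<open>flux_algebraic\<close>.\<close>

definition algebraic :: "real ^ 'n \<Rightarrow> real ^ 3 \<Rightarrow> bool" where
  "algebraic u x \<longleftrightarrow>
     (\<forall>i j k. distinct [i, j, k] \<longrightarrow>
        x $ j * Gam r s i j k u - x $ i * Gam r s j i k u - brc r s i j k u * x $ k = 0) \<and>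
     (\<forall>i j. i \<noteq> j \<longrightarrow> (\<forall>l\<in>{4..CARD('n)}. (x $ j - x $ i) * Gams r s j i l u = 0))"

lemma lambda_equations_algebraic: "lambda_equations r s U lam \<Longrightarrow> u \<in> U \<Longrightarrow> algebraic u (lam u)"
  unfolding lambda_equations_def algebraic_def by blast

lemma lambda_equationsI:
  assumes "smooth_on U lam" "\<And>u. u \<in> U \<Longrightarrow> algebraic u (lam u)"
    "\<And>u i j. u \<in> U \<Longrightarrow> i \<noteq> j \<Longrightarrow> nabla (r i) (\<lambda>v. lam v $ j) u = Gam r s j i j u * (lam u $ i - lam u $ j)"
  shows "lambda_equations r s U lam"
  using assms unfolding lambda_equations_def algebraic_def by blast

context
  fixes u x assumes u: "u \<in> W" and x: "algebraic u x"
begin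

lemma algebraic_3: "distinct [i, j, k] \<Longrightarrow> x $ j * Gam r s i j k u - x $ i * Gam r s j i k u - brc r s i j k u * x $ k = 0"
  using x unfolding algebraic_def by blast

lemma equal_if_scoord: "i \<noteq> j \<Longrightarrow> l \<in> {4..CARD('n)} \<Longrightarrow> scoord l u (nabla (r i) (r j) u) \<noteq> 0 \<Longrightarrow> x $ i = x $ j"
proof -
  assume a: "i \<noteq> j" "l \<in> {4..CARD('n)}" "scoord l u (nabla (r i) (r j) u) \<noteq> 0"
  then have "(x $ i - x $ j) * Gams r s i j l u = 0" using x unfolding algebraic_def by metis
  then show "x $ i = x $ j" using a(3) by (simp add: Gams_scoord)
qed

lemma equal_if_not_range:
  assumes "i \<noteq> j" "nabla (r i) (r j) u \<notin> span (range (\<lambda>k. r k u))"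
  shows "x $ i = x $ j"
  using assms equal_if_scoord in_span_iff[OF u, of _ UNIV] by blast

text \<open>Since \<open>Gam r s i j k u\<close> vanishes, \<open>Gam r s j i k u\<close> is the
  negative of the nonzero bracket coefficient, and the equation for \<open>i, j, k\<close> becomes
  \<open>brc r s i j k u * (x $ i - x $ k) = 0\<close>.\<close>

lemma equal_if_bracket_not:
  assumes d: "distinct [i, j, k]" and "nabla (r i) (r j) u \<in> span {r i u, r j u}" "lie_bracket (r i) (r j) u \<notin> span {r i u, r j u}"
  shows "x $ i = x $ k"
proof -
  have "Gam r s i j k u = 0" using assms in_span_pair[OF u] by (auto simp: Gam_rcoord)
  moreover obtain m where "m \<notin> {i, j}" "brc r s i j m u \<noteq> 0"
    using assms(3) scoord_bracket[OF u] unfolding in_span_pair[OF u] brc_rcoord by blast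
  then have "brc r s i j k u \<noteq> 0" using UNIV_3_distinct[OF d] by auto
  moreover have "Gam r s j i k u = Gam r s i j k u - brc r s i j k u" using brc_Gam[OF u] by simp
  ultimately show ?thesis using algebraic_3[OF d] by (simp add: algebra_simps)
qed

text \<open>Either a component along a completing field forces the equality, or
  \<open>Gam r s i j k u\<close> is nonzero for the third index. In the latter case it equals
  \<open>Gam r s j i k u\<close>, the bracket coefficient being zero, and it multiplies
  \<open>x $ j - x $ i\<close>.\<close>

lemma equal_if_nabla_not:
  assumes ij: "i \<noteq> j" and "nabla (r i) (r j) u \<notin> span {r i u, r j u}" "lie_bracket (r i) (r j) u \<in> span {r i u, r j u}"
  shows "x $ i = x $ j"
proof (cases "\<exists>l\<in>{4..CARD('n)}. scoord l u (nabla (r i) (r j) u) \<noteq> 0")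
  case True
  then show ?thesis using equal_if_scoord ij by blast
next
  case False
  then obtain k where k: "k \<notin> {i, j}" "Gam r s i j k u \<noteq> 0"
    using assms(2) unfolding in_span_pair[OF u] Gam_rcoord by blast
  then have "brc r s i j k u = 0" using assms(3) unfolding in_span_pair[OF u] brc_rcoord by blast
  then show ?thesis using k ij algebraic_3[of i j k] brc_Gam[OF u, of i j k] by (auto simp: algebra_simps)
qed

text \<open>With \<open>x $ i = x $ j\<close> the two \<open>Gam\<close> terms combine to a multiple
  of the bracket coefficient, which then multiplies \<open>x $ i - x $ k\<close> and is
  nonzero.\<close>

lemma third_equal_if_bracket:
  assumes d: "distinct [i, j, k]" and eq: "x $ i = x $ j" and "lie_bracket (r i) (r j) u \<notin> span {r i u, r j u}"
  shows "x $ k = x $ i"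
proof -
  obtain m where "m \<notin> {i, j}" "brc r s i j m u \<noteq> 0"
    using assms(3) scoord_bracket[OF u] unfolding in_span_pair[OF u] brc_rcoord by blast
  then have "brc r s i j k u \<noteq> 0" using UNIV_3_distinct[OF d] by auto
  moreover have "brc r s i j k u * (x $ i - x $ k) = 0"
    using algebraic_3[OF d] eq brc_Gam[OF u, of i j k] by algebra
  ultimately show ?thesis by simp
qed

text \<open>With \<open>x $ i = x $ j\<close> the equation for \<open>i, k, j\<close> collapses to
  \<open>Gam r s i k j u * (x $ k - x $ i) = 0\<close>, because
  \<open>Gam r s k i j u + brc r s i k j u\<close> is \<open>Gam r s i k j u\<close>.\<close>

lemma third_equal_if_nabla:
  assumes d: "distinct [i, j, k]" and eq: "x $ i = x $ j" and "nabla (r i) (r k) u \<notin> span {r i u, r k u}"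
  shows "x $ k = x $ i"
proof (cases "\<exists>l\<in>{4..CARD('n)}. scoord l u (nabla (r i) (r k) u) \<noteq> 0")
  case True
  then show ?thesis using equal_if_scoord[of i k] d by auto
next
  case False
  then obtain m where "m \<notin> {i, k}" "Gam r s i k m u \<noteq> 0"
    using assms(3) unfolding in_span_pair[OF u] Gam_rcoord by blast
  then have "Gam r s i k j u \<noteq> 0" using UNIV_3_distinct[OF d] by auto
  moreover have "distinct [i, k, j]" using d by auto
  from algebraic_3[OF this] have "Gam r s i k j u * (x $ k - x $ i) = 0"
    using eq brc_Gam[OF u, of i k j] by algebra
  ultimately show ?thesis by simp
qed

end

text \<open>Once the functions \<open>i\<close> and \<open>j\<close> coincide, the first three
  conditions make all algebraic equations hold, and the last makes the two differential equations
  along \<open>r k\<close> agree.\<close>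

definition flat_pair :: "3 \<Rightarrow> 3 \<Rightarrow> 3 \<Rightarrow> real ^ 'n \<Rightarrow> bool" where
  "flat_pair i j k u \<longleftrightarrow> lie_bracket (r i) (r j) u \<in> span {r i u, r j u} \<and>
     nabla (r i) (r k) u \<in> span {r i u, r k u} \<and> nabla (r j) (r k) u \<in> span {r j u, r k u} \<and>
     Gam r s i k i u = Gam r s j k j u"

lemma smooth_nabla_r: "U \<subseteq> W \<Longrightarrow> open U \<Longrightarrow> smooth_on U (nabla (r i) (r j))"
  by (intro smooth_on_nabla smooth_on_subset[OF r_smooth])

lemma smooth_bracket_r: "U \<subseteq> W \<Longrightarrow> open U \<Longrightarrow> smooth_on U (lie_bracket (r i) (r j))"
  by (intro smooth_on_lie_bracket smooth_on_subset[OF r_smooth])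

text \<open>\<open>P\<close> is a pointwise condition whose violation forces two functions to
  coincide and which is violated arbitrarily close to \<open>ubar\<close>. The condition and the
  pair depend on the frame alone, not on a solution.\<close>

lemma some_pair_equal:
  assumes "\<not> (\<exists>V. nbhd_in ubar W V \<and> condition_i V r \<and> condition_ii V r)"
  obtains P a b V where "a \<noteq> b" "\<not> eventually P (nhds ubar)" "nbhd_in ubar W V"
    "\<And>u x. u \<in> V \<Longrightarrow> algebraic u x \<Longrightarrow> \<not> P u \<Longrightarrow> x $ a = x $ b"
    "constant_type_at ubar r s \<Longrightarrow> decided_at ubar P"
proof -
  let ?SR = "\<lambda>i j u. nabla (r i) (r j) u \<in> span (range (\<lambda>k. r k u))"
  let ?SP = "\<lambda>i j u. nabla (r i) (r j) u \<in> span {r i u, r j u}"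
  let ?SB = "\<lambda>i j u. lie_bracket (r i) (r j) u \<in> span {r i u, r j u}"
  let ?Ev = "\<lambda>P. eventually P (nhds ubar)"
  have WW: "nbhd_in ubar W W" using open_W ubar_W by (simp add: nbhd_in_def)
  \<comment> \<open>\<open>A\<close> is a failure of (ii), while \<open>B\<close> and
    \<open>C\<close> are failures of one direction each of (i). In the remaining case both
    conditions hold near \<open>ubar\<close>, contrary to the assumption.\<close>
  consider (A) i j where "i \<noteq> j" "\<not> ?Ev (?SR i j)"
    | (B) i j where "i \<noteq> j" "?Ev (?SP i j)" "\<not> ?Ev (?SB i j)"
    | (C) i j where "i \<noteq> j" "\<not> ?Ev (?SP i j)" "?Ev (?SB i j)"
    | (D) "\<And>i j. i \<noteq> j \<Longrightarrow> ?Ev (?SR i j)" "\<And>i j. i \<noteq> j \<Longrightarrow> ?Ev (?SP i j) \<longleftrightarrow> ?Ev (?SB i j)"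
    by blast
  then show thesis
  proof cases
    case A
    show thesis
    proof (rule that[OF A(1,2) WW])
      show "x $ i = x $ j" if "u \<in> W" "algebraic u x" "\<not> ?SR i j u" for u x
        by (rule equal_if_not_range[OF that(1,2) A(1) that(3)])
      show "decided_at ubar (?SR i j)" if "constant_type_at ubar r s"
        using that A(1) unfolding constant_type_at_def by blast
    qed
  next
    case B
    obtain V where V: "nbhd_in ubar W V" "\<And>u. u \<in> V \<Longrightarrow> ?SP i j u"
      using nhds_open_subset[OF B(2) open_W ubar_W] by blast
    obtain k where k: "distinct [i, j, k]" using ex_third[OF B(1)] by blast
    show thesis
    proof (rule that[OF _ B(3) V(1)])
      show "i \<noteq> k" using k by simp
      show "x $ i = x $ k" if "u \<in> V" "algebraic u x" "\<not> ?SB i j u" for u x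
        by (rule equal_if_bracket_not[OF _ that(2) k V(2)[OF that(1)] that(3)])
          (use V(1) that(1) in \<open>auto simp: nbhd_in_def\<close>)
      show "decided_at ubar (?SB i j)" if "constant_type_at ubar r s"
        using that B(1) unfolding constant_type_at_def by blast
    qed
  next
    case C
    obtain V where V: "nbhd_in ubar W V" "\<And>u. u \<in> V \<Longrightarrow> ?SB i j u"
      using nhds_open_subset[OF C(3) open_W ubar_W] by blast
    show thesis
    proof (rule that[OF C(1,2) V(1)])
      show "x $ i = x $ j" if "u \<in> V" "algebraic u x" "\<not> ?SP i j u" for u x
        by (rule equal_if_nabla_not[OF _ that(2) C(1) that(3) V(2)[OF that(1)]])
          (use V(1) that(1) in \<open>auto simp: nbhd_in_def\<close>)
      show "decided_at ubar (?SP i j)" if "constant_type_at ubar r s"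
        using that C(1) unfolding constant_type_at_def by blast
    qed
  next
    case D
    obtain V0 where V0': "coordinate_domain V0" using ex_coordinate_domain by blast
    note V0 = coordinate_domainD(1)[OF V0'] and coord = coordinate_domainD(2)[OF V0']
    have "?Ev (\<lambda>u. (i \<noteq> j \<longrightarrow> ?SR i j u) \<and> (i \<noteq> j \<and> ?Ev (?SP i j) \<longrightarrow> ?SP i j u \<and> ?SB i j u))" for i j
    proof (cases "i \<noteq> j \<and> ?Ev (?SP i j)")
      case True
      then show ?thesis using D(1)[of i j] D(2)[of i j] by (simp add: eventually_conj_iff)
    next
      case False
      then show ?thesis using D(1)[of i j] by (cases "i = j") auto
    qed
    \<comment> \<open>All memberships that hold near \<open>ubar\<close> are collected on one
      neighbourhood. A membership that does not hold near \<open>ubar\<close> fails in the smooth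
      span over every neighbourhood, so both sides of (i) fail together.\<close>
    then have "?Ev (\<lambda>u. \<forall>i j. (i \<noteq> j \<longrightarrow> ?SR i j u) \<and> (i \<noteq> j \<and> ?Ev (?SP i j) \<longrightarrow> ?SP i j u \<and> ?SB i j u))"
      by (intro eventually_all_finite)
    moreover have "open V0" "ubar \<in> V0" using V0 by (auto simp: nbhd_in_def)
    ultimately obtain V where V: "nbhd_in ubar V0 V"
      and VQ: "\<And>u. u \<in> V \<Longrightarrow> \<forall>i j. (i \<noteq> j \<longrightarrow> ?SR i j u) \<and> (i \<noteq> j \<and> ?Ev (?SP i j) \<longrightarrow> ?SP i j u \<and> ?SB i j u)"
      by (rule nhds_open_subset) blast
    have VR: "?SR i j u" if "u \<in> V" "i \<noteq> j" for u i j using VQ[OF that(1)] that(2) by blast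
    have VPB: "?SP i j u \<and> ?SB i j u" if "u \<in> V" "i \<noteq> j" "?Ev (?SP i j)" for u i j using VQ[OF that(1)] that(2,3) by blast
    have VW: "V \<subseteq> W" "open V" "V \<subseteq> V0" using V V0 by (auto simp: nbhd_in_def)
    have ss: "X \<in> smooth_span V r I" if "smooth_on V X" "\<And>u. u \<in> V \<Longrightarrow> X u \<in> span ((\<lambda>i. r i u) ` I)" for X I
    proof -
      have "X u \<in> span (range (\<lambda>i. r i u))" if "u \<in> V" for u
        using \<open>\<And>u. u \<in> V \<Longrightarrow> X u \<in> span ((\<lambda>i. r i u) ` I)\<close>[OF that] span_mono[of "(\<lambda>i. r i u) ` I" "range (\<lambda>i. r i u)"] by blast
      then have "smooth_on V (\<lambda>u. rcoord k u (X u))" for k using coord[OF VW(2,3) that(1)] by blast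
      moreover have "X u = (\<Sum>i\<in>I. rcoord i u (X u) *\<^sub>R r i u)" if u: "u \<in> V" for u
      proof -
        have uW: "u \<in> W" using u VW by blast
        have *: "(\<forall>k. k \<notin> I \<longrightarrow> rcoord k u (X u) = 0) \<and> (\<forall>l\<in>{4..CARD('n)}. scoord l u (X u) = 0)"
          using \<open>\<And>u. u \<in> V \<Longrightarrow> X u \<in> span ((\<lambda>i. r i u) ` I)\<close>[OF u] in_span_iff[OF uW] by blast
        have "X u = (\<Sum>k\<in>UNIV. rcoord k u (X u) *\<^sub>R r k u)" using frame_expansion[OF uW, of "X u"] * by simp
        also have "\<dots> = (\<Sum>k\<in>I. rcoord k u (X u) *\<^sub>R r k u)"
          using * by (intro sum.mono_neutral_right) auto
        finally show ?thesis .
      qed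
      ultimately show ?thesis unfolding smooth_span_def by (intro CollectI exI[of _ "\<lambda>i u. rcoord i u (X u)"]) auto
    qed
    have Vn: "nbhd_in ubar W V" using V V0 by (auto simp: nbhd_in_def)
    have "condition_ii V r"
      unfolding condition_ii_def using ss[OF smooth_nabla_r[OF VW(1,2)], of _ _ UNIV] VR by blast
    moreover have "condition_i V r"
      unfolding condition_i_def
    proof (intro allI impI)
      fix i j :: 3 assume ij: "i \<noteq> j"
      show "nabla (r i) (r j) \<in> smooth_span V r {i, j} \<longleftrightarrow> lie_bracket (r i) (r j) \<in> smooth_span V r {i, j}"
      proof (cases "?Ev (?SP i j)")
        case True
        then show ?thesis
          using VPB[OF _ ij] ss[OF smooth_nabla_r[OF VW(1,2)], of i j "{i, j}"] ss[OF smooth_bracket_r[OF VW(1,2)], of i j "{i, j}"]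
          by simp
      next
        case False
        have "nabla (r i) (r j) \<notin> smooth_span V r {i, j}"
          using False nbhd_in_eventually[OF Vn, of "?SP i j"] smooth_span_pointwise[of "nabla (r i) (r j)" V r "{i, j}"] by auto
        moreover have "lie_bracket (r i) (r j) \<notin> smooth_span V r {i, j}"
          using False D(2)[OF ij] nbhd_in_eventually[OF Vn, of "?SB i j"]
            smooth_span_pointwise[of "lie_bracket (r i) (r j)" V r "{i, j}"] by auto
        ultimately show ?thesis by blast
      qed
    qed
    ultimately show thesis using assms Vn by blast
  qed
qed

end

section \<open>Reduction of the lambda system when two functions agree\<close>

lemma lie_bracket_scaleR:
  fixes X Y :: "'a::euclidean_space \<Rightarrow> 'a"
  assumes "a differentiable at u" "Y differentiable at u" "X differentiable at u"
  shows "lie_bracket X (\<lambda>v. a v *\<^sub>R Y v) u = nabla X a u *\<^sub>R Y u + a u *\<^sub>R lie_bracket X Y u"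
  unfolding lie_bracket_nabla nabla_scaleR[OF assms(1,2)] scaleR_diff_right
  using linear_cmul[OF frechet_derivative_linear_at[OF assms(3)]] by (simp add: nabla_def)

lemma lie_bracket_add:
  fixes X Y :: "'a::euclidean_space \<Rightarrow> 'a"
  assumes "Y differentiable at u" "Z differentiable at u" "X differentiable at u"
  shows "lie_bracket X (\<lambda>v. Y v + Z v) u = lie_bracket X Y u + lie_bracket X Z u"
  unfolding lie_bracket_nabla nabla_add[OF assms(1,2)]
  using linear_add[OF frechet_derivative_linear_at[OF assms(3)]] by (simp add: nabla_def)

lemma lie_bracket_cong:
  fixes X Y :: "'a::euclidean_space \<Rightarrow> 'a"
  assumes "open U" "u \<in> U" "\<And>v. v \<in> U \<Longrightarrow> Y v = Z v"
  shows "lie_bracket X Y u = lie_bracket X Z u"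
proof -
  have "nabla X Y u = nabla X Z u" by (rule nabla_cong[OF assms])
  then show ?thesis using assms(3)[OF assms(2)] by (simp add: lie_bracket_nabla nabla_def)
qed

section \<open>Frobenius problems on the leaves of the whole frame\<close>

context completed_frame
begin

lemma coordinate_domain_subset: "coordinate_domain V \<Longrightarrow> nbhd_in ubar V U \<Longrightarrow> coordinate_domain U"
  unfolding coordinate_domain_def nbhd_in_def by (meson subset_trans)

lemma frobenius_unique_3:
  fixes \<delta> :: "real ^ 'n \<Rightarrow> 'b::euclidean_space"
  assumes U: "nbhd_in ubar W U"
    and M: "submanifold (CARD('n) - 3) M" "ubar \<in> M" "tangent_space M ubar \<inter> span (range (\<lambda>i. r i ubar)) = {0}"
    and \<delta>: "\<And>u. u \<in> U \<Longrightarrow> \<delta> differentiable at u" "\<And>u i. u \<in> U \<Longrightarrow> nabla (r i) \<delta> u = 0"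
      "\<And>u. u \<in> U \<inter> M \<Longrightarrow> \<delta> u = 0"
  shows "\<exists>V. nbhd_in ubar U V \<and> (\<forall>u\<in>V. \<delta> u = 0)"
proof -
  have U': "open U" "ubar \<in> U" "U \<subseteq> W" using U by (auto simp: nbhd_in_def)
  show ?thesis
  proof (rule frobenius_uniqueness[OF U'(1,2) smooth_on_subset[OF r_smooth U'(3)] r_inj[OF ubar_W] r_indep[OF ubar_W] _ M(1,2) _ M(3) \<delta>])
    show "CARD('n) - 3 + CARD(3) = CARD('n)" using card_ge_3[OF ubar_W] by simp
  qed (use involutive U'(3) in auto)
qed

lemma frobenius_exists_3:
  fixes h :: "3 \<Rightarrow> real ^ 'n \<Rightarrow> 'b::euclidean_space"
  assumes U: "nbhd_in ubar W U" and h: "\<And>i. smooth_on U (h i)" and g: "smooth_on U g"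
    and M: "submanifold (CARD('n) - 3) M" "ubar \<in> M" "tangent_space M ubar \<inter> span (range (\<lambda>i. r i ubar)) = {0}"
    and closed: "\<And>u i j. u \<in> U \<Longrightarrow> nabla (r i) (h j) u - nabla (r j) (h i) u = (\<Sum>k\<in>UNIV. brc r s i j k u *\<^sub>R h k u)"
  shows "\<exists>V f. nbhd_in ubar U V \<and> smooth_on V f \<and> (\<forall>u\<in>V. \<forall>i. nabla (r i) f u = h i u) \<and> (\<forall>u\<in>V \<inter> M. f u = g u)"
proof -
  have U': "open U" "ubar \<in> U" "U \<subseteq> W" using U by (auto simp: nbhd_in_def)
  show ?thesis
  proof (rule frobenius_existence[OF U'(1,2) smooth_on_subset[OF r_smooth U'(3)] h g r_inj[OF ubar_W] r_indep[OF ubar_W] _ M(1,2) _ M(3)])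
    show "CARD('n) - 3 + CARD(3) = CARD('n)" using card_ge_3[OF ubar_W] by simp
    show "\<exists>c. lie_bracket (r i) (r j) u = (\<Sum>k\<in>UNIV. c k *\<^sub>R r k u) \<and>
        nabla (r i) (h j) u - nabla (r j) (h i) u = (\<Sum>k\<in>UNIV. c k *\<^sub>R h k u)" if "u \<in> U" for u i j
      using bracket_expansion[of u i j] closed[OF that, of i j] that U'(3) by (intro exI[of _ "\<lambda>k. brc r s i j k u"]) auto
  qed
qed

end

text \<open>The fields \<open>r i\<close> and \<open>r j\<close> carry the two equal functions,
  \<open>r k\<close> the third.\<close>

locale flat_triple = completed_frame ubar W r s
  for ubar :: "real ^ 'n" and W :: "(real ^ 'n) set"
    and r :: "3 \<Rightarrow> real ^ 'n \<Rightarrow> real ^ 'n" and s :: "nat \<Rightarrow> real ^ 'n \<Rightarrow> real ^ 'n" +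
  fixes i j k :: 3 and V :: "(real ^ 'n) set"
  assumes distinct: "distinct [i, j, k]" and V: "coordinate_domain V" and flat: "\<And>u. u \<in> V \<Longrightarrow> flat_pair i j k u"
begin

lemma V_facts: "open V" "ubar \<in> V" "V \<subseteq> W"
  using coordinate_domainD(1)[OF V] by (auto simp: nbhd_in_def)

text \<open>With the next three, these are the structure functions that survive in the reduced
  system. By flatness of the pair, \<open>\<Gamma>\<close> is also the coefficient for
  \<open>j\<close>; the difference \<open>\<beta> a - \<kappa> a\<close> is the coefficient in the
  equation of the third function along \<open>r a\<close>.\<close>

definition \<Gamma> :: "real ^ 'n \<Rightarrow> real" where "\<Gamma> = Gam r s i k i"
definition \<beta> :: "3 \<Rightarrow> real ^ 'n \<Rightarrow> real" where "\<beta> a = Gam r s a k k"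
definition \<kappa> :: "3 \<Rightarrow> real ^ 'n \<Rightarrow> real" where "\<kappa> a = brc r s a k k"
definition \<mu> :: "3 \<Rightarrow> real ^ 'n \<Rightarrow> real" where "\<mu> a = brc r s i j a"

lemma Gam_third: "u \<in> V \<Longrightarrow> Gam r s k a k u = \<beta> a u - \<kappa> a u"
  using brc_Gam[of u a k k] V_facts(3) by (auto simp: \<beta>_def \<kappa>_def)

lemma brc_third: "u \<in> V \<Longrightarrow> brc r s i j k u = 0"
  using flat[of u] in_span_pair[of u] V_facts(3) distinct by (auto simp: flat_pair_def brc_rcoord)

lemma nabla_third:
  assumes "u \<in> V"
  shows "nabla (r i) (r k) u = \<Gamma> u *\<^sub>R r i u + \<beta> i u *\<^sub>R r k u"
    "nabla (r j) (r k) u = \<Gamma> u *\<^sub>R r j u + \<beta> j u *\<^sub>R r k u"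
proof -
  have u: "u \<in> W" using assms V_facts by blast
  have *: "v = rcoord i u v *\<^sub>R r i u + rcoord j u v *\<^sub>R r j u + rcoord k u v *\<^sub>R r k u"
    if "\<forall>l\<in>{4..CARD('n)}. scoord l u v = 0" for v
    using frame_expansion[OF u, of v] that by (simp add: sum_3_distinct[OF distinct])
  have "nabla (r i) (r k) u \<in> span {r i u, r k u}" "nabla (r j) (r k) u \<in> span {r j u, r k u}" and eq: "Gam r s j k j u = \<Gamma> u"
    using flat[OF assms] by (auto simp: flat_pair_def \<Gamma>_def)
  then show "nabla (r i) (r k) u = \<Gamma> u *\<^sub>R r i u + \<beta> i u *\<^sub>R r k u"
    "nabla (r j) (r k) u = \<Gamma> u *\<^sub>R r j u + \<beta> j u *\<^sub>R r k u"
    using *[of "nabla (r i) (r k) u"] *[of "nabla (r j) (r k) u"] distinct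
    unfolding in_span_pair[OF u] by (auto simp: \<Gamma>_def \<beta>_def Gam_rcoord eq[symmetric])
qed

lemma bracket_pair: "u \<in> V \<Longrightarrow> lie_bracket (r i) (r j) u = \<mu> i u *\<^sub>R r i u + \<mu> j u *\<^sub>R r j u"
  using bracket_expansion[of u i j] brc_third[of u] V_facts(3) by (auto simp: sum_3_distinct[OF distinct] \<mu>_def)

lemma smooth_brc: "smooth_on V (brc r s a b c)"
proof -
  have "smooth_on V (\<lambda>u. rcoord c u (lie_bracket (r a) (r b) u))"
    using V_facts bracket_in_span by (intro coordinate_domainD(2)[OF V] smooth_bracket_r) auto
  then show ?thesis by (simp add: brc_rcoord[abs_def])
qed

lemma smooth_Gam: "a = i \<or> a = j \<Longrightarrow> smooth_on V (Gam r s a k c)"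
proof -
  assume a: "a = i \<or> a = j"
  have "nabla (r a) (r k) u \<in> span (range (\<lambda>m. r m u))" if "u \<in> V" for u
  proof -
    have "r m u \<in> span (range (\<lambda>m. r m u))" for m by (rule span_base) auto
    then show ?thesis using a nabla_third[OF that] by (auto intro!: span_add span_scale)
  qed
  then have "smooth_on V (\<lambda>u. rcoord c u (nabla (r a) (r k) u))"
    using V_facts by (intro coordinate_domainD(2)[OF V] smooth_nabla_r) auto
  then show ?thesis by (simp add: Gam_rcoord[abs_def])
qed

lemma smooth_coefficients:
  "smooth_on V \<Gamma>" "smooth_on V (\<beta> i)" "smooth_on V (\<beta> j)" "smooth_on V (\<kappa> a)" "smooth_on V (\<mu> a)"
  unfolding \<Gamma>_def \<beta>_def \<kappa>_def \<mu>_def by (intro smooth_Gam smooth_brc; simp)+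

lemma r_V: "smooth_on V (r a)"
  by (rule smooth_on_subset[OF r_smooth V_facts(3)])

lemma r_diff: "u \<in> V \<Longrightarrow> r a differentiable at u"
  using smooth_on_differentiable[OF r_V] .

text \<open>Coefficients of \<open>r j\<close>, \<open>r i\<close> and \<open>r k\<close>, in this
  order, in the vanishing curvature of \<open>r i\<close> and \<open>r j\<close> applied to
  \<open>r k\<close>.\<close>

lemma flatness_identities:
  assumes u: "u \<in> V"
  shows "nabla (r i) \<Gamma> u = \<beta> i u * \<Gamma> u" "nabla (r j) \<Gamma> u = \<beta> j u * \<Gamma> u"
    "nabla (r i) (\<beta> j) u - nabla (r j) (\<beta> i) u = \<mu> i u * \<beta> i u + \<mu> j u * \<beta> j u"
proof -
  have d: "\<Gamma> differentiable at u" "\<beta> i differentiable at u" "\<beta> j differentiable at u"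
    using smooth_on_differentiable[OF _ u] smooth_coefficients by blast+
  have D: "nabla X (\<lambda>v. \<Gamma> v *\<^sub>R r a v + b v *\<^sub>R r k v) u =
      (nabla X \<Gamma> u *\<^sub>R r a u + \<Gamma> u *\<^sub>R nabla X (r a) u) + (nabla X b u *\<^sub>R r k u + b u *\<^sub>R nabla X (r k) u)"
    if "b differentiable at u" for X a b
    using nabla_add[OF differentiable_scaleR[OF d(1) r_diff[OF u]] differentiable_scaleR[OF that r_diff[OF u]], of X a k]
    unfolding nabla_scaleR[OF d(1) r_diff[OF u]] nabla_scaleR[OF that r_diff[OF u]] .
  have ij: "nabla (r i) (nabla (r j) (r k)) u = (nabla (r i) \<Gamma> u *\<^sub>R r j u + \<Gamma> u *\<^sub>R nabla (r i) (r j) u) +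
      (nabla (r i) (\<beta> j) u *\<^sub>R r k u + \<beta> j u *\<^sub>R nabla (r i) (r k) u)"
    using nabla_cong[OF V_facts(1) u, of "nabla (r j) (r k)" "\<lambda>v. \<Gamma> v *\<^sub>R r j v + \<beta> j v *\<^sub>R r k v" "r i"] nabla_third(2)
      D[OF d(3)] by simp
  have ji: "nabla (r j) (nabla (r i) (r k)) u = (nabla (r j) \<Gamma> u *\<^sub>R r i u + \<Gamma> u *\<^sub>R nabla (r j) (r i) u) +
      (nabla (r j) (\<beta> i) u *\<^sub>R r k u + \<beta> i u *\<^sub>R nabla (r j) (r k) u)"
    using nabla_cong[OF V_facts(1) u, of "nabla (r i) (r k)" "\<lambda>v. \<Gamma> v *\<^sub>R r i v + \<beta> i v *\<^sub>R r k v" "r j"] nabla_third(1)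
      D[OF d(2)] by simp
  have br: "nabla (lie_bracket (r i) (r j)) (r k) u = \<mu> i u *\<^sub>R nabla (r i) (r k) u + \<mu> j u *\<^sub>R nabla (r j) (r k) u"
    by (rule nabla_field_add[where X = "lie_bracket (r i) (r j)" and Y = "r i" and Z = "r j", OF r_diff[OF u] bracket_pair[OF u]])
  \<comment> \<open>\<open>nabla (r i) (r j)\<close> may leave the span of the three fields; only
    its difference with \<open>nabla (r j) (r i)\<close> occurs, and this is the bracket.\<close>
  have tors: "nabla (r i) (r j) u = nabla (r j) (r i) u + (\<mu> i u *\<^sub>R r i u + \<mu> j u *\<^sub>R r j u)"
    using bracket_pair[OF u] by (simp add: lie_bracket_nabla algebra_simps)
  have "(\<beta> j u * \<Gamma> u - nabla (r j) \<Gamma> u) *\<^sub>R r i u + (nabla (r i) \<Gamma> u - \<beta> i u * \<Gamma> u) *\<^sub>R r j u +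
      (nabla (r i) (\<beta> j) u - nabla (r j) (\<beta> i) u - \<mu> i u * \<beta> i u - \<mu> j u * \<beta> j u) *\<^sub>R r k u = 0"
    using nabla_commutator[OF V_facts(1) u r_V[of i] r_V[of j] r_V[of k]]
    unfolding ij ji br tors nabla_third[OF u] by (simp add: algebra_simps)
  from r_combination_zero[OF _ distinct this] u V_facts(3)
  show "nabla (r i) \<Gamma> u = \<beta> i u * \<Gamma> u" "nabla (r j) \<Gamma> u = \<beta> j u * \<Gamma> u"
    "nabla (r i) (\<beta> j) u - nabla (r j) (\<beta> i) u = \<mu> i u * \<beta> i u + \<mu> j u * \<beta> j u"
    by auto
qed

lemma rcoord_bracket_expansion:
  assumes u: "u \<in> V"
  shows "rcoord k u (lie_bracket (r a) (lie_bracket (r b) (r c)) u) =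
    nabla (r a) (brc r s b c k) u + brc r s b c i u * brc r s a i k u + brc r s b c j u * brc r s a j k u +
    brc r s b c k u * brc r s a k k u"
proof -
  have uW: "u \<in> W" using u V_facts by blast
  have bd: "brc r s b c m differentiable at u" for m using smooth_on_differentiable[OF smooth_brc u] .
  let ?t = "\<lambda>m v. brc r s b c m v *\<^sub>R r m v"
  have td: "?t m differentiable at u" for m using differentiable_scaleR[OF bd r_diff[OF u]] .
  have "lie_bracket (r b) (r c) v = ?t i v + ?t j v + ?t k v" if "v \<in> V" for v
    using bracket_expansion[of v b c] that V_facts(3) by (auto simp: sum_3_distinct[OF distinct])
  then have "lie_bracket (r a) (lie_bracket (r b) (r c)) u = lie_bracket (r a) (\<lambda>v. ?t i v + ?t j v + ?t k v) u"
    by (rule lie_bracket_cong[OF V_facts(1) u])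
  also have "\<dots> = lie_bracket (r a) (?t i) u + lie_bracket (r a) (?t j) u + lie_bracket (r a) (?t k) u"
    using lie_bracket_add[OF differentiable_add[OF td[of i] td[of j]] td[of k] r_diff[OF u, of a]] lie_bracket_add[OF td[of i] td[of j] r_diff[OF u, of a]]
    by simp
  finally show ?thesis
    unfolding lie_bracket_scaleR[OF bd r_diff[OF u] r_diff[OF u]]
    using distinct
    by (auto simp: linear_add[OF linear_rcoord[OF uW]] linear_cmul[OF linear_rcoord[OF uW]] rcoord_r[OF uW] brc_rcoord[symmetric])
qed

text \<open>In the \<open>r k\<close> component of the Jacobi identity the products of
  \<open>\<kappa> i\<close> and \<open>\<kappa> j\<close> cancel. The other products contain
  \<open>brc r s i j k\<close> or the coefficient of a self-bracket, both zero, except those with a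
  factor \<open>\<mu>\<close>.\<close>

lemma jacobi_identity_third:
  assumes u: "u \<in> V"
  shows "nabla (r i) (\<kappa> j) u - nabla (r j) (\<kappa> i) u = \<mu> i u * \<kappa> i u + \<mu> j u * \<kappa> j u"
proof -
  have uW: "u \<in> W" using u V_facts by blast
  have "rcoord k u (lie_bracket (r i) (lie_bracket (r j) (r k)) u) - rcoord k u (lie_bracket (r j) (lie_bracket (r i) (r k)) u) +
      rcoord k u (lie_bracket (r k) (lie_bracket (r i) (r j)) u) = 0"
    using arg_cong[OF jacobi_identity[OF V_facts(1) u r_V[of i] r_V[of j] r_V[of k]], of "rcoord k u"]
    by (simp add: linear_add[OF linear_rcoord[OF uW]] linear_diff[OF linear_rcoord[OF uW]] linear_0[OF linear_rcoord[OF uW]])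
  moreover have "nabla (r k) (brc r s i j k) u = 0"
    using nabla_cong[OF V_facts(1) u, of "brc r s i j k" "\<lambda>v. 0" "r k"] brc_third by (simp add: nabla_const)
  ultimately show ?thesis
    unfolding rcoord_bracket_expansion[OF u] \<kappa>_def \<mu>_def
    using brc_third[OF u] brc_swap[OF uW, of i j k] brc_swap[OF uW, of i k k] brc_swap[OF uW, of j k k] brc_self[OF uW]
    by (simp add: algebra_simps)
qed

text \<open>\<open>bool\<close> serves as an index type with two elements, for which the Frobenius
  theorems yield leaves of dimension two.\<close>

definition pair :: "bool \<Rightarrow> real ^ 'n \<Rightarrow> real ^ 'n" where
  "pair b = r (if b then i else j)"

lemma pair_facts:
  "inj (\<lambda>b. pair b ubar)" "range (\<lambda>b. pair b ubar) = {r i ubar, r j ubar}" "independent (range (\<lambda>b. pair b ubar))"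
proof -
  show "inj (\<lambda>b. pair b ubar)"
    using r_inj[OF ubar_W] distinct by (auto simp: pair_def inj_def)
  show eq: "range (\<lambda>b. pair b ubar) = {r i ubar, r j ubar}" by (auto simp: pair_def UNIV_bool)
  show "independent (range (\<lambda>b. pair b ubar))"
    unfolding eq by (rule independent_mono[OF r_indep[OF ubar_W]]) auto
qed

text \<open>Antisymmetry reduces the integrability conditions to the single one for \<open>i\<close>
  and \<open>j\<close>.\<close>

lemma pair_integrable:
  assumes u: "u \<in> V" and closed: "nabla (r i) (h False) u - nabla (r j) (h True) u = \<mu> i u *\<^sub>R h True u + \<mu> j u *\<^sub>R h False u"
  shows "\<exists>c. lie_bracket (pair a) (pair b) u = (\<Sum>m\<in>UNIV. c m *\<^sub>R pair m u) \<and>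
    nabla (pair a) (h b) u - nabla (pair b) (h a) u = (\<Sum>m\<in>UNIV. c m *\<^sub>R h m u)"
proof -
  let ?c = "\<lambda>m. if m then \<mu> i u else \<mu> j u"
  consider "a = b" | "a" "\<not> b" | "\<not> a" "b" by blast
  then show ?thesis
  proof cases
    case 1
    then show ?thesis by (intro exI[of _ "\<lambda>m. 0"]) (simp add: lie_bracket_self)
  next
    case 2
    then show ?thesis
      using bracket_pair[OF u] closed by (intro exI[of _ ?c]) (simp add: pair_def UNIV_bool add.commute)
  next
    case 3
    then show ?thesis
      using bracket_pair[OF u] closed lie_bracket_swap[of "r j" "r i" u]
      by (intro exI[of _ "\<lambda>m. - ?c m"]) (simp add: pair_def UNIV_bool algebra_simps)
  qed
qed

lemma solve_pair:
  assumes U: "nbhd_in ubar V U" and h: "smooth_on U hi" "smooth_on U hj" and g: "smooth_on U g"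
    and closed: "\<And>u. u \<in> U \<Longrightarrow> nabla (r i) hj u - nabla (r j) hi u = \<mu> i u * hi u + \<mu> j u * (hj u :: real)"
    and M: "submanifold (CARD('n) - 2) M" "ubar \<in> M" "tangent_space M ubar \<inter> span {r i ubar, r j ubar} = {0}"
  shows "\<exists>U' f. nbhd_in ubar U U' \<and> smooth_on U' f \<and>
    (\<forall>u\<in>U'. nabla (r i) f u = hi u \<and> nabla (r j) f u = hj u) \<and> (\<forall>u\<in>U' \<inter> M. f u = g u)"
proof -
  have U': "open U" "ubar \<in> U" "U \<subseteq> V" using U by (auto simp: nbhd_in_def)
  define h where "h b = (if b then hi else hj)" for b
  have hs: "smooth_on U (h b)" for b using assms(2,3) by (simp add: h_def)
  have pr: "smooth_on U (pair b)" for b unfolding pair_def by (rule smooth_on_subset[OF r_V U'(3)])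
  have "\<exists>U' f. nbhd_in ubar U U' \<and> smooth_on U' f \<and> (\<forall>u\<in>U'. \<forall>b. nabla (pair b) f u = h b u) \<and> (\<forall>u\<in>U' \<inter> M. f u = g u)"
  proof (rule frobenius_existence[OF U'(1,2) pr hs g pair_facts(1,3) _ M(1,2)])
    show "CARD('n) - 2 + CARD(bool) = CARD('n)" using card_ge_3[OF ubar_W] by simp
    show "tangent_space M ubar \<inter> span (range (\<lambda>b. pair b ubar)) = {0}" unfolding pair_facts(2) by (rule M(3))
    show "\<exists>c. lie_bracket (pair a) (pair b) u = (\<Sum>m\<in>UNIV. c m *\<^sub>R pair m u) \<and>
        nabla (pair a) (h b) u - nabla (pair b) (h a) u = (\<Sum>m\<in>UNIV. c m *\<^sub>R h m u)" if "u \<in> U" for u a b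
      using that U'(3) closed[OF that] by (intro pair_integrable) (auto simp: h_def)
  qed
  then obtain U' f where f: "nbhd_in ubar U U'" "smooth_on U' f" "\<forall>u\<in>U'. \<forall>b. nabla (pair b) f u = h b u" "\<forall>u\<in>U' \<inter> M. f u = g u"
    by blast
  then have "\<forall>u\<in>U'. nabla (r i) f u = hi u \<and> nabla (r j) f u = hj u"
    using f(3) unfolding pair_def h_def by (metis (full_types))
  then show ?thesis using f by blast
qed

lemma unique_pair:
  fixes \<delta> :: "real ^ 'n \<Rightarrow> real"
  assumes U: "nbhd_in ubar V U" and \<delta>: "\<And>u. u \<in> U \<Longrightarrow> \<delta> differentiable at u"
      "\<And>u. u \<in> U \<Longrightarrow> nabla (r i) \<delta> u = 0" "\<And>u. u \<in> U \<Longrightarrow> nabla (r j) \<delta> u = 0" "\<And>u. u \<in> U \<inter> M \<Longrightarrow> \<delta> u = 0"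
    and M: "submanifold (CARD('n) - 2) M" "ubar \<in> M" "tangent_space M ubar \<inter> span {r i ubar, r j ubar} = {0}"
  shows "\<exists>U'. nbhd_in ubar U U' \<and> (\<forall>u\<in>U'. \<delta> u = 0)"
proof -
  have U': "open U" "ubar \<in> U" "U \<subseteq> V" using U by (auto simp: nbhd_in_def)
  have pr: "smooth_on U (pair b)" for b unfolding pair_def by (rule smooth_on_subset[OF r_V U'(3)])
  show ?thesis
  proof (rule frobenius_uniqueness[OF U'(1,2) pr pair_facts(1,3) _ M(1,2) _ _ \<delta>(1)])
    show "CARD('n) - 2 + CARD(bool) = CARD('n)" using card_ge_3[OF ubar_W] by simp
    show "tangent_space M ubar \<inter> span (range (\<lambda>b. pair b ubar)) = {0}" unfolding pair_facts(2) by (rule M(3))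
    show "\<exists>c. lie_bracket (pair a) (pair b) u = (\<Sum>m\<in>UNIV. c m *\<^sub>R pair m u)" if "u \<in> U" for u a b
      using pair_integrable[of u "\<lambda>_ _. 0 :: real" a b] that U'(3) by (auto simp: nabla_const)
    show "nabla (pair b) \<delta> u = 0" if "u \<in> U" for u b using \<delta>(2,3)[OF that] by (simp add: pair_def)
  qed (use \<delta>(4) in auto)
qed

text \<open>The integrability conditions involving \<open>r k\<close> are the hypotheses on
  \<open>\<eta>\<close>; the one for \<open>r i\<close> and \<open>r j\<close> is
  \<open>brc r s i j k u * \<eta> u = 0\<close> and holds by flatness of the pair.\<close>

lemma solve_triple:
  assumes U: "nbhd_in ubar V U" and \<eta>: "smooth_on U \<eta>" and g: "smooth_on U g"
    and closed: "\<And>u. u \<in> U \<Longrightarrow> nabla (r i) \<eta> u = \<kappa> i u * \<eta> u" "\<And>u. u \<in> U \<Longrightarrow> nabla (r j) \<eta> u = \<kappa> j u * (\<eta> u :: real)"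
    and M: "submanifold (CARD('n) - 3) M" "ubar \<in> M" "tangent_space M ubar \<inter> span (range (\<lambda>i. r i ubar)) = {0}"
  shows "\<exists>U' f. nbhd_in ubar U U' \<and> smooth_on U' f \<and>
    (\<forall>u\<in>U'. nabla (r i) f u = 0 \<and> nabla (r j) f u = 0 \<and> nabla (r k) f u = \<eta> u) \<and> (\<forall>u\<in>U' \<inter> M. f u = g u)"
proof -
  have U': "open U" "ubar \<in> U" "U \<subseteq> V" using U by (auto simp: nbhd_in_def)
  define h where "h m = (if m = k then \<eta> else (\<lambda>u. 0))" for m
  have hs: "smooth_on U (h m)" for m using \<eta> U'(1) by (simp add: h_def smooth_on_const)
  have Un: "nbhd_in ubar W U" using U V_facts(3) by (auto simp: nbhd_in_def)
  have ne: "i \<noteq> k" "j \<noteq> k" "i \<noteq> j" using distinct by auto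
  have cases3: "a = i \<or> a = j \<or> a = k" for a using UNIV_3_distinct[OF distinct] by blast
  have "\<exists>U' f. nbhd_in ubar U U' \<and> smooth_on U' f \<and> (\<forall>u\<in>U'. \<forall>m. nabla (r m) f u = h m u) \<and> (\<forall>u\<in>U' \<inter> M. f u = g u)"
  proof (rule frobenius_exists_3[OF Un hs g M])
    fix u a b assume u: "u \<in> U"
    then have uV: "u \<in> V" "u \<in> W" using U'(3) V_facts(3) by auto
    have "nabla (r a) (h b) u - nabla (r b) (h a) u = brc r s a b k u * \<eta> u"
      using cases3[of a] cases3[of b] ne closed[OF u] brc_third[OF uV(1)] brc_self[OF uV(2)]
        brc_swap[OF uV(2), of i j k] brc_swap[OF uV(2), of i k k] brc_swap[OF uV(2), of j k k]
      by (elim disjE) (simp_all add: h_def nabla_const \<kappa>_def)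
    also have "\<dots> = (\<Sum>m\<in>UNIV. brc r s a b m u *\<^sub>R h m u)"
      unfolding sum_3_distinct[OF distinct] using ne by (simp add: h_def)
    finally show "nabla (r a) (h b) u - nabla (r b) (h a) u = (\<Sum>m\<in>UNIV. brc r s a b m u *\<^sub>R h m u)" .
  qed
  then obtain U' f where f: "nbhd_in ubar U U'" "smooth_on U' f" "\<forall>u\<in>U'. \<forall>m. nabla (r m) f u = h m u" "\<forall>u\<in>U' \<inter> M. f u = g u"
    by blast
  then have "\<forall>u\<in>U'. nabla (r i) f u = 0 \<and> nabla (r j) f u = 0 \<and> nabla (r k) f u = \<eta> u"
    using ne by (simp add: h_def)
  then show ?thesis using f by blast
qed

end

lemma nbhd_in_trans: "nbhd_in p W V \<Longrightarrow> nbhd_in p V U \<Longrightarrow> nbhd_in p W U"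
  by (auto simp: nbhd_in_def)

lemma nbhd_inD: "nbhd_in p W V \<Longrightarrow> open V" "nbhd_in p W V \<Longrightarrow> p \<in> V" "nbhd_in p W V \<Longrightarrow> V \<subseteq> W"
  by (auto simp: nbhd_in_def)

context flat_triple
begin

lemma ij_k: "i \<noteq> j" "i \<noteq> k" "j \<noteq> k" "j \<noteq> i" "k \<noteq> i" "k \<noteq> j"
  using distinct by auto

text \<open>
  These functions decouple the \<open>\<lambda>\<close>-system: if \<open>\<lambda>\<close> is the common value and \<open>\<lambda>\<^sup>k\<close> the third function, then
  \<open>w = \<lambda> + (\<lambda>\<^sup>k - \<lambda>) / \<sigma>\<close> is constant along \<open>r i\<close> and \<open>r j\<close>, it equals \<open>\<lambda>\<^sup>k\<close> on \<open>M1\<close>, and the derivatives of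
  \<open>exp E * \<lambda>\<close> along \<open>r i, r j, r k\<close> are \<open>0\<close>, \<open>0\<close> and \<open>exp E * \<Gamma> * \<sigma> * w\<close>.
\<close>

lemma adapted_functions:
  assumes M1: "submanifold (CARD('n) - 2) M1" "ubar \<in> M1" "tangent_space M1 ubar \<inter> span {r i ubar, r j ubar} = {0}"
    and M2: "submanifold (CARD('n) - 3) M2" "ubar \<in> M2" "tangent_space M2 ubar \<inter> span (range (\<lambda>i. r i ubar)) = {0}"
  obtains U \<sigma> E where "nbhd_in ubar V U" "smooth_on U \<sigma>" "smooth_on U E" "\<And>u. u \<in> U \<Longrightarrow> \<sigma> u > (0 :: real)"
    "\<And>u. u \<in> U \<Longrightarrow> nabla (r i) \<sigma> u = (\<kappa> i u - \<beta> i u) * \<sigma> u" "\<And>u. u \<in> U \<Longrightarrow> nabla (r j) \<sigma> u = (\<kappa> j u - \<beta> j u) * \<sigma> u"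
    "\<And>u. u \<in> U \<inter> M1 \<Longrightarrow> \<sigma> u = 1"
    "\<And>u. u \<in> U \<Longrightarrow> nabla (r i) E u = 0" "\<And>u. u \<in> U \<Longrightarrow> nabla (r j) E u = 0"
    "\<And>u. u \<in> U \<Longrightarrow> nabla (r k) E u = \<Gamma> u * (\<sigma> u :: real)"
    "\<And>u. u \<in> U \<Longrightarrow> nabla (r i) (\<lambda>v. \<Gamma> v * \<sigma> v) u = \<kappa> i u * (\<Gamma> u * \<sigma> u)"
    "\<And>u. u \<in> U \<Longrightarrow> nabla (r j) (\<lambda>v. \<Gamma> v * \<sigma> v) u = \<kappa> j u * (\<Gamma> u * \<sigma> u)"
proof -
  have VV: "nbhd_in ubar V V" using V_facts by (simp add: nbhd_in_def)
  have sm: "smooth_on V (\<lambda>u. \<kappa> i u - \<beta> i u)" "smooth_on V (\<lambda>u. \<kappa> j u - \<beta> j u)"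
    by (intro smooth_on_diff V_facts(1) smooth_coefficients)+
  have d: "\<kappa> a differentiable at u" "\<beta> i differentiable at u" "\<beta> j differentiable at u" "\<Gamma> differentiable at u" if "u \<in> V" for a u
    using smooth_on_differentiable[OF _ that] smooth_coefficients by blast+
  \<comment> \<open>The Jacobi component minus the flatness identity. The function \<open>S\<close>
    obtained from it is the logarithm of \<open>\<sigma>\<close>; along \<open>r i\<close> and
    \<open>r j\<close>, \<open>\<sigma>\<close> satisfies the same linear equation as
    \<open>\<lambda>\<^sup>k - \<lambda>\<close>, so their quotient is constant there.\<close>
  have closed: "nabla (r i) (\<lambda>u. \<kappa> j u - \<beta> j u) u - nabla (r j) (\<lambda>u. \<kappa> i u - \<beta> i u) u =
      \<mu> i u * (\<kappa> i u - \<beta> i u) + \<mu> j u * (\<kappa> j u - \<beta> j u)" if u: "u \<in> V" for u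
    unfolding nabla_diff[OF d(1)[OF u] d(2)[OF u]] nabla_diff[OF d(1)[OF u] d(3)[OF u]]
    using flatness_identities(3)[OF u] jacobi_identity_third[OF u] by (simp add: algebra_simps)
  obtain U1 S where S: "nbhd_in ubar V U1" "smooth_on U1 S"
    "\<And>u. u \<in> U1 \<Longrightarrow> nabla (r i) S u = \<kappa> i u - \<beta> i u" "\<And>u. u \<in> U1 \<Longrightarrow> nabla (r j) S u = \<kappa> j u - \<beta> j u"
    "\<And>u. u \<in> U1 \<inter> M1 \<Longrightarrow> S u = 0"
    using solve_pair[OF VV sm smooth_on_const[OF V_facts(1)] closed M1] by blast
  note U1 = nbhd_inD[OF S(1)]
  define \<sigma> where "\<sigma> u = exp (S u)" for u
  have \<sigma>: "smooth_on U1 \<sigma>" unfolding \<sigma>_def by (rule smooth_on_exp[OF U1(1) S(2)])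
  have \<sigma>ij: "nabla (r i) \<sigma> u = (\<kappa> i u - \<beta> i u) * \<sigma> u" "nabla (r j) \<sigma> u = (\<kappa> j u - \<beta> j u) * \<sigma> u" if "u \<in> U1" for u
    unfolding \<sigma>_def using S(3,4)[OF that] nabla_exp[OF smooth_on_differentiable[OF S(2) that]] by (simp_all add: mult.commute)
  have \<eta>: "smooth_on U1 (\<lambda>v. \<Gamma> v * \<sigma> v)"
    by (intro smooth_on_mult U1 \<sigma> smooth_on_subset[OF smooth_coefficients(1) U1(3)])
  \<comment> \<open>The terms with \<open>\<beta>\<close> from \<open>\<Gamma>\<close> and from
    \<open>\<sigma>\<close> cancel, which leaves exactly the integrability condition of
    \<open>solve_triple\<close>.\<close>
  have \<eta>ij: "nabla (r i) (\<lambda>v. \<Gamma> v * \<sigma> v) u = \<kappa> i u * (\<Gamma> u * \<sigma> u)" "nabla (r j) (\<lambda>v. \<Gamma> v * \<sigma> v) u = \<kappa> j u * (\<Gamma> u * \<sigma> u)"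
    if u: "u \<in> U1" for u
  proof -
    have uV: "u \<in> V" using u U1 by blast
    show "nabla (r i) (\<lambda>v. \<Gamma> v * \<sigma> v) u = \<kappa> i u * (\<Gamma> u * \<sigma> u)" "nabla (r j) (\<lambda>v. \<Gamma> v * \<sigma> v) u = \<kappa> j u * (\<Gamma> u * \<sigma> u)"
      unfolding nabla_mult[OF d(4)[OF uV] smooth_on_differentiable[OF \<sigma> u]] \<sigma>ij[OF u] flatness_identities(1,2)[OF uV]
      by (simp_all add: algebra_simps)
  qed
  obtain U E where E: "nbhd_in ubar U1 U" "smooth_on U E"
    "\<And>u. u \<in> U \<Longrightarrow> nabla (r i) E u = 0" "\<And>u. u \<in> U \<Longrightarrow> nabla (r j) E u = 0" "\<And>u. u \<in> U \<Longrightarrow> nabla (r k) E u = \<Gamma> u * \<sigma> u"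
    using solve_triple[OF S(1) \<eta> smooth_on_const[OF U1(1), of 0] \<eta>ij M2] by blast
  note U = nbhd_inD[OF E(1)]
  show thesis
  proof (rule that[of U \<sigma> E])
    show "nbhd_in ubar V U" by (rule nbhd_in_trans[OF S(1) E(1)])
    show "smooth_on U \<sigma>" by (rule smooth_on_subset[OF \<sigma> U(3)])
    show "\<sigma> u = 1" if "u \<in> U \<inter> M1" for u using S(5)[of u] that U(3) by (auto simp: \<sigma>_def)
    show "\<sigma> u > 0" for u by (simp add: \<sigma>_def)
  qed (use E \<sigma>ij \<eta>ij U(3) in auto)
qed

text \<open>The decoupling is run backwards: \<open>G1\<close> is constant along \<open>r i\<close>
  and \<open>r j\<close> with the data \<open>g1\<close>, and \<open>Q\<close> is
  \<open>exp E\<close> times the common value. The problem for \<open>Q\<close> is integrable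
  because \<open>E\<close> and \<open>G1\<close> are constant along the two fields.\<close>

lemma two_equal_solution:
  assumes M1: "submanifold (CARD('n) - 2) M1" "ubar \<in> M1" "tangent_space M1 ubar \<inter> span {r i ubar, r j ubar} = {0}"
    and M2: "submanifold (CARD('n) - 3) M2" "ubar \<in> M2" "tangent_space M2 ubar \<inter> span (range (\<lambda>i. r i ubar)) = {0}"
    and U0: "nbhd_in ubar V U0" and g: "smooth_on U0 g1" "smooth_on U0 g2"
  shows "\<exists>U lam. nbhd_in ubar U0 U \<and> lambda_equations r s U lam \<and> (\<forall>u\<in>U. lam u $ i = lam u $ j) \<and>
    (\<forall>u\<in>U \<inter> M1. lam u $ k = g1 u) \<and> (\<forall>u\<in>U \<inter> M2. lam u $ i = g2 u)"
proof -
  obtain U1 \<sigma> E where U1: "nbhd_in ubar V U1" and s: "smooth_on U1 \<sigma>" "smooth_on U1 E"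
    and \<sigma>i: "\<And>u. u \<in> U1 \<Longrightarrow> nabla (r i) \<sigma> u = (\<kappa> i u - \<beta> i u) * \<sigma> u"
    and \<sigma>j: "\<And>u. u \<in> U1 \<Longrightarrow> nabla (r j) \<sigma> u = (\<kappa> j u - \<beta> j u) * \<sigma> u"
    and \<sigma>1: "\<And>u. u \<in> U1 \<inter> M1 \<Longrightarrow> \<sigma> u = 1"
    and Ei: "\<And>u. u \<in> U1 \<Longrightarrow> nabla (r i) E u = 0" and Ej: "\<And>u. u \<in> U1 \<Longrightarrow> nabla (r j) E u = 0"
    and Ek: "\<And>u. u \<in> U1 \<Longrightarrow> nabla (r k) E u = \<Gamma> u * \<sigma> u"
    and \<eta>i: "\<And>u. u \<in> U1 \<Longrightarrow> nabla (r i) (\<lambda>v. \<Gamma> v * \<sigma> v) u = \<kappa> i u * (\<Gamma> u * \<sigma> u)"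
    and \<eta>j: "\<And>u. u \<in> U1 \<Longrightarrow> nabla (r j) (\<lambda>v. \<Gamma> v * \<sigma> v) u = \<kappa> j u * (\<Gamma> u * \<sigma> u)"
    by (rule adapted_functions[OF M1 M2]) (rule that; assumption)
  note U0' = nbhd_inD[OF U0] and U1' = nbhd_inD[OF U1]
  have zero: "nabla (r i) (\<lambda>u. 0 :: real) u - nabla (r j) (\<lambda>u. 0 :: real) u = \<mu> i u * 0 + \<mu> j u * 0" for u
    by (simp add: nabla_const)
  obtain U2 G1 where U2: "nbhd_in ubar U0 U2" and G1: "smooth_on U2 G1"
    "\<And>u. u \<in> U2 \<Longrightarrow> nabla (r i) G1 u = 0" "\<And>u. u \<in> U2 \<Longrightarrow> nabla (r j) G1 u = 0" "\<And>u. u \<in> U2 \<inter> M1 \<Longrightarrow> G1 u = g1 u"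
    using solve_pair[OF U0 smooth_on_const[OF U0'(1)] smooth_on_const[OF U0'(1)] g(1) zero M1] by blast
  note U2' = nbhd_inD[OF U2]
  define U3 where "U3 = U1 \<inter> U2"
  have U3: "open U3" "ubar \<in> U3" "U3 \<subseteq> V" "U3 \<subseteq> U1" "U3 \<subseteq> U2" "U3 \<subseteq> U0"
    using U1' U2' by (auto simp: U3_def)
  have sm: "smooth_on U3 \<sigma>" "smooth_on U3 E" "smooth_on U3 G1" "smooth_on U3 \<Gamma>" "smooth_on U3 g2"
    using s G1(1) g(2) smooth_coefficients(1) U3 smooth_on_subset by blast+
  have d: "\<sigma> differentiable at u" "E differentiable at u" "G1 differentiable at u" "(\<lambda>v. \<Gamma> v * \<sigma> v) differentiable at u"
    "(\<lambda>v. exp (E v)) differentiable at u" "(\<lambda>v. exp (E v) * (\<Gamma> v * \<sigma> v)) differentiable at u"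
    if u: "u \<in> U3" for u
    using smooth_on_differentiable[OF sm(1) u] smooth_on_differentiable[OF sm(2) u] smooth_on_differentiable[OF sm(3) u]
      smooth_on_differentiable[OF smooth_on_mult[OF U3(1) sm(4,1)] u] smooth_on_differentiable[OF smooth_on_exp[OF U3(1) sm(2)] u]
      smooth_on_differentiable[OF smooth_on_mult[OF U3(1) smooth_on_exp[OF U3(1) sm(2)] smooth_on_mult[OF U3(1) sm(4,1)]] u]
    by auto
  let ?\<eta> = "\<lambda>v. exp (E v) * (\<Gamma> v * \<sigma> v) * G1 v"
  have \<eta>: "smooth_on U3 ?\<eta>" using sm U3(1) by (intro smooth_on_mult smooth_on_exp)
  have D\<eta>: "nabla X ?\<eta> u = (exp (E u) * nabla X E u * (\<Gamma> u * \<sigma> u) + exp (E u) * nabla X (\<lambda>v. \<Gamma> v * \<sigma> v) u) * G1 u +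
      exp (E u) * (\<Gamma> u * \<sigma> u) * nabla X G1 u" if u: "u \<in> U3" for u X
    unfolding nabla_mult[OF d(6)[OF u] d(3)[OF u]] nabla_mult[OF d(5)[OF u] d(4)[OF u]] nabla_exp[OF d(2)[OF u]] ..
  have U3n: "nbhd_in ubar V U3" using U3 by (simp add: nbhd_in_def)
  have "\<exists>U Q. nbhd_in ubar U3 U \<and> smooth_on U Q \<and>
    (\<forall>u\<in>U. nabla (r i) Q u = 0 \<and> nabla (r j) Q u = 0 \<and> nabla (r k) Q u = ?\<eta> u) \<and> (\<forall>u\<in>U \<inter> M2. Q u = exp (E u) * g2 u)"
  proof (rule solve_triple[OF U3n \<eta> _ _ _ M2])
    show "smooth_on U3 (\<lambda>u. exp (E u) * g2 u)" using sm U3(1) by (intro smooth_on_mult smooth_on_exp)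
    fix u assume u: "u \<in> U3"
    then have "u \<in> U1" "u \<in> U2" using U3 by auto
    then show "nabla (r i) ?\<eta> u = \<kappa> i u * ?\<eta> u" "nabla (r j) ?\<eta> u = \<kappa> j u * ?\<eta> u"
      unfolding D\<eta>[OF u] by (simp_all add: Ei Ej \<eta>i \<eta>j G1(2,3))
  qed
  then obtain U Q where U: "nbhd_in ubar U3 U" and Q: "smooth_on U Q" "\<And>u. u \<in> U \<Longrightarrow> nabla (r i) Q u = 0"
    "\<And>u. u \<in> U \<Longrightarrow> nabla (r j) Q u = 0" "\<And>u. u \<in> U \<Longrightarrow> nabla (r k) Q u = ?\<eta> u" "\<And>u. u \<in> U \<inter> M2 \<Longrightarrow> Q u = exp (E u) * g2 u"
    by blast
  note U' = nbhd_inD[OF U]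
  define l where "l u = exp (- E u) * Q u" for u
  \<comment> \<open>Solves \<open>G1 = l + (lk - l) / \<sigma>\<close> for \<open>lk\<close>; on
    \<open>M1\<close>, where \<open>\<sigma>\<close> is 1, it equals \<open>G1\<close>.\<close>
  define lk where "lk u = l u + \<sigma> u * (G1 u - l u)" for u
  define lam :: "real ^ 'n \<Rightarrow> real ^ 3" where "lam u = (\<chi> m. if m = k then lk u else l u)" for u
  have smU: "smooth_on U \<sigma>" "smooth_on U E" "smooth_on U G1" using sm smooth_on_subset[OF _ U'(3)] by blast+
  have l_s: "smooth_on U l"
    unfolding l_def by (intro smooth_on_mult smooth_on_exp smooth_on_minus U'(1) smU Q(1))
  have lk_s: "smooth_on U lk"
    unfolding lk_def by (intro smooth_on_add smooth_on_mult smooth_on_diff U'(1) smU l_s)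
  have lam_s: "smooth_on U lam"
  proof (rule smooth_on_vec[OF U'(1)])
    show "smooth_on U (\<lambda>u. lam u $ a)" for a
      by (cases "a = k") (simp_all add: lam_def l_s lk_s)
  qed
  have Dl: "nabla X l u = exp (- E u) * (nabla X Q u - nabla X E u * Q u)" if u: "u \<in> U" for X u
  proof -
    have dE: "(\<lambda>v. - E v) differentiable at u" "(\<lambda>v. exp (- E v)) differentiable at u" "Q differentiable at u"
      using smooth_on_differentiable[OF _ u] smooth_on_minus[OF U'(1) smU(2)] smooth_on_exp[OF U'(1) smooth_on_minus[OF U'(1) smU(2)]] Q(1) by blast+
    have "nabla X (\<lambda>v. - E v) u = - nabla X E u"
      using nabla_diff[of "\<lambda>v. 0" u E X] smooth_on_differentiable[OF smU(2) u] by (simp add: nabla_const)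
    then show ?thesis
      unfolding l_def nabla_mult[OF dE(2,3)] nabla_exp[OF dE(1)] by (simp add: algebra_simps)
  qed
  have l_ij: "nabla (r i) l u = 0" "nabla (r j) l u = 0" if "u \<in> U" for u
    using Dl[OF that] Q(2,3)[OF that] Ei[of u] Ej[of u] that U'(3) U3(4) by auto
  have l_k: "nabla (r k) l u = \<Gamma> u * (lk u - l u)" if u: "u \<in> U" for u
  proof -
    have "nabla (r k) l u = exp (- E u) * (exp (E u) * (\<Gamma> u * \<sigma> u) * G1 u - \<Gamma> u * \<sigma> u * Q u)"
      using Dl[OF u] Q(4)[OF u] Ek[of u] u U'(3) U3(4) by auto
    also have "\<dots> = (exp (- E u) * exp (E u)) * (\<Gamma> u * \<sigma> u * G1 u) - \<Gamma> u * \<sigma> u * (exp (- E u) * Q u)"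
      by (simp only: right_diff_distrib mult.assoc mult.left_commute)
    also have "\<dots> = \<Gamma> u * (lk u - l u)"
      unfolding l_def[symmetric] exp_add[symmetric] by (simp add: lk_def algebra_simps)
    finally show ?thesis .
  qed
  have Dlk: "nabla X lk u = nabla X l u + (nabla X \<sigma> u * (G1 u - l u) + \<sigma> u * (nabla X G1 u - nabla X l u))" if u: "u \<in> U" for X u
  proof -
    have d: "l differentiable at u" "\<sigma> differentiable at u" "G1 differentiable at u" "(\<lambda>v. G1 v - l v) differentiable at u"
        "(\<lambda>v. \<sigma> v * (G1 v - l v)) differentiable at u"
      using smooth_on_differentiable[OF _ u] l_s smU smooth_on_diff[OF U'(1) smU(3) l_s]
        smooth_on_mult[OF U'(1) smU(1) smooth_on_diff[OF U'(1) smU(3) l_s]] by blast+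
    show ?thesis
      unfolding lk_def nabla_add[OF d(1,5)] nabla_mult[OF d(2,4)] nabla_diff[OF d(3,1)] ..
  qed
  have lk_ij: "nabla (r i) lk u = (\<beta> i u - \<kappa> i u) * (l u - lk u)" "nabla (r j) lk u = (\<beta> j u - \<kappa> j u) * (l u - lk u)" if u: "u \<in> U" for u
  proof -
    have u': "u \<in> U1" "u \<in> U2" using u U'(3) U3 by auto
    show "nabla (r i) lk u = (\<beta> i u - \<kappa> i u) * (l u - lk u)" "nabla (r j) lk u = (\<beta> j u - \<kappa> j u) * (l u - lk u)"
      unfolding Dlk[OF u] l_ij[OF u] \<sigma>i[OF u'(1)] \<sigma>j[OF u'(1)] G1(2)[OF u'(2)] G1(3)[OF u'(2)]
      by (simp_all add: lk_def algebra_simps)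
  qed
  have cases3: "a = i \<or> a = j \<or> a = k" for a using UNIV_3_distinct[OF distinct] by blast
  have lam_c: "lam u $ i = l u" "lam u $ j = l u" "lam u $ k = lk u" for u using ij_k by (auto simp: lam_def)
  have "lambda_equations r s U lam"
  proof (rule lambda_equationsI[OF lam_s])
    fix u assume u: "u \<in> U"
    then have uV: "u \<in> V" using U'(3) U3(3) by blast
    then have uW: "u \<in> W" using V_facts by blast
    have eqs: "nabla (r i) (r k) u \<in> span {r i u, r k u}" "nabla (r j) (r k) u \<in> span {r j u, r k u}" "Gam r s j k j u = \<Gamma> u"
      using flat[OF uV] by (auto simp: flat_pair_def \<Gamma>_def)
    have G0: "Gam r s i k j u = 0" "Gam r s j k i u = 0"
      using eqs(1,2) ij_k unfolding in_span_pair[OF uW] Gam_rcoord by auto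
    have S0: "Gams r s a k m u = 0" if "a = i \<or> a = j" "m \<in> {4..CARD('n)}" for a m
      using eqs(1,2) that unfolding in_span_pair[OF uW] Gams_scoord by blast
    show "algebraic u (lam u)"
      unfolding algebraic_def
    proof (intro conjI allI impI ballI)
      fix a b c :: 3 assume abc: "distinct [a, b, c]"
      show "lam u $ b * Gam r s a b c u - lam u $ a * Gam r s b a c u - brc r s a b c u * lam u $ c = 0"
      proof -
        have G: "Gam r s i j k u = Gam r s j i k u" using brc_third[OF uV] brc_Gam[OF uW, of i j k] by simp
        consider "a = i" "b = j" "c = k" | "a = j" "b = i" "c = k" | "a = i" "b = k" "c = j"
          | "a = k" "b = i" "c = j" | "a = j" "b = k" "c = i" | "a = k" "b = j" "c = i"
          using cases3[of a] cases3[of b] cases3[of c] abc by auto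
        then show ?thesis
          by cases (simp_all add: brc_Gam[OF uW] lam_c G G0)
      qed
    next
      fix a b :: 3 and m assume ab: "a \<noteq> b" and m: "m \<in> {4..CARD('n)}"
      show "(lam u $ b - lam u $ a) * Gams r s b a m u = 0"
      proof -
        have S: "Gams r s k i m u = 0" "Gams r s k j m u = 0" "Gams r s i k m u = 0" "Gams r s j k m u = 0"
          using S0[OF _ m] Gams_sym[OF uW m, of k] by auto
        consider "a = i" "b = j" | "a = j" "b = i" | "a = i" "b = k" | "a = k" "b = i" | "a = j" "b = k" | "a = k" "b = j"
          using cases3[of a] cases3[of b] ab by auto
        then show ?thesis by cases (simp_all add: lam_c S)
      qed
    qed
    fix a b :: 3 assume ab: "a \<noteq> b"
    have fun_eq: "(\<lambda>v. lam v $ b) = (if b = k then lk else l)" using ij_k by (auto simp: lam_def)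
    show "nabla (r a) (\<lambda>v. lam v $ b) u = Gam r s b a b u * (lam u $ a - lam u $ b)"
      unfolding fun_eq
    proof -
      consider "a = i" "b = j" | "a = j" "b = i" | "a = i" "b = k" | "a = k" "b = i" | "a = j" "b = k" | "a = k" "b = j"
        using cases3[of a] cases3[of b] ab by auto
      then show "nabla (r a) (if b = k then lk else l) u = Gam r s b a b u * (lam u $ a - lam u $ b)"
        by cases (simp_all add: ij_k lam_c l_ij[OF u] l_k[OF u] lk_ij[OF u] eqs(3) Gam_third[OF uV] \<Gamma>_def)
    qed
  qed
  moreover have "lam u $ k = g1 u" if "u \<in> U \<inter> M1" for u
  proof -
    have "u \<in> U1 \<inter> M1" "u \<in> U2 \<inter> M1" using that U'(3) U3 by auto
    then show ?thesis using \<sigma>1[of u] G1(4)[of u] by (simp add: lam_c lk_def)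
  qed
  moreover have "lam u $ i = g2 u" if "u \<in> U \<inter> M2" for u
    using Q(5)[OF that] by (simp add: lam_c l_def mult.assoc[symmetric] exp_add[symmetric])
  moreover have "nbhd_in ubar U0 U" using U' U3 by (auto simp: nbhd_in_def)
  ultimately show ?thesis using lam_c by (intro exI[of _ U] exI[of _ lam]) simp
qed

text \<open>The differences \<open>x\<close> of the common values and \<open>y\<close> of the third
  functions satisfy the same linear equations as a solution. Their decoupled combination
  \<open>w\<close> is constant along \<open>r i\<close> and \<open>r j\<close> and zero on
  \<open>M1\<close>, hence zero; then \<open>exp E * x\<close> is constant along the leaves of the
  whole frame and zero on \<open>M2\<close>.\<close>

lemma two_equal_unique:
  assumes M1: "submanifold (CARD('n) - 2) M1" "ubar \<in> M1" "tangent_space M1 ubar \<inter> span {r i ubar, r j ubar} = {0}"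
    and M2: "submanifold (CARD('n) - 3) M2" "ubar \<in> M2" "tangent_space M2 ubar \<inter> span (range (\<lambda>i. r i ubar)) = {0}"
    and U0: "nbhd_in ubar V U0" and lam: "lambda_equations r s U0 lam" "lambda_equations r s U0 lam'"
    and eq: "\<And>u. u \<in> U0 \<Longrightarrow> lam u $ i = lam u $ j" "\<And>u. u \<in> U0 \<Longrightarrow> lam' u $ i = lam' u $ j"
    and data: "\<And>u. u \<in> U0 \<inter> M1 \<Longrightarrow> lam u $ k = lam' u $ k" "\<And>u. u \<in> U0 \<inter> M2 \<Longrightarrow> lam u $ i = lam' u $ i"
  shows "\<exists>U. nbhd_in ubar U0 U \<and> (\<forall>u\<in>U. lam u = lam' u)"
proof -
  obtain U1 \<sigma> E where U1: "nbhd_in ubar V U1" and s: "smooth_on U1 \<sigma>" "smooth_on U1 E"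
    and pos: "\<And>u. u \<in> U1 \<Longrightarrow> \<sigma> u > 0"
    and \<sigma>i: "\<And>u. u \<in> U1 \<Longrightarrow> nabla (r i) \<sigma> u = (\<kappa> i u - \<beta> i u) * \<sigma> u"
    and \<sigma>j: "\<And>u. u \<in> U1 \<Longrightarrow> nabla (r j) \<sigma> u = (\<kappa> j u - \<beta> j u) * \<sigma> u"
    and \<sigma>1: "\<And>u. u \<in> U1 \<inter> M1 \<Longrightarrow> \<sigma> u = 1"
    and Ei: "\<And>u. u \<in> U1 \<Longrightarrow> nabla (r i) E u = 0" and Ej: "\<And>u. u \<in> U1 \<Longrightarrow> nabla (r j) E u = 0"
    and Ek: "\<And>u. u \<in> U1 \<Longrightarrow> nabla (r k) E u = \<Gamma> u * \<sigma> u"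
    by (rule adapted_functions[OF M1 M2]) (rule that; assumption)
  note U0' = nbhd_inD[OF U0] and U1' = nbhd_inD[OF U1]
  define U2 where "U2 = U0 \<inter> U1"
  have U2: "open U2" "ubar \<in> U2" "U2 \<subseteq> V" "U2 \<subseteq> U0" "U2 \<subseteq> U1" using U0' U1' by (auto simp: U2_def)
  define x where "x u = lam u $ i - lam' u $ i" for u
  define y where "y u = lam u $ k - lam' u $ k" for u
  have lc: "smooth_on U2 (\<lambda>u. lam u $ a)" "smooth_on U2 (\<lambda>u. lam' u $ a)" for a
    using lam U2(4) smooth_on_subset[OF _ U2(4)] unfolding lambda_equations_def
    by (auto intro!: smooth_on_nth[OF U2(1)])
  have xs: "smooth_on U2 x" and ys: "smooth_on U2 y"
    unfolding x_def y_def by (intro smooth_on_diff U2(1) lc)+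
  have Dlam: "nabla (r a) (\<lambda>v. lam v $ b) u = Gam r s b a b u * (lam u $ a - lam u $ b)"
    "nabla (r a) (\<lambda>v. lam' v $ b) u = Gam r s b a b u * (lam' u $ a - lam' u $ b)" if "u \<in> U2" "a \<noteq> b" for a b u
    using lam that U2(4) unfolding lambda_equations_def by auto
  have D: "nabla X x u = nabla X (\<lambda>v. lam v $ i) u - nabla X (\<lambda>v. lam' v $ i) u"
    "nabla X y u = nabla X (\<lambda>v. lam v $ k) u - nabla X (\<lambda>v. lam' v $ k) u" if u: "u \<in> U2" for X u
    unfolding x_def y_def
    using nabla_diff[OF smooth_on_differentiable[OF lc(1) u] smooth_on_differentiable[OF lc(2) u]] by blast+
  have x_j: "nabla (r j) x u = 0" and x_k: "nabla (r k) x u = \<Gamma> u * (y u - x u)" and x_i: "nabla (r i) x u = 0"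
    and y_i: "nabla (r i) y u = (\<beta> i u - \<kappa> i u) * (x u - y u)" and y_j: "nabla (r j) y u = (\<beta> j u - \<kappa> j u) * (x u - y u)"
    if u: "u \<in> U2" for u
  proof -
    have uV: "u \<in> V" and u0: "u \<in> U0" using u U2 by auto
    show "nabla (r j) x u = 0" unfolding D[OF u] Dlam[OF u ij_k(4)] using eq[OF u0] by simp
    show "nabla (r k) x u = \<Gamma> u * (y u - x u)"
      unfolding D[OF u] Dlam[OF u ij_k(5)] by (simp add: \<Gamma>_def x_def y_def algebra_simps)
    have "nabla (r i) (\<lambda>v. lam v $ i) u = nabla (r i) (\<lambda>v. lam v $ j) u" "nabla (r i) (\<lambda>v. lam' v $ i) u = nabla (r i) (\<lambda>v. lam' v $ j) u"
      using eq by (intro nabla_cong[OF U0'(1) u0]; simp)+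
    then show "nabla (r i) x u = 0" unfolding D[OF u] using Dlam[OF u ij_k(1)] eq[OF u0] by simp
    show "nabla (r i) y u = (\<beta> i u - \<kappa> i u) * (x u - y u)"
      unfolding D[OF u] Dlam[OF u ij_k(2)] Gam_third[OF uV] by (simp add: x_def y_def algebra_simps)
    show "nabla (r j) y u = (\<beta> j u - \<kappa> j u) * (x u - y u)"
      unfolding D[OF u] Dlam[OF u ij_k(3)] Gam_third[OF uV] using eq[OF u0] by (simp add: x_def y_def algebra_simps)
  qed
  have s2: "smooth_on U2 \<sigma>" "smooth_on U2 E" using s smooth_on_subset[OF _ U2(5)] by blast+
  have ws: "smooth_on U2 (\<lambda>u. x u + (y u - x u) / \<sigma> u)"
  proof (intro smooth_on_add smooth_on_divide smooth_on_diff U2(1) xs ys s2)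
    show "\<sigma> u \<noteq> 0" if "u \<in> U2" for u using pos[of u] that U2(5) by auto
  qed
  define w where "w u = x u + (y u - x u) / \<sigma> u" for u
  have wsm: "smooth_on U2 w" using ws by (simp add: w_def[abs_def])
  have yw: "y u - x u = \<sigma> u * (w u - x u)" if "u \<in> U2" for u
    using pos[of u] that U2(5) by (auto simp: w_def)
  have w_ij: "nabla (r i) w u = 0" "nabla (r j) w u = 0" if u: "u \<in> U2" for u
  proof -
    have u1: "u \<in> U1" using u U2(5) by blast
    have d: "x differentiable at u" "y differentiable at u" "w differentiable at u" "\<sigma> differentiable at u" "(\<lambda>v. w v - x v) differentiable at u"
      using smooth_on_differentiable[OF _ u] xs ys wsm s2 smooth_on_diff[OF U2(1) wsm xs] by blast+
    have "nabla X (\<lambda>v. y v - x v) u = nabla X (\<lambda>v. \<sigma> v * (w v - x v)) u" for X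
      by (rule nabla_cong[OF U2(1) u yw])
    then have *: "nabla X y u - nabla X x u = nabla X \<sigma> u * (w u - x u) + \<sigma> u * (nabla X w u - nabla X x u)" for X
      unfolding nabla_diff[OF d(2,1)] nabla_mult[OF d(4,5)] nabla_diff[OF d(3,1)] .
    have "\<sigma> u * nabla (r i) w u = 0"
    proof -
      have "(\<beta> i u - \<kappa> i u) * - (y u - x u) = (\<kappa> i u - \<beta> i u) * \<sigma> u * (w u - x u) + \<sigma> u * nabla (r i) w u"
        using *[of "r i"] unfolding x_i[OF u] y_i[OF u] \<sigma>i[OF u1] by simp
      then show ?thesis unfolding yw[OF u] by (simp add: algebra_simps)
    qed
    then show "nabla (r i) w u = 0" using pos[OF u1] by simp
    have "\<sigma> u * nabla (r j) w u = 0"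
    proof -
      have "(\<beta> j u - \<kappa> j u) * - (y u - x u) = (\<kappa> j u - \<beta> j u) * \<sigma> u * (w u - x u) + \<sigma> u * nabla (r j) w u"
        using *[of "r j"] unfolding x_j[OF u] y_j[OF u] \<sigma>j[OF u1] by simp
      then show ?thesis unfolding yw[OF u] by (simp add: algebra_simps)
    qed
    then show "nabla (r j) w u = 0" using pos[OF u1] by simp
  qed
  have U2n: "nbhd_in ubar V U2" using U2 by (simp add: nbhd_in_def)
  have "\<exists>U. nbhd_in ubar U2 U \<and> (\<forall>u\<in>U. w u = 0)"
  proof (rule unique_pair[OF U2n smooth_on_differentiable[OF wsm] w_ij _ M1])
    fix u assume "u \<in> U2 \<inter> M1"
    then have "u \<in> U0 \<inter> M1" "u \<in> U1 \<inter> M1" using U2 by auto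
    then show "w u = 0" using data(1) \<sigma>1 by (simp add: w_def y_def)
  qed
  then obtain U3 where U3: "nbhd_in ubar U2 U3" and w0: "\<And>u. u \<in> U3 \<Longrightarrow> w u = 0" by blast
  note U3' = nbhd_inD[OF U3]
  have U3W: "nbhd_in ubar W U3" using U3' U2(3) V_facts(3) by (auto simp: nbhd_in_def)
  let ?z = "\<lambda>u. exp (E u) * x u"
  have "\<exists>U. nbhd_in ubar U3 U \<and> (\<forall>u\<in>U. ?z u = 0)"
  proof (rule frobenius_unique_3[OF U3W M2])
    fix u assume u: "u \<in> U3"
    then have u2: "u \<in> U2" using U3'(3) by blast
    then have u1: "u \<in> U1" using U2(5) by blast
    have d: "x differentiable at u" "E differentiable at u" "(\<lambda>u. exp (E u)) differentiable at u"
      using smooth_on_differentiable[OF _ u2] xs s2 smooth_on_exp[OF U2(1) s2(2)] by blast+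
    show "?z differentiable at u"
      using smooth_on_differentiable[OF smooth_on_mult[OF U2(1) smooth_on_exp[OF U2(1) s2(2)] xs] u2] .
    have Dz: "nabla X ?z u = exp (E u) * (nabla X E u * x u + nabla X x u)" for X
      unfolding nabla_mult[OF d(3,1)] nabla_exp[OF d(2)] by (simp add: algebra_simps)
    \<comment> \<open>With \<open>w = 0\<close> the derivative of \<open>x\<close> along
      \<open>r k\<close> is \<open>- (\<Gamma> u * \<sigma> u * x u)\<close>, and
      \<open>exp E\<close> is the integrating factor.\<close>
    have zk: "nabla (r k) E u * x u + nabla (r k) x u = 0"
      unfolding Ek[OF u1] x_k[OF u2] yw[OF u2] w0[OF u] by (simp add: algebra_simps)
    have "nabla (r a) E u * x u + nabla (r a) x u = 0" for a
    proof -
      consider "a = i" | "a = j" | "a = k" using UNIV_3_distinct[OF distinct] by blast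
      then show ?thesis by cases (simp_all add: zk x_i[OF u2] x_j[OF u2] Ei[OF u1] Ej[OF u1])
    qed
    then show "nabla (r a) ?z u = 0" for a
      unfolding Dz by simp
  next
    fix u assume "u \<in> U3 \<inter> M2"
    then have "u \<in> U0 \<inter> M2" using U3'(3) U2(4) by auto
    then show "?z u = 0" using data(2) by (simp add: x_def)
  qed
  then obtain U where U: "nbhd_in ubar U3 U" and z0: "\<And>u. u \<in> U \<Longrightarrow> x u = 0" by auto
  note U' = nbhd_inD[OF U]
  have "lam u = lam' u" if u: "u \<in> U" for u
  proof -
    have u0: "u \<in> U0" and u2: "u \<in> U2" and u3: "u \<in> U3" using u U'(3) U3'(3) U2(4) by auto
    have "x u = 0" "y u = 0" using z0[OF u] yw[OF u2] w0[OF u3] by auto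
    then have *: "lam u $ i = lam' u $ i" "lam u $ k = lam' u $ k" "lam u $ j = lam' u $ j"
      using eq[OF u0] by (auto simp: x_def y_def)
    have "lam u $ a = lam' u $ a" for a
    proof -
      consider "a = i" | "a = j" | "a = k" using UNIV_3_distinct[OF distinct] by blast
      then show ?thesis by cases (simp_all only: *)
    qed
    then show ?thesis by (simp add: vec_eq_iff)
  qed
  moreover have "nbhd_in ubar U0 U" using U' U3' U2 by (auto simp: nbhd_in_def)
  ultimately show ?thesis by blast
qed

end

section \<open>Fluxes\<close>

lemma transversal_at:
  assumes "transversal p W r I d M"
  shows "submanifold d M" "p \<in> M" "tangent_space M p \<inter> span ((\<lambda>i. r i p) ` I) = {0}"
  using assms by (auto simp: transversal_def transverse_def Let_def)

lemma smooth_data_extension: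
  assumes "smooth_data M g" "p \<in> M" "nbhd_in p W V"
  obtains U h where "nbhd_in p V U" "smooth_on U h" "\<And>u. u \<in> U \<inter> M \<Longrightarrow> h u = g u"
proof -
  obtain U h where U: "open U" "p \<in> U" "smooth_on U h" "\<forall>u\<in>U \<inter> M. h u = g u"
    using assms(1,2) unfolding smooth_data_def by blast
  show thesis
  proof (rule that)
    show "nbhd_in p V (U \<inter> V)" using U(1,2) assms(3) by (auto simp: nbhd_in_def)
    show "smooth_on (U \<inter> V) h" by (rule smooth_on_subset[OF U(3)]) auto
  qed (use U(4) in auto)
qed

lemma decided_equal:
  fixes f g :: "'a::topological_space \<Rightarrow> real"
  assumes "decided_at p P" "\<not> eventually P (nhds p)" "open U" "p \<in> U" "continuous_on U f" "continuous_on U g"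
    "\<And>u. u \<in> U \<Longrightarrow> \<not> P u \<Longrightarrow> f u = g u"
  shows "eventually (\<lambda>u. f u = g u) (nhds p)"
proof -
  have "continuous_on U (\<lambda>u. f u - g u)" "\<forall>u\<in>U. \<not> P u \<longrightarrow> f u - g u = 0"
    using assms(5-7) by (auto intro: continuous_on_diff)
  then have "eventually (\<lambda>u. f u - g u = 0) (nhds p)"
    using decided_dichotomy[OF assms(1)] assms(2-4) by blast
  then show ?thesis by simp
qed

section \<open>Integrability conditions of the flux system\<close>

context completed_frame
begin

lemma lambda_equationsD:
  assumes "lambda_equations r s U lam"
  shows "smooth_on U lam"
    "u \<in> U \<Longrightarrow> i \<noteq> j \<Longrightarrow> nabla (r i) (\<lambda>v. lam v $ j) u = Gam r s j i j u * (lam u $ i - lam u $ j)"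
  using assms unfolding lambda_equations_def by blast+

lemma lambda_equations_subset:
  assumes "lambda_equations r s U lam" "V \<subseteq> U"
  shows "lambda_equations r s V lam"
proof (rule lambda_equationsI)
  show "smooth_on V lam" by (rule smooth_on_subset[OF lambda_equationsD(1)[OF assms(1)] assms(2)])
  show "algebraic u (lam u)" if "u \<in> V" for u
    by (rule lambda_equations_algebraic[OF assms(1)]) (use that assms(2) in auto)
  show "nabla (r i) (\<lambda>v. lam v $ j) u = Gam r s j i j u * (lam u $ i - lam u $ j)" if "u \<in> V" "i \<noteq> j" for u i j
    by (rule lambda_equationsD(2)[OF assms(1) _ that(2)]) (use that assms(2) in auto)
qed

context
  fixes U lam
  assumes U: "nbhd_in ubar W U" and lam_smooth: "smooth_on U (lam :: real ^ 'n \<Rightarrow> real ^ 3)"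
begin

text \<open>\<open>X\<close> is what the commutator of \<open>r a\<close> and \<open>r b\<close> on
  a flux would be. When it is equated with the derivative along the bracket, the components along
  \<open>r a\<close> and \<open>r b\<close> give the differential equations of the
  \<open>\<lambda>\<close>-system, the remaining ones the algebraic equations.\<close>

lemma flux_bracket_coord:
  fixes a b
  defines "X \<equiv> \<lambda>u. nabla (r a) (\<lambda>v. lam v $ b *\<^sub>R r b v) u - nabla (r b) (\<lambda>v. lam v $ a *\<^sub>R r a v) u"
  assumes u: "u \<in> U"
  shows "rcoord m u (X u) = nabla (r a) (\<lambda>v. lam v $ b) u * (if b = m then 1 else 0) + lam u $ b * Gam r s a b m u -
      (nabla (r b) (\<lambda>v. lam v $ a) u * (if a = m then 1 else 0) + lam u $ a * Gam r s b a m u)"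
    and "l \<in> {4..CARD('n)} \<Longrightarrow> scoord l u (X u) = (lam u $ b - lam u $ a) * Gams r s b a l u"
proof -
  note U' = nbhd_inD[OF U]
  have uW: "u \<in> W" using u U'(3) by blast
  have d: "(\<lambda>v. lam v $ c) differentiable at u" "r c differentiable at u" for c
    using smooth_on_differentiable[OF smooth_on_nth[OF U'(1) lam_smooth] u] smooth_on_differentiable[OF r_smooth uW] by blast+
  have X: "X u = nabla (r a) (\<lambda>v. lam v $ b) u *\<^sub>R r b u + lam u $ b *\<^sub>R nabla (r a) (r b) u -
      (nabla (r b) (\<lambda>v. lam v $ a) u *\<^sub>R r a u + lam u $ a *\<^sub>R nabla (r b) (r a) u)"
    unfolding X_def nabla_scaleR[OF d(1) d(2)] ..
  show "rcoord m u (X u) = nabla (r a) (\<lambda>v. lam v $ b) u * (if b = m then 1 else 0) + lam u $ b * Gam r s a b m u -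
      (nabla (r b) (\<lambda>v. lam v $ a) u * (if a = m then 1 else 0) + lam u $ a * Gam r s b a m u)"
    unfolding X linear_diff[OF linear_rcoord[OF uW]] linear_add[OF linear_rcoord[OF uW]] linear_cmul[OF linear_rcoord[OF uW]]
      rcoord_r[OF uW] Gam_rcoord real_scaleR_def ..
  assume l: "l \<in> {4..CARD('n)}"
  show "scoord l u (X u) = (lam u $ b - lam u $ a) * Gams r s b a l u"
    unfolding X linear_diff[OF linear_scoord[OF uW]] linear_add[OF linear_scoord[OF uW]] linear_cmul[OF linear_scoord[OF uW]]
      scoord_r[OF uW l] Gams_scoord[symmetric] Gams_sym[OF uW l, of a b] by (simp add: algebra_simps)
qed

lemma bracket_coord:
  assumes "u \<in> U"
  shows "rcoord m u (\<Sum>k\<in>UNIV. brc r s a b k u *\<^sub>R (lam u $ k *\<^sub>R r k u)) = brc r s a b m u * lam u $ m"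
    and "l \<in> {4..CARD('n)} \<Longrightarrow> scoord l u (\<Sum>k\<in>UNIV. brc r s a b k u *\<^sub>R (lam u $ k *\<^sub>R r k u)) = 0"
proof -
  have uW: "u \<in> W" using assms nbhd_inD(3)[OF U] by blast
  show "rcoord m u (\<Sum>k\<in>UNIV. brc r s a b k u *\<^sub>R (lam u $ k *\<^sub>R r k u)) = brc r s a b m u * lam u $ m"
    by (simp add: linear_sum[OF linear_rcoord[OF uW]] linear_cmul[OF linear_rcoord[OF uW]] rcoord_r[OF uW] if_distrib cong: if_cong)
  show "l \<in> {4..CARD('n)} \<Longrightarrow> scoord l u (\<Sum>k\<in>UNIV. brc r s a b k u *\<^sub>R (lam u $ k *\<^sub>R r k u)) = 0"
    by (simp add: linear_sum[OF linear_scoord[OF uW]] linear_cmul[OF linear_scoord[OF uW]] scoord_r[OF uW])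
qed

text \<open>Here the equations of the system are used to match the commutator and the bracket
  component by component.\<close>

lemma flux_closed:
  assumes lam: "lambda_equations r s U lam" and u: "u \<in> U"
  shows "nabla (r a) (\<lambda>v. lam v $ b *\<^sub>R r b v) u - nabla (r b) (\<lambda>v. lam v $ a *\<^sub>R r a v) u =
    (\<Sum>k\<in>UNIV. brc r s a b k u *\<^sub>R (lam u $ k *\<^sub>R r k u))"
proof (cases "a = b")
  case True
  then show ?thesis using brc_self u nbhd_inD(3)[OF U] by auto
next
  case False
  then obtain c where abc: "distinct [a, b, c]" using ex_third by blast
  have uW: "u \<in> W" using u nbhd_inD(3)[OF U] by blast
  note alg = lambda_equations_algebraic[OF lam u]
  show ?thesis
  proof (rule coord_eqI[OF uW])
    fix m
    consider "m = a" | "m = b" | "m = c" using UNIV_3_distinct[OF abc] by blast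
    then show "rcoord m u (nabla (r a) (\<lambda>v. lam v $ b *\<^sub>R r b v) u - nabla (r b) (\<lambda>v. lam v $ a *\<^sub>R r a v) u) =
        rcoord m u (\<Sum>k\<in>UNIV. brc r s a b k u *\<^sub>R (lam u $ k *\<^sub>R r k u))"
      unfolding flux_bracket_coord(1)[OF u] bracket_coord(1)[OF u] lambda_equationsD(2)[OF lam u False]
        lambda_equationsD(2)[OF lam u False[symmetric]]
      using algebraic_3[OF uW alg abc] abc by cases (simp_all add: brc_Gam[OF uW] algebra_simps)
  next
    fix l assume l: "l \<in> {4..CARD('n)}"
    show "scoord l u (nabla (r a) (\<lambda>v. lam v $ b *\<^sub>R r b v) u - nabla (r b) (\<lambda>v. lam v $ a *\<^sub>R r a v) u) =
        scoord l u (\<Sum>k\<in>UNIV. brc r s a b k u *\<^sub>R (lam u $ k *\<^sub>R r k u))"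
      unfolding flux_bracket_coord(2)[OF u l] bracket_coord(2)[OF u l] using alg False l unfolding algebraic_def by blast
  qed
qed

text \<open>The converse reading: a flux exists, so \<open>nabla_commutator\<close> gives the
  identity, and its components along the third field and the completing fields are the algebraic
  equations.\<close>

lemma flux_algebraic:
  assumes f: "smooth_on U f" "\<And>v m. v \<in> U \<Longrightarrow> nabla (r m) f v = lam v $ m *\<^sub>R r m v" and u: "u \<in> U"
  shows "algebraic u (lam u)"
proof -
  note U' = nbhd_inD[OF U]
  have uW: "u \<in> W" using u U'(3) by blast
  have lin: "linear (frechet_derivative f (at u))"
    by (rule frechet_derivative_linear_at[OF smooth_on_differentiable[OF f(1) u]])
  have fr: "frechet_derivative f (at u) (r m u) = lam u $ m *\<^sub>R r m u" for m using f(2)[OF u, of m] by (simp add: nabla_def)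
  have eq: "nabla (r a) (\<lambda>v. lam v $ b *\<^sub>R r b v) u - nabla (r b) (\<lambda>v. lam v $ a *\<^sub>R r a v) u =
    (\<Sum>k\<in>UNIV. brc r s a b k u *\<^sub>R (lam u $ k *\<^sub>R r k u))" for a b
  proof -
    have "nabla (r a) (\<lambda>v. lam v $ b *\<^sub>R r b v) u - nabla (r b) (\<lambda>v. lam v $ a *\<^sub>R r a v) u =
        nabla (r a) (nabla (r b) f) u - nabla (r b) (nabla (r a) f) u"
      using nabla_cong[OF U'(1) u f(2)] by simp
    also have "\<dots> = nabla (lie_bracket (r a) (r b)) f u"
      by (rule nabla_commutator[OF U'(1) u smooth_on_subset[OF r_smooth U'(3)] smooth_on_subset[OF r_smooth U'(3)] f(1)])
    also have "\<dots> = (\<Sum>k\<in>UNIV. brc r s a b k u *\<^sub>R (lam u $ k *\<^sub>R r k u))"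
      unfolding nabla_def bracket_expansion[OF uW] linear_sum[OF lin] linear_cmul[OF lin] fr ..
    finally show ?thesis .
  qed
  show ?thesis
    unfolding algebraic_def
  proof (intro conjI allI impI ballI)
    fix a b c :: 3 assume abc: "distinct [a, b, c]"
    show "lam u $ b * Gam r s a b c u - lam u $ a * Gam r s b a c u - brc r s a b c u * lam u $ c = 0"
      using flux_bracket_coord(1)[OF u, of c a b] abc unfolding eq bracket_coord(1)[OF u] by simp
  next
    fix a b :: 3 and l assume l: "l \<in> {4..CARD('n)}"
    show "(lam u $ b - lam u $ a) * Gams r s b a l u = 0"
      using flux_bracket_coord(2)[OF u l, of a b] unfolding eq bracket_coord(2)[OF u l] by simp
  qed
qed

end

text \<open>Closedness of the right-hand sides \<open>lam u $ i *\<^sub>R r i u\<close> is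
  \<open>flux_closed\<close>; the difference of two solutions is constant along the leaves.\<close>

lemma flux_uniquely_solvable:
  assumes U: "nbhd_in ubar W U" and lam: "lambda_equations r s U lam"
    and M: "transversal ubar W r UNIV (CARD('n) - 3) M" and g: "smooth_data M g"
  shows "locally_uniquely_solvable ubar U (\<lambda>V f. flux_system r lam V f \<and> (\<forall>u\<in>V \<inter> M. f u = g u))"
  unfolding locally_uniquely_solvable_def
proof (intro conjI allI impI)
  note M' = transversal_at[OF M] and lam_s = lambda_equationsD(1)[OF lam]
  obtain U0 h where U0: "nbhd_in ubar U U0" and h: "smooth_on U0 h" "\<And>u. u \<in> U0 \<inter> M \<Longrightarrow> h u = g u"
    by (rule smooth_data_extension[OF g M'(2) U]) (rule that; assumption)
  note U0' = nbhd_inD[OF U0] and U0W = nbhd_in_trans[OF U U0]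
  have "\<exists>V f. nbhd_in ubar U0 V \<and> smooth_on V f \<and> (\<forall>u\<in>V. \<forall>i. nabla (r i) f u = lam u $ i *\<^sub>R r i u) \<and> (\<forall>u\<in>V \<inter> M. f u = h u)"
  proof (rule frobenius_exists_3[OF U0W _ h(1) M'])
    show "smooth_on U0 (\<lambda>u. lam u $ i *\<^sub>R r i u)" for i
      using smooth_on_subset[OF lam_s U0'(3)] smooth_on_subset[OF r_smooth nbhd_inD(3)[OF U0W]] U0'(1)
      by (intro smooth_on_scaleR smooth_on_nth)
    show "nabla (r i) (\<lambda>u. lam u $ j *\<^sub>R r j u) u - nabla (r j) (\<lambda>u. lam u $ i *\<^sub>R r i u) u =
        (\<Sum>k\<in>UNIV. brc r s i j k u *\<^sub>R (lam u $ k *\<^sub>R r k u))" if "u \<in> U0" for u i j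
      by (rule flux_closed[OF U lam_s lam]) (use that U0'(3) in auto)
  qed
  then obtain V f where V: "nbhd_in ubar U0 V" and "smooth_on V f" "\<forall>u\<in>V. \<forall>i. nabla (r i) f u = lam u $ i *\<^sub>R r i u" "\<forall>u\<in>V \<inter> M. f u = h u"
    by blast
  then have "flux_system r lam V f \<and> (\<forall>u\<in>V \<inter> M. f u = g u)"
    using h(2) nbhd_inD(3)[OF V] by (auto simp: flux_system_def)
  then show "\<exists>V f. nbhd_in ubar U V \<and> flux_system r lam V f \<and> (\<forall>u\<in>V \<inter> M. f u = g u)"
    using nbhd_in_trans[OF U0 V] by blast
next
  fix V V' f f'
  assume *: "nbhd_in ubar U V \<and> (flux_system r lam V f \<and> (\<forall>u\<in>V \<inter> M. f u = g u)) \<and>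
    nbhd_in ubar U V' \<and> flux_system r lam V' f' \<and> (\<forall>u\<in>V' \<inter> M. f' u = g u)"
  then have n: "nbhd_in ubar U V" "nbhd_in ubar U V'" and f: "smooth_on V f" "smooth_on V' f'" 
    "\<And>u i. u \<in> V \<Longrightarrow> nabla (r i) f u = lam u $ i *\<^sub>R r i u" "\<And>u i. u \<in> V' \<Longrightarrow> nabla (r i) f' u = lam u $ i *\<^sub>R r i u"
    and eq: "\<And>u. u \<in> V \<inter> V' \<inter> M \<Longrightarrow> f u = f' u"
    by (auto simp: flux_system_def)
  have n': "nbhd_in ubar W (V \<inter> V')" using n U by (auto simp: nbhd_in_def)
  have d: "f differentiable at u" "f' differentiable at u" if "u \<in> V \<inter> V'" for u
    using that smooth_on_differentiable[OF f(1)] smooth_on_differentiable[OF f(2)] by auto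
  have "\<exists>V0. nbhd_in ubar (V \<inter> V') V0 \<and> (\<forall>u\<in>V0. f u - f' u = 0)"
  proof (rule frobenius_unique_3[OF n' transversal_at[OF M]])
    show "(\<lambda>u. f u - f' u) differentiable at u" if "u \<in> V \<inter> V'" for u by (rule differentiable_diff[OF d[OF that]])
    show "nabla (r i) (\<lambda>u. f u - f' u) u = 0" if "u \<in> V \<inter> V'" for u i
      unfolding nabla_diff[OF d[OF that]] using f(3,4) that by simp
    show "f u - f' u = 0" if "u \<in> V \<inter> V' \<inter> M" for u using eq that by simp
  qed
  then show "\<exists>V0. nbhd_in ubar (V \<inter> V') V0 \<and> (\<forall>u\<in>V0. f u = f' u)" by simp
qed

lemma no_hyperbolic_flux:
  assumes pair: "\<not> (\<exists>V. nbhd_in ubar W V \<and> condition_i V r \<and> condition_ii V r)" and f: "f \<in> fluxes ubar A r"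
  shows "\<not> strictly_hyperbolic ubar f"
proof
  assume "strictly_hyperbolic ubar f"
  then obtain H where H: "nbhd_in ubar UNIV H"
    "\<And>u. u \<in> H \<Longrightarrow> card {\<mu>::real. \<exists>v. v \<noteq> 0 \<and> nabla (\<lambda>_. v) f u = \<mu> *\<^sub>R v} = CARD('n)"
    unfolding strictly_hyperbolic_def by blast
  obtain U lam where U: "nbhd_in ubar A U" and lam: "smooth_on U lam" and fs: "flux_system r lam U f"
    using f unfolding fluxes_def by blast
  obtain P a b V where ab: "a \<noteq> b" and P: "\<not> eventually P (nhds ubar)" and V: "nbhd_in ubar W V"
    and eq: "\<And>u x. u \<in> V \<Longrightarrow> algebraic u x \<Longrightarrow> \<not> P u \<Longrightarrow> x $ a = x $ b"
    by (rule some_pair_equal[OF pair]) (rule that; assumption)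
  define U0 where "U0 = U \<inter> V"
  have U0: "nbhd_in ubar W U0" using U V by (auto simp: nbhd_in_def U0_def)
  have "open (U0 \<inter> H)" "ubar \<in> U0 \<inter> H" using nbhd_inD[OF U0] nbhd_inD[OF H(1)] by auto
  \<comment> \<open>Failure of \<open>P\<close> arbitrarily close to \<open>ubar\<close> supplies a
    point in all the neighbourhoods at which two eigenvalues coincide.\<close>
  then obtain u where u: "u \<in> U0" "u \<in> H" "\<not> P u" using P unfolding eventually_nhds by blast
  have uU: "u \<in> U" "u \<in> V" "u \<in> W" using u(1) nbhd_inD(3)[OF U0] by (auto simp: U0_def)
  have f0: "smooth_on U0 f" "\<And>v m. v \<in> U0 \<Longrightarrow> nabla (r m) f v = lam v $ m *\<^sub>R r m v" "smooth_on U0 lam"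
    using fs lam unfolding flux_system_def U0_def by (auto intro: smooth_on_subset)
  have "lam u $ a = lam u $ b" by (rule eq[OF uU(2) flux_algebraic[OF U0 f0(3,1,2) u(1)] u(3)])
  then have T: "frechet_derivative f (at u) (r a u) = lam u $ a *\<^sub>R r a u" "frechet_derivative f (at u) (r b u) = lam u $ a *\<^sub>R r b u"
    using f0(2)[OF u(1), of a] f0(2)[OF u(1), of b] by (simp_all add: nabla_def)
  have "card {\<mu>. \<exists>v. v \<noteq> 0 \<and> frechet_derivative f (at u) v = \<mu> *\<^sub>R v} \<noteq> DIM(real ^ 'n)"
  proof (rule repeated_eigenvalue_card[OF _ _ _ T])
    show "linear (frechet_derivative f (at u))"
      by (rule frechet_derivative_linear_at[OF smooth_on_differentiable[OF f0(1) u(1)]])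
    show "r a u \<noteq> r b u" using r_inj[OF uU(3)] ab by (auto dest: injD)
    show "independent {r a u, r b u}" by (rule independent_mono[OF r_indep[OF uU(3)]]) auto
  qed
  then show False using H(2)[OF u(2)] by (simp add: nabla_def)
qed

end

section \<open>The two cases\<close>

context completed_frame
begin

lemma lambda_nth:
  assumes "nbhd_in ubar W U" "lambda_equations r s U lam"
  shows "smooth_on U (\<lambda>u. lam u $ a)"
  by (rule smooth_on_nth[OF nbhd_inD(1)[OF assms(1)] lambda_equationsD(1)[OF assms(2)]])

text \<open>The pair is fixed before the solution. One solution in which only two of the functions
  agree at \<open>ubar\<close> therefore determines it for all solutions.\<close>

lemma common_equal_pair:
  assumes ct: "constant_type_at ubar r s" and pair: "\<not> (\<exists>V. nbhd_in ubar W V \<and> condition_i V r \<and> condition_ii V r)"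
  obtains a b where "a \<noteq> b" "\<And>U lam. nbhd_in ubar W U \<Longrightarrow> lambda_equations r s U lam \<Longrightarrow>
    eventually (\<lambda>u. lam u $ a = lam u $ b) (nhds ubar)"
proof -
  obtain P a b V where ab: "a \<noteq> b" and P: "\<not> eventually P (nhds ubar)" and V: "nbhd_in ubar W V"
    and eq: "\<And>u x. u \<in> V \<Longrightarrow> algebraic u x \<Longrightarrow> \<not> P u \<Longrightarrow> x $ a = x $ b"
    and dec: "constant_type_at ubar r s \<Longrightarrow> decided_at ubar P"
    by (rule some_pair_equal[OF pair]) (rule that; assumption)
  show thesis
  proof (rule that[OF ab])
    fix U and lam :: "real ^ 'n \<Rightarrow> real ^ 3" assume U: "nbhd_in ubar W U" and lam: "lambda_equations r s U lam"
    have c: "continuous_on (U \<inter> V) (\<lambda>u. lam u $ m)" for m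
      using continuous_on_subset[OF smooth_on_continuous[OF lambda_nth[OF U lam]]] by blast
    show "eventually (\<lambda>u. lam u $ a = lam u $ b) (nhds ubar)"
    proof (rule decided_equal[OF dec[OF ct] P _ _ c c])
      show "open (U \<inter> V)" "ubar \<in> U \<inter> V" using nbhd_inD[OF U] nbhd_inD[OF V] by auto
      show "lam u $ a = lam u $ b" if "u \<in> U \<inter> V" "\<not> P u" for u
        using eq[OF _ lambda_equations_algebraic[OF lam] that(2)] that(1) by blast
    qed
  qed
qed

lemma third_equal:
  assumes ct: "constant_type_at ubar r s" and d: "distinct [i, j, k]"
    and U: "nbhd_in ubar W U" and lam: "lambda_equations r s U lam"
    and eq: "\<And>u. u \<in> U \<Longrightarrow> lam u $ i = lam u $ j" and nf: "\<not> eventually (flat_pair i j k) (nhds ubar)"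
  shows "eventually (\<lambda>u. lam u $ k = lam u $ i) (nhds ubar)"
proof -
  let ?Ev = "\<lambda>P. eventually P (nhds ubar)"
  note U' = nbhd_inD[OF U]
  have c: "continuous_on U (\<lambda>u. lam u $ m)" for m by (rule smooth_on_continuous[OF lambda_nth[OF U lam]])
  note alg = lambda_equations_algebraic[OF lam]
  have uW: "u \<in> W" if "u \<in> U" for u using that U'(3) by blast
  have ne: "i \<noteq> j" "i \<noteq> k" "j \<noteq> k" "k \<noteq> i" "k \<noteq> j" and d': "distinct [j, i, k]" using d by auto
  consider (A) "\<not> ?Ev (\<lambda>u. lie_bracket (r i) (r j) u \<in> span {r i u, r j u})"
    | (B) "\<not> ?Ev (\<lambda>u. nabla (r i) (r k) u \<in> span {r i u, r k u})"
    | (C) "\<not> ?Ev (\<lambda>u. nabla (r j) (r k) u \<in> span {r j u, r k u})"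
    | (D) "\<not> ?Ev (\<lambda>u. Gam r s i k i u = Gam r s j k j u)"
    using nf unfolding flat_pair_def[abs_def] eventually_conj_iff by blast
  then show ?thesis
  proof cases
    case A
    have "decided_at ubar (\<lambda>u. lie_bracket (r i) (r j) u \<in> span {r i u, r j u})"
      using ct ne(1) unfolding constant_type_at_def by blast
    from decided_equal[OF this A U'(1,2) c c] show ?thesis
      using third_equal_if_bracket[OF uW alg d eq] by blast
  next
    case B
    have "decided_at ubar (\<lambda>u. nabla (r i) (r k) u \<in> span {r i u, r k u})"
      using ct ne(2) unfolding constant_type_at_def by blast
    from decided_equal[OF this B U'(1,2) c c] show ?thesis
      using third_equal_if_nabla[OF uW alg d eq] by blast
  next
    case C
    have "decided_at ubar (\<lambda>u. nabla (r j) (r k) u \<in> span {r j u, r k u})"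
      using ct ne(3) unfolding constant_type_at_def by blast
    from decided_equal[OF this C U'(1,2) c c] show ?thesis
      using third_equal_if_nabla[OF uW alg d' eq[symmetric]] eq by simp
  next
    case D
    have "decided_at ubar (\<lambda>u. Gam r s i k i u = Gam r s j k j u)"
      using ct d unfolding constant_type_at_def by blast
    then show ?thesis
    proof (rule decided_equal[OF _ D U'(1,2) c c])
      fix u assume u: "u \<in> U" and G: "Gam r s i k i u \<noteq> Gam r s j k j u"
      \<comment> \<open>Two expressions for the derivative of the common function along
        \<open>r k\<close>; in their difference \<open>lam u $ k - lam u $ i\<close> is multiplied
        by the difference of the coefficients.\<close>
      have "nabla (r k) (\<lambda>v. lam v $ i) u = nabla (r k) (\<lambda>v. lam v $ j) u"
        by (rule nabla_cong[OF U'(1) u eq])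
      then have "(Gam r s i k i u - Gam r s j k j u) * (lam u $ k - lam u $ i) = 0"
        unfolding lambda_equationsD(2)[OF lam u ne(4)] lambda_equationsD(2)[OF lam u ne(5)]
        using eq[OF u] by (simp add: algebra_simps)
      then show "lam u $ k = lam u $ i" using G by simp
    qed
  qed
qed

lemma all_equal_near:
  assumes ct: "constant_type_at ubar r s" and pair: "\<not> (\<exists>V. nbhd_in ubar W V \<and> condition_i V r \<and> condition_ii V r)"
    and nf: "\<forall>i j k. distinct [i, j, k] \<longrightarrow> \<not> eventually (flat_pair i j k) (nhds ubar)"
    and U: "nbhd_in ubar W U" and lam: "lambda_equations r s U lam"
  obtains V where "nbhd_in ubar U V" "\<And>u i j. u \<in> V \<Longrightarrow> lam u $ i = lam u $ j"
proof -
  obtain a b where ab: "a \<noteq> b" and eq: "\<And>U lam. nbhd_in ubar W U \<Longrightarrow> lambda_equations r s U lam \<Longrightarrow>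
    eventually (\<lambda>u. lam u $ a = lam u $ b) (nhds ubar)"
    by (rule common_equal_pair[OF ct pair]) (rule that; assumption)
  obtain c where abc: "distinct [a, b, c]" using ex_third[OF ab] .
  note U' = nbhd_inD[OF U]
  obtain V1 where V1: "nbhd_in ubar U V1" and e1: "\<And>u. u \<in> V1 \<Longrightarrow> lam u $ a = lam u $ b"
    using nhds_open_subset[OF eq[OF U lam] U'(1,2)] by blast
  note V1' = nbhd_inD[OF V1]
  have "eventually (\<lambda>u. lam u $ c = lam u $ a) (nhds ubar)"
    by (rule third_equal[OF ct abc nbhd_in_trans[OF U V1] lambda_equations_subset[OF lam V1'(3)] e1]) (use nf abc in blast)+
  then obtain V where V: "nbhd_in ubar V1 V" and e2: "\<And>u. u \<in> V \<Longrightarrow> lam u $ c = lam u $ a"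
    using nhds_open_subset[OF _ V1'(1,2)] by blast
  show thesis
  proof (rule that[OF nbhd_in_trans[OF V1 V]])
    fix u i j assume u: "u \<in> V"
    have *: "lam u $ m = lam u $ a" for m
    proof -
      consider "m = a" | "m = b" | "m = c" using UNIV_3_distinct[OF abc] by blast
      then show ?thesis using e1[of u] e2[OF u] u nbhd_inD(3)[OF V] by cases auto
    qed
    show "lam u $ i = lam u $ j" using *[of i] *[of j] by simp
  qed
qed

text \<open>The system has no equation for \<open>r m\<close> applied to the function
  \<open>m\<close>. Since all functions agree, one passes to an index \<open>j\<close> other than
  \<open>m\<close>, where the right-hand side vanishes.\<close>

lemma equal_components_leafwise_constant:
  assumes U: "nbhd_in ubar W U" and lam: "lambda_equations r s U lam"
    and eq: "\<And>u i j. u \<in> U \<Longrightarrow> lam u $ i = lam u $ j" and u: "u \<in> U"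
  shows "nabla (r m) (\<lambda>v. lam v $ i) u = 0"
proof -
  obtain j where j: "m \<noteq> j"
  proof (cases "m = 1")
    case True then show thesis using that[of 2] by simp
  next
    case False then show thesis using that[of 1] by simp
  qed
  have "nabla (r m) (\<lambda>v. lam v $ i) u = nabla (r m) (\<lambda>v. lam v $ j) u"
    by (rule nabla_cong[OF nbhd_inD(1)[OF U] u eq])
  also have "\<dots> = 0" using lambda_equationsD(2)[OF lam u j] eq[OF u, of m j] by simp
  finally show ?thesis .
qed

lemma all_equal:
  assumes ct: "constant_type_at ubar r s" and pair: "\<not> (\<exists>V. nbhd_in ubar W V \<and> condition_i V r \<and> condition_ii V r)"
    and nf: "\<forall>i j k. distinct [i, j, k] \<longrightarrow> \<not> eventually (flat_pair i j k) (nhds ubar)"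
  shows "all_equal_case ubar W r s"
  unfolding all_equal_case_def locally_uniquely_solvable_def
proof (intro conjI allI impI; (elim conjE)?)
  fix U lam assume U: "nbhd_in ubar W U" and lam: "lambda_equations r s U lam"
  obtain V where V: "nbhd_in ubar U V" and eq: "\<And>u i j. u \<in> V \<Longrightarrow> lam u $ i = lam u $ j"
    by (rule all_equal_near[OF ct pair nf U lam]) (rule that; assumption)
  note VW = nbhd_in_trans[OF U V] and lamV = lambda_equations_subset[OF lam nbhd_inD(3)[OF V]]
  have "(\<lambda>u. lam u $ 1) constant_on N" if "N \<subseteq> V" "integral_manifold r N" for N
    by (rule constant_on_integral_manifold[OF that(2,1) smooth_on_differentiable[OF lambda_nth[OF VW lamV]]
      equal_components_leafwise_constant[OF VW lamV eq]])
  then show "\<exists>V. nbhd_in ubar U V \<and> (\<forall>u\<in>V. lam u $ 1 = lam u $ 2 \<and> lam u $ 2 = lam u $ 3) \<and>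
      (\<forall>N. N \<subseteq> V \<and> integral_manifold r N \<longrightarrow> (\<lambda>u. lam u $ 1) constant_on N)"
    using V eq by (intro exI[of _ V]) blast
next
  fix M and g :: "real ^ 'n \<Rightarrow> real" assume M: "transversal ubar W r UNIV (CARD('n) - 3) M" and g: "smooth_data M g"
  note M' = transversal_at[OF M]
  have WW: "nbhd_in ubar W W" using open_W ubar_W by (simp add: nbhd_in_def)
  obtain U0 h where U0: "nbhd_in ubar W U0" and h: "smooth_on U0 h" "\<And>u. u \<in> U0 \<inter> M \<Longrightarrow> h u = g u"
    by (rule smooth_data_extension[OF g M'(2) WW]) (rule that; assumption)
  have "\<exists>V f. nbhd_in ubar U0 V \<and> smooth_on V f \<and> (\<forall>u\<in>V. \<forall>i. nabla (r i) f u = 0) \<and> (\<forall>u\<in>V \<inter> M. f u = h u)"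
    by (rule frobenius_exists_3[OF U0 smooth_on_const[OF nbhd_inD(1)[OF U0]] h(1) M']) (simp add: nabla_const)
  then obtain V f where V: "nbhd_in ubar U0 V" and f: "smooth_on V f" "\<And>u i. u \<in> V \<Longrightarrow> nabla (r i) f u = 0" "\<And>u. u \<in> V \<inter> M \<Longrightarrow> f u = h u"
    by blast
  note VW = nbhd_in_trans[OF U0 V]
  \<comment> \<open>A function constant along the leaves, repeated three times, solves the system:
    both sides of the differential equations vanish, and the algebraic ones reduce to
    \<open>brc_Gam\<close>.\<close>
  define lam :: "real ^ 'n \<Rightarrow> real ^ 3" where "lam u = (\<chi> i. f u)" for u
  have "lambda_equations r s V lam"
  proof (rule lambda_equationsI)
    show "smooth_on V lam" by (rule smooth_on_vec[OF nbhd_inD(1)[OF V]]) (simp add: lam_def f(1))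
    show "algebraic u (lam u)" if "u \<in> V" for u
      using that nbhd_inD(3)[OF VW] unfolding algebraic_def lam_def by (auto simp: brc_Gam algebra_simps)
    show "nabla (r i) (\<lambda>v. lam v $ j) u = Gam r s j i j u * (lam u $ i - lam u $ j)" if "u \<in> V" for u i j
      using f(2)[OF that] by (simp add: lam_def)
  qed
  moreover have "\<forall>u\<in>V \<inter> M. \<forall>i. lam u $ i = g u"
    using f(3) h(2) nbhd_inD(3)[OF V] by (auto simp: lam_def)
  ultimately show "\<exists>U lam. nbhd_in ubar W U \<and> lambda_equations r s U lam \<and> (\<forall>u\<in>U \<inter> M. \<forall>i. lam u $ i = g u)"
    using VW by blast
next
  fix M g U U' lam lam'
  assume M: "transversal ubar W r UNIV (CARD('n) - 3) M"
    and U: "nbhd_in ubar W U" "nbhd_in ubar W U'" and lam: "lambda_equations r s U lam" "lambda_equations r s U' lam'"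
    and g: "\<forall>u\<in>U \<inter> M. \<forall>i. lam u $ i = g u" "\<forall>u\<in>U' \<inter> M. \<forall>i. lam' u $ i = g u"
  obtain V where V: "nbhd_in ubar U V" and eq: "\<And>u i j. u \<in> V \<Longrightarrow> lam u $ i = lam u $ j"
    by (rule all_equal_near[OF ct pair nf U(1) lam(1)]) (rule that; assumption)
  obtain V' where V': "nbhd_in ubar U' V'" and eq': "\<And>u i j. u \<in> V' \<Longrightarrow> lam' u $ i = lam' u $ j"
    by (rule all_equal_near[OF ct pair nf U(2) lam(2)]) (rule that; assumption)
  note VW = nbhd_in_trans[OF U(1) V] and lamV = lambda_equations_subset[OF lam(1) nbhd_inD(3)[OF V]]
  note VW' = nbhd_in_trans[OF U(2) V'] and lamV' = lambda_equations_subset[OF lam(2) nbhd_inD(3)[OF V']]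
  have VV: "nbhd_in ubar W (V \<inter> V')" using VW VW' by (auto simp: nbhd_in_def)
  have "\<exists>V0. nbhd_in ubar (V \<inter> V') V0 \<and> (\<forall>u\<in>V0. lam u $ 1 - lam' u $ 1 = 0)"
  proof (rule frobenius_unique_3[OF VV transversal_at[OF M]])
    fix u assume u: "u \<in> V \<inter> V'"
    then have u': "u \<in> V" "u \<in> V'" by auto
    note d = smooth_on_differentiable[OF lambda_nth[OF VW lamV, of 1] u'(1)] smooth_on_differentiable[OF lambda_nth[OF VW' lamV', of 1] u'(2)]
    show "(\<lambda>u. lam u $ 1 - lam' u $ 1) differentiable at u" by (rule differentiable_diff[OF d])
    show "nabla (r i) (\<lambda>u. lam u $ 1 - lam' u $ 1) u = 0" for i
    proof -
      have "nabla (r i) (\<lambda>u. lam u $ 1) u = 0" by (rule equal_components_leafwise_constant[OF VW lamV eq u'(1)])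
      moreover have "nabla (r i) (\<lambda>u. lam' u $ 1) u = 0" by (rule equal_components_leafwise_constant[OF VW' lamV' eq' u'(2)])
      ultimately show ?thesis unfolding nabla_diff[OF d] by simp
    qed
  next
    fix u assume "u \<in> V \<inter> V' \<inter> M"
    then have "u \<in> U \<inter> M" "u \<in> U' \<inter> M" using nbhd_inD(3)[OF V] nbhd_inD(3)[OF V'] by auto
    then have "lam u $ 1 = g u" "lam' u $ 1 = g u" using g by blast+
    then show "lam u $ 1 - lam' u $ 1 = 0" by simp
  qed
  then obtain V0 where V0: "nbhd_in ubar (V \<inter> V') V0" and e: "\<And>u. u \<in> V0 \<Longrightarrow> lam u $ 1 = lam' u $ 1" by auto
  have "lam u = lam' u" if u: "u \<in> V0" for u
  proof -
    have "u \<in> V" "u \<in> V'" using u nbhd_inD(3)[OF V0] by auto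
    then have "lam u $ m = lam' u $ m" for m
      using e[OF u] eq[of u m 1] eq'[of u m 1] by simp
    then show ?thesis by (simp add: vec_eq_iff)
  qed
  moreover have "nbhd_in ubar (U \<inter> U') V0" using V0 V V' by (auto simp: nbhd_in_def)
  ultimately show "\<exists>V. nbhd_in ubar (U \<inter> U') V \<and> (\<forall>u\<in>V. lam u = lam' u)" by blast
qed

lemma ex_flat_triple:
  assumes d: "distinct [i, j, k]" and ev: "eventually (flat_pair i j k) (nhds ubar)"
  shows "\<exists>V. flat_triple ubar W r s i j k V"
proof -
  obtain V0 where V0: "coordinate_domain V0" using ex_coordinate_domain by blast
  note V0' = nbhd_inD[OF coordinate_domainD(1)[OF V0]]
  obtain V where V: "nbhd_in ubar V0 V" "\<And>u. u \<in> V \<Longrightarrow> flat_pair i j k u"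
    using nhds_open_subset[OF ev V0'(1,2)] by blast
  have "flat_triple ubar W r s i j k V"
    by unfold_locales (use d V coordinate_domain_subset[OF V0 V(1)] in auto)
  then show ?thesis ..
qed

end

section \<open>The case of two equal functions\<close>

context flat_triple
begin

text \<open>Prescribing 1 for the third function on \<open>M1\<close> and 0 for the common value on
  \<open>M2\<close> separates the two at \<open>ubar\<close>, which lies on both manifolds, and by
  continuity nearby.\<close>

lemma two_distinct_eigenvalues:
  obtains U lam where "nbhd_in ubar W U" "lambda_equations r s U lam"
    "\<And>u. u \<in> U \<Longrightarrow> lam u $ i = lam u $ j" "\<And>u. u \<in> U \<Longrightarrow> lam u $ i \<noteq> lam u $ k"
proof -
  obtain M1 where M1: "submanifold (CARD('n) - 2) M1" "ubar \<in> M1" "tangent_space M1 ubar \<inter> span {r i ubar, r j ubar} = {0}"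
    using exists_transversal[OF pair_facts(1,3), of ubar] unfolding pair_facts(2) by auto
  obtain M2 where M2: "submanifold (CARD('n) - 3) M2" "ubar \<in> M2" "tangent_space M2 ubar \<inter> span (range (\<lambda>i. r i ubar)) = {0}"
    using exists_transversal[OF r_inj[OF ubar_W] r_indep[OF ubar_W], of ubar] by auto
  have VV: "nbhd_in ubar V V" using V_facts by (simp add: nbhd_in_def)
  obtain U lam where U: "nbhd_in ubar V U" and lam: "lambda_equations r s U lam" and ij: "\<And>u. u \<in> U \<Longrightarrow> lam u $ i = lam u $ j"
    and k: "\<And>u. u \<in> U \<inter> M1 \<Longrightarrow> lam u $ k = 1" and i: "\<And>u. u \<in> U \<inter> M2 \<Longrightarrow> lam u $ i = 0"
    using two_equal_solution[OF M1 M2 VV smooth_on_const[OF V_facts(1)] smooth_on_const[OF V_facts(1)]] by blast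
  note UW = nbhd_in_trans[OF coordinate_domainD(1)[OF V] U]
  note U' = nbhd_inD[OF U]
  let ?U = "U \<inter> (\<lambda>u. lam u $ k - lam u $ i) -` {0<..}"
  have "continuous_on U (\<lambda>u. lam u $ k - lam u $ i)"
    by (intro continuous_on_diff smooth_on_continuous[OF lambda_nth[OF UW lam]])
  then have "open ?U" by (intro continuous_open_preimage U'(1)) auto
  moreover have "ubar \<in> ?U" using U'(2) k[of ubar] i[of ubar] M1(2) M2(2) by simp
  ultimately have UU: "nbhd_in ubar W ?U" using nbhd_inD(3)[OF UW] by (auto simp: nbhd_in_def)
  show thesis
  proof (rule that[OF UU lambda_equations_subset[OF lam]])
    show "?U \<subseteq> U" by blast
    show "lam u $ i = lam u $ j" if "u \<in> ?U" for u using ij that by blast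
    show "lam u $ i \<noteq> lam u $ k" if "u \<in> ?U" for u using that by auto
  qed
qed

lemma two_equal:
  assumes ct: "constant_type_at ubar r s" and pair: "\<not> (\<exists>V. nbhd_in ubar W V \<and> condition_i V r \<and> condition_ii V r)"
  shows "two_equal_case ubar W r s i j k"
proof -
  obtain Ud lamd where Ud: "nbhd_in ubar W Ud" and lamd: "lambda_equations r s Ud lamd"
    and dij: "\<And>u. u \<in> Ud \<Longrightarrow> lamd u $ i = lamd u $ j" and dik: "\<And>u. u \<in> Ud \<Longrightarrow> lamd u $ i \<noteq> lamd u $ k"
    by (rule two_distinct_eigenvalues) (rule that; assumption)
  obtain a b where ab: "a \<noteq> b" and eq: "\<And>U lam. nbhd_in ubar W U \<Longrightarrow> lambda_equations r s U lam \<Longrightarrow>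
    eventually (\<lambda>u. lam u $ a = lam u $ b) (nhds ubar)"
    by (rule common_equal_pair[OF ct pair]) (rule that; assumption)
  \<comment> \<open>The pair that coincides in all solutions can only be \<open>i, j\<close>: in
    \<open>lamd\<close> no other two functions agree at \<open>ubar\<close>.\<close>
  have "lamd ubar $ a = lamd ubar $ b" using eventually_nhds_x_imp_x[OF eq[OF Ud lamd]] .
  moreover have "a = i \<or> a = j \<or> a = k" "b = i \<or> b = j \<or> b = k" using UNIV_3_distinct[OF distinct] by blast+
  ultimately have "a = i \<and> b = j \<or> a = j \<and> b = i"
    using ab dij[of ubar] dik[of ubar] nbhd_inD(2)[OF Ud] by auto
  then have near: "eventually (\<lambda>u. lam u $ i = lam u $ j) (nhds ubar)"
    if "nbhd_in ubar W U" "lambda_equations r s U lam" for U lam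
    using eq[OF that] by (auto simp: eq_commute)
  have near': "\<exists>V'. nbhd_in ubar U V' \<and> (\<forall>u\<in>V'. lam u $ i = lam u $ j)"
    if "nbhd_in ubar W U" "lambda_equations r s U lam" for U lam
    by (rule nhds_open_subset[OF near[OF that] nbhd_inD(1,2)[OF that(1)]]) blast
  note VW = coordinate_domainD(1)[OF V]
  show ?thesis
    unfolding two_equal_case_def locally_uniquely_solvable_def
  proof (intro conjI allI impI; (elim conjE)?)
    show "\<exists>V'. nbhd_in ubar U V' \<and> (\<forall>u\<in>V'. lam u $ i = lam u $ j)"
      if "nbhd_in ubar W U" "lambda_equations r s U lam" for U lam
      by (rule near'[OF that])
    show "\<exists>U lam. nbhd_in ubar W U \<and> lambda_equations r s U lam \<and> (\<forall>u\<in>U. lam u $ i = lam u $ j \<and> lam u $ i \<noteq> lam u $ k)"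
      using Ud lamd dij dik by blast
  next
    fix M1 M2 and g1 g2 :: "real ^ 'n \<Rightarrow> real"
    assume M1: "transversal ubar W r {i, j} (CARD('n) - 2) M1" and M2: "transversal ubar W r UNIV (CARD('n) - 3) M2"
      and g: "smooth_data M1 g1" "smooth_data M2 g2"
    note M1' = transversal_at[OF M1, simplified] and M2' = transversal_at[OF M2]
    obtain U1 h1 where U1: "nbhd_in ubar V U1" and h1: "smooth_on U1 h1" "\<And>u. u \<in> U1 \<inter> M1 \<Longrightarrow> h1 u = g1 u"
      by (rule smooth_data_extension[OF g(1) M1'(2) VW]) (rule that; assumption)
    obtain U2 h2 where U2: "nbhd_in ubar U1 U2" and h2: "smooth_on U2 h2" "\<And>u. u \<in> U2 \<inter> M2 \<Longrightarrow> h2 u = g2 u"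
      by (rule smooth_data_extension[OF g(2) M2'(2) U1]) (rule that; assumption)
    obtain U lam where U: "nbhd_in ubar U2 U" "lambda_equations r s U lam" "\<And>u. u \<in> U \<Longrightarrow> lam u $ i = lam u $ j"
        "\<And>u. u \<in> U \<inter> M1 \<Longrightarrow> lam u $ k = h1 u" "\<And>u. u \<in> U \<inter> M2 \<Longrightarrow> lam u $ i = h2 u"
      using two_equal_solution[OF M1' M2' nbhd_in_trans[OF U1 U2] smooth_on_subset[OF h1(1) nbhd_inD(3)[OF U2]] h2(1)] by blast
    have sub: "U \<subseteq> U2" "U \<subseteq> U1" using nbhd_inD(3)[OF U2] nbhd_inD(3)[OF U(1)] by auto
    have "\<forall>u\<in>U \<inter> M1. lam u $ k = g1 u" "\<forall>u\<in>U \<inter> M2. lam u $ i = g2 u \<and> lam u $ j = g2 u"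
      using U(3-5) h1(2) h2(2) sub by auto
    moreover have "nbhd_in ubar W U" by (rule nbhd_in_trans[OF VW nbhd_in_trans[OF U1 nbhd_in_trans[OF U2 U(1)]]])
    ultimately show "\<exists>U lam. nbhd_in ubar W U \<and> lambda_equations r s U lam \<and> (\<forall>u\<in>U \<inter> M1. lam u $ k = g1 u) \<and>
        (\<forall>u\<in>U \<inter> M2. lam u $ i = g2 u \<and> lam u $ j = g2 u)"
      using U(2) by blast
  next
    fix M1 M2 g1 g2 U U' lam lam'
    assume M1: "transversal ubar W r {i, j} (CARD('n) - 2) M1" and M2: "transversal ubar W r UNIV (CARD('n) - 3) M2"
      and U: "nbhd_in ubar W U" "nbhd_in ubar W U'" and lam: "lambda_equations r s U lam" "lambda_equations r s U' lam'"
      and g: "\<forall>u\<in>U \<inter> M1. lam u $ k = g1 u" "\<forall>u\<in>U' \<inter> M1. lam' u $ k = g1 u"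
        "\<forall>u\<in>U \<inter> M2. lam u $ i = g2 u \<and> lam u $ j = g2 u" "\<forall>u\<in>U' \<inter> M2. lam' u $ i = g2 u \<and> lam' u $ j = g2 u"
    obtain V1 where V1: "nbhd_in ubar U V1" and e1: "\<And>u. u \<in> V1 \<Longrightarrow> lam u $ i = lam u $ j"
      using near'[OF U(1) lam(1)] by blast
    obtain V2 where V2: "nbhd_in ubar U' V2" and e2: "\<And>u. u \<in> V2 \<Longrightarrow> lam' u $ i = lam' u $ j"
      using near'[OF U(2) lam(2)] by blast
    define U0 where "U0 = V \<inter> (V1 \<inter> V2)"
    have U0: "nbhd_in ubar V U0" using V1 V2 V_facts by (auto simp: nbhd_in_def U0_def)
    have sub: "U0 \<subseteq> V1" "U0 \<subseteq> V2" "U0 \<subseteq> U" "U0 \<subseteq> U'"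
      using nbhd_inD(3)[OF V1] nbhd_inD(3)[OF V2] by (auto simp: U0_def)
    have data: "lam u $ k = lam' u $ k" if "u \<in> U0 \<inter> M1" for u
    proof -
      have "u \<in> U \<inter> M1" "u \<in> U' \<inter> M1" using that sub by auto
      then have "lam u $ k = g1 u" "lam' u $ k = g1 u" using g(1,2) by blast+
      then show ?thesis by simp
    qed
    have data': "lam u $ i = lam' u $ i" if "u \<in> U0 \<inter> M2" for u
    proof -
      have "u \<in> U \<inter> M2" "u \<in> U' \<inter> M2" using that sub by auto
      then have "lam u $ i = g2 u" "lam' u $ i = g2 u" using g(3,4) by blast+
      then show ?thesis by simp
    qed
    have "\<exists>V'. nbhd_in ubar U0 V' \<and> (\<forall>u\<in>V'. lam u = lam' u)"
      by (rule two_equal_unique[OF transversal_at[OF M1, simplified] transversal_at[OF M2] U0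
            lambda_equations_subset[OF lam(1) sub(3)] lambda_equations_subset[OF lam(2) sub(4)] _ _ data data'])
        (use e1 e2 sub in auto)
    then show "\<exists>V'. nbhd_in ubar (U \<inter> U') V' \<and> (\<forall>u\<in>V'. lam u = lam' u)"
      using sub(3,4) unfolding nbhd_in_def by blast
  qed
qed

end

text \<open>The second alternative supplies a solution with distinct values at \<open>ubar\<close>,
  which the first excludes.\<close>

lemma not_all_and_two_equal:
  assumes "all_equal_case ubar W r s" "two_equal_case ubar W r s i j k"
  shows False
proof -
  obtain U lam where U: "nbhd_in ubar W U" "lambda_equations r s U lam" "\<forall>u\<in>U. lam u $ i = lam u $ j \<and> lam u $ i \<noteq> lam u $ k"
    using assms(2) unfolding two_equal_case_def by blast
  obtain V where V: "nbhd_in ubar U V" "\<forall>u\<in>V. lam u $ 1 = lam u $ 2 \<and> lam u $ 2 = lam u $ 3"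
    using assms(1) U(1,2) unfolding all_equal_case_def by blast
  have "ubar \<in> U" "ubar \<in> V" using V(1) by (auto simp: nbhd_in_def)
  then have "lam ubar $ 1 = lam ubar $ 2" "lam ubar $ 2 = lam ubar $ 3" "lam ubar $ i \<noteq> lam ubar $ k" using U(3) V(2) by auto
  moreover have "lam ubar $ m = lam ubar $ 1" for m
    using exhaust_3[of m] calculation(1,2) by auto
  from this[of i] this[of k] have "lam ubar $ i = lam ubar $ k" by simp
  ultimately show False by simp
qed

theorem theorem5p10:
  fixes ubar :: "real^'n"
    and Om W :: "(real^'n) set"
    and r :: "3 \<Rightarrow> real^'n \<Rightarrow> real^'n"
    and s :: "nat \<Rightarrow> real^'n \<Rightarrow> real^'n"
  assumes "open Om" and "ubar \<in> Om"
    and "partial_frame Om r"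
    and "in_involution Om r"
    and "\<not> rich Om r"
    and "\<not> (\<exists>Om'. nbhd_in ubar Om Om' \<and> condition_i Om' r \<and> condition_ii Om' r)"
    and "nbhd_in ubar Om W" and "completes_to_frame W r s"
  shows "(constant_type_at ubar r s \<longrightarrow>
            (all_equal_case ubar W r s \<or>
             (\<exists>i j k. distinct [i, j, k] \<and> two_equal_case ubar W r s i j k)) \<and>
            \<not> (all_equal_case ubar W r s \<and>
               (\<exists>i j k. distinct [i, j, k] \<and> two_equal_case ubar W r s i j k))) \<and>
         (\<forall>U lam \<Xi> g.
            nbhd_in ubar W U \<and> lambda_equations r s U lam \<and>
            transversal ubar W r UNIV (CARD('n) - 3) \<Xi> \<and> smooth_data \<Xi> g \<longrightarrow>
            locally_uniquely_solvable ubar U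
              (\<lambda>V f. flux_system r lam V f \<and> (\<forall>u\<in>V \<inter> \<Xi>. f u = g u))) \<and>
         \<not> (\<exists>f \<in> fluxes ubar Om r. strictly_hyperbolic ubar f)"
proof -
  note W = nbhd_inD[OF \<open>nbhd_in ubar Om W\<close>]
  interpret completed_frame ubar W r s
  proof
    show "open W" "ubar \<in> W" by (fact W)+
    show "smooth_on W (r i)" for i
      using \<open>partial_frame Om r\<close> W(3) unfolding partial_frame_def by (auto intro: smooth_on_subset)
    show "inj (\<lambda>i. r i u)" "independent (range (\<lambda>i. r i u))" if "u \<in> W" for u
      using \<open>partial_frame Om r\<close> W(3) that unfolding partial_frame_def by auto
    show "\<exists>c. lie_bracket (r i) (r j) u = (\<Sum>k\<in>UNIV. c k *\<^sub>R r k u)" if "u \<in> W" for u i j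
    proof -
      obtain a where "\<forall>u\<in>Om. lie_bracket (r i) (r j) u = (\<Sum>k\<in>UNIV. a k u *\<^sub>R r k u)"
        using \<open>in_involution Om r\<close> unfolding in_involution_def smooth_span_def by blast
      then show ?thesis using that W(3) by (intro exI[of _ "\<lambda>k. a k u"]) auto
    qed
    show "completes_to_frame W r s" by fact
  qed
  have pair: "\<not> (\<exists>V. nbhd_in ubar W V \<and> condition_i V r \<and> condition_ii V r)"
    using assms(6) nbhd_in_trans[OF assms(7)] by blast
  have "all_equal_case ubar W r s \<or> (\<exists>i j k. distinct [i, j, k] \<and> two_equal_case ubar W r s i j k)"
    if ct: "constant_type_at ubar r s"
  \<comment> \<open>Existence of a pair that is flat near \<open>ubar\<close> is what separates the
    two alternatives.\<close>
  proof (cases "\<exists>i j k. distinct [i, j, k] \<and> eventually (flat_pair i j k) (nhds ubar)")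
    case True
    then obtain i j k where ijk: "distinct [i, j, k]" "eventually (flat_pair i j k) (nhds ubar)" by blast
    then obtain V where "flat_triple ubar W r s i j k V" using ex_flat_triple by blast
    then interpret flat_triple ubar W r s i j k V .
    show ?thesis using two_equal[OF ct pair] ijk(1) by blast
  next
    case False
    then show ?thesis using all_equal[OF ct pair] by blast
  qed
  then show ?thesis
    using not_all_and_two_equal flux_uniquely_solvable no_hyperbolic_flux[OF pair] by blast
qed

end
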